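(* Let $r\ge 2$, let $a_1,\dots,a_r\in\mathbb{C}$ satisfy $\Re(a_1+\cdots+a_j)>0$ for all $j=1,\dots,r$, let $z_1,\dots,z_r\in\mathbb{C}\setminus(1,\infty)$, and let $l_1,\dots,l_r$ be non-negative integers. Let $\epsilon_1,\dots,\epsilon_r$ be complex numbers such that $|\epsilon_1|,\dots,|\epsilon_r|$ are sufficiently small, $\epsilon_j\neq 0$ and $\epsilon(j,r)\neq 0$ for $j=1,\dots,r$, and $|\epsilon_k/\epsilon(j,r)|\ll 1$ as $(\epsilon_1,\dots,\epsilon_r)\to(0,\dots,0)$ for $j=1,\dots,r$ and $k=j,\dots,r$, where $\epsilon(j,r)=\epsilon_j+\cdots+\epsilon_r$. Then \begin{align*} &\zeta(-l_1+\epsilon_1,\dots,-l_r+\epsilon_r;a_1,\dots,a_r;z_1,\dots,z_r)\\ &=(-1)^{l_1+\cdots+l_r+r}\sum_{d_1,\dots,d_{r-1}\in\{0,1\}}\ \sum_{(n_1,\dots,n_r)\in S^{(d_1,\dots,d_{r-1})}}\frac{B_{n_1}(a_1;z_1)\cdots B_{n_r}(a_r;z_r)}{n_1!\cdots n_r!}\,h^{(d_1,\dots,d_{r-1})}(n_1,\dots,n_r)+\sum_{j=1}^{r}O(|\epsilon_j|). \end{align*} Explicitly: for every constant $M>0$ there exist $\delta>0$ and $C>0$ (depending on $M$, $r$, the $a_j$, the $z_j$ and the $l_j$) such that, for all $(\epsilon_1,\dots,\epsilon_r)\in\mathbb{C}^r$ with $|\epsilon_j|<\delta$, $\epsilon_j\ne0$,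 $\epsilon(j,r)\neq0$ for $1\le j\le r$, and $|\epsilon_k|\le M|\epsilon(j,r)|$ for all $1\le j\le k\le r$, the left-hand side and the main term on the right-hand side differ by at most $C\sum_{j=1}^r|\epsilon_j|$ in absolute value.
   Context: **Hurwitz-Lerch multiple zeta function.** Let $a_1,\dots,a_r\in\mathbb{C}$ with $\Re(a_1+\cdots+a_j)>0$ for $1\le j\le r$. For $z_1,\dots,z_r\in\mathbb{C}\setminus\{0\}$ with $|z_j|\le 1$ and $s_1,\dots,s_r\in\mathbb{C}$ with $\Re(s_j)>1$, define $$\zeta(s_1,\dots,s_r;a_1,\dots,a_r;z_1,\dots,z_r):=\sum_{m_1,\dots,m_r\ge 0}\frac{z_1^{m_1}\cdots z_r^{m_r}}{(m_1+a_1)^{s_1}(m_1+m_2+a_1+a_2)^{s_2}\cdots(m_1+\cdots+m_r+a_1+\cdots+a_r)^{s_r}},$$ with complex powers defined by the branch $-\pi<\arg(m_1+\cdots+m_j+a_1+\cdots+a_j)\le\pi$. For $\Re(s_j)>1$ one has $$\Gamma(s_1)\cdots\Gamma(s_r)\,\zeta(s_1,\dots,s_r;a_1,\dots,a_r;z_1,\dots,z_r)=\int_0^\infty\cdots\int_0^\infty\ \prod_{j=1}^r\frac{e^{-a_j(u_j+\cdots+u_r)}}{1-z_je^{-(u_j+\cdots+u_r)}}\,u_j^{s_j-1}\,du_1\cdots du_r.$$ For general $z_1,\dots,z_r\in\mathbb{C}\setminus(1,\infty)$, $\zeta$ denotes the analytic continuation: keeping those $z_q$ which equal $1$ fixed at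 $1$, and letting the remaining variables $z_p$ ($z_p\ne1$) range over $\mathbb{C}\setminus[1,\infty)$, the function given for $\Re(s_j)>1$ by $$\frac{1}{\Gamma(s_1)\cdots\Gamma(s_r)}\int_0^\infty\cdots\int_0^\infty\ \prod_{j=1}^r\frac{e^{-a_j(u_j+\cdots+u_r)}}{1-z_je^{-(u_j+\cdots+u_r)}}\,u_j^{s_j-1}\,du_1\cdots du_r$$ continues meromorphically in $(s_1,\dots,s_r)$ together with the variables $z_p$ to all $(s_1,\dots,s_r)\in\mathbb{C}^r$ and all $z_p\in\mathbb{C}\setminus[1,\infty)$. **Apostol-Bernoulli polynomials.** $B_n(a;z)$ is defined by $$\frac{xe^{ax}}{ze^x-1}=\sum_{n\ge0}B_n(a;z)\frac{x^n}{n!}$$ (power series expansion at $x=0$); for $z=1$, $B_n(a;1)$ is the usual Bernoulli polynomial. **Notation.** For $1\le i\le r$ put $n(i,r):=n_i+\cdots+n_r$, $l(i,r):=l_i+\cdots+l_r$, $\epsilon(i,r):=\epsilon_i+\cdots+\epsilon_r$. For $j=1,\dots,r-1$ set $$S_j^{(0)}:=\{(n_1,\dots,n_r)\in\mathbb{Z}_{\ge0}^r\mid n(j+1,r)\le l(j+1,r)+(r-j),\ n(1,r)=l(1,r)+r\},$$ $$S_j^{(1)}:=\{(n_1,\dots,n_r)\in\mathbb{Z}_{\ge0}^r\mid l(j,r)+(r-j)<n(j+1,r),\ n(1,r)=l(1,r)+r\},$$ and, for $d_1,\dots,d_{r-1}\in\{0,1\}$, $S^{(d_1,\dots,d_{r-1})}:=\bigcap_{j=1}^{r-1}S_j^{(d_j)}$.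 For $(n_1,\dots,n_r)\in S^{(d_1,\dots,d_{r-1})}$ set $$h^{(d_1,\dots,d_{r-1})}(n_1,\dots,n_r):=(-1)^{l_r}\,l_r!\prod_{j=1}^{r-1}h_j^{(d_j)}(n_1,\dots,n_r),$$ where $$h_j^{(0)}(n_1,\dots,n_r):=\frac{(-1)^{l_j}\,\bigl(-(n(j+1,r)-l(j,r)-(r-j))\bigr)!}{\bigl(-(n(j+1,r)-l(j+1,r)-(r-j))\bigr)!},$$ $$h_j^{(1)}(n_1,\dots,n_r):=\frac{\epsilon(j+1,r)}{\epsilon(j,r)}\cdot\frac{\bigl(n(j+1,r)-l(j+1,r)-(r-j)-1\bigr)!}{\bigl(n(j+1,r)-l(j,r)-(r-j)-1\bigr)!}.$$ *)

theory Defs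
  imports "HOL-Complex_Analysis.Complex_Analysis"
begin

section \<open>Functions of finitely many complex variables\<close>

text \<open>
  A point of $\mathbb{C}^I$ is an extensional function on the finite index set \<open>I\<close>.
\<close>

abbreviation cspace :: "'i set \<Rightarrow> ('i \<Rightarrow> complex) topology" where
  "cspace I \<equiv> product_topology (\<lambda>_. euclidean) I"

text \<open>Holomorphic on the open set \<open>U\<close>: continuous, and holomorphic in each variable separately.\<close>

definition mv_holomorphic_on ::
    "'i set \<Rightarrow> (('i \<Rightarrow> complex) \<Rightarrow> complex) \<Rightarrow> ('i \<Rightarrow> complex) set \<Rightarrow> bool" where
  "mv_holomorphic_on I f U \<longleftrightarrow>
     openin (cspace I) U \<and>
     continuous_map (subtopology (cspace I) U) euclidean f \<and>
     (\<forall>x\<in>U. \<forall>i\<in>I. (\<lambda>w. f (x(i := w))) field_differentiable (at (x i)))"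

text \<open>
  Meromorphic: locally a quotient \<open>f / g\<close> of holomorphic functions, where \<open>g\<close> does not vanish
  identically on any nonempty open set. The values of \<open>F\<close> are unconstrained at points where
  \<open>g\<close> vanishes.
\<close>

definition mv_meromorphic_on ::
    "'i set \<Rightarrow> (('i \<Rightarrow> complex) \<Rightarrow> complex) \<Rightarrow> ('i \<Rightarrow> complex) set \<Rightarrow> bool" where
  "mv_meromorphic_on I F D \<longleftrightarrow>
     openin (cspace I) D \<and>
     (\<forall>x\<in>D. \<exists>U f g. x \<in> U \<and> U \<subseteq> D \<and>
        mv_holomorphic_on I f U \<and> mv_holomorphic_on I g U \<and>
        (\<forall>V. openin (cspace I) V \<and> V \<subseteq> U \<and> V \<noteq> {} \<longrightarrow> (\<exists>y\<in>V. g y \<noteq> 0)) \<and>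
        (\<forall>y\<in>U. g y \<noteq> 0 \<longrightarrow> F y = f y / g y))"


section \<open>The Hurwitz-Lerch multiple zeta function\<close>

definition hl_integral ::
    "nat \<Rightarrow> (nat \<Rightarrow> complex) \<Rightarrow> (nat \<Rightarrow> complex) \<Rightarrow> (nat \<Rightarrow> complex) \<Rightarrow> complex" where
  "hl_integral r s a z =
     (LINT u : ({1..r} \<rightarrow>\<^sub>E {0<..}) | PiM {1..r} (\<lambda>_. lborel).
        (\<Prod>j=1..r. exp (- a j * of_real (\<Sum>k=j..r. u k)) /
                    (1 - z j * exp (- of_real (\<Sum>k=j..r. u k))) *
                    of_real (u j) powr (s j - 1)))
     / (\<Prod>j=1..r. Gamma (s j))"

text \<open>
  The variables are \<open>s\<^sub>j\<close> (index \<open>Inl j\<close>, \<open>1 \<le> j \<le> r\<close>) and \<open>z\<^sub>p\<close> (index \<open>Inr p\<close>, \<open>p \<in> P\<close>);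
  the remaining \<open>z\<^sub>q\<close> are fixed at \<open>1\<close>.
\<close>

abbreviation hl_index :: "nat \<Rightarrow> nat set \<Rightarrow> (nat + nat) set" where
  "hl_index r P \<equiv> {1..r} <+> P"

definition hl_domain :: "nat \<Rightarrow> nat set \<Rightarrow> (nat + nat \<Rightarrow> complex) set" where
  "hl_domain r P =
     PiE (hl_index r P) (case_sum (\<lambda>_. UNIV) (\<lambda>_. - (complex_of_real ` {1..})))"

definition hl_continuation ::
    "nat \<Rightarrow> (nat \<Rightarrow> complex) \<Rightarrow> nat set \<Rightarrow> ((nat + nat \<Rightarrow> complex) \<Rightarrow> complex) \<Rightarrow> bool" where
  "hl_continuation r a P F \<longleftrightarrow>
     mv_meromorphic_on (hl_index r P) F (hl_domain r P) \<and>
     (\<forall>x\<in>hl_domain r P. (\<forall>j\<in>{1..r}. Re (x (Inl j)) > 1) \<longrightarrow>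
        F x = hl_integral r (\<lambda>j. x (Inl j)) a (\<lambda>j. if j \<in> P then x (Inr j) else 1))"

text \<open>
  The value at a regular point. A continuation may have spurious values where its local
  denominators vanish, hence \<open>F\<close> is only evaluated at points near which it is holomorphic; there all
  continuations agree, because the domain is connected.
\<close>

definition hl_zeta ::
    "nat \<Rightarrow> (nat \<Rightarrow> complex) \<Rightarrow> (nat \<Rightarrow> complex) \<Rightarrow> (nat \<Rightarrow> complex) \<Rightarrow> complex" where
  "hl_zeta r s a z =
     (let P = {p\<in>{1..r}. z p \<noteq> 1};
          x = restrict (case_sum s z) (hl_index r P)
      in THE w. \<exists>F U. hl_continuation r a P F \<and>
           x \<in> U \<and> mv_holomorphic_on (hl_index r P) F U \<and> F x = w)"


section \<open>Apostol-Bernoulli polynomials\<close>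

text \<open>
  The quotient of formal power series is exact: for \<open>z \<noteq> 1\<close> the denominator is a unit, and for
  \<open>z = 1\<close> numerator and denominator both have order \<open>1\<close>.
\<close>

definition apostol_bernoulli :: "nat \<Rightarrow> complex \<Rightarrow> complex \<Rightarrow> complex" where
  "apostol_bernoulli n a z =
     fact n * fps_nth (fps_X * fps_exp a / (fps_const z * fps_exp 1 - 1)) n"


section \<open>The main term\<close>

definition S_set :: "nat \<Rightarrow> (nat \<Rightarrow> nat) \<Rightarrow> nat \<Rightarrow> nat \<Rightarrow> (nat \<Rightarrow> nat) set" where
  "S_set r l j d = {n \<in> {1..r} \<rightarrow>\<^sub>E UNIV.
     (if d = 0 then (\<Sum>k=j+1..r. n k) \<le> (\<Sum>k=j+1..r. l k) + (r - j)
      else (\<Sum>k=j..r. l k) + (r - j) < (\<Sum>k=j+1..r. n k)) \<and>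
     (\<Sum>k=1..r. n k) = (\<Sum>k=1..r. l k) + r}"

text \<open>
  The arguments of the factorials are nonnegative for \<open>n \<in> S_set r l j d\<close>, so the truncated
  subtractions of natural numbers below are exact there.
\<close>

definition h_factor ::
    "nat \<Rightarrow> (nat \<Rightarrow> nat) \<Rightarrow> (nat \<Rightarrow> complex) \<Rightarrow> nat \<Rightarrow> nat \<Rightarrow> (nat \<Rightarrow> nat) \<Rightarrow> complex" where
  "h_factor r l \<epsilon> j d n =
     (if d = 0 then
        (-1) ^ l j * fact ((\<Sum>k=j..r. l k) + (r - j) - (\<Sum>k=j+1..r. n k))
          / fact ((\<Sum>k=j+1..r. l k) + (r - j) - (\<Sum>k=j+1..r. n k))
      else
        (\<Sum>k=j+1..r. \<epsilon> k) / (\<Sum>k=j..r. \<epsilon> k)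
          * (fact ((\<Sum>k=j+1..r. n k) - (\<Sum>k=j+1..r. l k) - (r - j) - 1)
             / fact ((\<Sum>k=j+1..r. n k) - (\<Sum>k=j..r. l k) - (r - j) - 1)))"

definition h_coeff ::
    "nat \<Rightarrow> (nat \<Rightarrow> nat) \<Rightarrow> (nat \<Rightarrow> complex) \<Rightarrow> (nat \<Rightarrow> nat) \<Rightarrow> (nat \<Rightarrow> nat) \<Rightarrow> complex" where
  "h_coeff r l \<epsilon> d n = (-1) ^ l r * fact (l r) * (\<Prod>j=1..r-1. h_factor r l \<epsilon> j (d j) n)"

definition main_term ::
    "nat \<Rightarrow> (nat \<Rightarrow> nat) \<Rightarrow> (nat \<Rightarrow> complex) \<Rightarrow> (nat \<Rightarrow> complex) \<Rightarrow> (nat \<Rightarrow> complex) \<Rightarrow> complex" where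
  "main_term r l \<epsilon> a z =
     (-1) ^ ((\<Sum>k=1..r. l k) + r) *
     (\<Sum>d \<in> {1..r-1} \<rightarrow>\<^sub>E {0, 1}. \<Sum>n \<in> (\<Inter>j\<in>{1..r-1}. S_set r l j (d j)).
        (\<Prod>j=1..r. apostol_bernoulli (n j) (a j) (z j) / fact (n j)) * h_coeff r l \<epsilon> d n)"

end

theory Submission
  imports Defs "HOL-Real_Asymp.Real_Asymp"
begin

text \<open>
  In the variables \<open>U\<^sub>j = u\<^sub>j + \<dots> + u\<^sub>r\<close> the integral becomes an iterated one: an Erdelyi-Kober average
  \<open>\<integral>\<^sub>0\<^sup>1 \<phi>(t U) t\<^bsup>\<sigma>-1\<^esup> (1 - t)\<^bsup>s-1\<^esup> dt\<close> for each of \<open>u\<^bsub>r-1\<^esub>, \<dots>, u\<^sub>1\<close>, and a final Mellin transform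
  \<open>\<integral>\<^sub>0\<^sup>\<infinity> \<phi>(u) u\<^bsup>\<sigma>-1\<^esup> du\<close>, with exponents \<open>\<sigma>\<^sub>j = s\<^sub>j + \<dots> + s\<^sub>r - (r + 1 - j)\<close>. After division by
  \<open>\<Gamma>(\<sigma>) \<Gamma>(s)\<close> and \<open>\<Gamma>(\<sigma>)\<close> respectively, both operations continue to entire functions of the exponents (integrate
  by parts), so that \<open>\<zeta>\<close> is an explicit holomorphic numerator over \<open>\<Prod>\<^sub>j 1/\<Gamma>(\<sigma>\<^sub>j)\<close>.

  Let \<open>s\<^sub>j = - l\<^sub>j + \<epsilon>\<^sub>j\<close> and \<open>\<eta>\<^sub>j = \<epsilon>(j,r)\<close>. At \<open>\<sigma>\<^sub>1 = - K\<close> the normalized Mellin transform is, up to sign, the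
  \<open>K\<close>-th derivative of \<open>\<phi>\<close> at \<open>0\<close>; its expansion gives the products of Apostol-Bernoulli polynomials, weighted by
  quotients of Gamma values that tend to the factors \<open>h\<^sub>j\<close>. The difference between the Mellin transform and this
  derivative is holomorphic near the point, and it vanishes when \<open>\<eta>\<^sub>1 = 0\<close> and also when \<open>\<eta>\<^sub>j = \<epsilon>\<^bsub>j-1\<^esub> = 0\<close> for
  some \<open>j \<ge> 2\<close>, because then both exponents of an average are nonpositive integers and the normalized average is
  identically zero. By the Schwarz lemma it is therefore
  \<open>O(|\<eta>\<^sub>1| \<Prod>\<^bsub>j\<ge>2\<^esub> (|\<eta>\<^sub>j| + |\<epsilon>\<^bsub>j-1\<^esub>|))\<close>, and the hypothesis \<open>\<epsilon>\<^sub>k = O(\<epsilon>(j,r))\<close> makes this small against the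
  zeros \<open>\<eta>\<^sub>1 \<dots> \<eta>\<^sub>r\<close> of the denominator.
\<close>

section \<open>Integrals depending on a parameter\<close>

text \<open>Three obstacles shape the proof. Since \<open>hl_zeta\<close> is a description over all
  meromorphic continuations, a formula near one point does not suffice: one continuation has to be
  built on the whole domain, jointly in the exponents and the free \<open>z\<close>, and every other
  one has to be shown to agree with it. Hence the families that are holomorphic both in the
  parameters and in \<open>U\<close>, and the check that the number of integrations by parts is
  immaterial. Secondly, a single \<open>a j\<close> may have negative real part. An average keeps no
  decay, so the decay has to be recovered from the kernels outside it; this works because every
  partial sum of the \<open>a j\<close> has positive real part. Thirdly, the ratios
  \<epsilon>(j+1,r)/\<epsilon>(j,r) have no limit, so continuity at the point says nothing. In the
  remainder the exponents \<sigma>_j and s_j, although linked, are therefore treated as independent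
  coordinates: only then is the zero set a union of coordinate subspaces, to which one-variable
  Schwarz estimates apply.\<close>

lemma param_set_integral_continuous:
  fixes h :: "'p::metric_space \<Rightarrow> 't \<Rightarrow> complex"
  assumes meas: "\<And>x. x \<in> X \<Longrightarrow> set_borel_measurable M S (h x)"
    and cont: "\<And>t. t \<in> S \<Longrightarrow> continuous_on X (\<lambda>x. h x t)"
    and dom: "\<And>x0. x0 \<in> X \<Longrightarrow> \<exists>e>0. \<exists>b::'t \<Rightarrow> real. set_integrable M S b \<and>
                (\<forall>x\<in>X \<inter> ball x0 e. \<forall>t\<in>S. norm (h x t) \<le> b t)"
  shows "continuous_on X (\<lambda>x. LINT t:S|M. h x t)"
  unfolding continuous_on_sequentially
proof (intro allI ballI impI, elim conjE)
  fix x :: "nat \<Rightarrow> 'p" and a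
  assume a: "a \<in> X" and xX: "\<forall>n. x n \<in> X" and lim: "x \<longlonglongrightarrow> a"
  obtain e b where e: "e > 0" "set_integrable M S b"
    "\<And>y t. y \<in> X \<Longrightarrow> y \<in> ball a e \<Longrightarrow> t \<in> S \<Longrightarrow> norm (h y t) \<le> b t"
    using dom[OF a] by blast
  obtain N where N: "\<And>n. n \<ge> N \<Longrightarrow> dist (x n) a < e"
    using lim e(1) unfolding lim_sequentially by blast
  \<comment> \<open>Dropping the first \<open>N\<close> terms keeps the sequence in the ball on
    which \<open>b\<close> dominates.\<close>
  have "(\<lambda>n. LINT t:S|M. h (x (n + N)) t) \<longlonglongrightarrow> (LINT t:S|M. h a t)"
    unfolding set_lebesgue_integral_def
  proof (rule integral_dominated_convergence)
    show "(\<lambda>t. indicator S t *\<^sub>R h a t) \<in> borel_measurable M"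
      using meas[OF a] by (simp add: set_borel_measurable_def)
    show "(\<lambda>t. indicator S t *\<^sub>R h (x (n + N)) t) \<in> borel_measurable M" for n
      using meas xX by (simp add: set_borel_measurable_def)
    show "integrable M (\<lambda>t. indicator S t *\<^sub>R b t)"
      using e(2) by (simp add: set_integrable_def)
    show "AE t in M. (\<lambda>n. indicator S t *\<^sub>R h (x (n + N)) t) \<longlonglongrightarrow> indicator S t *\<^sub>R h a t"
    proof (rule AE_I2)
      fix t
      show "(\<lambda>n. indicator S t *\<^sub>R h (x (n + N)) t) \<longlonglongrightarrow> indicator S t *\<^sub>R h a t"
      proof (cases "t \<in> S")
        case True
        have "((\<lambda>y. h y t) \<circ> x) \<longlonglongrightarrow> h a t"
          using cont[OF True] a xX lim unfolding continuous_on_sequentially by blast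
        then have "(\<lambda>n. h (x (n + N)) t) \<longlonglongrightarrow> h a t"
          by (intro LIMSEQ_ignore_initial_segment) (simp add: o_def)
        then show ?thesis by (intro tendsto_intros)
      qed auto
    qed
    show "AE t in M. norm (indicator S t *\<^sub>R h (x (n + N)) t) \<le> indicator S t *\<^sub>R b t" for n
      using e(3)[of "x (n + N)"] xX N[of "n + N"]
      by (intro AE_I2) (auto simp: indicator_def dist_commute)
  qed
  then show "((\<lambda>x. LINT t:S|M. h x t) \<circ> x) \<longlonglongrightarrow> (LINT t:S|M. h a t)"
    by (simp add: o_def LIMSEQ_offset)
qed

text \<open>No bound on the derivative is assumed: Cauchy's inequality on discs of radius
  \<open>e/4\<close> turns the local bound \<open>b\<close> on \<open>h\<close> into the Lipschitz
  constant \<open>4 b / e\<close>, which dominates the difference quotients.\<close>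

lemma param_set_integral_derivative:
  fixes h :: "complex \<Rightarrow> 't \<Rightarrow> complex"
  assumes W: "open W" and w0: "w0 \<in> W"
    and meas: "\<And>x. x \<in> W \<Longrightarrow> set_borel_measurable M S (h x)"
    and hol: "\<And>t. t \<in> S \<Longrightarrow> (\<lambda>w. h w t) holomorphic_on W"
    and dom: "\<exists>e>0. \<exists>b::'t \<Rightarrow> real. set_integrable M S b \<and>
                (\<forall>x\<in>W \<inter> ball w0 e. \<forall>t\<in>S. norm (h x t) \<le> b t)"
  shows "((\<lambda>w. LINT t:S|M. h w t) has_field_derivative (LINT t:S|M. deriv (\<lambda>w. h w t) w0)) (at w0)"
proof -
  obtain e1 b where e1: "e1 > 0" "set_integrable M S b"
    "\<And>y t. y \<in> W \<Longrightarrow> y \<in> ball w0 e1 \<Longrightarrow> t \<in> S \<Longrightarrow> norm (h y t) \<le> b t"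
    using dom by blast
  obtain e2 where e2: "e2 > 0" "ball w0 e2 \<subseteq> W"
    using W w0 open_contains_ball by blast
  define e where "e = min e1 e2"
  have e: "e > 0" "ball w0 e \<subseteq> W" using e1 e2 by (auto simp: e_def)
  have eb: "norm (h y t) \<le> b t" if "y \<in> ball w0 e" "t \<in> S" for y t
    using e1(3)[of y t] that e by (auto simp: e_def)
  have lip: "norm (h w t - h w0 t) \<le> b t / (e/4) * norm (w - w0)" if t: "t \<in> S" and w: "w \<in> ball w0 (e/2)"
    for t w
  proof -
    have D: "norm (deriv (\<lambda>w. h w t) y) \<le> b t / (e/4)" if y: "y \<in> ball w0 (e/2)" for y
    proof -
      have sub: "cball y (e/4) \<subseteq> ball w0 e"
      proof
        fix z assume "z \<in> cball y (e/4)"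
        then have "dist w0 z \<le> dist w0 y + e/4" using dist_triangle[of w0 z y] by (simp)
        then show "z \<in> ball w0 e" using y e(1) by simp
      qed
      have "norm ((deriv ^^ 1) (\<lambda>w. h w t) y) \<le> fact 1 * b t / (e/4) ^ 1"
      proof (rule Cauchy_inequality)
        show "(\<lambda>w. h w t) holomorphic_on ball y (e/4)"
          using hol[OF t] sub e by (meson ball_subset_cball holomorphic_on_subset subset_trans)
        show "continuous_on (cball y (e/4)) (\<lambda>w. h w t)"
          using hol[OF t] sub e by (meson holomorphic_on_imp_continuous_on holomorphic_on_subset subset_trans)
        show "0 < e/4" using e by simp
        fix x assume "norm (y - x) = e/4"
        then have "x \<in> cball y (e/4)" by (simp add: dist_norm)
        then show "norm (h x t) \<le> b t" using eb sub t by blast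
      qed
      then show ?thesis by simp
    qed
    have hd: "((\<lambda>w. h w t) has_field_derivative deriv (\<lambda>w. h w t) y) (at y within ball w0 (e/2))"
      if "y \<in> ball w0 (e/2)" for y
    proof -
      have "y \<in> W" using that e by (auto simp: subset_iff)
      then show ?thesis
        using hol[OF t] W holomorphic_derivI by blast
    qed
    show ?thesis
      by (rule field_differentiable_bound[where S="ball w0 (e/2)"]) (use hd D w e in auto)
  qed
  have "((\<lambda>w. ((LINT t:S|M. h w t) - (LINT t:S|M. h w0 t)) / (w - w0)) \<longlongrightarrow> (LINT t:S|M. deriv (\<lambda>w. h w t) w0))
    (at w0)"
    unfolding tendsto_at_iff_sequentially
  proof (intro allI impI)
    fix x :: "nat \<Rightarrow> complex"
    assume x: "\<forall>i. x i \<in> UNIV - {w0}" and lim: "x \<longlonglongrightarrow> w0"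
    obtain N where N: "\<And>n. n \<ge> N \<Longrightarrow> dist (x n) w0 < e/2"
      using lim e(1) unfolding lim_sequentially by (meson half_gt_zero)
    define y where "y n = x (n + N)" for n
    have y: "y n \<in> ball w0 (e/2)" "y n \<noteq> w0" "y n \<in> W" for n
      using N[of "n+N"] x e by (auto simp: y_def dist_commute subset_iff)
    have limy: "y \<longlonglongrightarrow> w0" unfolding y_def using lim by (rule LIMSEQ_ignore_initial_segment)
    have m: "(\<lambda>t. indicator S t *\<^sub>R ((h (y n) t - h w0 t) / (y n - w0))) \<in> borel_measurable M" for n
    proof -
      have "(\<lambda>t. (indicator S t *\<^sub>R h (y n) t - indicator S t *\<^sub>R h w0 t) / (y n - w0)) \<in> borel_measurable M"
        using meas[OF y(3)] meas[OF w0] unfolding set_borel_measurable_def by measurable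
      moreover have "(\<lambda>t. (indicator S t *\<^sub>R h (y n) t - indicator S t *\<^sub>R h w0 t) / (y n - w0))
          = (\<lambda>t. indicator S t *\<^sub>R ((h (y n) t - h w0 t) / (y n - w0)))"
        by (auto simp: indicator_def)
      ultimately show ?thesis by simp
    qed
    have c: "(\<lambda>n. indicator S t *\<^sub>R ((h (y n) t - h w0 t) / (y n - w0)))
       \<longlonglongrightarrow> indicator S t *\<^sub>R deriv (\<lambda>w. h w t) w0" for t
    proof (cases "t \<in> S")
      case True
      have "((\<lambda>w. h w t) has_field_derivative deriv (\<lambda>w. h w t) w0) (at w0)"
        using hol[OF True] W w0 holomorphic_derivI by blast
      then have "((\<lambda>w. (h w t - h w0 t) / (w - w0)) \<longlongrightarrow> deriv (\<lambda>w. h w t) w0) (at w0)"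
        by (simp add: has_field_derivative_iff)
      then have "((\<lambda>w. (h w t - h w0 t) / (w - w0)) \<circ> y) \<longlonglongrightarrow> deriv (\<lambda>w. h w t) w0"
        using y limy unfolding tendsto_at_iff_sequentially by blast
      then show ?thesis by (intro tendsto_intros) (simp add: o_def)
    qed auto
    have b: "norm (indicator S t *\<^sub>R ((h (y n) t - h w0 t) / (y n - w0))) \<le> indicator S t *\<^sub>R b t * (4/e)"
      for n t
      using lip[of t "y n"] y[of n] e(1)
      by (auto simp: indicator_def norm_divide field_simps)
    have "(\<lambda>n. LINT t:S|M. (h (y n) t - h w0 t) / (y n - w0)) \<longlonglongrightarrow> (LINT t:S|M. deriv (\<lambda>w. h w t) w0)"
      unfolding set_lebesgue_integral_def
    proof (rule integral_dominated_convergence)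
      show "(\<lambda>t. indicator S t *\<^sub>R deriv (\<lambda>w. h w t) w0) \<in> borel_measurable M"
        by (rule borel_measurable_LIMSEQ_metric[OF m c])
      show "integrable M (\<lambda>t. indicator S t *\<^sub>R b t * (4/e))"
        using e1(2) by (intro integrable_mult_left) (simp add: set_integrable_def)
    qed (use m c b in auto)
    moreover have "(LINT t:S|M. (h (y n) t - h w0 t) / (y n - w0)) =
        ((LINT t:S|M. h (y n) t) - (LINT t:S|M. h w0 t)) / (y n - w0)" for n
    proof -
      have si: "set_integrable M S (h u)" if "u \<in> W" "u \<in> ball w0 e" for u
        unfolding set_integrable_def
      proof (rule Bochner_Integration.integrable_bound)
        show "integrable M (\<lambda>t. indicator S t *\<^sub>R b t)" using e1(2) by (simp add: set_integrable_def)
        show "(\<lambda>t. indicator S t *\<^sub>R h u t) \<in> borel_measurable M" using meas[OF that(1)]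
          by (simp add: set_borel_measurable_def)
        show "AE t in M. norm (indicator S t *\<^sub>R h u t) \<le> norm (indicator S t *\<^sub>R b t)"
          using eb[OF that(2)] by (intro AE_I2)
            (auto simp: indicator_def intro: order_trans[OF _ abs_ge_self])
      qed
      have "set_integrable M S (h (y n))" "set_integrable M S (h w0)"
        using y[of n] e w0 by (auto intro!: si)
      then show ?thesis by (simp add: set_integral_diff)
    qed
    ultimately have "(\<lambda>n. ((LINT t:S|M. h (x (n+N)) t) - (LINT t:S|M. h w0 t)) / (x (n+N) - w0))
       \<longlonglongrightarrow> (LINT t:S|M. deriv (\<lambda>w. h w t) w0)" by (simp only: y_def)
    then show "((\<lambda>w. ((LINT t:S|M. h w t) - (LINT t:S|M. h w0 t)) / (w - w0)) \<circ> x) \<longlonglongrightarrow>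
      (LINT t:S|M. deriv (\<lambda>w. h w t) w0)"
      by (simp add: o_def LIMSEQ_offset)
  qed
  then show ?thesis by (simp add: has_field_derivative_iff)
qed

lemma param_set_integral_holomorphic:
  fixes h :: "complex \<Rightarrow> 't \<Rightarrow> complex"
  assumes W: "open W"
    and meas: "\<And>x. x \<in> W \<Longrightarrow> set_borel_measurable M S (h x)"
    and hol: "\<And>t. t \<in> S \<Longrightarrow> (\<lambda>w. h w t) holomorphic_on W"
    and dom: "\<And>w0. w0 \<in> W \<Longrightarrow> \<exists>e>0. \<exists>b::'t \<Rightarrow> real. set_integrable M S b \<and>
                (\<forall>x\<in>W \<inter> ball w0 e. \<forall>t\<in>S. norm (h x t) \<le> b t)"
  shows "(\<lambda>w. LINT t:S|M. h w t) holomorphic_on W"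
  using param_set_integral_derivative[OF W _ meas hol dom] W
  by (auto simp: holomorphic_on_open)

text \<open>Presents the derivative as a Lebesgue integral over a parameter, so that stability of
  families under differentiation becomes a case of stability under integration.\<close>

lemma deriv_circle_integral:
  assumes hol: "f holomorphic_on S" and S: "open S" and r: "r > 0" and sub: "cball U r \<subseteq> S"
  shows "deriv f U = (LINT t:{0..1}|lborel. f (U + of_real r * exp (2 * of_real pi * \<i> * of_real t))
            / (of_real r * exp (2 * of_real pi * \<i> * of_real t)))"
proof -
  let ?g = "\<lambda>t::real. f (U + of_real r * exp (2 * of_real pi * \<i> * of_real t))
            / (of_real r * exp (2 * of_real pi * \<i> * of_real t))"
  have c: "continuous_on (cball U r) f"
    using hol sub holomorphic_on_imp_continuous_on continuous_on_subset by blast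
  have h: "f holomorphic_on ball U r"
    using hol sub by (meson ball_subset_cball holomorphic_on_subset subset_trans)
  have "(f has_field_derivative (1 / (2 * of_real pi * \<i>) * contour_integral(circlepath U r)
    (\<lambda>u. f u / (u-U)^2))) (at U)"
    by (rule Cauchy_derivative_integral_circlepath(2)[OF c h]) (use r in auto)
  then have "deriv f U = 1 / (2 * of_real pi * \<i>) * contour_integral(circlepath U r) (\<lambda>u. f u / (u-U)^2)"
    by (rule DERIV_imp_deriv)
  also have "contour_integral (circlepath U r) (\<lambda>u. f u / (u-U)^2)
    = integral {0..1} (\<lambda>t. 2 * of_real pi * \<i> * ?g t)"
    unfolding contour_integral_integral vector_derivative_circlepath
  proof (rule integral_cong)
    fix t :: real
    show "f (circlepath U r t) / (circlepath U r t - U)\<^sup>2 * (of_real (2 * pi) * \<i> * of_real r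
      * exp (2 * of_real pi * \<i> * of_real t))
        = 2 * of_real pi * \<i> * ?g t"
      using r by (simp add: circlepath divide_simps power2_eq_square)
  qed
  also have "integral {0..1} (\<lambda>t. 2 * of_real pi * \<i> * ?g t) = 2 * of_real pi * \<i> * integral {0..1} ?g"
    by (rule integral_mult_right)
  also have "1 / (2 * of_real pi * \<i>) * \<dots> = integral {0..1} ?g" by simp
  also have "\<dots> = (LINT t:{0..1}|lborel. ?g t)"
  proof (rule set_borel_integral_eq_integral(2)[symmetric])
    have "continuous_on {0..1} ?g"
    proof (intro continuous_intros continuous_on_compose2[OF c])
      show "(\<lambda>x. U + complex_of_real r * exp (2 * complex_of_real pi * \<i> * complex_of_real x)) ` {0..1}
        \<subseteq> cball U r"
        using r by (auto simp: dist_norm norm_mult)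
    qed (use r in auto)
    then show "set_integrable lborel {0..1} ?g"
      unfolding set_integrable_def by (intro borel_integrable_compact) auto
  qed
  finally show ?thesis .
qed

section \<open>Holomorphic families on half-strips\<close>

text \<open>The half-strip contains the half-line of the Mellin integral, a full neighbourhood of 0
  for Taylor coefficients, and with \<open>U\<close> all points \<open>t U\<close>,
  \<open>0 \<le> t \<le> 1\<close>, which an average evaluates.\<close>

definition strip :: "real \<Rightarrow> complex set" where
  "strip \<rho> = {U. - \<rho> < Re U \<and> \<bar>Im U\<bar> < \<rho>}"

lemma open_strip [simp]: "open (strip \<rho>)"
proof -
  have "strip \<rho> = {U. Re U > - \<rho>} \<inter> {U. Im U < \<rho>} \<inter> {U. Im U > - \<rho>}"
    by (auto simp: strip_def)
  then show ?thesis
    by (simp add: open_Int open_halfspace_Re_gt open_halfspace_Im_lt open_halfspace_Im_gt)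
qed

lemma convex_strip [simp]: "convex (strip \<rho>)"
proof -
  have "strip \<rho> = {U. Re U > - \<rho>} \<inter> {U. Im U < \<rho>} \<inter> {U. Im U > - \<rho>}"
    by (auto simp: strip_def)
  then show ?thesis
    by (simp add: convex_Int convex_halfspace_Re_gt convex_halfspace_Im_lt convex_halfspace_Im_gt)
qed

lemma connected_strip [simp]: "connected (strip \<rho>)"
  by (simp add: convex_connected)

lemma zero_in_strip [simp]: "0 \<in> strip \<rho> \<longleftrightarrow> 0 < \<rho>"
  by (auto simp: strip_def)

lemma strip_mono: "\<rho> \<le> \<rho>' \<Longrightarrow> strip \<rho> \<subseteq> strip \<rho>'"
  by (auto simp: strip_def)

lemma of_real_in_strip [simp]: "0 < \<rho> \<Longrightarrow> 0 \<le> u \<Longrightarrow> complex_of_real u \<in> strip \<rho>"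
  by (auto simp: strip_def)

lemma strip_rho_pos: "U \<in> strip \<rho> \<Longrightarrow> 0 < \<rho>"
  by (auto simp: strip_def)

lemma scale_in_strip:
  assumes "U \<in> strip \<rho>" "0 \<le> t" "t \<le> 1"
  shows "complex_of_real t * U \<in> strip \<rho>"
proof -
  have "(1 - t) *\<^sub>R 0 + t *\<^sub>R U \<in> strip \<rho>"
    using assms strip_rho_pos[OF assms(1)] by (intro convexD[OF convex_strip]) auto
  then show ?thesis by (simp add: scaleR_conv_of_real)
qed

lemma cball_strip: "U \<in> strip \<rho> \<Longrightarrow> \<rho> + r \<le> \<rho>' \<Longrightarrow> cball U r \<subseteq> strip \<rho>'"
proof
  fix z assume a: "U \<in> strip \<rho>" "\<rho> + r \<le> \<rho>'" "z \<in> cball U r"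
  have "\<bar>Re z - Re U\<bar> \<le> r" "\<bar>Im z - Im U\<bar> \<le> r"
    using a(3) abs_Re_le_cmod[of "z - U"] abs_Im_le_cmod[of "z - U"]
    by (auto simp: dist_norm norm_minus_commute)
  with a show "z \<in> strip \<rho>'" by (auto simp: strip_def)
qed

lemma strip_inner: "U \<in> strip \<rho> \<Longrightarrow> \<exists>\<rho>'>0. \<rho>' < \<rho> \<and> U \<in> strip \<rho>'"
proof -
  assume a: "U \<in> strip \<rho>"
  then have "max (max (- Re U) \<bar>Im U\<bar>) 0 < \<rho>" by (auto simp: strip_def)
  then obtain \<rho>' where "max (max (- Re U) \<bar>Im U\<bar>) 0 < \<rho>'" "\<rho>' < \<rho>" using dense by blast
  then show ?thesis by (intro exI[of _ \<rho>']) (auto simp: strip_def)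
qed

text \<open>
  Holomorphy in several parameters is expressed through a set \<open>C\<close> of analytic curves in the parameter space; the
  coordinate lines give separate holomorphy, and complex affine lines are used for the Schwarz lemma.
\<close>

definition curve_hol :: "'p set \<Rightarrow> (complex \<Rightarrow> 'p) set \<Rightarrow> ('p \<Rightarrow> complex) \<Rightarrow> bool" where
  "curve_hol X C p \<longleftrightarrow> (\<forall>c\<in>C. \<forall>W. open W \<longrightarrow> c ` W \<subseteq> X \<longrightarrow> (\<lambda>w. p (c w)) holomorphic_on W)"

definition param_hol :: "'p::metric_space set \<Rightarrow> (complex \<Rightarrow> 'p) set \<Rightarrow> ('p \<Rightarrow> complex) \<Rightarrow> bool" where
  "param_hol X C p \<longleftrightarrow> continuous_on X p \<and> curve_hol X C p"

text \<open>The bound is asked only for exponents above \<gamma> and on narrower strips. This slack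
  absorbs polynomial factors such as \<open>U\<close> and the radius of Cauchy circles, so that
  multiplication by \<open>U\<close> and differentiation do not change \<gamma>.\<close>

definition hol_family ::
    "'p::metric_space set \<Rightarrow> (complex \<Rightarrow> 'p) set \<Rightarrow> real \<Rightarrow> real \<Rightarrow> ('p \<Rightarrow> complex \<Rightarrow> complex) \<Rightarrow> bool" where
  "hol_family X C \<gamma> \<rho> F \<longleftrightarrow>
     continuous_on (X \<times> strip \<rho>) (\<lambda>(x, U). F x U) \<and>
     (\<forall>x\<in>X. F x holomorphic_on strip \<rho>) \<and>
     (\<forall>U\<in>strip \<rho>. curve_hol X C (\<lambda>x. F x U)) \<and>
     (\<forall>x0\<in>X. \<forall>\<gamma>'>\<gamma>. \<forall>\<rho>'>0. \<rho>' < \<rho> \<longrightarrow>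
        (\<exists>e>0. \<exists>B. \<forall>x\<in>X \<inter> ball x0 e. \<forall>U\<in>strip \<rho>'. norm (F x U) \<le> B * exp (\<gamma>' * Re U)))"

lemma hol_familyD:
  assumes "hol_family X C \<gamma> \<rho> F"
  shows "continuous_on (X \<times> strip \<rho>) (\<lambda>(x, U). F x U)"
    and "x \<in> X \<Longrightarrow> F x holomorphic_on strip \<rho>"
    and "U \<in> strip \<rho> \<Longrightarrow> curve_hol X C (\<lambda>x. F x U)"
    and "x0 \<in> X \<Longrightarrow> \<gamma>' > \<gamma> \<Longrightarrow> \<rho>' > 0 \<Longrightarrow> \<rho>' < \<rho> \<Longrightarrow>
        \<exists>e>0. \<exists>B\<ge>0. \<forall>x\<in>X \<inter> ball x0 e. \<forall>U\<in>strip \<rho>'. norm (F x U) \<le> B * exp (\<gamma>' * Re U)"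
proof -
  show "\<exists>e>0. \<exists>B\<ge>0. \<forall>x\<in>X \<inter> ball x0 e. \<forall>U\<in>strip \<rho>'. norm (F x U) \<le> B * exp (\<gamma>' * Re U)"
    if h: "x0 \<in> X" "\<gamma>' > \<gamma>" "\<rho>' > 0" "\<rho>' < \<rho>"
  proof -
    obtain e B where eB: "e > 0" "\<forall>x\<in>X \<inter> ball x0 e. \<forall>U\<in>strip \<rho>'. norm (F x U) \<le> B * exp (\<gamma>' * Re U)"
      using assms h unfolding hol_family_def by meson
    \<comment> \<open>At \<open>U = 0\<close> the exponential factor is 1, which forces
      \<open>B \<ge> 0\<close>.\<close>
    have "norm (F x0 0) \<le> B * exp (\<gamma>' * Re 0)"
      using eB(1) h by (intro eB(2)[rule_format]) auto
    then have "B \<ge> 0" using norm_ge_zero[of "F x0 0"] by (simp del: norm_ge_zero)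
    with eB show ?thesis by blast
  qed
qed (use assms in \<open>auto simp: hol_family_def\<close>)

text \<open>All four requirements only concern narrower strips, so a proof may fix one and use
  circles of a fixed radius or bounds that are uniform up to its edge.\<close>

lemma hol_family_localI:
  assumes "\<And>\<rho>'. 0 < \<rho>' \<Longrightarrow> \<rho>' < \<rho> \<Longrightarrow> hol_family X C \<gamma> \<rho>' F"
  shows "hol_family X C \<gamma> \<rho> F"
  unfolding hol_family_def
proof (intro conjI ballI allI impI)
  show "continuous_on (X \<times> strip \<rho>) (\<lambda>(x, U). F x U)"
    unfolding continuous_on_eq_continuous_within
  proof
    fix p assume p: "p \<in> X \<times> strip \<rho>"
    then obtain \<rho>' where r: "0 < \<rho>'" "\<rho>' < \<rho>" "snd p \<in> strip \<rho>'" using strip_inner[of "snd p" \<rho>] by auto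
    have "continuous (at p within X \<times> strip \<rho>') (\<lambda>(x, U). F x U)"
      using hol_familyD(1)[OF assms[OF r(1,2)]] p r(3)
      unfolding continuous_on_eq_continuous_within by auto
    moreover have "at p within X \<times> strip \<rho>' = at p within X \<times> strip \<rho>"
      by (rule at_within_nhd[of _ "UNIV \<times> strip \<rho>'"])
         (use p r strip_mono[of \<rho>' \<rho>] in \<open>auto intro!: open_Times simp: mem_Times_iff\<close>)
    ultimately show "continuous (at p within X \<times> strip \<rho>) (\<lambda>(x, U). F x U)" by simp
  qed
next
  fix x assume x: "x \<in> X"
  show "F x holomorphic_on strip \<rho>"
    unfolding holomorphic_on_def
  proof
    fix U assume U: "U \<in> strip \<rho>"
    then obtain \<rho>' where r: "0 < \<rho>'" "\<rho>' < \<rho>" "U \<in> strip \<rho>'" using strip_inner by blast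
    have "F x field_differentiable at U"
      using hol_familyD(2)[OF assms[OF r(1,2)] x] r(3) holomorphic_on_imp_differentiable_at open_strip
        by blast
    then show "F x field_differentiable at U within strip \<rho>" by (rule field_differentiable_at_within)
  qed
next
  fix U assume "U \<in> strip \<rho>"
  then obtain \<rho>' where r: "0 < \<rho>'" "\<rho>' < \<rho>" "U \<in> strip \<rho>'" using strip_inner by blast
  show "curve_hol X C (\<lambda>x. F x U)" using hol_familyD(3)[OF assms[OF r(1,2)] r(3)] .
next
  fix x0 \<gamma>' \<rho>' assume h: "x0 \<in> X" "\<gamma> < \<gamma>'" "0 < \<rho>'" "\<rho>' < \<rho>"
  then obtain \<rho>'' where "\<rho>' < \<rho>''" "\<rho>'' < \<rho>" using dense by blast
  then show "\<exists>e>0. \<exists>B. \<forall>x\<in>X \<inter> ball x0 e. \<forall>U\<in>strip \<rho>'. norm (F x U) \<le> B * exp (\<gamma>' * Re U)"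
    using hol_familyD(4)[OF assms[of \<rho>''] h(1,2) h(3)] h by fastforce
qed

lemma hol_family_mono:
  assumes "hol_family X C \<gamma> \<rho> F" "\<gamma> \<le> \<gamma>'" "\<rho>' \<le> \<rho>" "X' \<subseteq> X" "C' \<subseteq> C"
  shows "hol_family X' C' \<gamma>' \<rho>' F"
  unfolding hol_family_def
proof (intro conjI ballI allI impI)
  note st = strip_mono[OF assms(3)]
  show "continuous_on (X' \<times> strip \<rho>') (\<lambda>(x, U). F x U)"
    by (rule continuous_on_subset[OF hol_familyD(1)[OF assms(1)]]) (use assms st in auto)
  show "F x holomorphic_on strip \<rho>'" if "x \<in> X'" for x
    using hol_familyD(2)[OF assms(1), of x] that assms(4) st holomorphic_on_subset by blast
  show "curve_hol X' C' (\<lambda>x. F x U)" if "U \<in> strip \<rho>'" for U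
    using hol_familyD(3)[OF assms(1), of U] that assms(4,5) st unfolding curve_hol_def
    by (meson subset_eq subset_trans)
  fix x0 g r assume h: "x0 \<in> X'" "\<gamma>' < g" "0 < r" "r < \<rho>'"
  then have "x0 \<in> X" "\<gamma> < g" "r < \<rho>" using assms by auto
  from hol_familyD(4)[OF assms(1) this(1,2) h(3) this(3)] obtain e B where
    "e > 0" "\<forall>x\<in>X \<inter> ball x0 e. \<forall>U\<in>strip r. norm (F x U) \<le> B * exp (g * Re U)" by blast
  then show "\<exists>e>0. \<exists>B. \<forall>x\<in>X' \<inter> ball x0 e. \<forall>U\<in>strip r. norm (F x U) \<le> B * exp (g * Re U)"
    using assms(4) by (intro exI[of _ e] conjI exI[of _ B]) auto
qed

section \<open>Sums, products and basic examples of families\<close>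

lemma curve_hol_comb:
  assumes "curve_hol X C p" "curve_hol X C q"
  shows "curve_hol X C (\<lambda>x. p x + q x)" "curve_hol X C (\<lambda>x. p x - q x)" "curve_hol X C (\<lambda>x. p x * q x)"
  using assms unfolding curve_hol_def by (auto intro!: holomorphic_intros)

lemma curve_hol_unary:
  assumes "curve_hol X C p"
  shows "curve_hol X C (\<lambda>x. - p x)" "curve_hol X C (\<lambda>x. rGamma (p x))" "curve_hol X C (\<lambda>x. exp (p x))"
  using assms unfolding curve_hol_def by (auto intro!: holomorphic_intros holomorphic_rGamma')

lemma param_hol_const: "param_hol X C (\<lambda>x. k)"
  unfolding param_hol_def curve_hol_def by auto

lemma param_hol_binary:
  assumes "param_hol X C p" "param_hol X C q"
  shows "param_hol X C (\<lambda>x. p x + q x)" "param_hol X C (\<lambda>x. p x - q x)" "param_hol X C (\<lambda>x. p x * q x)"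
  using assms unfolding param_hol_def
  by (auto intro!: continuous_intros curve_hol_comb)

lemma param_hol_unary:
  assumes "param_hol X C p"
  shows "param_hol X C (\<lambda>x. - p x)" "param_hol X C (\<lambda>x. rGamma (p x))" "param_hol X C (\<lambda>x. exp (p x))"
  using assms unfolding param_hol_def
  by (auto intro!: continuous_intros curve_hol_unary continuous_on_compose2[OF continuous_on_rGamma[of UNIV]])

lemmas param_hol_comb = param_hol_const param_hol_binary param_hol_unary

lemma hol_family_cong:
  assumes "\<And>x U. x \<in> X \<Longrightarrow> U \<in> strip \<rho> \<Longrightarrow> F x U = G x U"
  shows "hol_family X C \<gamma> \<rho> F \<Longrightarrow> hol_family X C \<gamma> \<rho> G"
  unfolding hol_family_def
proof (elim conjE, intro conjI ballI allI impI)
  assume "continuous_on (X \<times> strip \<rho>) (\<lambda>(x, U). F x U)"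
  then show "continuous_on (X \<times> strip \<rho>) (\<lambda>(x, U). G x U)"
    by (rule continuous_on_eq) (use assms in auto)
next
  fix x assume "\<forall>x\<in>X. F x holomorphic_on strip \<rho>" "x \<in> X"
  then show "G x holomorphic_on strip \<rho>" using assms by (metis holomorphic_transform)
next
  fix U assume "\<forall>U\<in>strip \<rho>. curve_hol X C (\<lambda>x. F x U)" "U \<in> strip \<rho>"
  then show "curve_hol X C (\<lambda>x. G x U)" unfolding curve_hol_def
  proof (intro ballI allI impI)
    fix c W assume a: "\<forall>U\<in>strip \<rho>. \<forall>c\<in>C. \<forall>W. open W \<longrightarrow> c ` W \<subseteq> X \<longrightarrow> (\<lambda>w. F (c w) U) holomorphic_on W"
      and u: "U \<in> strip \<rho>" and c: "c \<in> C" "open W" "c ` W \<subseteq> X"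
    have "(\<lambda>w. F (c w) U) holomorphic_on W" using a u c by blast
    then show "(\<lambda>w. G (c w) U) holomorphic_on W"
      by (rule holomorphic_transform) (use assms u c in auto)
  qed
next
  fix x0 g r
  assume "\<forall>x0\<in>X. \<forall>\<gamma>'>\<gamma>. \<forall>\<rho>'>0. \<rho>' < \<rho> \<longrightarrow>
        (\<exists>e>0. \<exists>B. \<forall>x\<in>X \<inter> ball x0 e. \<forall>U\<in>strip \<rho>'. norm (F x U) \<le> B * exp (\<gamma>' * Re U))"
    and h: "x0 \<in> X" "\<gamma> < g" "0 < r" "r < \<rho>"
  then obtain e B where eB: "e > 0" "\<forall>x\<in>X \<inter> ball x0 e. \<forall>U\<in>strip r. norm (F x U) \<le> B * exp (g * Re U)"
    by meson
  show "\<exists>e>0. \<exists>B. \<forall>x\<in>X \<inter> ball x0 e. \<forall>U\<in>strip r. norm (G x U) \<le> B * exp (g * Re U)"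
  proof (rule exI[of _ e], rule conjI[OF _ exI[of _ B]]; (intro ballI)?)
    fix x U assume a: "x \<in> X \<inter> ball x0 e" "U \<in> strip r"
    then have "U \<in> strip \<rho>" using strip_mono[of r \<rho>] h by auto
    then show "norm (G x U) \<le> B * exp (g * Re U)" using eB(2) a assms[of x U] by force
  qed (use eB in auto)
qed

lemma hol_family_add:
  assumes "hol_family X C \<gamma> \<rho> F" "hol_family X C \<gamma> \<rho> G"
  shows "hol_family X C \<gamma> \<rho> (\<lambda>x U. F x U + G x U)"
  unfolding hol_family_def
proof (intro conjI ballI allI impI)
  show "continuous_on (X \<times> strip \<rho>) (\<lambda>(x, U). F x U + G x U)"
    using hol_familyD(1)[OF assms(1)] hol_familyD(1)[OF assms(2)]
    unfolding case_prod_beta by (intro continuous_intros)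
  show "(\<lambda>U. F x U + G x U) holomorphic_on strip \<rho>" if "x \<in> X" for x
    using hol_familyD(2)[OF assms(1) that] hol_familyD(2)[OF assms(2) that] by (intro holomorphic_intros)
  show "curve_hol X C (\<lambda>x. F x U + G x U)" if "U \<in> strip \<rho>" for U
    using hol_familyD(3)[OF assms(1) that] hol_familyD(3)[OF assms(2) that] by (intro curve_hol_comb)
  fix x0 g r assume h: "x0 \<in> X" "\<gamma> < g" "0 < r" "r < \<rho>"
  from hol_familyD(4)[OF assms(1) h] obtain e1 B1 where
    1: "e1 > 0" "\<forall>x\<in>X \<inter> ball x0 e1. \<forall>U\<in>strip r. norm (F x U) \<le> B1 * exp (g * Re U)" by blast
  from hol_familyD(4)[OF assms(2) h] obtain e2 B2 where
    2: "e2 > 0" "\<forall>x\<in>X \<inter> ball x0 e2. \<forall>U\<in>strip r. norm (G x U) \<le> B2 * exp (g * Re U)" by blast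
  show "\<exists>e>0. \<exists>B. \<forall>x\<in>X \<inter> ball x0 e. \<forall>U\<in>strip r. norm (F x U + G x U) \<le> B * exp (g * Re U)"
  proof (rule exI[of _ "min e1 e2"], rule conjI[OF _ exI[of _ "B1 + B2"]]; (intro ballI)?)
    fix x U assume "x \<in> X \<inter> ball x0 (min e1 e2)" "U \<in> strip r"
    then have "norm (F x U) \<le> B1 * exp (g * Re U)" "norm (G x U) \<le> B2 * exp (g * Re U)" using 1 2 by auto
    then show "norm (F x U + G x U) \<le> (B1 + B2) * exp (g * Re U)"
      using norm_triangle_ineq[of "F x U" "G x U"] by (simp add: algebra_simps)
  qed (use 1 2 in auto)
qed

lemma hol_family_mult:
  assumes "hol_family X C \<gamma>1 \<rho> F" "hol_family X C \<gamma>2 \<rho> G"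
  shows "hol_family X C (\<gamma>1 + \<gamma>2) \<rho> (\<lambda>x U. F x U * G x U)"
  unfolding hol_family_def
proof (intro conjI ballI allI impI)
  show "continuous_on (X \<times> strip \<rho>) (\<lambda>(x, U). F x U * G x U)"
    using hol_familyD(1)[OF assms(1)] hol_familyD(1)[OF assms(2)]
    unfolding case_prod_beta by (intro continuous_intros)
  show "(\<lambda>U. F x U * G x U) holomorphic_on strip \<rho>" if "x \<in> X" for x
    using hol_familyD(2)[OF assms(1) that] hol_familyD(2)[OF assms(2) that] by (intro holomorphic_intros)
  show "curve_hol X C (\<lambda>x. F x U * G x U)" if "U \<in> strip \<rho>" for U
    using hol_familyD(3)[OF assms(1) that] hol_familyD(3)[OF assms(2) that] by (intro curve_hol_comb)
  fix x0 g r assume h: "x0 \<in> X" "\<gamma>1 + \<gamma>2 < g" "0 < r" "r < \<rho>"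
  \<comment> \<open>The slack above the sum of the exponents is shared equally by the two
    factors.\<close>
  define g1 where "g1 = \<gamma>1 + (g - \<gamma>1 - \<gamma>2) / 2"
  define g2 where "g2 = \<gamma>2 + (g - \<gamma>1 - \<gamma>2) / 2"
  have g12: "\<gamma>1 < g1" "\<gamma>2 < g2" "g1 + g2 = g" using h by (auto simp: g1_def g2_def field_simps)
  from hol_familyD(4)[OF assms(1) h(1) g12(1) h(3,4)] obtain e1 B1 where
    1: "e1 > 0" "B1 \<ge> 0" "\<forall>x\<in>X \<inter> ball x0 e1. \<forall>U\<in>strip r. norm (F x U) \<le> B1 * exp (g1 * Re U)" by blast
  from hol_familyD(4)[OF assms(2) h(1) g12(2) h(3,4)] obtain e2 B2 where
    2: "e2 > 0" "B2 \<ge> 0" "\<forall>x\<in>X \<inter> ball x0 e2. \<forall>U\<in>strip r. norm (G x U) \<le> B2 * exp (g2 * Re U)" by blast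
  show "\<exists>e>0. \<exists>B. \<forall>x\<in>X \<inter> ball x0 e. \<forall>U\<in>strip r. norm (F x U * G x U) \<le> B * exp (g * Re U)"
  proof (rule exI[of _ "min e1 e2"], rule conjI[OF _ exI[of _ "B1 * B2"]]; (intro ballI)?)
    fix x U assume "x \<in> X \<inter> ball x0 (min e1 e2)" "U \<in> strip r"
    then have "norm (F x U) \<le> B1 * exp (g1 * Re U)" "norm (G x U) \<le> B2 * exp (g2 * Re U)" using 1 2 by auto
    then have "norm (F x U) * norm (G x U) \<le> (B1 * exp (g1 * Re U)) * (B2 * exp (g2 * Re U))"
      using 1 2 by (intro mult_mono) auto
    also have "\<dots> = B1 * B2 * exp (g * Re U)"
      using g12(3) by (simp add: exp_add[symmetric] distrib_right[symmetric] mult_ac)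
    finally show "norm (F x U * G x U) \<le> B1 * B2 * exp (g * Re U)" by (simp add: norm_mult)
  qed (use 1 2 in auto)
qed

lemma hol_family_const:
  assumes "param_hol X C p"
  shows "hol_family X C 0 \<rho> (\<lambda>x U. p x)"
  unfolding hol_family_def
proof (intro conjI ballI allI impI)
  have c: "continuous_on X p" using assms by (simp add: param_hol_def)
  show "continuous_on (X \<times> strip \<rho>) (\<lambda>(x, U). p x)"
    unfolding case_prod_beta by (rule continuous_on_compose2[OF c]) (auto intro: continuous_intros)
  show "curve_hol X C p" using assms by (simp add: param_hol_def)
  fix x0 g r assume h: "x0 \<in> X" "0 < (g::real)" "0 < (r::real)" "r < \<rho>"
  have "continuous (at x0 within X) p" using c h(1) by (simp add: continuous_on_eq_continuous_within)
  then obtain e where e: "e > 0" "\<And>x. x \<in> X \<Longrightarrow> dist x x0 < e \<Longrightarrow> dist (p x) (p x0) < 1"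
    unfolding continuous_within_eps_delta by (metis zero_less_one)
  show "\<exists>e>0. \<exists>B. \<forall>x\<in>X \<inter> ball x0 e. \<forall>U\<in>strip r. norm (p x) \<le> B * exp (g * Re U)"
  proof (rule exI[of _ e], rule conjI[OF _ exI[of _ "(norm (p x0) + 1) * exp (g * r)"]]; (intro ballI)?)
    fix x U assume "x \<in> X \<inter> ball x0 e" "U \<in> strip r"
    then have "norm (p x) \<le> norm (p x0) + 1"
      using e(2)[of x] norm_triangle_ineq2[of "p x" "p x0"] by (simp add: dist_norm dist_commute)
    \<comment> \<open>On \<open>strip r\<close> the number \<open>r + Re U\<close> is positive, so
      this exponential is at least 1.\<close>
    also have "\<dots> * 1 \<le> \<dots> * exp (g * (r + Re U))"
      using \<open>U \<in> strip r\<close> h by (intro mult_left_mono) (auto simp: strip_def)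
    finally show "norm (p x) \<le> (norm (p x0) + 1) * exp (g * r) * exp (g * Re U)"
      by (simp add: exp_add distrib_left mult_ac) (simp add: algebra_simps)
  qed (use e in auto)
qed auto

text \<open>Linear growth has exponent 0 here, because every bound is taken with some
  \<open>g > 0\<close> and \<open>g v \<le> exp (g v)\<close>.\<close>

lemma hol_family_ident: "hol_family X C 0 \<rho> (\<lambda>x U. U)"
  unfolding hol_family_def
proof (intro conjI ballI allI impI)
  show "continuous_on (X \<times> strip \<rho>) (\<lambda>(x, U). U)"
    unfolding case_prod_beta by (intro continuous_intros)
  show "curve_hol X C (\<lambda>x. U)" for U by (auto simp: curve_hol_def)
  fix x0 g r assume h: "x0 \<in> X" "0 < (g::real)" "0 < (r::real)" "r < \<rho>"
  show "\<exists>e>0. \<exists>B. \<forall>x\<in>X \<inter> ball x0 e. \<forall>U\<in>strip r. norm U \<le> B * exp (g * Re U)"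
  proof (rule exI[of _ 1], rule conjI[OF _ exI[of _ "(1/g + 2 * r) * exp (g * r)"]]; (intro ballI)?)
    fix U assume U: "U \<in> strip r"
    have "norm U \<le> \<bar>Re U\<bar> + \<bar>Im U\<bar>" by (rule cmod_le)
    also have "\<dots> \<le> (Re U + r) + 2 * r" using U by (auto simp: strip_def)
    also have "Re U + r \<le> 1/g * exp (g * (Re U + r))"
    proof -
      have "g * (Re U + r) \<le> exp (g * (Re U + r))"
        using exp_ge_add_one_self[of "g * (Re U + r)"] by linarith
      then show ?thesis using h by (simp add: field_simps)
    qed
    also have "2 * r \<le> 2 * r * exp (g * (Re U + r))"
      using U h by (auto simp: strip_def)
    finally show "norm U \<le> (1/g + 2 * r) * exp (g * r) * exp (g * Re U)"
      by (simp add: algebra_simps exp_add)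
  qed auto
qed auto

lemma hol_family_param:
  assumes "hol_family X C \<gamma> \<rho> F" "U \<in> strip \<rho>"
  shows "param_hol X C (\<lambda>x. F x U)"
  unfolding param_hol_def
proof
  have "continuous_on X ((\<lambda>(x, U). F x U) \<circ> (\<lambda>x. (x, U)))"
    by (intro continuous_on_compose continuous_intros continuous_on_subset[OF hol_familyD(1)[OF assms(1)]])
       (use assms in auto)
  then show "continuous_on X (\<lambda>x. F x U)" by (simp add: o_def)
  show "curve_hol X C (\<lambda>x. F x U)" using hol_familyD(3)[OF assms] .
qed

text \<open>A single domination, in which the growth factor is separated from an integrable function
  of \<open>t\<close>, delivers continuity, both kinds of holomorphy and the growth bound of the
  integral.\<close>

lemma hol_family_set_integral:
  fixes H :: "'p::metric_space \<Rightarrow> complex \<Rightarrow> 't \<Rightarrow> complex"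
  assumes contC: "\<And>c. c \<in> C \<Longrightarrow> continuous_on UNIV c"
    and meas: "\<And>x U. x \<in> X \<Longrightarrow> U \<in> strip \<rho> \<Longrightarrow> set_borel_measurable M S (H x U)"
    and cont: "\<And>t. t \<in> S \<Longrightarrow> continuous_on (X \<times> strip \<rho>) (\<lambda>(x, U). H x U t)"
    and hol: "\<And>t x. t \<in> S \<Longrightarrow> x \<in> X \<Longrightarrow> (\<lambda>U. H x U t) holomorphic_on strip \<rho>"
    and curve: "\<And>t U. t \<in> S \<Longrightarrow> U \<in> strip \<rho> \<Longrightarrow> curve_hol X C (\<lambda>x. H x U t)"
    and bound: "\<And>x0 \<gamma>'. x0 \<in> X \<Longrightarrow> \<gamma>' > \<gamma> \<Longrightarrow> \<exists>e>0. \<exists>b::'t \<Rightarrow> real. set_integrable M S b \<and>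
        (\<forall>x\<in>X \<inter> ball x0 e. \<forall>U\<in>strip \<rho>. \<forall>t\<in>S. norm (H x U t) \<le> b t * exp (\<gamma>' * Re U))"
  shows "hol_family X C \<gamma> \<rho> (\<lambda>x U. LINT t:S|M. H x U t)"
  unfolding hol_family_def
proof (intro conjI ballI allI impI)
  have dom: "\<exists>e>0. \<exists>b::'t \<Rightarrow> real. set_integrable M S b \<and>
        (\<forall>x\<in>X. \<forall>U\<in>strip \<rho>. x \<in> ball x0 e \<longrightarrow> U \<in> ball U0 e \<longrightarrow> (\<forall>t\<in>S. norm (H x U t) \<le> b t))"
    if x0: "x0 \<in> X" for x0 U0
  proof -
    \<comment> \<open>The exponent \<open>\<bar>\<gamma>\<bar> + 1\<close> exceeds \<gamma> and is
      positive; the growth factor then increases with \<open>Re U\<close> and is controlled on a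
      unit ball by its value at \<open>Re U0 + 1\<close>.\<close>
    obtain e b where eb: "e > 0" "set_integrable M S b"
      "\<And>x U t. x \<in> X \<Longrightarrow> x \<in> ball x0 e \<Longrightarrow> U \<in> strip \<rho> \<Longrightarrow> t \<in> S \<Longrightarrow> norm (H x U t) \<le> b t * exp ((\<bar>\<gamma>\<bar> + 1) * Re U)"
      using bound[OF x0, of "\<bar>\<gamma>\<bar> + 1"] by (fastforce simp del: mem_ball)
    show ?thesis
    proof (intro exI[of _ "min e 1"] exI[of _ "\<lambda>t. b t * exp ((\<bar>\<gamma>\<bar> + 1) * (Re U0 + 1))"] conjI ballI impI)
      show "set_integrable M S (\<lambda>t. b t * exp ((\<bar>\<gamma>\<bar> + 1) * (Re U0 + 1)))" using eb(2) by simp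
      fix x U t assume h: "x \<in> X" "U \<in> strip \<rho>" "x \<in> ball x0 (min e 1)" "U \<in> ball U0 (min e 1)" "t \<in> S"
      have le: "norm (H x U t) \<le> b t * exp ((\<bar>\<gamma>\<bar> + 1) * Re U)" using eb(3) h by auto
      then have b0: "b t \<ge> 0" by (smt (verit) exp_gt_zero norm_ge_zero zero_le_mult_iff)
      have "Re U \<le> Re U0 + 1"
        using h(4) abs_Re_le_cmod[of "U - U0"] by (auto simp: dist_norm norm_minus_commute)
      then have "exp ((\<bar>\<gamma>\<bar> + 1) * Re U) \<le> exp ((\<bar>\<gamma>\<bar> + 1) * (Re U0 + 1))" by (simp add: mult_left_mono)
      then show "norm (H x U t) \<le> b t * exp ((\<bar>\<gamma>\<bar> + 1) * (Re U0 + 1))"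
        using le mult_left_mono[OF _ b0] order_trans by blast
    qed (use eb in auto)
  qed
  have "continuous_on (X \<times> strip \<rho>) (\<lambda>p. LINT t:S|M. H (fst p) (snd p) t)"
  proof (rule param_set_integral_continuous)
    show "set_borel_measurable M S (H (fst p) (snd p))" if "p \<in> X \<times> strip \<rho>" for p
      using meas that by auto
    show "continuous_on (X \<times> strip \<rho>) (\<lambda>p. H (fst p) (snd p) t)" if "t \<in> S" for t
      using cont[OF that] by (simp add: case_prod_beta)
    fix p assume p: "p \<in> X \<times> strip \<rho>"
    then obtain e b where eb: "e > 0" "set_integrable M S b"
      "\<And>x U t. x \<in> X \<Longrightarrow> U \<in> strip \<rho> \<Longrightarrow> x \<in> ball (fst p) e \<Longrightarrow> U \<in> ball (snd p) e \<Longrightarrow> t \<in> S \<Longrightarrow> norm (H x U t) \<le> b t"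
      using dom[of "fst p" "snd p"] by (metis SigmaE fst_conv)
    show "\<exists>e>0. \<exists>b. set_integrable M S b \<and> (\<forall>q\<in>X \<times> strip \<rho> \<inter> ball p e. \<forall>t\<in>S. norm (H (fst q) (snd q) t)
      \<le> b t)"
    proof (intro exI[of _ e] exI[of _ b] conjI ballI)
      fix q t assume q: "q \<in> X \<times> strip \<rho> \<inter> ball p e" "t \<in> S"
      have "dist (fst p) (fst q) < e" "dist (snd p) (snd q) < e"
        using q dist_fst_le[of p q] dist_snd_le[of p q] by auto
      then show "norm (H (fst q) (snd q) t) \<le> b t" using q by (intro eb(3)) auto
    qed (use eb in auto)
  qed
  then show "continuous_on (X \<times> strip \<rho>) (\<lambda>(x, U). LINT t:S|M. H x U t)" by (simp add: case_prod_beta)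
  show "(\<lambda>U. LINT t:S|M. H x U t) holomorphic_on strip \<rho>" if x: "x \<in> X" for x
  proof (rule param_set_integral_holomorphic)
    fix U0 assume "U0 \<in> strip \<rho>"
    show "\<exists>e>0. \<exists>b. set_integrable M S b \<and> (\<forall>U\<in>strip \<rho> \<inter> ball U0 e. \<forall>t\<in>S. norm (H x U t) \<le> b t)"
      using dom[OF x, of U0] x by (metis IntE centre_in_ball)
  qed (use meas x hol in auto)
  show "curve_hol X C (\<lambda>x. LINT t:S|M. H x U t)" if U: "U \<in> strip \<rho>" for U
    unfolding curve_hol_def
  proof (intro ballI allI impI)
    fix c W assume c: "c \<in> C" and W: "open W" "c ` W \<subseteq> X"
    show "(\<lambda>w. LINT t:S|M. H (c w) U t) holomorphic_on W"
    proof (rule param_set_integral_holomorphic[OF W(1)])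
      show "(\<lambda>w. H (c w) U t) holomorphic_on W" if "t \<in> S" for t
        using curve[OF that U] c W unfolding curve_hol_def by blast
      fix w0 assume w0: "w0 \<in> W"
      then obtain e b where eb: "e > 0" "set_integrable M S b"
        "\<And>x t. x \<in> X \<Longrightarrow> x \<in> ball (c w0) e \<Longrightarrow> t \<in> S \<Longrightarrow> norm (H x U t) \<le> b t"
        using dom[of "c w0" U] W(2) U by (metis centre_in_ball imageI subsetD)
      have "continuous (at w0) c" using contC[OF c] by (simp add: continuous_on_eq_continuous_at)
      then obtain d where d: "d > 0" "\<And>w. dist w w0 < d \<Longrightarrow> dist (c w) (c w0) < e"
        using eb(1) unfolding continuous_at_eps_delta by blast
      show "\<exists>e>0. \<exists>b. set_integrable M S b \<and> (\<forall>w\<in>W \<inter> ball w0 e. \<forall>t\<in>S. norm (H (c w) U t) \<le> b t)"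
      proof (intro exI[of _ d] exI[of _ b] conjI ballI)
        fix w t assume wt: "w \<in> W \<inter> ball w0 d" "t \<in> S"
        then have "dist (c w) (c w0) < e" using d(2)[of w] by (simp add: dist_commute)
        then show "norm (H (c w) U t) \<le> b t" using eb(3)[of "c w" t] wt W(2) by (auto simp: dist_commute)
      qed (use d eb in auto)
    qed (use meas U W in auto)
  qed
  fix x0 g r assume h: "x0 \<in> X" "\<gamma> < g" "0 < (r::real)" "r < \<rho>"
  obtain e b where eb: "e > 0" "set_integrable M S b"
      "\<And>x U t. x \<in> X \<Longrightarrow> x \<in> ball x0 e \<Longrightarrow> U \<in> strip \<rho> \<Longrightarrow> t \<in> S \<Longrightarrow> norm (H x U t) \<le> b t * exp (g * Re U)"
      using bound[OF h(1,2)] by auto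
  show "\<exists>e>0. \<exists>B. \<forall>x\<in>X \<inter> ball x0 e. \<forall>U\<in>strip r. norm (LINT t:S|M. H x U t) \<le> B * exp (g * Re U)"
  proof (rule exI[of _ e], rule conjI[OF _ exI[of _ "LINT t:S|M. b t"]]; (intro ballI)?)
    fix x U assume x: "x \<in> X \<inter> ball x0 e" "U \<in> strip r"
    then have U: "U \<in> strip \<rho>" using strip_mono[of r \<rho>] h by auto
    have "norm (LINT t:S|M. H x U t) \<le> (LINT t:S|M. b t * exp (g * Re U))"
      unfolding set_lebesgue_integral_def
    proof (rule order_trans[OF integral_norm_bound integral_mono])
      show i: "integrable M (\<lambda>t. indicator S t *\<^sub>R (b t * exp (g * Re U)))"
        using eb(2) unfolding set_integrable_def[symmetric] by simp
      show "integrable M (\<lambda>t. norm (indicator S t *\<^sub>R H x U t))"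
        by (rule integrable_norm, rule Bochner_Integration.integrable_bound[OF i])
           (use meas[of x U] x U eb(3)[of x U] in \<open>auto simp: set_borel_measurable_def indicator_def
              intro!: AE_I2 intro: order_trans[OF _ abs_ge_self]\<close>)
      show "norm (indicator S t *\<^sub>R H x U t) \<le> indicator S t *\<^sub>R (b t * exp (g * Re U))" for t
        using eb(3)[of x U t] x U by (auto simp: indicator_def)
    qed
    then show "norm (LINT t:S|M. H x U t) \<le> (LINT t:S|M. b t) * exp (g * Re U)" by simp
  qed (use eb in auto)
qed

text \<open>Cauchy's formula on a circle of fixed radius writes the derivative as an average of
  translates of \<open>F\<close>, and translation by a bounded amount changes the growth bound only
  by a constant.\<close>

lemma hol_family_deriv:
  assumes contC: "\<And>c. c \<in> C \<Longrightarrow> continuous_on UNIV c" and F: "hol_family X C \<gamma> \<rho> F"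
  shows "hol_family X C \<gamma> \<rho> (\<lambda>x. deriv (F x))"
proof (rule hol_family_localI)
  fix \<rho>' assume r': "0 < \<rho>'" "\<rho>' < \<rho>"
  \<comment> \<open>The circles about points of \<open>strip \<rho>'\<close> stay in
    \<open>strip \<rho>2\<close>, which is still strictly inside \<open>strip \<rho>\<close>, where
    the growth bound of \<open>F\<close> is available.\<close>
  define \<rho>2 where "\<rho>2 = (\<rho>' + \<rho>) / 2"
  define r where "r = \<rho>2 - \<rho>'"
  have r: "0 < r" "\<rho>' + r = \<rho>2" "\<rho>2 < \<rho>" "0 < \<rho>2" using r' by (auto simp: r_def \<rho>2_def field_simps)
  define w where "w t = complex_of_real r * exp (2 * of_real pi * \<i> * of_real t)" for t :: real
  have nw: "norm (w t) = r" "w t \<noteq> 0" for t using r by (auto simp: w_def norm_mult)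
  have inst: "U + w t \<in> strip \<rho>2" if "U \<in> strip \<rho>'" for U t
    using cball_strip[OF that, of r \<rho>2] r nw by (auto simp: dist_norm)
  have inst': "U + w t \<in> strip \<rho>" if "U \<in> strip \<rho>'" for U t
    using inst[OF that] strip_mono[of \<rho>2 \<rho>] r by auto
  have cw: "continuous_on A w" for A unfolding w_def by (intro continuous_intros)
  have "hol_family X C \<gamma> \<rho>' (\<lambda>x U. LINT t:{0..1}|lborel. F x (U + w t) / w t)"
  proof (rule hol_family_set_integral[OF contC])
    show "set_borel_measurable lborel {0..1} (\<lambda>t. F x (U + w t) / w t)" if "x \<in> X" "U \<in> strip \<rho>'" for x U
    proof -
      have "continuous_on {0..1} (\<lambda>t. F x (U + w t) / w t)"
        using nw inst' that
        by (intro continuous_intros cw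
          continuous_on_compose2[OF holomorphic_on_imp_continuous_on[OF hol_familyD(2)[OF F]]]) auto
      then show ?thesis
        unfolding set_borel_measurable_def by (auto intro!: borel_measurable_continuous_on_indicator)
    qed
    show "continuous_on (X \<times> strip \<rho>') (\<lambda>(x, U). F x (U + w t) / w t)" for t
    proof -
      have "continuous_on (X \<times> strip \<rho>') (\<lambda>p. (\<lambda>(x, U). F x U) (fst p, snd p + w t))"
        by (rule continuous_on_compose2[OF hol_familyD(1)[OF F]])
           (use inst' in \<open>auto intro!: continuous_intros\<close>)
      then show ?thesis using nw unfolding case_prod_beta by (intro continuous_intros) auto
    qed
    show "(\<lambda>U. F x (U + w t) / w t) holomorphic_on strip \<rho>'" if "x \<in> X" for x t
    proof -
      have "(F x \<circ> (\<lambda>U. U + w t)) holomorphic_on strip \<rho>'"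
        by (rule holomorphic_on_compose_gen[OF _ hol_familyD(2)[OF F that]])
           (use inst' in \<open>auto intro!: holomorphic_intros\<close>)
      then show ?thesis using nw by (intro holomorphic_intros) (auto simp: o_def)
    qed
    show "curve_hol X C (\<lambda>x. F x (U + w t) / w t)" if "U \<in> strip \<rho>'" for t U
      using hol_familyD(3)[OF F inst'[OF that, of t]] nw unfolding curve_hol_def
      by (auto intro!: holomorphic_intros)
    fix x0 g assume h: "x0 \<in> X" "\<gamma> < g"
    obtain e B where eB: "e > 0" "B \<ge> 0"
      "\<forall>x\<in>X \<inter> ball x0 e. \<forall>U\<in>strip \<rho>2. norm (F x U) \<le> B * exp (g * Re U)"
      using hol_familyD(4)[OF F h r(4,3)] by blast
    show "\<exists>e>0. \<exists>b. set_integrable lborel {0..1} b \<and>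
       (\<forall>x\<in>X \<inter> ball x0 e. \<forall>U\<in>strip \<rho>'. \<forall>t\<in>{0..1}. norm (F x (U + w t) / w t) \<le> b t * exp (g * Re U))"
    proof (intro exI[of _ e] exI[of _ "\<lambda>t. B * exp (\<bar>g\<bar> * r) / r"] conjI ballI)
      show "set_integrable lborel {0..1::real} (\<lambda>t. B * exp (\<bar>g\<bar> * r) / r)"
        by (simp add: set_integrable_def)
      fix x U t assume x: "x \<in> X \<inter> ball x0 e" "U \<in> strip \<rho>'" "t \<in> {0..1::real}"
      have "norm (F x (U + w t)) \<le> B * exp (g * Re (U + w t))"
        using x by (intro eB(3)[rule_format] inst) auto
      also have "\<dots> \<le> B * exp (\<bar>g\<bar> * r + g * Re U)"
      proof -
        have "g * Re (w t) \<le> \<bar>g\<bar> * \<bar>Re (w t)\<bar>" by (metis abs_ge_self abs_mult)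
        also have "\<dots> \<le> \<bar>g\<bar> * r" using nw(1)[of t] abs_Re_le_cmod[of "w t"] by (intro mult_left_mono) auto
        finally show ?thesis using eB by (intro mult_left_mono) (auto simp: distrib_left)
      qed
      finally show "norm (F x (U + w t) / w t) \<le> B * exp (\<bar>g\<bar> * r) / r * exp (g * Re U)"
        using r by (simp add: norm_divide nw exp_add field_simps)
    qed (use eB in auto)
  qed
  then show "hol_family X C \<gamma> \<rho>' (\<lambda>x. deriv (F x))"
  proof (rule hol_family_cong[rotated])
    fix x U assume that: "x \<in> X" "U \<in> strip \<rho>'"
    have "deriv (F x) U = (LINT t:{0..1}|lborel. F x (U + w t) / w t)"
      unfolding w_def
      by (rule deriv_circle_integral[OF hol_familyD(2)[OF F that(1)]])
         (use r cball_strip[OF that(2), of r \<rho>] in auto)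
    then show "(LINT t:{0..1}|lborel. F x (U + w t) / w t) = deriv (F x) U" by simp
  qed
qed

section \<open>Normalized Erdelyi-Kober averages\<close>

definition beta_ker :: "complex \<Rightarrow> complex \<Rightarrow> real \<Rightarrow> complex" where
  "beta_ker \<sigma> s t = of_real t powr (\<sigma> - 1) * of_real (1 - t) powr (s - 1)"

text \<open>
  The average \<open>ek N\<close> makes sense for \<open>Re \<sigma> > - N\<close> and \<open>Re s > - N\<close>. The recursion comes from integrating
  \<open>(d/dt) (t\<^sup>\<sigma> (1 - t)\<^sup>s ((s - (\<sigma> + s) t) \<phi>(t U)))\<close> over \<open>[0,1]\<close>.
\<close>

primrec ek :: "nat \<Rightarrow> (complex \<Rightarrow> complex) \<Rightarrow> complex \<Rightarrow> complex \<Rightarrow> complex \<Rightarrow> complex" where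
  "ek 0 \<phi> \<sigma> s U = rGamma \<sigma> * rGamma s * (LINT t:{0<..<1}|lborel. \<phi> (of_real t * U) * beta_ker \<sigma> s t)"
| "ek (Suc N) \<phi> \<sigma> s U =
     (\<sigma> + s) * (ek N (\<lambda>u. u * deriv \<phi> u) (\<sigma> + 1) (s + 1) U + (\<sigma> + s + 1) * ek N \<phi> (\<sigma> + 1) (s + 1) U)
     + (- s) * (U * ek N (deriv \<phi>) (\<sigma> + 1) (s + 1) U)"

lemma powr_of_real_pos: "t > 0 \<Longrightarrow> complex_of_real t powr w = exp (w * of_real (ln t))"
  by (simp add: powr_def Ln_of_real)

lemma norm_powr_of_real: "t > 0 \<Longrightarrow> norm (complex_of_real t powr w) = t powr Re w"
  by (subst norm_powr_real_powr) auto

lemma norm_beta_ker: "0 < t \<Longrightarrow> t < 1 \<Longrightarrow> norm (beta_ker \<sigma> s t) = t powr (Re \<sigma> - 1) * (1 - t) powr (Re s - 1)"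
  unfolding beta_ker_def norm_mult by (subst norm_powr_of_real | simp)+

lemma continuous_beta_ker: "continuous_on {0<..<1} (beta_ker \<sigma> s)"
proof -
  have "continuous_on {0<..<1} (\<lambda>t. exp ((\<sigma> - 1) * of_real (ln t)) * exp ((s - 1) * of_real (ln (1 - t))))"
    by (intro continuous_intros) auto
  then show ?thesis
    by (rule continuous_on_eq) (simp add: beta_ker_def powr_of_real_pos del: of_real_diff)
qed

lemma beta_ker_Suc_left: "0 < t \<Longrightarrow> beta_ker (\<sigma> + 1) s t = of_real t * beta_ker \<sigma> s t"
  by (simp add: beta_ker_def powr_diff)

lemma beta_ker_Suc_right: "t < 1 \<Longrightarrow> beta_ker \<sigma> (s + 1) t = (1 - of_real t) * beta_ker \<sigma> s t"
  by (simp add: beta_ker_def powr_diff)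

lemma set_integrable_beta_Ioo:
  assumes "a > 0" "b > (0::real)"
  shows "set_integrable lborel {0<..<1} (\<lambda>t. t powr (a - 1) * (1 - t) powr (b - 1))"
  by (rule set_integrable_subset[OF integrable_Beta[OF assms]]) auto

lemma param_hol_beta_ker:
  assumes "param_hol X C \<sigma>" "param_hol X C s" "0 < t" "t < 1"
  shows "param_hol X C (\<lambda>x. beta_ker (\<sigma> x) (s x) t)"
proof -
  have "param_hol X C (\<lambda>x. exp ((\<sigma> x - 1) * of_real (ln t)) * exp ((s x - 1) * of_real (ln (1 - t))))"
    by (intro param_hol_comb assms)
  then show ?thesis using assms(3,4) by (simp add: beta_ker_def powr_of_real_pos del: of_real_diff)
qed

lemma param_hol_pos_nbhd:
  assumes "param_hol X C \<sigma>" "x0 \<in> X" "Re (\<sigma> x0) > 0"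
  shows "\<exists>e>0. \<forall>x\<in>X \<inter> ball x0 e. Re (\<sigma> x) > Re (\<sigma> x0) / 2"
proof -
  have "continuous_on X (\<lambda>x. Re (\<sigma> x))" using assms(1) unfolding param_hol_def
    by (intro continuous_intros) auto
  then have "continuous (at x0 within X) (\<lambda>x. Re (\<sigma> x))" using assms(2)
    by (simp add: continuous_on_eq_continuous_within)
  then obtain e where "e > 0" "\<And>x. x \<in> X \<Longrightarrow> dist x x0 < e \<Longrightarrow> dist (Re (\<sigma> x)) (Re (\<sigma> x0)) < Re (\<sigma> x0) / 2"
    unfolding continuous_within_eps_delta using assms(3) by (meson half_gt_zero)
  then have "Re (\<sigma> x) > Re (\<sigma> x0) / 2" if "x \<in> X \<inter> ball x0 e" for x
    using that by (force simp: dist_real_def dist_commute abs_if split: if_splits)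
  then show ?thesis using \<open>e > 0\<close> by blast
qed

text \<open>An average evaluates its argument down to \<open>t = 0\<close>, where decay is of no
  use; only positive exponents survive scaling. This is the origin of \<open>max \<gamma> 0\<close>
  for averages. The constant \<open>exp (g * \<rho>)\<close> pays for negative
  \<open>Re U\<close>.\<close>

lemma scaled_exp_bound:
  assumes "U \<in> strip \<rho>" "0 \<le> t" "t \<le> 1" "0 < (g::real)"
  shows "exp (g * Re (of_real t * U)) \<le> exp (g * \<rho>) * exp (g * Re U)"
proof -
  have "t * Re U \<le> \<rho> + Re U"
  proof (cases "Re U \<ge> 0")
    case True
    then show ?thesis using assms mult_left_le_one_le[of "Re U" t] strip_rho_pos[OF assms(1)] by linarith
  next
    case False
    then have "t * Re U \<le> 0" using assms by (simp add: mult_nonneg_nonpos)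
    then show ?thesis using assms(1) by (auto simp: strip_def)
  qed
  then have "g * (t * Re U) \<le> g * (\<rho> + Re U)" using assms by (intro mult_left_mono) auto
  then show ?thesis by (simp add: exp_add[symmetric] algebra_simps)
qed

lemma hol_family_ek_0:
  assumes contC: "\<And>c. c \<in> C \<Longrightarrow> continuous_on UNIV c"
    and F: "hol_family X C \<gamma> \<rho> F" and \<sigma>: "param_hol X C \<sigma>" and s: "param_hol X C s"
    and pos: "\<And>x. x \<in> X \<Longrightarrow> Re (\<sigma> x) > 0" "\<And>x. x \<in> X \<Longrightarrow> Re (s x) > 0"
  shows "hol_family X C (max \<gamma> 0) \<rho> (\<lambda>x. ek 0 (F x) (\<sigma> x) (s x))"
proof -
  have "hol_family X C (max \<gamma> 0) \<rho> (\<lambda>x U. LINT t:{0<..<1}|lborel. F x (of_real t * U)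
    * beta_ker (\<sigma> x) (s x) t)"
  proof (rule hol_family_localI)
    fix r assume r: "0 < r" "r < \<rho>"
    note st = strip_mono[of r \<rho>]
    have inst: "of_real t * U \<in> strip r" "of_real t * U \<in> strip \<rho>" if "t \<in> {0<..<1}" "U \<in> strip r" for t U
      using scale_in_strip[of U r t] st that r by auto
    show "hol_family X C (max \<gamma> 0) r (\<lambda>x U. LINT t:{0<..<1}|lborel. F x (of_real t * U)
      * beta_ker (\<sigma> x) (s x) t)"
    proof (rule hol_family_set_integral[OF contC])
      show "set_borel_measurable lborel {0<..<1} (\<lambda>t. F x (of_real t * U) * beta_ker (\<sigma> x) (s x) t)"
        if "x \<in> X" "U \<in> strip r" for x U
      proof -
        have "continuous_on {0<..<1} (\<lambda>t. F x (of_real t * U) * beta_ker (\<sigma> x) (s x) t)"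
          by (intro continuous_intros continuous_beta_ker
                continuous_on_compose2[OF holomorphic_on_imp_continuous_on[OF hol_familyD(2)[OF F that(1)]]])
             (use inst that in auto)
        then show ?thesis unfolding set_borel_measurable_def
          by (auto intro!: borel_measurable_continuous_on_indicator)
      qed
      show "continuous_on (X \<times> strip r) (\<lambda>(x, U). F x (of_real t * U) * beta_ker (\<sigma> x) (s x) t)"
        if t: "t \<in> {0<..<1}" for t
      proof -
        have "continuous_on (X \<times> strip r) (\<lambda>p. (\<lambda>(x, U). F x U) (fst p, of_real t * snd p))"
          by (rule continuous_on_compose2[OF hol_familyD(1)[OF F]])
             (use inst t in \<open>auto intro!: continuous_intros\<close>)
        moreover have "continuous_on (X \<times> strip r) (\<lambda>p. beta_ker (\<sigma> (fst p)) (s (fst p)) t)"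
          by (rule continuous_on_compose2[of X "\<lambda>x. beta_ker (\<sigma> x) (s x) t" _ fst])
             (use param_hol_beta_ker[OF \<sigma> s, of t] t in \<open>auto simp: param_hol_def intro!: continuous_intros\<close>)
        ultimately show ?thesis unfolding case_prod_beta by (intro continuous_on_mult) auto
      qed
      show "(\<lambda>U. F x (of_real t * U) * beta_ker (\<sigma> x) (s x) t) holomorphic_on strip r"
        if t: "t \<in> {0<..<1}" "x \<in> X" for t x
      proof -
        have "(F x \<circ> (\<lambda>U. of_real t * U)) holomorphic_on strip r"
          by (rule holomorphic_on_compose_gen[OF _ hol_familyD(2)[OF F that(2)]])
             (use inst t in \<open>auto intro!: holomorphic_intros\<close>)
        then show ?thesis by (intro holomorphic_intros) (simp add: o_def)
      qed
      show "curve_hol X C (\<lambda>x. F x (of_real t * U) * beta_ker (\<sigma> x) (s x) t)"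
        if "t \<in> {0<..<1}" "U \<in> strip r" for t U
        using param_hol_beta_ker[OF \<sigma> s, of t] hol_familyD(3)[OF F inst(2)[OF that]] that
        by (intro curve_hol_comb) (auto simp: param_hol_def)
      fix x0 g assume h: "x0 \<in> X" "max \<gamma> 0 < g"
      then have g: "\<gamma> < g" "0 < g" by auto
      obtain e1 B where 1: "e1 > 0" "B \<ge> 0" "\<forall>x\<in>X \<inter> ball x0 e1. \<forall>U\<in>strip r. norm (F x U) \<le> B * exp (g * Re U)"
        using hol_familyD(4)[OF F h(1) g(1) r] by blast
      obtain e2 where 2: "e2 > 0" "\<forall>x\<in>X \<inter> ball x0 e2. Re (\<sigma> x) > Re (\<sigma> x0) / 2"
        using param_hol_pos_nbhd[OF \<sigma> h(1) pos(1)[OF h(1)]] by blast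
      obtain e3 where 3: "e3 > 0" "\<forall>x\<in>X \<inter> ball x0 e3. Re (s x) > Re (s x0) / 2"
        using param_hol_pos_nbhd[OF s h(1) pos(2)[OF h(1)]] by blast
      \<comment> \<open>On the unit interval powers decrease in the exponent, so half of the real
        parts at \<open>x0\<close> gives an integrable majorant for all nearby parameters.\<close>
      define b where "b t = B * exp (g * r) * (t powr (Re (\<sigma> x0) / 2 - 1) * (1 - t) powr (Re (s x0) / 2 - 1))"
        for t
      show "\<exists>e>0. \<exists>b. set_integrable lborel {0<..<1} b \<and>
        (\<forall>x\<in>X \<inter> ball x0 e. \<forall>U\<in>strip r. \<forall>t\<in>{0<..<1}. norm (F x (of_real t * U) * beta_ker (\<sigma> x) (s x) t) \<le> b t
          * exp (g * Re U))"
      proof (intro exI[of _ "min e1 (min e2 e3)"] exI[of _ b] conjI ballI)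
        show "set_integrable lborel {0<..<1} b"
          unfolding b_def using pos h by (intro set_integrable_mult_right set_integrable_beta_Ioo) auto
        fix x U t assume x: "x \<in> X \<inter> ball x0 (min e1 (min e2 e3))" "U \<in> strip r" "t \<in> {0<..<1::real}"
        have "norm (F x (of_real t * U)) \<le> B * exp (g * Re (of_real t * U))"
          using x inst by (intro 1(3)[rule_format]) auto
        also have "\<dots> \<le> B * (exp (g * r) * exp (g * Re U))"
          using scaled_exp_bound[OF x(2), of t g] x g 1 by (intro mult_left_mono) auto
        finally have A: "norm (F x (of_real t * U)) \<le> B * (exp (g * r) * exp (g * Re U))" .
        have "norm (beta_ker (\<sigma> x) (s x) t) = t powr (Re (\<sigma> x) - 1) * (1 - t) powr (Re (s x) - 1)"
          using x by (intro norm_beta_ker) auto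
        also have "\<dots> \<le> t powr (Re (\<sigma> x0) / 2 - 1) * (1 - t) powr (Re (s x0) / 2 - 1)"
          using 2(2)[rule_format, of x] 3(2)[rule_format, of x] x by (intro mult_mono powr_mono') auto
        finally have "norm (F x (of_real t * U)) * norm (beta_ker (\<sigma> x) (s x) t)
            \<le> (B * (exp (g * r) * exp (g * Re U))) *
              (t powr (Re (\<sigma> x0) / 2 - 1) * (1 - t) powr (Re (s x0) / 2 - 1))"
          using A 1(2) by (intro mult_mono) auto
        then show "norm (F x (of_real t * U) * beta_ker (\<sigma> x) (s x) t) \<le> b t * exp (g * Re U)"
          by (simp add: norm_mult b_def mult_ac)
      qed (use 1 2 3 in auto)
    qed
  qed
  moreover have "hol_family X C 0 \<rho> (\<lambda>x U. rGamma (\<sigma> x) * rGamma (s x))"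
    by (intro hol_family_const param_hol_comb \<sigma> s)
  ultimately have "hol_family X C (0 + max \<gamma> 0) \<rho> (\<lambda>x U. rGamma (\<sigma> x) * rGamma (s x) *
        (LINT t:{0<..<1}|lborel. F x (of_real t * U) * beta_ker (\<sigma> x) (s x) t))"
    by (intro hol_family_mult)
  then have "hol_family X C (max \<gamma> 0) \<rho> (\<lambda>x U. rGamma (\<sigma> x) * rGamma (s x) *
        (LINT t:{0<..<1}|lborel. F x (of_real t * U) * beta_ker (\<sigma> x) (s x) t))"
    by simp
  then show ?thesis by (rule hol_family_cong[rotated]) simp
qed

lemma hol_family_euler:
  assumes contC: "\<And>c. c \<in> C \<Longrightarrow> continuous_on UNIV c" and F: "hol_family X C \<gamma> \<rho> F"
  shows "hol_family X C \<gamma> \<rho> (\<lambda>x u. u * deriv (F x) u)"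
  using hol_family_mult[OF hol_family_ident[of X C \<rho>] hol_family_deriv[OF contC F]] by simp

lemma hol_family_ek:
  assumes contC: "\<And>c. c \<in> C \<Longrightarrow> continuous_on UNIV c"
    and F: "hol_family X C \<gamma> \<rho> F" and \<sigma>: "param_hol X C \<sigma>" and s: "param_hol X C s"
    and pos: "\<And>x. x \<in> X \<Longrightarrow> Re (\<sigma> x) > - real N" "\<And>x. x \<in> X \<Longrightarrow> Re (s x) > - real N"
  shows "hol_family X C (max \<gamma> 0) \<rho> (\<lambda>x. ek N (F x) (\<sigma> x) (s x))"
  using F \<sigma> s pos
proof (induction N arbitrary: F \<sigma> s)
  case 0
  then show ?case using hol_family_ek_0[OF contC, of C X \<gamma> \<rho> F \<sigma> s] by (auto simp del: ek.simps)
next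
  case (Suc N)
  have IH: "hol_family X C (max \<gamma> 0) \<rho> (\<lambda>x. ek N (G x) (\<sigma> x + 1) (s x + 1))" if "hol_family X C \<gamma> \<rho> G" for G
  proof (rule Suc.IH[OF that])
    show "- real N < Re (\<sigma> x + 1)" "- real N < Re (s x + 1)" if "x \<in> X" for x
      using Suc.prems(4,5)[OF that] by auto
  qed (use Suc.prems in \<open>auto intro!: param_hol_comb\<close>)
  note c = hol_family_const[of X C _ \<rho>]
  note m = hol_family_mult[of X C 0 \<rho> _ "max \<gamma> 0", simplified]
  have "hol_family X C (max \<gamma> 0) \<rho> (\<lambda>x U.
     (\<sigma> x + s x) * (ek N (\<lambda>u. u * deriv (F x) u) (\<sigma> x + 1) (s x + 1) U + (\<sigma> x + s x + 1) * ek N (F x)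
       (\<sigma> x + 1) (s x + 1) U)
     + (- s x) * (U * ek N (deriv (F x)) (\<sigma> x + 1) (s x + 1) U))"
    by (intro hol_family_add m c hol_family_ident IH hol_family_euler[OF contC] hol_family_deriv[OF contC]
          param_hol_comb Suc.prems)
  then show ?case by simp
qed

text \<open>A single function is encoded as a constant family over a dummy parameter space without
  curves, so that every lemma on families applies to it.\<close>

abbreviation exp_bounded :: "real \<Rightarrow> real \<Rightarrow> (complex \<Rightarrow> complex) \<Rightarrow> bool" where
  "exp_bounded \<gamma> \<rho> \<phi> \<equiv> hol_family (UNIV :: complex set) {} \<gamma> \<rho> (\<lambda>_. \<phi>)"

lemma hol_family_slice:
  assumes "hol_family X C \<gamma> \<rho> F" "x \<in> X"
  shows "exp_bounded \<gamma> \<rho> (F x)"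
  unfolding hol_family_def
proof (intro conjI ballI allI impI)
  have "continuous_on (UNIV \<times> strip \<rho>) (\<lambda>p. F x (snd p))"
    by (rule continuous_on_compose2[OF holomorphic_on_imp_continuous_on[OF hol_familyD(2)[OF assms]]])
       (auto intro!: continuous_intros)
  then show "continuous_on (UNIV \<times> strip \<rho>) (\<lambda>(_::complex, U). F x U)" by (simp add: case_prod_beta)
  show "F x holomorphic_on strip \<rho>" using hol_familyD(2)[OF assms] .
  fix g r assume h: "\<gamma> < g" "0 < (r::real)" "r < \<rho>"
  obtain e B where eB: "e > 0" "\<forall>y\<in>X \<inter> ball x e. \<forall>U\<in>strip r. norm (F y U) \<le> B * exp (g * Re U)"
    using hol_familyD(4)[OF assms h] by blast
  show "\<exists>e>0. \<exists>B. \<forall>x'\<in>(UNIV::complex set) \<inter> ball x0 e. \<forall>U\<in>strip r. norm (F x U) \<le> B * exp (g * Re U)" for x0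
    by (rule exI[of _ 1], rule conjI[OF _ exI[of _ B]]) (use eB assms(2) in auto)
qed (auto simp: curve_hol_def)

lemma exp_boundedD:
  assumes "exp_bounded \<gamma> \<rho> \<phi>"
  shows "\<phi> holomorphic_on strip \<rho>"
  using hol_familyD(2)[OF assms, of 0] by auto

lemma exp_bounded_intros:
  assumes "exp_bounded \<gamma> \<rho> \<phi>"
  shows "exp_bounded \<gamma> \<rho> (deriv \<phi>)" "exp_bounded \<gamma> \<rho> (\<lambda>u. u * deriv \<phi> u)" "exp_bounded \<gamma> \<rho> ((deriv ^^ n) \<phi>)"
proof -
  show "exp_bounded \<gamma> \<rho> (deriv \<phi>)" using hol_family_deriv[OF _ assms] by auto
  show "exp_bounded \<gamma> \<rho> (\<lambda>u. u * deriv \<phi> u)" using hol_family_euler[OF _ assms] by auto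
  show "exp_bounded \<gamma> \<rho> ((deriv ^^ n) \<phi>)"
  proof (induction n)
    case (Suc n)
    then show ?case using hol_family_deriv[OF _ Suc] by auto
  qed (use assms in auto)
qed

lemma exp_bounded_ek:
  assumes "exp_bounded \<gamma> \<rho> \<phi>" "Re \<sigma> > - real N" "Re s > - real N"
  shows "exp_bounded (max \<gamma> 0) \<rho> (ek N \<phi> \<sigma> s)"
  by (rule hol_family_ek) (use assms in \<open>auto intro: param_hol_const\<close>)

lemma exp_bounded_segment:
  assumes \<phi>: "\<phi> holomorphic_on strip \<rho>" and U: "U \<in> strip \<rho>"
  shows "\<exists>B\<ge>0. \<forall>t\<in>{0..1}. norm (\<phi> (of_real t * U)) \<le> B"
proof -
  have "continuous_on {0..1::real} (\<lambda>t. \<phi> (of_real t * U))"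
    by (intro continuous_on_compose2[OF holomorphic_on_imp_continuous_on[OF \<phi>]] continuous_intros)
       (use scale_in_strip[OF U] in auto)
  then have "compact ((\<lambda>t. \<phi> (of_real t * U)) ` {0..1::real})" by (rule compact_continuous_image) auto
  then obtain B where "\<forall>z\<in>(\<lambda>t. \<phi> (of_real t * U)) ` {0..1::real}. norm z \<le> B"
    using compact_imp_bounded bounded_iff by blast
  then show ?thesis by (intro exI[of _ "max B 0"]) (auto simp: max.coboundedI1)
qed

lemma set_integrable_ek:
  assumes \<phi>: "\<phi> holomorphic_on strip \<rho>" and U: "U \<in> strip \<rho>" and pos: "Re \<sigma> > 0" "Re s > 0"
  shows "set_integrable lborel {0<..<1} (\<lambda>t. \<phi> (of_real t * U) * beta_ker \<sigma> s t)"
proof -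
  obtain B where B: "B \<ge> 0" "\<And>t. t \<in> {0..1} \<Longrightarrow> norm (\<phi> (of_real t * U)) \<le> B"
    using exp_bounded_segment[OF \<phi> U] by blast
  have m: "set_borel_measurable lborel {0<..<1} (\<lambda>t. \<phi> (of_real t * U) * beta_ker \<sigma> s t)"
  proof -
    have "continuous_on {0<..<1} (\<lambda>t. \<phi> (of_real t * U) * beta_ker \<sigma> s t)"
      by (intro continuous_intros continuous_beta_ker
            continuous_on_compose2[OF holomorphic_on_imp_continuous_on[OF \<phi>]])
         (use scale_in_strip[OF U] in auto)
    then show ?thesis unfolding set_borel_measurable_def
      by (auto intro!: borel_measurable_continuous_on_indicator)
  qed
  show ?thesis
    unfolding set_integrable_def
  proof (rule Bochner_Integration.integrable_bound)
    show "integrable lborel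
      (\<lambda>t. indicator {0<..<1} t *\<^sub>R (B * (t powr (Re \<sigma> - 1) * (1 - t) powr (Re s - 1))))"
      using set_integrable_mult_right[OF set_integrable_beta_Ioo[OF pos], of B]
        by (simp add: set_integrable_def)
    show "(\<lambda>t. indicator {0<..<1} t *\<^sub>R (\<phi> (of_real t * U) * beta_ker \<sigma> s t)) \<in> borel_measurable lborel"
      using m by (simp add: set_borel_measurable_def)
    show "AE t in lborel. norm (indicator {0<..<1} t *\<^sub>R (\<phi> (of_real t * U) * beta_ker \<sigma> s t))
        \<le> norm (indicator {0<..<1} t *\<^sub>R (B * (t powr (Re \<sigma> - 1) * (1 - t) powr (Re s - 1))))"
      using B by (intro AE_I2) (auto simp: indicator_def norm_mult norm_beta_ker intro!: mult_right_mono)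
  qed
qed

lemma has_vector_derivative_powr_real:
  assumes "t > 0"
  shows "((\<lambda>t. complex_of_real t powr w) has_vector_derivative (w * of_real t powr (w - 1))) (at t)"
proof -
  have "((\<lambda>z. z powr w) has_field_derivative w * of_real t powr (w - 1)) (at (complex_of_real t))"
    by (rule has_field_derivative_powr) (use assms in \<open>auto simp: complex_nonpos_Reals_iff\<close>)
  from has_vector_derivative_real_field[OF this] show ?thesis by simp
qed

text \<open>The logarithmic derivative of the weight contributes
  \<open>\<sigma> - (\<sigma> + s) * t\<close>, with values \<open>\<sigma>\<close> and
  \<open>- s\<close> at the endpoints. The linear factor of \<open>Q\<close> has the values
  \<open>s\<close> and \<open>- \<sigma>\<close> there, so the product equals
  \<open>\<sigma> * s\<close> up to a multiple of \<open>t * (1 - t)\<close>. Every other term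
  carries \<open>t * (1 - t)\<close>, which raises both exponents by one.\<close>

lemma ek_Suc_0:
  assumes \<phi>: "\<phi> holomorphic_on strip \<rho>" and U: "U \<in> strip \<rho>" and pos: "Re \<sigma> > 0" "Re s > 0"
  shows "ek (Suc 0) \<phi> \<sigma> s U = ek 0 \<phi> \<sigma> s U"
proof -
  define p where "p t = \<phi> (of_real t * U)" for t :: real
  define p' where "p' t = U * deriv \<phi> (of_real t * U)" for t :: real
  define P where "P = beta_ker \<sigma> s"
  define Q where "Q t = of_real t powr \<sigma> * of_real (1 - t) powr s * ((s - (\<sigma> + s) * of_real t) * p t)"
    for t :: real
  define Q' where "Q' t = P t * (\<sigma> * s * p t - (\<sigma> + s) * (\<sigma> + s + 1) * of_real t * (1 - of_real t) * p t
       + of_real t * (1 - of_real t) * p' t * (s - (\<sigma> + s) * of_real t))" for t :: real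
  note inst = scale_in_strip[OF U]
  have pd: "(p has_vector_derivative p' t) (at t)" if "t \<in> {0..1}" for t
  proof -
    have "(\<phi> has_field_derivative deriv \<phi> (of_real t * U)) (at (of_real t * U))"
      using \<phi> inst that by (intro holomorphic_derivI) auto
    moreover have "((\<lambda>z. z * U) has_field_derivative U) (at (of_real t))"
      by (auto intro!: derivative_eq_intros)
    ultimately have "((\<lambda>z. \<phi> (z * U)) has_field_derivative deriv \<phi> (of_real t * U) * U) (at (of_real t))"
      by (rule DERIV_chain2)
    from has_vector_derivative_real_field[OF this] show ?thesis
      unfolding p_def p'_def by (simp add: mult.commute)
  qed
  have Qd: "(Q has_vector_derivative Q' t) (at t)" if t: "t \<in> {0<..<1}" for t
  proof -
    have d1: "((\<lambda>t. complex_of_real t powr \<sigma>) has_vector_derivative (\<sigma> * of_real t powr (\<sigma> - 1))) (at t)"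
      using t by (intro has_vector_derivative_powr_real) auto
    have "((\<lambda>t. complex_of_real t powr s) has_vector_derivative (s * of_real (1 - t) powr (s - 1)))
      (at (1 - t))"
      using t by (intro has_vector_derivative_powr_real) auto
    moreover have "((\<lambda>t. 1 - t) has_vector_derivative (-1)) (at t)"
      by (auto intro!: derivative_eq_intros)
    ultimately have "((\<lambda>t. complex_of_real t powr s) \<circ> (\<lambda>t. 1 - t) has_vector_derivative (-1) *\<^sub>R
      (s * of_real (1 - t) powr (s - 1))) (at t)"
      by (intro vector_diff_chain_at)
    then have d2: "((\<lambda>t. complex_of_real (1 - t) powr s) has_vector_derivative
      - (s * of_real (1 - t) powr (s - 1))) (at t)"
      by (simp add: o_def)
    have d4: "((\<lambda>t. (s - (\<sigma> + s) * of_real t) * p t) has_vector_derivative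
        ((s - (\<sigma> + s) * of_real t) * p' t + (- (\<sigma> + s)) * p t)) (at t)"
    proof (rule has_vector_derivative_mult)
      show "((\<lambda>t. s - (\<sigma> + s) * complex_of_real t) has_vector_derivative - (\<sigma> + s)) (at t)"
        by (auto intro!: derivative_eq_intros)
      show "(p has_vector_derivative p' t) (at t)" using pd t by auto
    qed
    have "(Q has_vector_derivative
        (of_real t powr \<sigma> * of_real (1 - t) powr s) * ((s - (\<sigma> + s) * of_real t) * p' t + (- (\<sigma> + s)) * p t)
         + (of_real t powr \<sigma> * (- (s * of_real (1 - t) powr (s - 1))) + (\<sigma> * of_real t powr (\<sigma> - 1)) * of_real
           (1 - t) powr s)
            * ((s - (\<sigma> + s) * of_real t) * p t)) (at t)"
      unfolding Q_def by (intro has_vector_derivative_mult d1 d2 d4)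
    moreover have "of_real t powr \<sigma> = of_real t * complex_of_real t powr (\<sigma> - 1)"
      using t by (simp add: powr_diff)
    moreover have "complex_of_real (1 - t) powr s = (1 - of_real t) * complex_of_real (1 - t) powr (s - 1)"
    proof -
      have "complex_of_real (1 - t) \<noteq> 0" using t
        by (metis diff_gt_0_iff_gt greaterThanLessThan_iff less_numeral_extra(3) of_real_eq_0_iff)
      then show ?thesis by (simp add: powr_diff)
    qed
    moreover have "(T * A) * ((1 - T) * B) * ((s - (\<sigma> + s) * T) * p' t + (- (\<sigma> + s)) * p t)
         + ((T * A) * (- (s * B)) + (\<sigma> * A) * ((1 - T) * B)) * ((s - (\<sigma> + s) * T) * p t)
       = (A * B) * (\<sigma> * s * p t - (\<sigma> + s) * (\<sigma> + s + 1) * T * (1 - T) * p t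
           + T * (1 - T) * p' t * (s - (\<sigma> + s) * T))" for T A B :: complex
      by algebra
    ultimately show ?thesis
      unfolding Q'_def P_def beta_ker_def by metis
  qed
  have Qc: "continuous_on {0..1} Q"
  proof -
    have "continuous_on {0..1} p"
      using pd by (meson continuous_at_imp_continuous_on has_vector_derivative_continuous)
    moreover have "continuous_on {0..1} (\<lambda>t. complex_of_real t powr \<sigma>)"
      using pos by (intro continuous_on_powr_complex continuous_intros) auto
    moreover have "continuous_on {0..1} (\<lambda>t. complex_of_real (1 - t) powr s)"
      using pos by (intro continuous_on_powr_complex continuous_intros) auto
    ultimately show ?thesis unfolding Q_def
      by (intro continuous_on_mult continuous_on_diff continuous_on_const continuous_on_of_real
        continuous_on_id)
  qed
  \<comment> \<open>Both boundary values are 0, since the powers in \<open>Q\<close> vanish at an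
    endpoint when \<open>Re \<sigma>\<close> and \<open>Re s\<close> are positive.\<close>
  have "(Q' has_integral Q 1 - Q 0) {0..1}"
    by (rule fundamental_theorem_of_calculus_interior_strong[of "{}"]) (use Qd Qc in auto)
  then have Q0: "integral {0<..<1} Q' = 0"
    using pos by (simp add: has_integral_Icc_iff_Ioo Q_def integral_unique)
  define I where "I f = (LINT t:{0<..<1}|lborel. f (of_real t * U) * beta_ker (\<sigma> + 1) (s + 1) t)" for f
  define I0 where "I0 = (LINT t:{0<..<1}|lborel. p t * P t)"
  have h': "deriv \<phi> holomorphic_on strip \<rho>" using \<phi> by (rule holomorphic_deriv) auto
  then have h2: "(\<lambda>u. u * deriv \<phi> u) holomorphic_on strip \<rho>"
    by (intro holomorphic_on_mult holomorphic_on_ident)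
  have int: "set_integrable lborel {0<..<1} (\<lambda>t. f (of_real t * U) * beta_ker (\<sigma> + 1) (s + 1) t)"
    if "f holomorphic_on strip \<rho>" for f
    using set_integrable_ek[OF that U, of "\<sigma> + 1" "s + 1"] pos by auto
  have int0: "set_integrable lborel {0<..<1} (\<lambda>t. p t * P t)"
    using set_integrable_ek[OF \<phi> U pos] by (simp add: p_def P_def)
  let ?R = "\<lambda>t. \<sigma> * s * (p t * P t)
     - (\<sigma> + s) * (\<sigma> + s + 1) * (\<phi> (of_real t * U) * beta_ker (\<sigma> + 1) (s + 1) t)
     - (\<sigma> + s) * ((of_real t * U) * deriv \<phi> (of_real t * U) * beta_ker (\<sigma> + 1) (s + 1) t)
     + s * U * (deriv \<phi> (of_real t * U) * beta_ker (\<sigma> + 1) (s + 1) t)"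
  have intR: "set_integrable lborel {0<..<1} ?R"
    by (intro set_integral_add set_integral_diff set_integrable_mult_right int int0 h' \<phi> int[OF h2])
  have Q'R: "Q' t = ?R t" if "t \<in> {0<..<1}" for t
  proof -
    have "beta_ker (\<sigma> + 1) (s + 1) t = of_real t * ((1 - of_real t) * beta_ker \<sigma> s t)"
      using that by (simp add: beta_ker_Suc_left beta_ker_Suc_right)
    then show ?thesis unfolding Q'_def p_def p'_def P_def by algebra
  qed
  have "0 = integral {0<..<1} ?R"
    unfolding Q0[symmetric] by (rule integral_cong) (use Q'R in auto)
  also have "\<dots> = (LINT t:{0<..<1}|lborel. ?R t)"
    using set_borel_integral_eq_integral(2)[OF intR] by simp
  also have "\<dots> = \<sigma> * s * I0 - (\<sigma> + s) * (\<sigma> + s + 1) * I \<phi> - (\<sigma> + s) * I (\<lambda>u. u * deriv \<phi> u) + s * U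
    * I (deriv \<phi>)"
    unfolding I_def I0_def
    by (simp only: set_integral_add set_integral_diff set_integrable_mult_right int int0 h' \<phi> int[OF h2]
      set_integral_mult_right simp_thms)
  finally have *: "\<sigma> * s * I0 = (\<sigma> + s) * (I (\<lambda>u. u * deriv \<phi> u) + (\<sigma> + s + 1) * I \<phi>) - s * U * I (deriv \<phi>)"
    by (simp add: algebra_simps)
  \<comment> \<open>The factor \<open>\<sigma> * s\<close> in front of the integral is what the
    reciprocal Gamma factors produce when both arguments move up by one.\<close>
  have "ek 0 \<phi> \<sigma> s U = rGamma (\<sigma> + 1) * rGamma (s + 1) * (\<sigma> * s * I0)"
    unfolding I0_def p_def P_def ek.simps
    by (subst (1 2) rGamma_plus1[symmetric]) (simp only: mult_ac)
  also have "\<dots> = ek (Suc 0) \<phi> \<sigma> s U"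
    unfolding * by (simp add: I_def algebra_simps)
  finally show ?thesis by simp
qed

text \<open>Both sides unfold by the same recursion to exponents larger by one; positive real parts,
  and the integration by parts, are needed only at the bottom.\<close>

lemma ek_Suc_eq:
  assumes "\<phi> holomorphic_on strip \<rho>" and "U \<in> strip \<rho>" and "Re \<sigma> > - real N" "Re s > - real N"
  shows "ek (Suc N) \<phi> \<sigma> s U = ek N \<phi> \<sigma> s U"
  using assms
proof (induction N arbitrary: \<phi> \<sigma> s)
  case 0
  then show ?case using ek_Suc_0[of \<phi> \<rho> U \<sigma> s] by simp
next
  case (Suc N)
  have h': "deriv \<phi> holomorphic_on strip \<rho>" using Suc.prems(1) by (rule holomorphic_deriv) auto
  then have h2: "(\<lambda>u. u * deriv \<phi> u) holomorphic_on strip \<rho>"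
    by (intro holomorphic_on_mult holomorphic_on_ident)
  have IH: "ek (Suc N) f (\<sigma> + 1) (s + 1) U = ek N f (\<sigma> + 1) (s + 1) U" if "f holomorphic_on strip \<rho>" for f
    by (rule Suc.IH[OF that]) (use Suc.prems in auto)
  show ?case
    by (subst (1 2) ek.simps(2)) (simp only: IH[OF h'] IH[OF h2] IH[OF Suc.prems(1)])
qed

lemma ek_eq_ek_0:
  assumes "\<phi> holomorphic_on strip \<rho>" and "U \<in> strip \<rho>" and "Re \<sigma> > 0" "Re s > 0"
  shows "ek N \<phi> \<sigma> s U = ek 0 \<phi> \<sigma> s U"
proof (induction N)
  case (Suc N)
  have "ek (Suc N) \<phi> \<sigma> s U = ek N \<phi> \<sigma> s U"
    by (rule ek_Suc_eq[OF assms(1,2)]) (use assms in auto)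
  then show ?case using Suc by simp
qed simp

text \<open>Differentiating under the integral brings down a factor \<open>t\<close>, which raises
  the first exponent, and \<open>rGamma \<sigma> = \<sigma> * rGamma (\<sigma> + 1)\<close> restores
  the normalization.\<close>

lemma ek_0_deriv:
  assumes \<phi>: "exp_bounded \<gamma> \<rho> \<phi>" and U: "U \<in> strip \<rho>" and pos: "Re \<sigma> > 0" "Re s > 0"
  shows "deriv (ek 0 \<phi> \<sigma> s) U = \<sigma> * ek 0 (deriv \<phi>) (\<sigma> + 1) s U"
proof -
  note hol = exp_boundedD[OF \<phi>]
  have "((\<lambda>U. LINT t:{0<..<1}|lborel. \<phi> (of_real t * U) * beta_ker \<sigma> s t) has_field_derivative
      (LINT t:{0<..<1}|lborel. deriv (\<lambda>U. \<phi> (of_real t * U) * beta_ker \<sigma> s t) U)) (at U)"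
  proof (rule param_set_integral_derivative[OF open_strip U])
    show "set_borel_measurable lborel {0<..<1} (\<lambda>t. \<phi> (of_real t * u) * beta_ker \<sigma> s t)" if "u \<in> strip \<rho>"
      for u
      using set_integrable_ek[OF hol that pos] unfolding set_integrable_def set_borel_measurable_def by auto
    show "(\<lambda>w. \<phi> (of_real t * w) * beta_ker \<sigma> s t) holomorphic_on strip \<rho>" if t: "t \<in> {0<..<1}" for t
    proof -
      have "(\<phi> \<circ> (\<lambda>U. of_real t * U)) holomorphic_on strip \<rho>"
        by (rule holomorphic_on_compose_gen[OF _ hol])
           (use scale_in_strip t in \<open>auto intro!: holomorphic_intros\<close>)
      then show ?thesis by (intro holomorphic_on_mult holomorphic_on_const) (simp add: o_def)
    qed
    obtain r where r: "0 < r" "r < \<rho>" "U \<in> strip r" using strip_inner[OF U] by blast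
    define g where "g = \<bar>\<gamma>\<bar> + 1"
    have "\<gamma> < g" by (simp add: g_def)
    then obtain e0 B where eB: "e0 > 0" "B \<ge> 0"
      "\<forall>x\<in>(UNIV::complex set) \<inter> ball 0 e0. \<forall>u\<in>strip r. norm (\<phi> u) \<le> B * exp (g * Re u)"
      using hol_familyD(4)[OF \<phi> UNIV_I _ r(1,2), of g 0] by blast
    have B: "B \<ge> 0" "\<And>u. u \<in> strip r \<Longrightarrow> norm (\<phi> u) \<le> B * exp (g * Re u)"
      using eB(2) eB(3)[rule_format, of 0] eB(1) by auto
    obtain e where e: "e > 0" "ball U e \<subseteq> strip r" using r open_strip open_contains_ball by blast
    show "\<exists>e>0. \<exists>b. set_integrable lborel {0<..<1} b \<and>
       (\<forall>x\<in>strip \<rho> \<inter> ball U e. \<forall>t\<in>{0<..<1}. norm (\<phi> (of_real t * x) * beta_ker \<sigma> s t) \<le> b t)"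
    proof (intro exI[of _ "min e 1"] exI[of _ "\<lambda>t. B * exp (g * r) * exp (g * (Re U + 1))
      * (t powr (Re \<sigma> - 1) * (1 - t) powr (Re s - 1))"] conjI ballI)
      show "set_integrable lborel {0<..<1} (\<lambda>t. B * exp (g * r) * exp (g * (Re U + 1))
        * (t powr (Re \<sigma> - 1) * (1 - t) powr (Re s - 1)))"
        using pos by (intro set_integrable_mult_right set_integrable_beta_Ioo) auto
      fix x and t :: real assume x: "x \<in> strip \<rho> \<inter> ball U (min e 1)" "t \<in> {0<..<1}"
      then have xr: "x \<in> strip r" using e by auto
      have g0: "g > 0" by (simp add: g_def)
      have "Re x \<le> Re U + 1"
        using x abs_Re_le_cmod[of "x - U"] by (auto simp: dist_norm norm_minus_commute)
      then have "exp (g * Re x) \<le> exp (g * (Re U + 1))" using g0 by simp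
      then have "exp (g * Re (of_real t * x)) \<le> exp (g * r) * exp (g * (Re U + 1))"
        using scaled_exp_bound[OF xr, of t g] x g0
          by (smt (verit) exp_gt_zero greaterThanLessThan_iff mult_left_mono)
      then have "B * exp (g * Re (of_real t * x)) \<le> B * (exp (g * r) * exp (g * (Re U + 1)))"
        using B by (intro mult_left_mono)
      then have "norm (\<phi> (of_real t * x)) \<le> B * (exp (g * r) * exp (g * (Re U + 1)))"
        using B(2)[OF scale_in_strip[OF xr, of t]] x by fastforce
      then show "norm (\<phi> (of_real t * x) * beta_ker \<sigma> s t)
         \<le> B * exp (g * r) * exp (g * (Re U + 1)) * (t powr (Re \<sigma> - 1) * (1 - t) powr (Re s - 1))"
        unfolding norm_mult using x by (simp add: norm_beta_ker mult.assoc[symmetric] mult_right_mono)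
    qed (use e in auto)
  qed
  moreover have "deriv (\<lambda>U. \<phi> (of_real t * U) * beta_ker \<sigma> s t) U = deriv \<phi> (of_real t * U)
    * beta_ker (\<sigma> + 1) s t"
    if t: "t \<in> {0<..<1}" for t
  proof -
    have "(\<phi> has_field_derivative deriv \<phi> (of_real t * U)) (at (of_real t * U))"
      using hol scale_in_strip[OF U, of t] t by (intro holomorphic_derivI) auto
    moreover have "((\<lambda>z. of_real t * z) has_field_derivative of_real t) (at U)"
      by (auto intro!: derivative_eq_intros)
    ultimately have "((\<lambda>z. \<phi> (of_real t * z)) has_field_derivative deriv \<phi> (of_real t * U) * of_real t)
      (at U)"
      by (rule DERIV_chain2)
    from DERIV_cmult_right[OF this, of "beta_ker \<sigma> s t"] show ?thesis
      using t by (intro DERIV_imp_deriv) (simp add: beta_ker_Suc_left mult_ac)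
  qed
  ultimately have "((\<lambda>U. LINT t:{0<..<1}|lborel. \<phi> (of_real t * U) * beta_ker \<sigma> s t) has_field_derivative
      (LINT t:{0<..<1}|lborel. deriv \<phi> (of_real t * U) * beta_ker (\<sigma> + 1) s t)) (at U)"
    using set_lebesgue_integral_cong[of "{0<..<1}" lborel
      "\<lambda>t. deriv (\<lambda>U. \<phi> (of_real t * U) * beta_ker \<sigma> s t) U"
      "\<lambda>t. deriv \<phi> (of_real t * U) * beta_ker (\<sigma> + 1) s t"] by simp
  moreover have "ek 0 \<phi> \<sigma> s
    = (\<lambda>U. rGamma \<sigma> * rGamma s * (LINT t:{0<..<1}|lborel. \<phi> (of_real t * U) * beta_ker \<sigma> s t))"
    by (simp add: fun_eq_iff)
  ultimately
  have "deriv (ek 0 \<phi> \<sigma> s) U = rGamma \<sigma> * rGamma s * (LINT t:{0<..<1}|lborel. deriv \<phi> (of_real t * U)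
    * beta_ker (\<sigma> + 1) s t)"
    by (intro DERIV_imp_deriv) (simp only: DERIV_cmult)
  then show ?thesis using rGamma_plus1[of \<sigma>] by simp
qed

section \<open>The Beta integral and the action of averages on Taylor coefficients\<close>

lemma ek_0_one_real:
  assumes "a > 0" "b > (0::real)"
  shows "ek 0 (\<lambda>_. 1) (of_real a) (of_real b) U = rGamma (of_real a + of_real b)"
proof -
  have "(LINT t:{0<..<1}|lborel. 1 * beta_ker (of_real a) (of_real b) t)
      = (LINT t:{0<..<1}|lborel. complex_of_real (t powr (a - 1) * (1 - t) powr (b - 1)))"
    by (rule set_lebesgue_integral_cong)
       (auto simp: beta_ker_def powr_of_real[symmetric] simp del: powr_of_real)
  also have "\<dots> = of_real (LINT t:{0<..<1}|lborel. t powr (a - 1) * (1 - t) powr (b - 1))"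
    by (rule set_integral_complex_of_real)
  also have "(LINT t:{0<..<1}|lborel. t powr (a - 1) * (1 - t) powr (b - 1)) = Beta a b"
    using set_borel_integral_eq_integral(2)[OF set_integrable_beta_Ioo[OF assms]]
      has_integral_Beta_real[OF assms] by (simp add: has_integral_Icc_iff_Ioo integral_unique)
  finally have "ek 0 (\<lambda>_. 1) (of_real a) (of_real b) U = of_real (rGamma a * rGamma b * Beta a b)"
    by (simp add: rGamma_complex_of_real)
  also have "rGamma a * rGamma b * Beta a b = rGamma (a + b)"
    using Gamma_real_pos[OF assms(1)] Gamma_real_pos[OF assms(2)]
      by (simp add: Beta_def rGamma_inverse_Gamma field_simps)
  finally show ?thesis by (simp add: rGamma_complex_of_real flip: of_real_add)
qed

lemma islimpt_pos_reals: "(1::complex) islimpt (of_real ` {0<..})"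
  unfolding islimpt_approachable
proof (intro allI impI)
  fix e :: real assume "e > 0"
  then show "\<exists>x'\<in>complex_of_real ` {0<..}. x' \<noteq> 1 \<and> dist x' 1 < e"
  proof (intro bexI[of _ "of_real (1 + e/2)"])
    have "complex_of_real (1 + e/2) - 1 = of_real (e/2)" by simp
    then show "complex_of_real (1 + e/2) \<noteq> 1 \<and> dist (complex_of_real (1 + e/2)) 1 < e"
      unfolding dist_norm using \<open>e > 0\<close>
        by (metis abs_of_pos diff_self half_gt_zero less_irrefl norm_of_real of_real_eq_0_iff
        field_sum_of_halves less_add_same_cancel1)
    show "complex_of_real (1 + e/2) \<in> complex_of_real ` {0<..}"
      using \<open>e > 0\<close> by (intro imageI) auto
  qed
qed

lemma holomorphic_ek_0_one:
  shows "Re s > 0 \<Longrightarrow> (\<lambda>\<sigma>. ek 0 (\<lambda>_. 1) \<sigma> s 0) holomorphic_on {w. Re w > 0}"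
    and "Re \<sigma> > 0 \<Longrightarrow> (\<lambda>s. ek 0 (\<lambda>_. 1) \<sigma> s 0) holomorphic_on {w. Re w > 0}"
proof -
  have id: "param_hol {w. Re w > 0} {\<lambda>w. w} (\<lambda>w. w)"
    by (auto simp: param_hol_def curve_hol_def)
  have F: "hol_family {w. Re w > 0} {\<lambda>w. w} 0 1 (\<lambda>(_::complex) _. 1)"
    by (intro hol_family_const param_hol_const)
  have A: "hol_family {w. Re w > 0} {\<lambda>w. w} (max 0 0) 1 (\<lambda>w. ek 0 (\<lambda>_. 1) w s)" if "Re s > 0"
    by (rule hol_family_ek_0[OF _ F id param_hol_const]) (use that in auto)
  have B: "hol_family {w. Re w > 0} {\<lambda>w. w} (max 0 0) 1 (\<lambda>w. ek 0 (\<lambda>_. 1) \<sigma> w)" if "Re \<sigma> > 0"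
    by (rule hol_family_ek_0[OF _ F param_hol_const id]) (use that in auto)
  show "(\<lambda>\<sigma>. ek 0 (\<lambda>_. 1) \<sigma> s 0) holomorphic_on {w. Re w > 0}" if "Re s > 0"
    using hol_familyD(3)[OF A[OF that], of 0] open_halfspace_Re_gt[of 0]
    unfolding curve_hol_def by (auto simp del: ek.simps)
  show "(\<lambda>s. ek 0 (\<lambda>_. 1) \<sigma> s 0) holomorphic_on {w. Re w > 0}" if "Re \<sigma> > 0"
    using hol_familyD(3)[OF B[OF that], of 0] open_halfspace_Re_gt[of 0]
    unfolding curve_hol_def by (auto simp del: ek.simps)
qed

text \<open>Euler's Beta integral for positive real exponents is carried to the right half-plane by
  the identity theorem, first in \<open>\<sigma>\<close> with \<open>s\<close> real, then in
  \<open>s\<close>.\<close>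

lemma ek_0_one:
  assumes "Re \<sigma> > 0" "Re s > 0"
  shows "ek 0 (\<lambda>_. 1) \<sigma> s 0 = rGamma (\<sigma> + s)"
proof -
  let ?H = "{w::complex. Re w > 0}"
  have H: "open ?H" "connected ?H"
    by (auto simp: open_halfspace_Re_gt intro: convex_connected convex_halfspace_Re_gt)
  have sub: "complex_of_real ` {0<..} \<subseteq> ?H" by auto
  have 1: "ek 0 (\<lambda>_. 1) \<sigma> (of_real b) 0 - rGamma (\<sigma> + of_real b) = 0" if b: "b > 0" for b
    by (rule analytic_continuation[OF _ H sub _ islimpt_pos_reals])
       (use ek_0_one_real[OF _ b] assms b in \<open>auto intro!: holomorphic_intros holomorphic_ek_0_one simp del:
         ek.simps\<close>)
  have "ek 0 (\<lambda>_. 1) \<sigma> s 0 - rGamma (\<sigma> + s) = 0"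
    by (rule analytic_continuation[OF _ H sub _ islimpt_pos_reals])
       (use 1 assms in \<open>auto intro!: holomorphic_intros holomorphic_ek_0_one simp del: ek.simps\<close>)
  then show ?thesis by simp
qed

lemma ek_0_at_0:
  assumes "Re \<sigma> > 0" "Re s > 0"
  shows "ek 0 \<psi> \<sigma> s 0 = \<psi> 0 * rGamma (\<sigma> + s)"
  using ek_0_one[OF assms] by (simp add: mult_ac)

lemma ek_0_higher_deriv:
  assumes \<phi>: "exp_bounded \<gamma> \<rho> \<phi>" and U: "U \<in> strip \<rho>" and pos: "Re \<sigma> > 0" "Re s > 0"
  shows "(deriv ^^ n) (ek 0 \<phi> \<sigma> s) U = pochhammer \<sigma> n * ek 0 ((deriv ^^ n) \<phi>) (\<sigma> + of_nat n) s U"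
  using U
proof (induction n arbitrary: U)
  case (Suc n)
  have "eventually (\<lambda>u. u \<in> strip \<rho>) (nhds U)" using Suc.prems open_strip eventually_nhds by blast
  then have "eventually (\<lambda>u. (deriv ^^ n) (ek 0 \<phi> \<sigma> s) u
    = pochhammer \<sigma> n * ek 0 ((deriv ^^ n) \<phi>) (\<sigma> + of_nat n) s u) (nhds U)"
    by (rule eventually_mono) (rule Suc.IH)
  then have "deriv ((deriv ^^ n) (ek 0 \<phi> \<sigma> s)) U
    = deriv (\<lambda>u. pochhammer \<sigma> n * ek 0 ((deriv ^^ n) \<phi>) (\<sigma> + of_nat n) s u) U"
    by (rule deriv_cong_ev) simp
  also have "\<dots> = pochhammer \<sigma> n * deriv (ek 0 ((deriv ^^ n) \<phi>) (\<sigma> + of_nat n) s) U"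
  proof (rule deriv_cmult)
    have "ek 0 ((deriv ^^ n) \<phi>) (\<sigma> + of_nat n) s holomorphic_on strip \<rho>"
      using pos by (intro exp_boundedD[OF exp_bounded_ek[OF exp_bounded_intros(3)[OF \<phi>]]]) auto
    then show "ek 0 ((deriv ^^ n) \<phi>) (\<sigma> + of_nat n) s field_differentiable at U"
      using Suc.prems holomorphic_on_imp_differentiable_at open_strip by blast
  qed
  also have "\<dots> = pochhammer \<sigma> n * ((\<sigma> + of_nat n) * ek 0 (deriv ((deriv ^^ n) \<phi>)) (\<sigma> + of_nat n + 1) s U)"
    using pos by (subst ek_0_deriv[OF exp_bounded_intros(3)[OF \<phi>] Suc.prems]) auto
  finally show ?case by (simp add: pochhammer_Suc add_ac mult_ac del: ek.simps)
qed (simp del: ek.simps)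

lemma higher_deriv_ident_mult:
  assumes f: "f holomorphic_on S" and S: "open S" and u: "u \<in> S"
  shows "(deriv ^^ n) (\<lambda>u. u * f u) u = u * (deriv ^^ n) f u + of_nat n * (deriv ^^ (n - 1)) f u"
  using u
proof (induction n arbitrary: u)
  case (Suc n)
  have hol: "(deriv ^^ k) f holomorphic_on S" for k using f S by (rule holomorphic_higher_deriv)
  have D: "((deriv ^^ k) f has_field_derivative (deriv ^^ Suc k) f u) (at u)" for k
    using holomorphic_derivI[OF hol S Suc.prems] by simp
  have "eventually (\<lambda>u. u \<in> S) (nhds u)" using Suc.prems S eventually_nhds by blast
  then have "eventually (\<lambda>u. (deriv ^^ n) (\<lambda>u. u * f u) u = u * (deriv ^^ n) f u + of_nat n
    * (deriv ^^ (n - 1)) f u) (nhds u)"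
    by (rule eventually_mono) (rule Suc.IH)
  then have "deriv ((deriv ^^ n) (\<lambda>u. u * f u)) u
    = deriv (\<lambda>u. u * (deriv ^^ n) f u + of_nat n * (deriv ^^ (n - 1)) f u) u"
    by (rule deriv_cong_ev) simp
  also have "\<dots> = u * (deriv ^^ Suc n) f u + (deriv ^^ n) f u + of_nat n * (deriv ^^ Suc (n - 1)) f u"
    by (rule DERIV_imp_deriv) (auto intro!: derivative_eq_intros D simp del: funpow.simps)
  \<comment> \<open>For \<open>n = 0\<close> the truncated index is wrong, but its coefficient is
    0.\<close>
  also have "of_nat n * (deriv ^^ Suc (n - 1)) f u = of_nat n * (deriv ^^ n) f u"
    by (cases n) auto
  finally show ?case by (simp add: algebra_simps)
qed simp

text \<open>An average is diagonal on monomials: by the Beta integral \<open>U ^ n\<close> is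
  multiplied by \<Gamma>(\<sigma>+n) / (\<Gamma>(\<sigma>) \<Gamma>(\<sigma>+s+n)), which is the
  coefficient stated. The induction shows that the recursion keeps these multipliers outside the
  region of convergence.\<close>

lemma ek_higher_deriv_0:
  assumes "exp_bounded \<gamma> \<rho> \<phi>" "0 < \<rho>" "Re \<sigma> > - real N" "Re s > - real N"
  shows "(deriv ^^ n) (ek N \<phi> \<sigma> s) 0 = pochhammer \<sigma> n * rGamma (\<sigma> + s + of_nat n) * (deriv ^^ n) \<phi> 0"
  using assms
proof (induction N arbitrary: \<phi> \<sigma> s n)
  case 0
  then show ?case
    by (subst ek_0_higher_deriv[OF 0(1)]) (auto simp: ek_0_at_0 add_ac mult_ac simp del: ek.simps)
next
  case (Suc N)
  note \<phi> = Suc.prems(1)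
  have hol: "\<phi> holomorphic_on strip \<rho>" using exp_boundedD[OF \<phi>] .
  then have hol': "deriv \<phi> holomorphic_on strip \<rho>" by (rule holomorphic_deriv) simp
  have z: "0 \<in> strip \<rho>" using Suc.prems by simp
  have pos: "Re (\<sigma> + 1) > - real N" "Re (s + 1) > - real N" using Suc.prems by auto
  define A where "A = ek N (\<lambda>u. u * deriv \<phi> u) (\<sigma> + 1) (s + 1)"
  define B where "B = ek N \<phi> (\<sigma> + 1) (s + 1)"
  define D where "D = ek N (deriv \<phi>) (\<sigma> + 1) (s + 1)"
  have h: "A holomorphic_on strip \<rho>" "B holomorphic_on strip \<rho>" "D holomorphic_on strip \<rho>"
    unfolding A_def B_def D_def using pos
    by (auto intro!: exp_boundedD[OF exp_bounded_ek] exp_bounded_intros \<phi>)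
  have dA: "(deriv ^^ n) A 0 = pochhammer (\<sigma> + 1) n * rGamma (\<sigma> + s + 2 + of_nat n)
    * (of_nat n * (deriv ^^ n) \<phi> 0)" for n
  proof -
    have "(deriv ^^ n) (\<lambda>u. u * deriv \<phi> u) 0 = of_nat n * (deriv ^^ (n - 1)) (deriv \<phi>) 0"
      by (subst higher_deriv_ident_mult[OF hol' open_strip z]) simp
    also have "\<dots> = of_nat n * (deriv ^^ n) \<phi> 0"
      by (cases n) (auto simp: funpow_swap1)
    finally show ?thesis
      unfolding A_def by (subst Suc.IH[OF exp_bounded_intros(2)[OF \<phi>] Suc.prems(2) pos]) (simp add: add_ac)
  qed
  have dB: "(deriv ^^ n) B 0 = pochhammer (\<sigma> + 1) n * rGamma (\<sigma> + s + 2 + of_nat n) * (deriv ^^ n) \<phi> 0" for n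
    unfolding B_def by (subst Suc.IH[OF \<phi> Suc.prems(2) pos]) (simp add: add_ac)
  have dD: "(deriv ^^ n) D 0 = pochhammer (\<sigma> + 1) n * rGamma (\<sigma> + s + 2 + of_nat n) * (deriv ^^ Suc n) \<phi> 0"
    for n
    unfolding D_def by (subst Suc.IH[OF exp_bounded_intros(1)[OF \<phi>] Suc.prems(2) pos])
      (simp add: add_ac funpow_swap1)
  have "(deriv ^^ n) (ek (Suc N) \<phi> \<sigma> s) 0 =
      (deriv ^^ n) (\<lambda>U. (\<sigma> + s) * (A U + (\<sigma> + s + 1) * B U) + (- s) * (U * D U)) 0"
    by (rule arg_cong2[where f="\<lambda>f. (deriv ^^ n) f"]) (auto simp: A_def B_def D_def fun_eq_iff)
  also have "\<dots> = (deriv ^^ n) (\<lambda>U. (\<sigma> + s) * (A U + (\<sigma> + s + 1) * B U)) 0 + (deriv ^^ n)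
    (\<lambda>U. (- s) * (U * D U)) 0"
    by (rule higher_deriv_add[OF _ _ open_strip z]) (intro holomorphic_intros h)+
  also have "(deriv ^^ n) (\<lambda>U. (- s) * (U * D U)) 0 = (- s) * (deriv ^^ n) (\<lambda>U. U * D U) 0"
    by (rule higher_deriv_cmult[OF _ z open_strip]) (intro holomorphic_intros h)
  also have "(deriv ^^ n) (\<lambda>U. U * D U) 0 = of_nat n * (deriv ^^ (n - 1)) D 0"
    by (subst higher_deriv_ident_mult[OF h(3) open_strip z]) simp
  also have "(deriv ^^ n) (\<lambda>U. (\<sigma> + s) * (A U + (\<sigma> + s + 1) * B U)) 0 = (\<sigma> + s)
    * (deriv ^^ n) (\<lambda>U. A U + (\<sigma> + s + 1) * B U) 0"
    by (rule higher_deriv_cmult[OF _ z open_strip]) (intro holomorphic_intros h)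
  also have "(deriv ^^ n) (\<lambda>U. A U + (\<sigma> + s + 1) * B U) 0 = (deriv ^^ n) A 0 + (deriv ^^ n)
    (\<lambda>U. (\<sigma> + s + 1) * B U) 0"
    by (rule higher_deriv_add[OF _ _ open_strip z]) (intro holomorphic_intros h)+
  also have "(deriv ^^ n) (\<lambda>U. (\<sigma> + s + 1) * B U) 0 = (\<sigma> + s + 1) * (deriv ^^ n) B 0"
    by (rule higher_deriv_cmult[OF _ z open_strip]) (intro holomorphic_intros h)
  finally have eq: "(deriv ^^ n) (ek (Suc N) \<phi> \<sigma> s) 0 =
     (\<sigma> + s) * ((deriv ^^ n) A 0 + (\<sigma> + s + 1) * (deriv ^^ n) B 0) + (- s) *
       (of_nat n * (deriv ^^ (n - 1)) D 0)" .
  \<comment> \<open>\<open>R\<close> lies between the Gamma argument of the lower-order averages and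
    that of the result; the functional equation is used once on either side of it.\<close>
  define R where "R = rGamma (\<sigma> + s + 1 + of_nat n)"
  have R1: "(\<sigma> + s + 1 + of_nat n) * rGamma (\<sigma> + s + 2 + of_nat n) = R"
    using rGamma_plus1[of "\<sigma> + s + 1 + of_nat n"] by (simp add: R_def add_ac)
  have R2: "(\<sigma> + s + of_nat n) * R = rGamma (\<sigma> + s + of_nat n)"
    using rGamma_plus1[of "\<sigma> + s + of_nat n"] by (simp add: R_def add_ac)
  show ?case
  proof (cases n)
    case 0
    then show ?thesis unfolding eq dA dB R2[symmetric] using R1 by (simp add: algebra_simps)
  next
    case (Suc m)
    define p where "p = pochhammer (\<sigma> + 1) m"
    define F where "F = (deriv ^^ n) \<phi> 0"
    define Q where "Q = rGamma (\<sigma> + s + 2 + of_nat n)"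
    have p1: "pochhammer (\<sigma> + 1) n = p * (\<sigma> + of_nat n)" by (simp add: p_def Suc pochhammer_Suc add_ac)
    have p2: "pochhammer \<sigma> n = \<sigma> * p" by (simp add: p_def Suc pochhammer_rec)
    have d: "(deriv ^^ (n - 1)) D 0 = p * R * F"
      unfolding dD by (simp add: p_def Suc F_def R_def add_ac)
    have R1': "(\<sigma> + s + 1 + of_nat n) * Q = R" using R1 by (simp add: Q_def)
    have "(deriv ^^ n) (ek (Suc N) \<phi> \<sigma> s) 0 = (\<sigma> + s) * (p * (\<sigma> + of_nat n) * Q * (of_nat n * F) + (\<sigma> + s + 1)
      * (p * (\<sigma> + of_nat n) * Q * F)) + (- s) * (of_nat n * (p * R * F))"
      unfolding eq dA dB d p1 by (simp add: F_def Q_def)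
    also have "\<dots> = (\<sigma> + s) * (\<sigma> + of_nat n) * p * F * ((\<sigma> + s + 1 + of_nat n) * Q) - s * of_nat n * p * R * F"
      by (simp add: algebra_simps)
    also have "\<dots> = \<sigma> * p * ((\<sigma> + s + of_nat n) * R) * F"
      unfolding R1' by (simp add: algebra_simps)
    finally show ?thesis unfolding p2 R2 F_def .
  qed
qed

text \<open>Every Taylor multiplier at 0 is zero: for \<open>n \<le> m + m'\<close> because
  \<open>rGamma\<close> vanishes at nonpositive integers, and for larger \<open>n\<close> because
  the Pochhammer product contains the factor 0. The identity theorem spreads this over the
  strip.\<close>

lemma ek_vanishes:
  assumes \<phi>: "exp_bounded \<gamma> \<rho> \<phi>" and U: "U \<in> strip \<rho>" and N: "m < N" "m' < N"
  shows "ek N \<phi> (- of_nat m) (- of_nat m') U = 0"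
proof -
  have \<rho>: "0 < \<rho>" using strip_rho_pos[OF U] .
  have pos: "Re (- of_nat m) > - real N" "Re (- of_nat m') > - real N" using N by auto
  have "(deriv ^^ n) (ek N \<phi> (- of_nat m) (- of_nat m')) 0 = 0" for n
  proof (cases "n \<le> m + m'")
    case True
    have "- of_nat m + - of_nat m' + of_nat n = - (of_nat (m + m' - n) :: complex)"
      using True by (simp add: of_nat_diff)
    then have "rGamma (- of_nat m + - of_nat m' + of_nat n :: complex) = 0"
      unfolding rGamma_eq_zero_iff by (metis minus_of_nat_in_nonpos_Ints)
    then show ?thesis by (simp only: ek_higher_deriv_0[OF \<phi> \<rho> pos] mult_zero_right mult_zero_left)
  next
    case False
    then have "pochhammer (- of_nat m :: complex) n = 0"
      by (intro pochhammer_of_nat_eq_0_lemma) simp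
    then show ?thesis by (simp only: ek_higher_deriv_0[OF \<phi> \<rho> pos] mult_zero_left)
  qed
  moreover have "ek N \<phi> (- of_nat m) (- of_nat m') holomorphic_on strip \<rho>"
    by (rule exp_boundedD[OF exp_bounded_ek[OF \<phi> pos]])
  ultimately show ?thesis
    using holomorphic_fun_eq_0_on_connected[of "ek N \<phi> (- of_nat m) (- of_nat m')" "strip \<rho>" 0 U] \<rho> U by auto
qed

section \<open>The normalized Mellin transform\<close>

text \<open>
  The recursion is an integration by parts; \<open>mellin N\<close> is meaningful for \<open>Re \<sigma> > - N\<close>.
\<close>

primrec mellin :: "nat \<Rightarrow> (complex \<Rightarrow> complex) \<Rightarrow> complex \<Rightarrow> complex" where
  "mellin 0 \<phi> \<sigma> = rGamma \<sigma> * (LINT u:{0<..}|lborel. \<phi> (of_real u) * of_real u powr (\<sigma> - 1))"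
| "mellin (Suc N) \<phi> \<sigma> = - mellin N (deriv \<phi>) (\<sigma> + 1)"

lemma continuous_on_powr_of_real: "continuous_on {0<..} (\<lambda>u. complex_of_real u powr w)"
proof -
  have "continuous_on {0<..} (\<lambda>u. exp (w * complex_of_real (ln u)))" by (intro continuous_intros) auto
  then show ?thesis by (rule continuous_on_eq) (simp add: powr_of_real_pos)
qed

lemma set_integrable_powr_exp:
  assumes "a > 0" "c > (0::real)"
  shows "set_integrable lborel {0<..} (\<lambda>u. u powr (a - 1) * exp (- c * u))"
proof -
  have "(\<lambda>t. complex_of_real t powr (of_real a - 1) / of_real (exp (c * t))) absolutely_integrable_on {0<..}"
    by (rule absolutely_integrable_Gamma_integral) (use assms in auto)
  then have "set_integrable lebesgue {0<..}
    (\<lambda>t. norm (complex_of_real t powr (of_real a - 1) / of_real (exp (c * t))))"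
    by (rule set_integrable_norm)
  then have "set_integrable lebesgue {0<..} (\<lambda>u. u powr (a - 1) * exp (- c * u))"
    by (rule set_integrable_cong[THEN iffD1, rotated -1])
       (auto simp: norm_divide norm_mult norm_inverse norm_powr_of_real exp_minus divide_inverse)
  moreover have "(\<lambda>u. indicator {0<..} u *\<^sub>R (u powr (a - 1) * exp (- c * u))) \<in> borel_measurable lborel"
    by measurable
  ultimately show ?thesis
    unfolding set_integrable_def by (simp add: integrable_completion)
qed

lemma param_hol_nbhd:
  assumes "param_hol X C \<sigma>" "x0 \<in> X" "d > 0"
  shows "\<exists>e>0. \<forall>x\<in>X \<inter> ball x0 e. \<bar>Re (\<sigma> x) - Re (\<sigma> x0)\<bar> < d"
proof -
  have "continuous_on X (\<lambda>x. Re (\<sigma> x))" using assms(1) unfolding param_hol_def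
    by (intro continuous_intros) auto
  then have "continuous (at x0 within X) (\<lambda>x. Re (\<sigma> x))" using assms(2)
    by (simp add: continuous_on_eq_continuous_within)
  then obtain e where "e > 0" "\<And>x. x \<in> X \<Longrightarrow> dist x x0 < e \<Longrightarrow> dist (Re (\<sigma> x)) (Re (\<sigma> x0)) < d"
    unfolding continuous_within_eps_delta using assms(3) by blast
  then show ?thesis by (intro exI[of _ e]) (auto simp: dist_real_def dist_commute)
qed

text \<open>A majorant valid for all exponents in an interval: the lower end serves
  \<open>u \<le> 1\<close>, the upper end \<open>u > 1\<close>.\<close>

lemma powr_le_sum_powr:
  assumes "(u::real) > 0" "a \<le> w" "w \<le> b"
  shows "u powr (w - 1) \<le> u powr (a - 1) + u powr (b - 1)"
proof (cases "u \<le> 1")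
  case True
  then have "u powr (w - 1) \<le> u powr (a - 1)" using assms by (intro powr_mono') auto
  then show ?thesis by (simp add: add_increasing2)
next
  case False
  then have "u powr (w - 1) \<le> u powr (b - 1)" using assms by (intro powr_mono) auto
  then show ?thesis by (simp add: add_increasing)
qed

lemma param_hol_mellin_0:
  assumes contC: "\<And>c. c \<in> C \<Longrightarrow> continuous_on UNIV c"
    and F: "hol_family X C \<gamma> \<rho> F" and \<sigma>: "param_hol X C \<sigma>" and neg: "\<gamma> < 0" and \<rho>: "0 < \<rho>"
    and pos: "\<And>x. x \<in> X \<Longrightarrow> Re (\<sigma> x) > 0"
  shows "param_hol X C (\<lambda>x. mellin 0 (F x) (\<sigma> x))"
proof -
  have pp: "param_hol X C (\<lambda>x. complex_of_real t powr (\<sigma> x - 1))" if "t > 0" for t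
    using that \<sigma> by (simp only: powr_of_real_pos) (intro param_hol_comb)
  \<comment> \<open>The integral does not depend on \<open>U\<close>; the dummy variable lets the
    lemma on integrals of families do the work, and \<open>U = 0\<close> recovers the parameter
    function.\<close>
  have "hol_family X C 0 \<rho> (\<lambda>x U. LINT u:{0<..}|lborel. F x (of_real u) * of_real u powr (\<sigma> x - 1))"
  proof (rule hol_family_set_integral[OF contC])
    show "set_borel_measurable lborel {0<..} (\<lambda>u. F x (of_real u) * of_real u powr (\<sigma> x - 1))" if "x \<in> X"
      for x
    proof -
      have "continuous_on {0<..} (\<lambda>u. F x (of_real u) * of_real u powr (\<sigma> x - 1))"
        by (intro continuous_on_mult continuous_on_powr_of_real
              continuous_on_compose2[OF holomorphic_on_imp_continuous_on[OF hol_familyD(2)[OF F that]]]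
                continuous_intros)
           (use \<rho> in auto)
      then show ?thesis unfolding set_borel_measurable_def
        by (auto intro!: borel_measurable_continuous_on_indicator)
    qed
    have ph: "param_hol X C (\<lambda>x. F x (of_real t) * of_real t powr (\<sigma> x - 1))" if "t \<in> {0<..}" for t :: real
      using that \<rho> by (intro param_hol_comb pp hol_family_param[OF F]) auto
    show "continuous_on (X \<times> strip \<rho>) (\<lambda>(x, U). F x (of_real t) * of_real t powr (\<sigma> x - 1))" if "t \<in> {0<..}"
      for t :: real
      using ph[OF that] unfolding param_hol_def case_prod_beta
      by (intro continuous_on_compose2[of X "\<lambda>x. F x (of_real t) * of_real t powr (\<sigma> x - 1)" _ fst])
         (auto intro!: continuous_intros)
    show "curve_hol X C (\<lambda>x. F x (of_real t) * of_real t powr (\<sigma> x - 1))" if "t \<in> {0<..}" for t :: real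
      using ph[OF that] unfolding param_hol_def by simp
    fix x0 and g :: real assume h: "x0 \<in> X" "0 < g"
    obtain e1 B where 1: "e1 > 0" "B \<ge> 0" "\<forall>x\<in>X \<inter> ball x0 e1. \<forall>U\<in>strip (\<rho>/2). norm (F x U)
      \<le> B * exp ((\<gamma>/2) * Re U)"
      using hol_familyD(4)[OF F h(1), of "\<gamma>/2" "\<rho>/2"] neg \<rho> by auto
    \<comment> \<open>With \<open>Re (\<sigma> x0) = 2 * a\<close> and a variation below
      \<open>a\<close>, the exponents near \<open>x0\<close> lie between \<open>a\<close> and
      \<open>3 * a\<close>; these are the two powers in the majorant.\<close>
    define a where "a = Re (\<sigma> x0) / 2"
    have a: "a > 0" "Re (\<sigma> x0) = 2 * a" using pos[OF h(1)] by (auto simp: a_def)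
    obtain e2 where 2: "e2 > 0" "\<forall>x\<in>X \<inter> ball x0 e2. \<bar>Re (\<sigma> x) - Re (\<sigma> x0)\<bar> < a"
      using param_hol_nbhd[OF \<sigma> h(1) a(1)] by blast
    define b where "b u = (B * exp (g * \<rho>)) * (u powr (a - 1) * exp (- (- \<gamma>/2) * u) + u powr (3 * a - 1)
      * exp (- (- \<gamma>/2) * u))" for u
    show "\<exists>e>0. \<exists>b. set_integrable lborel {0<..} b \<and>
        (\<forall>x\<in>X \<inter> ball x0 e. \<forall>U\<in>strip \<rho>. \<forall>t\<in>{0<..}. norm (F x (of_real t) * of_real t powr (\<sigma> x - 1)) \<le> b t *
          exp (g * Re U))"
    proof (intro exI[of _ "min e1 e2"] exI[of _ b] conjI ballI)
      show "set_integrable lborel {0<..} b"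
        unfolding b_def using a neg
          by (intro set_integrable_mult_right set_integral_add set_integrable_powr_exp) auto
      fix x U and t :: real assume x: "x \<in> X \<inter> ball x0 (min e1 e2)" "U \<in> strip \<rho>" "t \<in> {0<..}"
      have "norm (F x (of_real t)) \<le> B * exp (\<gamma>/2 * Re (of_real t))"
        using x \<rho> by (intro 1(3)[rule_format] of_real_in_strip) auto
      moreover have "t powr (Re (\<sigma> x) - 1) \<le> t powr (a - 1) + t powr (3 * a - 1)"
      proof -
        have "\<bar>Re (\<sigma> x) - Re (\<sigma> x0)\<bar> < a" using 2 x by auto
        then show ?thesis using x a by (intro powr_le_sum_powr) auto
      qed
      ultimately have "norm (F x (of_real t)) * t powr (Re (\<sigma> x) - 1) \<le> (B * exp (\<gamma>/2 * Re (of_real t)))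
        * (t powr (a - 1) + t powr (3 * a - 1))"
        using 1(2) by (intro mult_mono) auto
      also have "\<dots> = (B * exp (\<gamma>/2 * t) * (t powr (a - 1) + t powr (3 * a - 1))) * 1" by simp
      also have "\<dots> \<le> (B * exp (\<gamma>/2 * t) * (t powr (a - 1) + t powr (3 * a - 1))) * exp (g * (\<rho> + Re U))"
        using x(2) h(2) 1(2) by (intro mult_left_mono) (auto simp: strip_def)
      also have "\<dots> = b t * exp (g * Re U)"
        unfolding b_def by (simp add: exp_add algebra_simps)
      finally show "norm (F x (of_real t) * of_real t powr (\<sigma> x - 1)) \<le> b t * exp (g * Re U)"
        using x by (simp add: norm_mult norm_powr_of_real)
    qed (use 1 2 in auto)
  qed auto
  from hol_family_param[OF this, of 0] \<rho>
  have "param_hol X C (\<lambda>x. LINT u:{0<..}|lborel. F x (of_real u) * of_real u powr (\<sigma> x - 1))" by simp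
  then show ?thesis by (simp) (intro param_hol_comb \<sigma>)
qed

lemma param_hol_mellin:
  assumes contC: "\<And>c. c \<in> C \<Longrightarrow> continuous_on UNIV c"
    and F: "hol_family X C \<gamma> \<rho> F" and \<sigma>: "param_hol X C \<sigma>" and neg: "\<gamma> < 0" and \<rho>: "0 < \<rho>"
    and pos: "\<And>x. x \<in> X \<Longrightarrow> Re (\<sigma> x) > - real N"
  shows "param_hol X C (\<lambda>x. mellin N (F x) (\<sigma> x))"
  using F \<sigma> pos
proof (induction N arbitrary: F \<sigma>)
  case 0
  then show ?case using param_hol_mellin_0[OF contC 0(1,2) neg \<rho>] by simp
next
  case (Suc N)
  have "param_hol X C (\<lambda>x. mellin N (deriv (F x)) (\<sigma> x + 1))"
  proof (rule Suc.IH)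
    show "- real N < Re (\<sigma> x + 1)" if "x \<in> X" for x using Suc.prems(3)[OF that] by auto
    show "hol_family X C \<gamma> \<rho> (\<lambda>x. deriv (F x))" by (rule hol_family_deriv[OF contC Suc.prems(1)])
    show "param_hol X C (\<lambda>x. \<sigma> x + 1)" by (rule param_hol_binary(1)[OF Suc.prems(2) param_hol_const])
  qed
  then show ?case by (simp add: param_hol_unary)
qed

lemma FTC_Ioi:
  fixes f F :: "real \<Rightarrow> complex"
  assumes D: "\<And>u. u > 0 \<Longrightarrow> (F has_vector_derivative f u) (at u)"
    and c: "continuous_on {0<..} f" and i: "set_integrable lborel {0<..} f"
    and A: "(F \<longlongrightarrow> A) (at_right 0)" and B: "(F \<longlongrightarrow> B) at_top"
  shows "(LINT u:{0<..}|lborel. f u) = B - A"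
proof -
  have e: "einterval (ereal 0) \<infinity> = {0<..}" by (auto simp: einterval_def)
  have "(LBINT x=ereal 0..\<infinity>. f x) = B - A"
  proof (rule interval_integral_FTC_integrable[where F=F])
    show "isCont f x" if "ereal 0 < ereal x" for x
      using c that by (simp add: continuous_on_eq_continuous_at)
    show "((F \<circ> real_of_ereal) \<longlongrightarrow> A) (at_right (ereal 0))" using A by (simp add: ereal_tendsto_simps)
    show "((F \<circ> real_of_ereal) \<longlongrightarrow> B) (at_left \<infinity>)" using B by (simp add: ereal_tendsto_simps)
  qed (use D i e in auto)
  then show ?thesis by (simp add: interval_lebesgue_integral_def e)
qed

lemma exp_bounded_neg:
  assumes "exp_bounded \<gamma> \<rho> \<phi>" "\<gamma> < 0" "0 < \<rho>"
  obtains B where "B \<ge> 0" "\<And>u. u \<ge> 0 \<Longrightarrow> norm (\<phi> (of_real u)) \<le> B * exp (- (- \<gamma>/2) * u)"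
proof -
  obtain e B where eB: "e > 0" "B \<ge> 0"
      "\<forall>x\<in>(UNIV::complex set) \<inter> ball 0 e. \<forall>u\<in>strip (\<rho>/2). norm (\<phi> u) \<le> B * exp ((\<gamma>/2) * Re u)"
    using hol_familyD(4)[OF assms(1) UNIV_I, of "\<gamma>/2" "\<rho>/2" 0] assms by auto
  have "norm (\<phi> (of_real u)) \<le> B * exp (- (- \<gamma>/2) * u)" if "u \<ge> 0" for u
    using eB(3)[rule_format, of 0 "of_real u"] eB(1) that assms by auto
  with eB(2) show ?thesis using that by blast
qed

lemma continuous_on_of_real_strip:
  "\<phi> holomorphic_on strip \<rho> \<Longrightarrow> 0 < \<rho> \<Longrightarrow> continuous_on {0..} (\<lambda>u. \<phi> (complex_of_real u))"
  by (rule continuous_on_compose2[OF holomorphic_on_imp_continuous_on]) (auto intro!: continuous_intros)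

lemma has_vector_derivative_of_real_strip:
  assumes "\<phi> holomorphic_on strip \<rho>" "0 < \<rho>" "0 \<le> u"
  shows "((\<lambda>u. \<phi> (complex_of_real u)) has_vector_derivative deriv \<phi> (of_real u)) (at u)"
  by (rule has_vector_derivative_real_field) (use assms in \<open>auto intro!: holomorphic_derivI\<close>)

lemma set_integrable_mellin:
  assumes \<phi>: "exp_bounded \<gamma> \<rho> \<phi>" "\<gamma> < 0" "0 < \<rho>" and \<sigma>: "Re \<sigma> > 0"
  shows "set_integrable lborel {0<..} (\<lambda>u. \<phi> (of_real u) * of_real u powr (\<sigma> - 1))"
proof -
  obtain B where B: "B \<ge> 0" "\<And>u. u \<ge> 0 \<Longrightarrow> norm (\<phi> (of_real u)) \<le> B * exp (- (- \<gamma>/2) * u)"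
    using exp_bounded_neg[OF \<phi>] by blast
  show ?thesis
    unfolding set_integrable_def
  proof (rule Bochner_Integration.integrable_bound)
    show "integrable lborel (\<lambda>u. indicator {0<..} u *\<^sub>R (B * (u powr (Re \<sigma> - 1) * exp (- (- \<gamma>/2) * u))))"
      using set_integrable_mult_right[OF set_integrable_powr_exp[OF \<sigma>, of "-\<gamma>/2"], of B] \<phi>(2)
        by (simp add: set_integrable_def)
    have "continuous_on {0<..} (\<lambda>u. \<phi> (of_real u) * of_real u powr (\<sigma> - 1))"
      by (intro continuous_on_mult continuous_on_powr_of_real
             continuous_on_subset[OF continuous_on_of_real_strip[OF exp_boundedD[OF \<phi>(1)] \<phi>(3)]]) auto
    then show "(\<lambda>u. indicator {0<..} u *\<^sub>R (\<phi> (of_real u) * of_real u powr (\<sigma> - 1)))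
      \<in> borel_measurable lborel"
      by (auto intro!: borel_measurable_continuous_on_indicator)
    show "AE u in lborel. norm (indicator {0<..} u *\<^sub>R (\<phi> (of_real u) * of_real u powr (\<sigma> - 1)))
        \<le> norm (indicator {0<..} u *\<^sub>R (B * (u powr (Re \<sigma> - 1) * exp (- (- \<gamma>/2) * u))))"
    proof (rule AE_I2)
      fix u :: real
      show "norm (indicator {0<..} u *\<^sub>R (\<phi> (of_real u) * of_real u powr (\<sigma> - 1)))
        \<le> norm (indicator {0<..} u *\<^sub>R (B * (u powr (Re \<sigma> - 1) * exp (- (- \<gamma>/2) * u))))"
        using mult_right_mono[OF B(2)[of u], of "u powr (Re \<sigma> - 1)"] B(1)
        by (auto simp: indicator_def norm_mult norm_powr_of_real mult_ac)
    qed
  qed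
qed

lemma exp_powr_tendsto_0: "g < 0 \<Longrightarrow> ((\<lambda>u::real. B * exp (g * u) * u powr a) \<longlongrightarrow> 0) at_top"
  by real_asymp

text \<open>Integration by parts of \<open>\<phi> * u powr \<sigma>\<close>. The boundary term at 0
  vanishes because \<open>Re \<sigma> > 0\<close>, the one at infinity because
  \<open>\<gamma> < 0\<close>, and the factor \<open>\<sigma>\<close> is absorbed by the
  normalization.\<close>

lemma mellin_Suc_0:
  assumes \<phi>: "exp_bounded \<gamma> \<rho> \<phi>" "\<gamma> < 0" "0 < \<rho>" and \<sigma>: "Re \<sigma> > 0"
  shows "mellin (Suc 0) \<phi> \<sigma> = mellin 0 \<phi> \<sigma>"
proof -
  note hol = exp_boundedD[OF \<phi>(1)]
  have hol': "deriv \<phi> holomorphic_on strip \<rho>" using hol by (rule holomorphic_deriv) simp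
  note \<phi>' = exp_bounded_intros(1)[OF \<phi>(1)]
  obtain B where B: "B \<ge> 0" "\<And>u. u \<ge> 0 \<Longrightarrow> norm (\<phi> (of_real u)) \<le> B * exp (- (- \<gamma>/2) * u)"
    using exp_bounded_neg[OF \<phi>] by blast
  let ?f = "\<lambda>u::real. \<phi> (of_real u) * (\<sigma> * of_real u powr (\<sigma> - 1)) + deriv \<phi> (of_real u) * of_real u powr \<sigma>"
  let ?F = "\<lambda>u::real. \<phi> (of_real u) * of_real u powr \<sigma>"
  have i1: "set_integrable lborel {0<..} (\<lambda>u. \<phi> (of_real u) * of_real u powr (\<sigma> - 1))"
    by (rule set_integrable_mellin[OF \<phi> \<sigma>])
  have i2: "set_integrable lborel {0<..} (\<lambda>u. deriv \<phi> (of_real u) * of_real u powr \<sigma>)"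
    using set_integrable_mellin[OF \<phi>' \<phi>(2,3), of "\<sigma> + 1"] \<sigma> by simp
  have i1': "set_integrable lborel {0<..} (\<lambda>u. \<phi> (of_real u) * (\<sigma> * of_real u powr (\<sigma> - 1)))"
    using set_integrable_mult_right[OF i1, of \<sigma>] by (simp add: mult_ac)
  have lim0: "(?F \<longlongrightarrow> 0) (at_right 0)"
  proof -
    have "continuous_on {0..} ?F"
      by (intro continuous_on_mult continuous_on_of_real_strip[OF hol \<phi>(3)] continuous_on_powr_complex
            continuous_on_of_real continuous_on_id continuous_on_const) (use \<sigma> in auto)
    then have "(?F \<longlongrightarrow> ?F 0) (at 0 within {0..})" unfolding continuous_on_def by (rule bspec) simp
    then have "(?F \<longlongrightarrow> 0) (at 0 within {0..})" by simp
    then show ?thesis by (rule tendsto_within_subset) auto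
  qed
  have limt: "(?F \<longlongrightarrow> 0) at_top"
  proof (rule Lim_null_comparison[OF _ exp_powr_tendsto_0[of "\<gamma>/2" B "Re \<sigma>"]])
    show "eventually (\<lambda>u. norm (?F u) \<le> B * exp (\<gamma>/2 * u) * u powr Re \<sigma>) at_top"
      using eventually_gt_at_top[of 0]
    proof eventually_elim
      case (elim u)
      then show ?case using mult_right_mono[OF B(2)[of u], of "u powr Re \<sigma>"]
        by (simp add: norm_mult norm_powr_of_real)
    qed
  qed (use \<phi> in auto)
  have "(LINT u:{0<..}|lborel. ?f u) = 0 - 0"
  proof (rule FTC_Ioi[where F="?F"])
    show "(?F has_vector_derivative ?f u) (at u)" if "u > 0" for u
      by (intro has_vector_derivative_mult has_vector_derivative_of_real_strip[OF hol]
        has_vector_derivative_powr_real)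
         (use that \<phi> in auto)
    show "continuous_on {0<..} ?f"
      by (intro continuous_on_add continuous_on_mult continuous_on_powr_of_real continuous_on_const
            continuous_on_subset[OF continuous_on_of_real_strip[OF hol \<phi>(3)]]
            continuous_on_subset[OF continuous_on_of_real_strip[OF hol' \<phi>(3)]]) auto
    show "set_integrable lborel {0<..} ?f" by (intro set_integral_add i1' i2)
  qed (use lim0 limt in auto)
  then have "\<sigma> * (LINT u:{0<..}|lborel. \<phi> (of_real u) * of_real u powr (\<sigma> - 1))
    + (LINT u:{0<..}|lborel. deriv \<phi> (of_real u) * of_real u powr \<sigma>) = 0"
    using i1' i2 by (simp add: set_integral_add mult_ac flip: set_integral_mult_right)
  moreover define I1 where "I1 = (LINT u:{0<..}|lborel. \<phi> (of_real u) * of_real u powr (\<sigma> - 1))"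
  moreover define I2 where "I2 = (LINT u:{0<..}|lborel. deriv \<phi> (of_real u) * of_real u powr \<sigma>)"
  ultimately have I: "\<sigma> * I1 + I2 = 0" by simp
  have "mellin (Suc 0) \<phi> \<sigma> = - (rGamma (\<sigma> + 1) * I2)" by (simp add: I2_def)
  also have "\<dots> = \<sigma> * rGamma (\<sigma> + 1) * I1" using I by algebra
  also have "\<dots> = mellin 0 \<phi> \<sigma>" using rGamma_plus1[of \<sigma>] by (simp add: I1_def)
  finally show ?thesis .
qed

lemma mellin_Suc_eq:
  assumes "exp_bounded \<gamma> \<rho> \<phi>" "\<gamma> < 0" "0 < \<rho>" "Re \<sigma> > - real N"
  shows "mellin (Suc N) \<phi> \<sigma> = mellin N \<phi> \<sigma>"
  using assms
proof (induction N arbitrary: \<phi> \<sigma>)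
  case 0
  then show ?case using mellin_Suc_0[OF 0(1-3)] by simp
next
  case (Suc N)
  have "mellin (Suc N) (deriv \<phi>) (\<sigma> + 1) = mellin N (deriv \<phi>) (\<sigma> + 1)"
    by (rule Suc.IH) (use Suc.prems exp_bounded_intros(1)[OF Suc.prems(1)] in auto)
  then show ?case by (subst (1 2) mellin.simps(2)) (simp only:)
qed

lemma mellin_eq_le:
  assumes "exp_bounded \<gamma> \<rho> \<phi>" "\<gamma> < 0" "0 < \<rho>" "Re \<sigma> > - real N" "N \<le> N'"
  shows "mellin N' \<phi> \<sigma> = mellin N \<phi> \<sigma>"
  using assms(5)
proof (induction N' rule: dec_induct)
  case (step n)
  have "mellin (Suc n) \<phi> \<sigma> = mellin n \<phi> \<sigma>"
    by (rule mellin_Suc_eq[OF assms(1-3)]) (use assms step in auto)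
  then show ?case using step by simp
qed simp

text \<open>After \<open>K + 1\<close> integrations by parts the power of \<open>u\<close> has
  exponent 0, and what remains is the integral of a derivative, which is minus its primitive at 0 by
  decay at infinity.\<close>

lemma mellin_at_neg_nat:
  assumes "exp_bounded \<gamma> \<rho> \<phi>" "\<gamma> < 0" "0 < \<rho>"
  shows "mellin (Suc K) \<phi> (- of_nat K) = (-1) ^ K * (deriv ^^ K) \<phi> 0"
  using assms(1)
proof (induction K arbitrary: \<phi>)
  case 0
  note hol = exp_boundedD[OF 0]
  have hol': "deriv \<phi> holomorphic_on strip \<rho>" using hol by (rule holomorphic_deriv) simp
  obtain B where B: "B \<ge> 0" "\<And>u. u \<ge> 0 \<Longrightarrow> norm (\<phi> (of_real u)) \<le> B * exp (- (- \<gamma>/2) * u)"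
    using exp_bounded_neg[OF 0 assms(2,3)] by blast
  have "(LINT u:{0<..}|lborel. deriv \<phi> (of_real u)) = 0 - \<phi> 0"
  proof (rule FTC_Ioi[where F="\<lambda>u. \<phi> (of_real u)"])
    show "((\<lambda>u. \<phi> (of_real u)) has_vector_derivative deriv \<phi> (of_real u)) (at u)" if "u > 0" for u
      using that by (intro has_vector_derivative_of_real_strip[OF hol assms(3)]) auto
    show "continuous_on {0<..} (\<lambda>u. deriv \<phi> (complex_of_real u))"
      by (rule continuous_on_subset[OF continuous_on_of_real_strip[OF hol' assms(3)]]) auto
    have "set_integrable lborel {0<..} (\<lambda>u. deriv \<phi> (of_real u) * of_real u powr (1 - 1))"
      by (rule set_integrable_mellin[OF exp_bounded_intros(1)[OF 0] assms(2,3)]) auto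
    then show "set_integrable lborel {0<..} (\<lambda>u. deriv \<phi> (complex_of_real u))"
      by (rule set_integrable_cong[THEN iffD1, rotated -1]) auto
    have "continuous_on {0..} (\<lambda>u. \<phi> (complex_of_real u))"
      by (rule continuous_on_of_real_strip[OF hol assms(3)])
    then have "((\<lambda>u. \<phi> (complex_of_real u)) \<longlongrightarrow> \<phi> (of_real 0)) (at 0 within {0..})"
      unfolding continuous_on_def by (rule bspec) simp
    then show "((\<lambda>u. \<phi> (complex_of_real u)) \<longlongrightarrow> \<phi> 0) (at_right 0)"
      unfolding of_real_0 by (rule tendsto_within_subset) auto
    show "((\<lambda>u. \<phi> (complex_of_real u)) \<longlongrightarrow> 0) at_top"
    proof (rule Lim_null_comparison[OF _ exp_powr_tendsto_0[of "\<gamma>/2" B 0]])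
      show "eventually (\<lambda>u. norm (\<phi> (complex_of_real u)) \<le> B * exp (\<gamma>/2 * u) * u powr 0) at_top"
        using eventually_gt_at_top[of 0] by eventually_elim (use B(2) in auto)
    qed (use assms in auto)
  qed
  moreover have "(LINT u:{0<..}|lborel. deriv \<phi> (of_real u) * complex_of_real u powr 0)
    = (LINT u:{0<..}|lborel. deriv \<phi> (of_real u))"
    by (rule set_lebesgue_integral_cong) auto
  ultimately show ?case by simp
next
  case (Suc K)
  have "mellin (Suc K) (deriv \<phi>) (- of_nat K) = (-1) ^ K * (deriv ^^ K) (deriv \<phi>) 0"
    by (rule Suc.IH) (rule exp_bounded_intros(1)[OF Suc.prems])
  moreover have "mellin (Suc (Suc K)) \<phi> (- of_nat (Suc K)) = - mellin (Suc K) (deriv \<phi>) (- of_nat K)"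
    by (subst mellin.simps(2)) simp
  ultimately show ?case by (simp add: funpow_swap1 del: mellin.simps)
qed

section \<open>Holomorphic functions of several variables\<close>

lemma mv_holomorphic_on_subset:
  assumes "mv_holomorphic_on I f U" "openin (cspace I) V" "V \<subseteq> U"
  shows "mv_holomorphic_on I f V"
proof -
  have "continuous_map (subtopology (cspace I) V) euclidean f"
    by (rule continuous_map_from_subtopology_mono[of _ U]) (use assms in \<open>auto simp: mv_holomorphic_on_def\<close>)
  then show ?thesis using assms unfolding mv_holomorphic_on_def by auto
qed

lemma continuous_map_binop:
  fixes f g :: "'a \<Rightarrow> complex"
  assumes "continuous_map T euclidean f" "continuous_map T euclidean g"
    and "continuous_on UNIV (\<lambda>p. h (fst p) (snd p) :: complex)"
  shows "continuous_map T euclidean (\<lambda>x. h (f x) (g x))"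
proof -
  have "continuous_map T (prod_topology euclidean euclidean) (\<lambda>x. (f x, g x))"
    using assms by (intro continuous_map_pairedI)
  then have "continuous_map T euclidean ((\<lambda>p. h (fst p) (snd p)) \<circ> (\<lambda>x. (f x, g x)))"
    using assms(3) by (intro continuous_map_compose[where X'=euclidean]) auto
  then show ?thesis by (simp add: o_def)
qed

lemma mv_holomorphic_on_mult:
  assumes "mv_holomorphic_on I f U" "mv_holomorphic_on I g U"
  shows "mv_holomorphic_on I (\<lambda>x. f x * g x) U"
  using assms unfolding mv_holomorphic_on_def
  by (auto intro!: continuous_map_binop[where h="(*)"] field_differentiable_mult continuous_intros)

lemma mv_holomorphic_on_diff:
  assumes "mv_holomorphic_on I f U" "mv_holomorphic_on I g U"
  shows "mv_holomorphic_on I (\<lambda>x. f x - g x) U"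
  using assms unfolding mv_holomorphic_on_def
  by (auto intro!: continuous_map_binop[where h="(-)"] field_differentiable_diff continuous_intros)

lemma open_fun_upd_preimage:
  assumes o: "openin (cspace I) U" and x: "x \<in> topspace (cspace I)" and i: "i \<in> I"
  shows "open {w. x(i := w) \<in> U}"
proof -
  have "continuous_map euclidean (cspace I) (\<lambda>w. x(i := w))"
    by (subst continuous_map_componentwise) (use x i in \<open>auto simp: extensional_def PiE_def
      continuous_map_id[unfolded id_def]\<close>)
  then have "openin euclidean {w \<in> topspace euclidean. x(i := w) \<in> U}"
    using o by (rule openin_continuous_map_preimage)
  then show ?thesis by simp
qed

lemma mv_holomorphic_on_cong:
  assumes "mv_holomorphic_on I f U" and eq: "\<And>x. x \<in> U \<Longrightarrow> f x = g x"
  shows "mv_holomorphic_on I g U"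
  unfolding mv_holomorphic_on_def
proof (intro conjI ballI)
  show o: "openin (cspace I) U" using assms by (simp add: mv_holomorphic_on_def)
  show "continuous_map (subtopology (cspace I) U) euclidean g"
    by (rule continuous_map_eq[of _ _ f]) (use assms in \<open>auto simp: mv_holomorphic_on_def\<close>)
  fix x i assume x: "x \<in> U" and i: "i \<in> I"
  have "(\<lambda>w. f (x(i := w))) field_differentiable (at (x i))"
    using assms x i by (simp add: mv_holomorphic_on_def)
  then obtain D where D: "((\<lambda>w. f (x(i := w))) has_field_derivative D) (at (x i))"
    unfolding field_differentiable_def by blast
  have "((\<lambda>w. g (x(i := w))) has_field_derivative D) (at (x i))"
  proof (rule has_field_derivative_transform_within_open[OF D])
    show "open {w. x(i := w) \<in> U}"
      by (rule open_fun_upd_preimage[OF o _ i]) (use o openin_subset x in blast)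
  qed (use x eq in auto)
  then show "(\<lambda>w. g (x(i := w))) field_differentiable (at (x i))"
    unfolding field_differentiable_def by blast
qed

text \<open>The open set contains a small box. Its sides are enlarged to the full factors one
  coordinate at a time, each time by the one-variable identity theorem on a connected
  factor.\<close>

lemma box_identity:
  assumes I: "finite I" and B: "\<And>i. i \<in> I \<Longrightarrow> open (B i)" "\<And>i. i \<in> I \<Longrightarrow> connected (B i)"
    and f: "mv_holomorphic_on I f (PiE I B)"
    and V: "openin (cspace I) V" "V \<subseteq> PiE I B" "V \<noteq> {}" "\<And>x. x \<in> V \<Longrightarrow> f x = 0"
    and x: "x \<in> PiE I B"
  shows "f x = 0"
proof -
  obtain y where y: "y \<in> V" using V by blast
  obtain U where U: "\<And>i. i \<in> I \<Longrightarrow> open (U i)" "y \<in> PiE I U" "PiE I U \<subseteq> V"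
    using V(1) y unfolding openin_product_topology_alt by (metis open_openin)
  have UB: "U i \<subseteq> B i" if "i \<in> I" for i
  proof -
    have "PiE I U \<subseteq> PiE I B" "PiE I U \<noteq> {}" using U V by auto
    then show ?thesis using that subset_PiE[of I U B] by blast
  qed
  have "\<forall>x\<in>PiE I (\<lambda>i. if i \<in> J then B i else U i). f x = 0" if "finite J" "J \<subseteq> I" for J
    using that
  proof (induction J rule: finite_induct)
    case empty
    then show ?case using U V by auto
  next
    case (insert j J)
    show ?case
    proof
      fix x assume x: "x \<in> PiE I (\<lambda>i. if i \<in> insert j J then B i else U i)"
      have j: "j \<in> I" using insert by auto
      have xB: "x(j := w) \<in> PiE I B" if "w \<in> B j" for w
        using x j that UB by (auto simp: PiE_iff extensional_def split: if_splits)
      have "(\<lambda>w. f (x(j := w))) holomorphic_on B j"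
        unfolding holomorphic_on_def
      proof
        fix w assume w: "w \<in> B j"
        have "(\<lambda>w'. f ((x(j := w))(j := w'))) field_differentiable at ((x(j := w)) j)"
          using f xB[OF w] j unfolding mv_holomorphic_on_def by blast
        then show "(\<lambda>w. f (x(j := w))) field_differentiable at w within B j"
          by (auto intro: field_differentiable_at_within)
      qed
      moreover have "f (x(j := w)) = 0" if w: "w \<in> U j" for w
      proof -
        have "x(j := w) \<in> PiE I (\<lambda>i. if i \<in> J then B i else U i)"
          using x j w insert.hyps by (auto simp: PiE_iff extensional_def split: if_splits)
        then show ?thesis using insert by auto
      qed
      moreover have "U j \<noteq> {}" using U(2) j by auto
      moreover have "x j \<in> B j" using x j by (auto simp: PiE_iff)
      ultimately have "f (x(j := x j)) = 0"
        using analytic_continuation_open[of "U j" "B j" "\<lambda>w. f (x(j := w))" "\<lambda>_. 0" "x j"] U(1)[OF j] B[OF j]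
          UB[OF j]
        by auto
      then show "f x = 0" by simp
    qed
  qed
  from this[of I] I x show ?thesis by (simp cong: PiE_cong)
qed

section \<open>From parameter holomorphy to separate holomorphy, and Schwarz estimates\<close>

definition coord_curves :: "('i \<Rightarrow> complex) set \<Rightarrow> (complex \<Rightarrow> 'i \<Rightarrow> complex) set" where
  "coord_curves X = {\<lambda>w. x(i := w) | x i. x \<in> X}"

lemma continuous_coord_curves:
  assumes "c \<in> coord_curves X" shows "continuous_on UNIV c"
proof -
  obtain x i where c: "c = (\<lambda>w. x(i := w))" using assms by (auto simp: coord_curves_def)
  show ?thesis unfolding c
  proof (rule continuous_on_coordinatewise_then_product)
    fix j
    show "continuous_on UNIV (\<lambda>w. (x(i := w)) j)"
      by (cases "j = i") auto
  qed
qed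

text \<open>Connects two topologies: the metric one on all functions of a countable index type, used
  for parameters, and that of \<open>cspace I\<close>. The identity map between them is continuous
  because a coordinate outside \<open>I\<close> has the constant value
  \<open>undefined\<close>.\<close>

lemma param_hol_imp_mv_holomorphic_on:
  fixes X :: "('i::countable \<Rightarrow> complex) set"
  assumes X: "openin (cspace I) X" and f: "param_hol X (coord_curves X) f"
  shows "mv_holomorphic_on I f X"
  unfolding mv_holomorphic_on_def
proof (intro conjI ballI X)
  have sub: "X \<subseteq> topspace (cspace I)" using X openin_subset by blast
  have "continuous_map (cspace I) (product_topology (\<lambda>_. euclidean) UNIV) (\<lambda>x. x)"
    unfolding continuous_map_componentwise_UNIV
  proof
    fix i
    show "continuous_map (cspace I) euclidean (\<lambda>x. x i)"
    proof (cases "i \<in> I")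
      case True then show ?thesis by (rule continuous_map_product_projection)
    next
      case False
      show ?thesis
        by (rule continuous_map_eq[of _ _ "\<lambda>_. undefined"])
          (use False in \<open>auto simp: PiE_iff extensional_def\<close>)
    qed
  qed
  then have "continuous_map (subtopology (cspace I) X) (top_of_set X) (\<lambda>x. x)"
    unfolding continuous_map_in_subtopology euclidean_product_topology
    using sub by (auto intro: continuous_map_from_subtopology)
  moreover have "continuous_map (top_of_set X) euclidean f"
    using f by (simp add: param_hol_def)
  ultimately show "continuous_map (subtopology (cspace I) X) euclidean f"
    using continuous_map_compose[of "subtopology (cspace I) X" "top_of_set X" "\<lambda>x. x" euclidean f]
      by (simp add: o_def)
  fix x i assume x: "x \<in> X" and i: "i \<in> I"
  have o: "open {w. x(i := w) \<in> X}" using open_fun_upd_preimage[OF X _ i] x sub by blast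
  have "(\<lambda>w. f (x(i := w))) holomorphic_on {w. x(i := w) \<in> X}"
    using f x o unfolding param_hol_def curve_hol_def coord_curves_def by blast
  then show "(\<lambda>w. f (x(i := w))) field_differentiable at (x i)"
    using o x by (auto intro: holomorphic_on_imp_differentiable_at)
qed

text \<open>The bound \<open>B\<close> is neither strict nor positive, so the Schwarz lemma is
  applied to \<open>f / (B + e)\<close> and \<open>e\<close> tends to 0.\<close>

lemma Schwarz_bound:
  assumes f: "f holomorphic_on ball 0 1" "f 0 = 0" and B: "\<And>z. norm z < 1 \<Longrightarrow> norm (f z) \<le> B"
    and w: "norm w < 1"
  shows "norm (f w) \<le> B * norm w"
proof (rule field_le_epsilon)
  fix e :: real assume e: "e > 0"
  have B0: "B \<ge> 0" using B[of 0] f by auto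
  have "norm (f w / of_real (B + e)) \<le> norm w"
  proof (rule Schwarz_Lemma(1))
    show "(\<lambda>z. f z / of_real (B + e)) holomorphic_on ball 0 1"
      using B0 e by (intro holomorphic_intros f) (metis add_nonneg_pos of_real_eq_0_iff less_irrefl)
    show "norm (f z / of_real (B + e)) < 1" if "norm z < 1" for z
      using B[OF that] B0 e by (simp add: norm_divide del: of_real_add)
  qed (use f w in auto)
  then have "norm (f w) \<le> (B + e) * norm w"
    using B0 e by (simp add: norm_divide field_simps del: of_real_add)
  also have "\<dots> \<le> B * norm w + e"
    using w e mult_left_le[of "norm w" e] by (simp add: distrib_right)
  finally show "norm (f w) \<le> B * norm w + e" .
qed

text \<open>Induction on the set of variables: with \<open>v j\<close> moving, the estimate in the
  other variables is a uniform bound for the slice, and the Schwarz lemma in \<open>v j\<close>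
  supplies the next factor.\<close>

lemma Schwarz_polydisc:
  fixes h :: "('i \<Rightarrow> complex) \<Rightarrow> complex"
  assumes J: "finite J"
    and hol: "\<And>v j. (\<And>i. norm (v i) < 1) \<Longrightarrow> j \<in> J \<Longrightarrow> (\<lambda>w. h (v(j := w))) holomorphic_on ball 0 1"
    and zero: "\<And>v j. (\<And>i. norm (v i) < 1) \<Longrightarrow> j \<in> J \<Longrightarrow> v j = 0 \<Longrightarrow> h v = 0"
    and B: "\<And>v. (\<And>i. norm (v i) < 1) \<Longrightarrow> norm (h v) \<le> B"
    and v: "\<And>i. norm (v i) < 1"
  shows "norm (h v) \<le> B * (\<Prod>j\<in>J. norm (v j))"
  using J hol zero v
proof (induction J arbitrary: v rule: finite_induct)
  case empty
  then show ?case using B by simp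
next
  case (insert j J)
  have upd: "norm ((v(j := w)) i) < 1" if "norm w < 1" for w i
    using insert.prems(3) that by auto
  have "norm (h (v(j := v j))) \<le> (B * (\<Prod>i\<in>J. norm (v i))) * norm (v j)"
  proof (rule Schwarz_bound)
    show "(\<lambda>w. h (v(j := w))) holomorphic_on ball 0 1"
      by (rule insert.prems(1)) (use insert.prems(3) in auto)
    show "h (v(j := 0)) = 0"
    proof (rule insert.prems(2)[where j=j])
      show "cmod ((v(j := 0)) i) < 1" for i by (rule upd) simp
    qed simp_all
    show "norm (h (v(j := z))) \<le> B * (\<Prod>i\<in>J. norm (v i))" if z: "norm z < 1" for z
    proof -
      have "norm (h (v(j := z))) \<le> B * (\<Prod>i\<in>J. norm ((v(j := z)) i))"
      proof (rule insert.IH)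
        show "(\<lambda>w. h (v(j := w))) holomorphic_on ball 0 1" if "\<And>i. cmod (v i) < 1" "j \<in> J" for v j
          by (rule insert.prems(1)) (use that in auto)
        show "h v = 0" if "\<And>i. cmod (v i) < 1" "j \<in> J" "v j = 0" for v j
          by (rule insert.prems(2)[of v j]) (use that in auto)
        show "cmod ((v(j := z)) i) < 1" for i using upd[OF z] .
      qed
      also have "(\<Prod>i\<in>J. norm ((v(j := z)) i)) = (\<Prod>i\<in>J. norm (v i))"
        using insert.hyps by (intro prod.cong) auto
      finally show ?thesis .
    qed
    show "norm (v j) < 1" by (rule insert.prems(3))
  qed
  then show ?case using insert.hyps by (simp add: mult_ac)
qed

section \<open>The Lerch kernel\<close>

text \<open>The generating function of the Apostol-Bernoulli polynomials at \<open>x = - U\<close>,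
  with its limit filled in at 0. The factor \<open>U\<close> removes the pole that
  \<open>1 / (1 - z * exp (- U))\<close> has at 0 when \<open>z = 1\<close>.\<close>

definition lker :: "complex \<Rightarrow> complex \<Rightarrow> complex \<Rightarrow> complex" where
  "lker a z U = (if U = 0 then (if z = 1 then 1 else 0) else U * exp (- a * U) / (1 - z * exp (- U)))"

lemma exp_bound_shift:
  assumes "U \<in> strip \<rho>" "\<gamma> < g"
  shows "exp (\<gamma> * Re U) \<le> exp ((g - \<gamma>) * \<rho>) * exp (g * Re U)"
proof -
  have "0 \<le> (g - \<gamma>) * (Re U + \<rho>)" using assms by (intro mult_nonneg_nonneg) (auto simp: strip_def)
  then have "\<gamma> * Re U \<le> (g - \<gamma>) * \<rho> + g * Re U" by (simp add: algebra_simps)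
  then show ?thesis by (simp add: exp_add[symmetric])
qed

lemma hol_family_exp_boundedI:
  assumes "continuous_on (X \<times> strip \<rho>) (\<lambda>(x, U). F x U)"
    and "\<And>x. x \<in> X \<Longrightarrow> F x holomorphic_on strip \<rho>"
    and "\<And>U. U \<in> strip \<rho> \<Longrightarrow> curve_hol X C (\<lambda>x. F x U)"
    and B: "\<And>x U. x \<in> X \<Longrightarrow> U \<in> strip \<rho> \<Longrightarrow> norm (F x U) \<le> B * exp (\<gamma> * Re U)"
  shows "hol_family X C \<gamma> \<rho> F"
  unfolding hol_family_def
proof (intro conjI ballI allI impI)
  fix x0 g r assume h: "x0 \<in> X" "\<gamma> < g" "0 < r" "r < \<rho>"
  show "\<exists>e>0. \<exists>B. \<forall>x\<in>X \<inter> ball x0 e. \<forall>U\<in>strip r. norm (F x U) \<le> B * exp (g * Re U)"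
  proof (rule exI[of _ 1], rule conjI[OF _ exI[of _ "B * exp ((g - \<gamma>) * r)"]]; (intro ballI)?)
    fix x U assume x: "x \<in> X \<inter> ball x0 1" "U \<in> strip r"
    then have U: "U \<in> strip \<rho>" using strip_mono[of r \<rho>] h by auto
    have b: "norm (F x U) \<le> B * exp (\<gamma> * Re U)" using B x U by auto
    then have "B \<ge> 0" by (smt (verit) exp_gt_zero norm_ge_zero zero_le_mult_iff)
    then have "B * exp (\<gamma> * Re U) \<le> B * (exp ((g - \<gamma>) * r) * exp (g * Re U))"
      using exp_bound_shift[OF x(2) h(2)] by (rule mult_left_mono[rotated])
    with b show "norm (F x U) \<le> B * exp ((g - \<gamma>) * r) * exp (g * Re U)" by (simp add: mult_ac)
  qed auto
qed (use assms in auto)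

lemma curve_hol_const: "curve_hol X C (\<lambda>x. k)"
  by (auto simp: curve_hol_def)

lemma hol_family_exp: "hol_family X C (- Re a) \<rho> (\<lambda>x U. exp (- a * U))"
proof (rule hol_family_exp_boundedI)
  show "continuous_on (X \<times> strip \<rho>) (\<lambda>(x, U). exp (- a * U))"
    unfolding case_prod_beta by (intro continuous_intros)
  show "norm (exp (- a * U)) \<le> exp (\<bar>Im a\<bar> * \<rho>) * exp (- Re a * Re U)" if "U \<in> strip \<rho>" for U
  proof -
    have "Im a * Im U \<le> \<bar>Im a\<bar> * \<bar>Im U\<bar>" by (metis abs_ge_self abs_mult)
    also have "\<dots> \<le> \<bar>Im a\<bar> * \<rho>" using that by (intro mult_left_mono) (auto simp: strip_def)
    finally show ?thesis by (simp add: exp_add[symmetric])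
  qed
qed (auto intro!: holomorphic_intros curve_hol_const)

text \<open>
  A thickened segment from \<open>0\<close> to \<open>z0\<close>. It is connected and contains \<open>0\<close>, so that the identity theorem applies on
  boxes of such sets however close \<open>z0\<close> is to the slit.
\<close>

definition thick :: "complex \<Rightarrow> real \<Rightarrow> complex set" where
  "thick z0 \<eta> = (\<Union>y\<in>closed_segment 0 z0. \<Union>e\<in>ball 0 \<eta>. {y + e})"

lemma open_thick: "open (thick z0 \<eta>)"
  unfolding thick_def by (intro open_sums) auto

lemma convex_thick: "convex (thick z0 \<eta>)"
  unfolding thick_def by (intro convex_sums) auto

lemma thick_mem: "\<eta> > 0 \<Longrightarrow> z0 \<in> thick z0 \<eta>" "\<eta> > 0 \<Longrightarrow> 0 \<in> thick z0 \<eta>"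
  unfolding thick_def by (rule UN_I[of z0], simp, rule UN_I[of 0], simp, simp)
    (rule UN_I[of 0], simp, rule UN_I[of 0], simp, simp)

text \<open>In the strip \<open>exp (- U)\<close> is a real number \<open>y\<close> in the unit
  interval times some \<open>E\<close> close to 1. So \<open>w * exp (- U)\<close> stays close to a
  point of the segment from 0 to \<open>z0\<close>, and there \<open>1 - t * z0\<close> is bounded
  below by compactness because \<open>z0\<close> is off the slit.\<close>

lemma lker_denominator_bound:
  assumes z0: "z0 \<notin> complex_of_real ` {1..}"
  obtains d \<rho> \<eta> where "0 < d" "0 < \<rho>" "0 < \<eta>"
    "\<And>w U. w \<in> thick z0 \<eta> \<Longrightarrow> U \<in> strip \<rho> \<Longrightarrow> d \<le> norm (1 - w * exp (- U))"
proof -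
  have "continuous_on {0..1::real} (\<lambda>t. norm (1 - of_real t * z0))" by (intro continuous_intros)
  then obtain t0 where t0: "t0 \<in> {0..1}" "\<forall>t\<in>{0..1::real}. norm (1 - of_real t0 * z0)
    \<le> norm (1 - of_real t * z0)"
    using continuous_attains_inf[of "{0..1::real}" "\<lambda>t. norm (1 - of_real t * z0)"] by auto
  define d where "d = norm (1 - of_real t0 * z0)"
  have "1 - of_real t0 * z0 \<noteq> 0"
  proof
    assume "1 - of_real t0 * z0 = 0"
    then have e: "of_real t0 * z0 = 1" by simp
    then have "t0 \<noteq> 0" by auto
    then have "z0 = of_real (1 / t0)" using e by (simp add: field_simps)
    moreover have "1 / t0 \<ge> 1" using t0 \<open>t0 \<noteq> 0\<close> by auto
    ultimately show False using z0 by (metis atLeast_iff imageI)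
  qed
  then have d: "d > 0" by (simp add: d_def)
  have dl: "d \<le> norm (1 - of_real t * z0)" if "t \<in> {0..1}" for t using t0 that by (simp add: d_def)
  \<comment> \<open>The tolerance for \<open>E - 1\<close>: scaled by \<open>norm z0\<close> it
    costs at most \<open>d / 4\<close>, and being at most 1 it gives
    \<open>norm E \<le> 2\<close>.\<close>
  define k where "k = min 1 (d / (4 * (norm z0 + 1)))"
  have k: "k > 0" "k \<le> 1" "k * norm z0 \<le> d / 4"
  proof -
    show "k > 0" "k \<le> 1" using d by (auto simp: k_def intro!: divide_pos_pos add_nonneg_pos)
    have "k * norm z0 \<le> d / (4 * (norm z0 + 1)) * norm z0" by (intro mult_right_mono) (auto simp: k_def)
    also have "\<dots> = d / 4 * (norm z0 / (norm z0 + 1))" by simp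
    also have "\<dots> \<le> d / 4 * 1"
      using d by (intro mult_left_mono) (auto simp: divide_le_eq_1 add_nonneg_pos)
    also have "\<dots> = d / 4" by simp
    finally show "k * norm z0 \<le> d / 4" .
  qed
  have "isCont exp (0::complex)" by simp
  then obtain e where e: "e > 0" "\<And>v::complex. dist v 0 < e \<Longrightarrow> dist (exp v) (exp 0) < k"
    unfolding continuous_at_eps_delta using k(1) by blast
  define \<rho> where "\<rho> = e / 3"
  have \<rho>: "\<rho> > 0" using e by (simp add: \<rho>_def)
  \<comment> \<open>The errors from \<open>E - 1\<close> and from the displacement \<open>c\<close>,
    doubled by \<open>E\<close>, cost at most \<open>d / 4\<close> each; \<open>d / 2\<close> is
    left, of which \<open>d / 4\<close> is claimed.\<close>
  show ?thesis
  proof (rule that[of "d / 4" \<rho> "d / 8"])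
    fix w U assume w: "w \<in> thick z0 (d / 8)" and U: "U \<in> strip \<rho>"
    obtain s c where s: "s \<in> {0..1}" "w = of_real s * z0 + c" "norm c < d / 8"
      using w unfolding thick_def closed_segment_def by (auto simp: scaleR_conv_of_real)
    define y where "y = exp (- max (Re U) 0)"
    define V where "V = U - of_real (max (Re U) 0)"
    have y: "0 \<le> y" "y \<le> 1" by (auto simp: y_def)
    have "norm V \<le> \<bar>Re V\<bar> + \<bar>Im V\<bar>" by (rule cmod_le)
    also have "\<dots> < e" using U by (auto simp: V_def strip_def \<rho>_def max_def)
    finally have "norm (exp (- V) - 1) < k" using e(2)[of "- V"] by (simp add: dist_norm)
    moreover define E where "E = exp (- V)"
    ultimately have E: "norm (E - 1) < k" by simp
    have eU: "exp (- U) = of_real y * E"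
      unfolding y_def V_def E_def by (simp add: exp_of_real[symmetric] exp_add[symmetric])
    have nE: "norm E \<le> 2" using E k norm_triangle_ineq[of "E - 1" 1] by simp
    have "s * y \<in> {0..1}" using s y by (auto intro: mult_le_one)
    then have dd: "d \<le> norm (1 - of_real (s * y) * z0)" by (rule dl)
    have eq: "1 - w * exp (- U) = (1 - of_real (s * y) * z0) - (of_real (s * y) * z0 * (E - 1) + c * of_real y
      * E)"
      unfolding eU s(2) by (simp add: algebra_simps)
    have "norm (of_real (s * y) * z0 * (E - 1)) \<le> 1 * norm z0 * k"
      unfolding norm_mult using \<open>s * y \<in> {0..1}\<close> E
      by (intro mult_mono) (auto simp del: of_real_mult)
    moreover have "norm (c * of_real y * E) \<le> d / 8 * 1 * 2"
      unfolding norm_mult using s y nE d by (intro mult_mono) auto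
    ultimately have "norm (of_real (s * y) * z0 * (E - 1) + c * of_real y * E) \<le> d / 4 + d / 4"
      using k(3) norm_triangle_ineq[of "of_real (s * y) * z0 * (E - 1)" "c * of_real y * E"]
        by (simp add: mult.commute)
    then show "d / 4 \<le> norm (1 - w * exp (- U))"
      unfolding eq using dd norm_triangle_ineq2[of "1 - of_real (s * y) * z0"
        "of_real (s * y) * z0 * (E - 1) + c * of_real y * E"] d
      by linarith
  qed (use d \<rho> in auto)
qed

text \<open>A point \<open>t \<ge> 1\<close> of the slit would make the denominator vanish at
  \<open>U = ln t\<close>, which lies in the strip.\<close>

lemma thick_avoids:
  assumes b: "\<And>w U. w \<in> thick z0 \<eta> \<Longrightarrow> U \<in> strip \<rho> \<Longrightarrow> d \<le> norm (1 - w * exp (- U))" and d: "0 < d" "0 < \<rho>"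
  shows "thick z0 \<eta> \<subseteq> - (complex_of_real ` {1..})"
proof
  fix w assume w: "w \<in> thick z0 \<eta>"
  show "w \<in> - (complex_of_real ` {1..})"
  proof
    assume "w \<in> complex_of_real ` {1..}"
    then obtain t where t: "w = of_real t" "t \<ge> 1" by auto
    have "d \<le> norm (1 - w * exp (- of_real (ln t)))" using w d t by (intro b) auto
    also have "w * exp (- complex_of_real (ln t)) = of_real (t * exp (- ln t))"
      by (simp add: t exp_of_real[symmetric])
    also have "t * exp (- ln t) = 1" using t by (simp add: exp_minus)
    finally show False using d by simp
  qed
qed

lemma hol_family_lker_param:
  assumes contC: "\<And>c. c \<in> C \<Longrightarrow> continuous_on UNIV c"
    and b: "\<And>w U. w \<in> thick z0 \<eta> \<Longrightarrow> U \<in> strip \<rho> \<Longrightarrow> d \<le> norm (1 - w * exp (- U))" and d: "0 < d" "0 < \<rho>"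
    and z: "param_hol X C z" "\<And>x. x \<in> X \<Longrightarrow> z x \<in> thick z0 \<eta>"
  shows "hol_family X C (- Re a) \<rho> (\<lambda>x. lker a (z x))"
proof -
  have nz: "1 - z x * exp (- U) \<noteq> 0" if "x \<in> X" "U \<in> strip \<rho>" for x U
    using b[OF z(2)[OF that(1)] that(2)] d by auto
  have "hol_family X C 0 \<rho> (\<lambda>x U. 1 / (1 - z x * exp (- U)))"
  proof (rule hol_family_exp_boundedI)
    have "continuous_on (X \<times> strip \<rho>) (\<lambda>p. z (fst p))"
      using z(1) by (intro continuous_on_compose2[of X z _ fst])
        (auto simp: param_hol_def intro: continuous_intros)
    then show "continuous_on (X \<times> strip \<rho>) (\<lambda>(x, U). 1 / (1 - z x * exp (- U)))"
      unfolding case_prod_beta using nz by (intro continuous_intros) auto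
    show "(\<lambda>U. 1 / (1 - z x * exp (- U))) holomorphic_on strip \<rho>" if "x \<in> X" for x
      using nz[OF that] by (intro holomorphic_intros) auto
    show "curve_hol X C (\<lambda>x. 1 / (1 - z x * exp (- U)))" if "U \<in> strip \<rho>" for U
      using z(1) nz[OF _ that] unfolding curve_hol_def param_hol_def
      by (auto intro!: holomorphic_intros simp: image_subset_iff)
    show "norm (1 / (1 - z x * exp (- U))) \<le> 1 / d * exp (0 * Re U)" if "x \<in> X" "U \<in> strip \<rho>" for x U
      using b[OF z(2)[OF that(1)] that(2)] d by (simp add: norm_divide frac_le)
  qed
  from hol_family_mult[OF hol_family_ident[of X C \<rho>] hol_family_mult[OF hol_family_exp[of X C a \<rho>] this]]
  have "hol_family X C (- Re a) \<rho> (\<lambda>x U. U * (exp (- a * U) * (1 / (1 - z x * exp (- U)))))" by simp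
  then show ?thesis
  proof (rule hol_family_cong[rotated])
    fix x U assume x: "x \<in> X" "U \<in> strip \<rho>"
    \<comment> \<open>The denominator at \<open>U = 0\<close> is \<open>1 - z x\<close>, so the
      value of \<open>lker\<close> at 0 is here the plain quotient 0.\<close>
    have "z x \<noteq> 1" using nz[OF x(1), of 0] d by auto
    then show "U * (exp (- a * U) * (1 / (1 - z x * exp (- U)))) = lker a (z x) U" by (simp add: lker_def)
  qed
qed

section \<open>The kernel at \<open>z = 1\<close>\<close>

lemma strip_exp_eq_1: "U \<in> strip 1 \<Longrightarrow> exp (- U) = 1 \<Longrightarrow> U = 0"
proof -
  assume U: "U \<in> strip 1" "exp (- U) = 1"
  then obtain n :: int where n: "Re U = 0" "- Im U = of_int (2 * n) * pi" by (auto simp: exp_eq_1)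
  have "n = 0"
  proof (rule ccontr)
    assume "n \<noteq> 0"
    then have "\<bar>real_of_int (2 * n)\<bar> \<ge> 2" by simp
    then have "\<bar>real_of_int (2 * n)\<bar> * pi \<ge> 2 * pi" by (intro mult_right_mono) auto
    moreover have "\<bar>Im U\<bar> = \<bar>real_of_int (2 * n)\<bar> * pi"
      unfolding abs_minus_cancel[of "Im U", symmetric] n(2) by (simp add: abs_mult)
    moreover have "\<bar>Im U\<bar> < 1" using U(1) by (simp add: strip_def)
    ultimately show False using pi_gt3 by linarith
  qed
  with n show ?thesis by (simp add: complex_eq_iff)
qed

text \<open>The generating function of the Todd class; the kernel at \<open>z = 1\<close> is
  \<open>exp (- a * U) * todd U\<close>.\<close>

definition todd :: "complex \<Rightarrow> complex" where
  "todd U = (if U = 0 then 1 else U / (1 - exp (- U)))"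

lemma todd_holomorphic: "todd holomorphic_on strip 1"
proof (rule no_isolated_singularity'[where K="{0}"])
  have "((\<lambda>U. 1 - exp (- U)) has_field_derivative 1) (at (0::complex))"
    by (auto intro!: derivative_eq_intros)
  then have "((\<lambda>U. (1 - exp (- U)) / U) \<longlongrightarrow> 1) (at (0::complex))"
    by (simp add: has_field_derivative_iff)
  then have "((\<lambda>U. inverse ((1 - exp (- U)) / U)) \<longlongrightarrow> inverse 1) (at (0::complex))"
    by (rule tendsto_inverse) simp
  moreover have "eventually (\<lambda>U. inverse ((1 - exp (- U)) / U) = todd U) (at (0::complex))"
    unfolding eventually_at_filter by (auto simp: todd_def)
  ultimately have "(todd \<longlongrightarrow> 1) (at 0)"
    using tendsto_cong[of "\<lambda>U. inverse ((1 - exp (- U)) / U)" todd "at 0" 1] by simp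
  then show "(todd \<longlongrightarrow> todd z) (at z within strip 1)" if "z \<in> {0}" for z
    using that by (auto simp: todd_def intro: tendsto_within_subset)
  have "(\<lambda>U. U / (1 - exp (- U))) holomorphic_on strip 1 - {0}"
    using strip_exp_eq_1 by (intro holomorphic_intros) auto
  then show "todd holomorphic_on strip 1 - {0}"
    by (rule holomorphic_transform) (auto simp: todd_def)
qed auto

text \<open>Bounded on the compact part with \<open>Re U \<le> 1\<close> and of at most linear
  growth beyond it, hence of exponent 0.\<close>

lemma hol_family_todd: "hol_family X C 0 1 (\<lambda>x. todd)"
proof (rule hol_family_localI)
  fix r :: real assume r: "0 < r" "r < 1"
  have sub: "strip r \<subseteq> strip 1" using strip_mono[of r 1] r by simp
  define K where "K = cbox (Complex (- r) (- r)) (Complex 1 r)"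
  have K: "K \<subseteq> strip 1" using r by (auto simp: K_def in_cbox_complex_iff strip_def)
  have "compact (todd ` K)"
    by (rule compact_continuous_image)
       (use K todd_holomorphic in \<open>auto simp: K_def intro: holomorphic_on_imp_continuous_on
         continuous_on_subset\<close>)
  then obtain B0 where B0: "\<And>U. U \<in> K \<Longrightarrow> norm (todd U) \<le> B0"
    using compact_imp_bounded bounded_iff by (metis imageI)
  define B where "B = max B0 0"
  \<comment> \<open>For \<open>Re U > 1\<close> the denominator has modulus at least
    \<open>1 - exp (- 1)\<close>.\<close>
  define c where "c = 1 / (1 - exp (- 1 :: real))"
  have c: "c > 0" by (simp add: c_def)
  have bnd: "norm (todd U) \<le> B + c * norm U" if U: "U \<in> strip r" for U
  proof (cases "Re U \<le> 1")
    case True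
    then have "U \<in> K" using U by (auto simp: K_def in_cbox_complex_iff strip_def)
    then have "norm (todd U) \<le> B" using B0[of U] by (simp add: B_def le_max_iff_disj)
    moreover have "0 \<le> c * norm U" using c by simp
    ultimately show ?thesis by linarith
  next
    case False
    then have "norm (exp (- U)) \<le> exp (- 1)" by simp
    then have "1 - exp (- 1) \<le> norm (1::complex) - norm (exp (- U))" unfolding norm_one by linarith
    also have "\<dots> \<le> norm (1 - exp (- U))" by (rule norm_triangle_ineq2)
    finally have "1 - exp (- 1) \<le> norm (1 - exp (- U))" .
    then have "norm U / norm (1 - exp (- U)) \<le> norm U / (1 - exp (- 1))"
      by (intro divide_left_mono mult_pos_pos) (auto intro: less_le_trans[of 0 "1 - exp (-1)"])
    moreover have "U \<noteq> 0" using False by auto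
    ultimately show ?thesis by (simp add: todd_def norm_divide c_def B_def add_increasing)
  qed
  show "hol_family X C 0 r (\<lambda>x. todd)"
    unfolding hol_family_def
  proof (intro conjI ballI allI impI)
    show "continuous_on (X \<times> strip r) (\<lambda>(x, U). todd U)"
      unfolding case_prod_beta
      by (rule continuous_on_compose2[OF holomorphic_on_imp_continuous_on[OF todd_holomorphic]])
         (use sub in \<open>auto intro!: continuous_intros\<close>)
    show "todd holomorphic_on strip r" using todd_holomorphic sub by (rule holomorphic_on_subset)
    fix x0 g r' assume h: "x0 \<in> X" "0 < (g::real)" "0 < r'" "r' < r"
    obtain e B1 where "e > 0" "\<forall>x\<in>X \<inter> ball x0 e. \<forall>U\<in>strip r'. norm U \<le> B1 * exp (g * Re U)"
      using hol_familyD(4)[OF hol_family_ident[of X C r] h] by blast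
    then have B1: "\<forall>U\<in>strip r'. norm U \<le> B1 * exp (g * Re U)" using h(1) by (metis IntI centre_in_ball)
    show "\<exists>e>0. \<exists>B. \<forall>x\<in>X \<inter> ball x0 e. \<forall>U\<in>strip r'. norm (todd U) \<le> B * exp (g * Re U)"
    proof (rule exI[of _ 1], rule conjI[OF _ exI[of _ "B * exp (g * r') + c * B1"]]; (intro ballI)?)
      fix U assume U: "U \<in> strip r'"
      then have "U \<in> strip r" using strip_mono[of r' r] h by auto
      then have "norm (todd U) \<le> B + c * norm U" by (rule bnd)
      also have "\<dots> \<le> B * (exp (g * r') * exp (g * Re U)) + c * (B1 * exp (g * Re U))"
      proof (rule add_mono)
        have "1 \<le> exp (g * (r' + Re U))" using U h by (auto simp: strip_def)
        then show "B \<le> B * (exp (g * r') * exp (g * Re U))"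
          using mult_left_mono[of 1 "exp (g * (r' + Re U))" B] by (simp add: B_def exp_add distrib_left)
        show "c * norm U \<le> c * (B1 * exp (g * Re U))" using B1 U c by (intro mult_left_mono) auto
      qed
      finally show "norm (todd U) \<le> (B * exp (g * r') + c * B1) * exp (g * Re U)" by (simp add: algebra_simps)
    qed auto
  qed (auto intro!: curve_hol_const)
qed

lemma hol_family_lker_1: "hol_family X C (- Re a) 1 (\<lambda>x. lker a 1)"
proof -
  have "hol_family X C (- Re a + 0) 1 (\<lambda>x U. exp (- a * U) * todd U)"
    by (intro hol_family_mult hol_family_exp hol_family_todd)
  then have "hol_family X C (- Re a) 1 (\<lambda>x U. exp (- a * U) * todd U)" by simp
  then show ?thesis by (rule hol_family_cong[rotated]) (auto simp: lker_def todd_def)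
qed

text \<open>Both expansions satisfy the same linear equation over formal power series once
  \<open>X\<close> is replaced by \<open>- X\<close> in the Apostol-Bernoulli series. Working with
  products instead of quotients treats \<open>z = 1\<close>, where the denominator is not a unit,
  like every other \<open>z\<close>.\<close>

lemma lker_higher_deriv_0:
  assumes hol: "lker a z holomorphic_on strip \<rho>" "0 < \<rho>"
  shows "(deriv ^^ n) (lker a z) 0 / fact n = (-1) ^ n * (apostol_bernoulli n a z / fact n)"
proof -
  define g where "g = fps_expansion (lker a z) 0"
  have g: "lker a z has_fps_expansion g"
    unfolding g_def by (rule has_fps_expansion_fps_expansion[OF open_strip _ hol(1)]) (use hol in simp)
  have ev: "eventually (\<lambda>U. lker a z U * (1 - z * exp (- U)) = U * exp (- a * U)) (nhds 0)"
  proof (cases "z = 1")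
    case True
    have "eventually (\<lambda>U. U \<in> strip 1) (nhds 0)" by (intro eventually_nhds_in_open) auto
    then show ?thesis
    proof eventually_elim
      case (elim U)
      show ?case using strip_exp_eq_1[OF elim] True by (cases "U = 0") (auto simp: lker_def)
    qed
  next
    case False
    have "open {U. 1 - z * exp (- U) \<noteq> 0}" by (intro open_Collect_neq continuous_intros)
    from eventually_nhds_in_open[OF this, of 0] have "eventually (\<lambda>U. 1 - z * exp (- U) \<noteq> 0) (nhds 0)"
      using False by simp
    then show ?thesis by eventually_elim (use False in \<open>auto simp: lker_def\<close>)
  qed
  have "(\<lambda>U. lker a z U * (1 - z * exp ((-1) * U))) has_fps_expansion g * (1 - fps_const z * fps_exp (-1))"
    by (intro fps_expansion_intros g)
  then have "(\<lambda>U. U * exp ((- a) * U)) has_fps_expansion g * (1 - fps_const z * fps_exp (-1))"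
    using has_fps_expansion_cong[OF ev refl, of "g * (1 - fps_const z * fps_exp (-1))"] by simp
  moreover have "(\<lambda>U. U * exp ((- a) * U)) has_fps_expansion fps_X * fps_exp (- a)"
    by (intro fps_expansion_intros)
  ultimately have e1: "g * (1 - fps_const z * fps_exp (-1)) = fps_X * fps_exp (- a)"
    by (rule fps_expansion_unique_complex)
  define D where "D = fps_const z * fps_exp 1 - (1 :: complex fps)"
  define b where "b = fps_X * fps_exp a / D"
  \<comment> \<open>The coefficients 0 and 1 of \<open>D\<close> are \<open>z - 1\<close> and
    \<open>z\<close>. Order at most 1 makes \<open>D\<close> divide a series of order 1, so the
    formal quotient is exact.\<close>
  have D: "D \<noteq> 0 \<and> subdegree D \<le> 1"
  proof (cases "z = 1")
    case True
    have "D $ 1 \<noteq> 0" using True by (simp add: D_def)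
    then show ?thesis using subdegree_leI[of D 1] by auto
  next
    case False
    have "D $ 0 \<noteq> 0" using False by (simp add: D_def)
    then show ?thesis using subdegree_leI[of D 0] by auto
  qed
  have nz: "fps_X * fps_exp a \<noteq> 0" by simp
  have "subdegree (fps_X * fps_exp a) = 1" by simp
  then have "D dvd fps_X * fps_exp a" using D nz by (subst fps_dvd_iff) auto
  then have e2: "b * D = fps_X * fps_exp a" unfolding b_def by simp
  define m where "m = fps_const (-1) * (fps_X :: complex fps)"
  have m0: "m $ 0 = 0" by (simp add: m_def)
  have mX: "m = - fps_X" by (simp add: m_def fps_eq_iff)
  have "(b oo m) * (D oo m) = (fps_X oo m) * (fps_exp a oo m)"
    using arg_cong[OF e2, of "\<lambda>f. f oo m"] by (simp only: fps_compose_mult_distrib[OF m0])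
  moreover have "D oo m = fps_const z * fps_exp (-1) - 1"
    unfolding D_def m_def
      by (simp only: fps_compose_sub_distrib fps_compose_mult_distrib[OF m0[unfolded m_def]] fps_const_compose
      fps_exp_compose_linear fps_compose_1 mult_1_right)
  moreover have "fps_X oo m = m" using m0 by simp
  moreover have "fps_exp a oo m = fps_exp (- a)" unfolding m_def by (simp only: fps_exp_compose_linear) simp
  ultimately have "(b oo m) * (1 - fps_const z * fps_exp (-1)) = fps_X * fps_exp (- a)"
    unfolding mX by algebra
  with e1 have "(g - (b oo m)) * (1 - fps_const z * fps_exp (-1)) = 0" by algebra
  \<comment> \<open>Its first two coefficients are \<open>1 - z\<close> and \<open>z\<close>, which
    cannot both vanish; this factor can therefore be cancelled.\<close>
  moreover have "1 - fps_const z * fps_exp (-1) \<noteq> (0 :: complex fps)"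
  proof
    assume "1 - fps_const z * fps_exp (-1) = (0 :: complex fps)"
    then have "(1 - fps_const z * fps_exp (-1)) $ 0 = (0 :: complex)"
      "(1 - fps_const z * fps_exp (-1)) $ 1 = (0 :: complex)" by simp_all
    then show False by simp
  qed
  ultimately have "g = b oo m" by simp
  then have "g $ n = (-1) ^ n * b $ n" unfolding m_def by (simp only: fps_compose_linear fps_nth_Abs_fps)
  moreover have "g $ n = (deriv ^^ n) (lker a z) 0 / fact n" by (simp add: g_def fps_expansion_def)
  ultimately show ?thesis by (simp add: apostol_bernoulli_def b_def D_def)
qed

section \<open>The integral as an iterated integral\<close>

interpretation lborel_prod: product_sigma_finite "\<lambda>_::nat. lborel :: real measure"
  by standard

abbreviation PiL :: "nat set \<Rightarrow> (nat \<Rightarrow> real) measure" where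
  "PiL I \<equiv> PiM I (\<lambda>_. lborel)"

text \<open>Coordinate \<open>a\<close> of the argument holds a sum, the extra real one of its two
  summands; the image lists both summands, at \<open>a\<close> and \<open>b\<close>.\<close>

definition shear :: "nat \<Rightarrow> nat \<Rightarrow> (nat \<Rightarrow> real) \<times> real \<Rightarrow> nat \<Rightarrow> real" where
  "shear a b p = (fst p)(a := fst p a - snd p, b := snd p)"

lemma measurable_shear:
  assumes "a \<in> K"
  shows "shear a b \<in> measurable (PiL K \<Otimes>\<^sub>M lborel) (PiL (insert b K))"
proof -
  have m: "fst \<in> measurable (PiL K \<Otimes>\<^sub>M lborel) (PiL K)" by (rule measurable_fst)
  have c: "(\<lambda>p. fst p a) \<in> borel_measurable (PiL K \<Otimes>\<^sub>M lborel)"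
    using measurable_compose[OF m measurable_component_singleton[OF assms]] by simp
  have "(\<lambda>p. fst p a - snd p) \<in> borel_measurable (PiL K \<Otimes>\<^sub>M lborel)"
    using c by (intro borel_measurable_diff) auto
  then have "(\<lambda>p. (fst p)(a := fst p a - snd p)) \<in> measurable (PiL K \<Otimes>\<^sub>M lborel) (PiL K)"
    using assms by (intro measurable_fun_upd[where J=K]) (auto intro: m)
  then show ?thesis
    unfolding shear_def by (rule measurable_fun_upd[rotated]) auto
qed

text \<open>Volume is preserved: for a fixed second component the map is a translation of coordinate
  \<open>a\<close>, so Tonelli and translation invariance of Lebesgue measure suffice.\<close>

lemma distr_shear:
  assumes I: "finite I" and ab: "a \<notin> I" "b \<notin> I" "a \<noteq> b"
  shows "distr (PiL (insert a I) \<Otimes>\<^sub>M lborel) (PiL (insert b (insert a I))) (shear a b)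
    = PiL (insert b (insert a I))"
proof (rule measure_eqI)
  let ?K = "insert a I"
  interpret K: sigma_finite_measure "PiL ?K" by (rule lborel_prod.sigma_finite) (use I in auto)
  interpret KL: pair_sigma_finite "PiL ?K" lborel ..
  note ms = measurable_shear[of a ?K b, OF insertI1]
  fix A assume "A \<in> sets (distr (PiL ?K \<Otimes>\<^sub>M lborel) (PiL (insert b ?K)) (shear a b))"
  then have A [measurable]: "A \<in> sets (PiL (insert b ?K))" by simp
  have iA: "(indicator A :: _ \<Rightarrow> ennreal) \<in> borel_measurable (PiL (insert b ?K))" by simp
  have mS: "(\<lambda>p. indicator A (shear a b p) :: ennreal) \<in> borel_measurable (PiL ?K \<Otimes>\<^sub>M lborel)"
    using measurable_compose[OF ms iA] by simp
  have m1: "(\<lambda>x. indicator A (x(b := v)) :: ennreal) \<in> borel_measurable (PiL ?K)" for v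
    by (rule measurable_compose[OF _ iA], rule measurable_fun_upd[where J="?K"]) auto
  have m2: "(\<lambda>x. indicator A (x(a := x a - v, b := v)) :: ennreal) \<in> borel_measurable (PiL ?K)" for v
  proof -
    have "(\<lambda>x. (x, v)) \<in> measurable (PiL ?K) (PiL ?K \<Otimes>\<^sub>M lborel)" by (rule measurable_Pair2') simp
    from measurable_compose[OF this mS] show ?thesis by (simp add: shear_def)
  qed
  have m3: "(\<lambda>p. indicator A ((fst p)(b := snd p)) :: ennreal) \<in> borel_measurable (PiL ?K \<Otimes>\<^sub>M lborel)"
    by (rule measurable_compose[OF _ iA], rule measurable_fun_upd[where J="?K"]) auto
  have "emeasure (distr (PiL ?K \<Otimes>\<^sub>M lborel) (PiL (insert b ?K)) (shear a b)) A
      = (\<integral>\<^sup>+p. indicator A (shear a b p) \<partial>(PiL ?K \<Otimes>\<^sub>M lborel))"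
    by (subst nn_integral_indicator[symmetric], simp, subst nn_integral_distr[OF ms]) (use iA in auto)
  also have "\<dots> = (\<integral>\<^sup>+x. \<integral>\<^sup>+v. indicator A (x(a := x a - v, b := v)) \<partial>lborel \<partial>PiL ?K)"
    using lborel.nn_integral_fst[OF mS] by (simp add: shear_def)
  also have "\<dots> = (\<integral>\<^sup>+v. \<integral>\<^sup>+x. indicator A (x(a := x a - v, b := v)) \<partial>PiL ?K \<partial>lborel)"
    by (rule KL.Fubini'[symmetric]) (use mS in \<open>simp add: shear_def case_prod_beta\<close>)
  also have "\<dots> = (\<integral>\<^sup>+v. \<integral>\<^sup>+x. indicator A (x(b := v)) \<partial>PiL ?K \<partial>lborel)"
  proof (rule nn_integral_cong)
    fix v :: real
    have "(\<integral>\<^sup>+x. indicator A (x(a := x a - v, b := v)) \<partial>PiL ?K)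
        = (\<integral>\<^sup>+x. \<integral>\<^sup>+y. indicator A (x(a := y - v, b := v)) \<partial>lborel \<partial>PiL I)"
      by (subst lborel_prod.product_nn_integral_insert[OF I ab(1) m2]) simp
    also have "\<dots> = (\<integral>\<^sup>+x. \<integral>\<^sup>+y. indicator A (x(a := y, b := v)) \<partial>lborel \<partial>PiL I)"
    proof (rule nn_integral_cong)
      fix x assume x: "x \<in> space (PiL I)"
      have "(\<lambda>y. x(a := y)) \<in> measurable lborel (PiL ?K)"
        using x by (intro measurable_fun_upd[where J=I]) auto
      from measurable_compose[OF this m1[of v]]
      have "(\<lambda>y. indicator A (x(a := y, b := v)) :: ennreal) \<in> borel_measurable borel" by simp
      from nn_integral_real_affine[OF this, of 1 "- v"]
      show "(\<integral>\<^sup>+y. indicator A (x(a := y - v, b := v)) \<partial>lborel)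
        = (\<integral>\<^sup>+y. indicator A (x(a := y, b := v)) \<partial>lborel)"
        by simp
    qed
    also have "\<dots> = (\<integral>\<^sup>+x. indicator A (x(b := v)) \<partial>PiL ?K)"
      by (subst lborel_prod.product_nn_integral_insert[OF I ab(1) m1]) simp
    finally show "(\<integral>\<^sup>+x. indicator A (x(a := x a - v, b := v)) \<partial>PiL ?K)
      = (\<integral>\<^sup>+x. indicator A (x(b := v)) \<partial>PiL ?K)" .
  qed
  also have "\<dots> = (\<integral>\<^sup>+x. \<integral>\<^sup>+v. indicator A (x(b := v)) \<partial>lborel \<partial>PiL ?K)"
    by (rule KL.Fubini') (use m3 in \<open>simp add: case_prod_beta\<close>)
  also have "\<dots> = (\<integral>\<^sup>+x. indicator A x \<partial>PiL (insert b ?K))"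
    by (subst lborel_prod.product_nn_integral_insert[OF _ _ iA]) (use I ab in auto)
  also have "\<dots> = emeasure (PiL (insert b ?K)) A" by simp
  finally show "emeasure (distr (PiL ?K \<Otimes>\<^sub>M lborel) (PiL (insert b ?K)) (shear a b)) A
    = emeasure (PiL (insert b ?K)) A" .
qed simp

lemma integral_shear:
  fixes Q :: "(nat \<Rightarrow> real) \<Rightarrow> complex"
  assumes I: "finite I" and ab: "a \<notin> I" "b \<notin> I" "a \<noteq> b"
    and Q: "integrable (PiL (insert b (insert a I))) Q"
  shows "integrable (PiL (insert a I)) (\<lambda>x. LINT v|lborel. Q (x(a := x a - v, b := v)))"
    and "integral\<^sup>L (PiL (insert b (insert a I))) Q
      = (LINT x|PiL (insert a I). LINT v|lborel. Q (x(a := x a - v, b := v)))"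
proof -
  let ?K = "insert a I"
  interpret K: sigma_finite_measure "PiL ?K" by (rule lborel_prod.sigma_finite) (use I in auto)
  interpret KL: pair_sigma_finite "PiL ?K" lborel ..
  note ms = measurable_shear[of a ?K b, OF insertI1]
  note d = distr_shear[OF I ab]
  have mQ: "Q \<in> borel_measurable (PiL (insert b ?K))" using Q by auto
  have i: "integrable (PiL ?K \<Otimes>\<^sub>M lborel) (\<lambda>p. Q (shear a b p))"
    using Q integrable_distr_eq[OF ms mQ] unfolding d by simp
  from KL.integrable_fst'[OF i] show "integrable (PiL ?K) (\<lambda>x. LINT v|lborel. Q (x(a := x a - v, b := v)))"
    by (simp add: shear_def)
  have "integral\<^sup>L (PiL (insert b ?K)) Q = (LINT p|(PiL ?K \<Otimes>\<^sub>M lborel). Q (shear a b p))"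
    using integral_distr[OF ms mQ] unfolding d by simp
  also have "\<dots> = (LINT x|PiL ?K. LINT v|lborel. Q (x(a := x a - v, b := v)))"
    using KL.integral_fst'[OF i] by (simp add: shear_def)
  finally show "integral\<^sup>L (PiL (insert b ?K)) Q
    = (LINT x|PiL ?K. LINT v|lborel. Q (x(a := x a - v, b := v)))" .
qed

definition lfrac :: "complex \<Rightarrow> complex \<Rightarrow> real \<Rightarrow> complex" where
  "lfrac a z U = exp (- a * of_real U) / (1 - z * exp (- of_real U))"

text \<open>The integrand once the variables beyond \<open>m\<close> have been integrated out:
  \<open>x m\<close> now holds the whole tail u_m + ... + u_r, and \<open>q\<close> is the function
  of this tail accumulated so far. The value 0 off the positive orthant replaces a domain of
  integration.\<close>

definition chain_integrand ::
    "(nat \<Rightarrow> complex) \<Rightarrow> (nat \<Rightarrow> complex) \<Rightarrow> (nat \<Rightarrow> complex) \<Rightarrow> nat \<Rightarrow> (real \<Rightarrow> complex) \<Rightarrow> (nat \<Rightarrow> real) \<Rightarrow> complex"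
      where
  "chain_integrand s a z m q x = (if \<forall>k\<in>{1..m}. 0 < x k then
     (\<Prod>j\<in>{1..<m}. lfrac (a j) (z j) (\<Sum>k=j..m. x k) * of_real (x j) powr (s j - 1)) * q (x m) else 0)"

text \<open>Integrates out the next tail \<open>v\<close>; the variable between the two tails is
  \<open>U - v\<close>, whence the convolution.\<close>

definition chain_step :: "complex \<Rightarrow> complex \<Rightarrow> complex \<Rightarrow> (real \<Rightarrow> complex) \<Rightarrow> real \<Rightarrow> complex" where
  "chain_step s a z q U = lfrac a z U * (LINT v:{0<..<U}|lborel. of_real (U - v) powr (s - 1) * q v)"

text \<open>The shear leaves every tail sum starting at \<open>j \<le> m\<close> unchanged, so only
  the power of \<open>x m - v\<close> and the function \<open>q\<close> depend on \<open>v\<close>;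
  the rest comes out of the integral.\<close>

lemma chain_integrand_Suc:
  assumes m: "m \<ge> 1"
  shows "(LINT v|lborel. chain_integrand s a z (Suc m) q (x(m := x m - v, Suc m := v)))
       = chain_integrand s a z m (chain_step (s m) (a m) (z m) q) x"
proof -
  define c where "c = (\<Prod>j\<in>{1..<m}. lfrac (a j) (z j) (\<Sum>k=j..m. x k) * of_real (x j) powr (s j - 1))"
  have eq: "chain_integrand s a z (Suc m) q (x(m := x m - v, Suc m := v)) =
     (if \<forall>k\<in>{1..<m}. 0 < x k then c * lfrac (a m) (z m) (x m) else 0) *
       (indicator {0<..<x m} v *\<^sub>R (of_real (x m - v) powr (s m - 1) * q v))" for v
  proof -
    let ?y = "x(m := x m - v, Suc m := v)"
    have "{1..Suc m} = insert (Suc m) (insert m {1..<m})" using m by auto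
    then have cond: "(\<forall>k\<in>{1..Suc m}. 0 < ?y k) \<longleftrightarrow> (\<forall>k\<in>{1..<m}. 0 < x k) \<and> v \<in> {0<..<x m}"
      by auto
    have sum: "(\<Sum>k=j..Suc m. ?y k) = (\<Sum>k=j..m. x k)" if "j \<le> m" for j
    proof -
      have "{j..Suc m} = insert (Suc m) (insert m {j..<m})" "{j..m} = insert m {j..<m}" using that by auto
      moreover have "(\<Sum>k\<in>{j..<m}. ?y k) = (\<Sum>k\<in>{j..<m}. x k)" by (intro sum.cong) auto
      ultimately show ?thesis by simp
    qed
    have "(\<Prod>j\<in>{1..<Suc m}. lfrac (a j) (z j) (\<Sum>k=j..Suc m. ?y k) * of_real (?y j) powr (s j - 1))
        = (\<Prod>j\<in>insert m {1..<m}. lfrac (a j) (z j) (\<Sum>k=j..m. x k) * of_real (?y j) powr (s j - 1))"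
    proof (rule prod.cong)
      show "{1..<Suc m} = insert m {1..<m}" using m by auto
      fix j assume "j \<in> insert m {1..<m}"
      then have "j \<le> m" by auto
      show "lfrac (a j) (z j) (\<Sum>k=j..Suc m. ?y k) * of_real (?y j) powr (s j - 1)
          = lfrac (a j) (z j) (\<Sum>k=j..m. x k) * of_real (?y j) powr (s j - 1)"
        by (simp only: sum[OF \<open>j \<le> m\<close>])
    qed
    also have "\<dots> = lfrac (a m) (z m) (x m) * of_real (x m - v) powr (s m - 1) * c"
      unfolding c_def by (subst prod.insert) (auto intro!: arg_cong2[where f="(*)"] prod.cong)
    finally show ?thesis
      unfolding chain_integrand_def cond by (auto simp: indicator_def mult_ac)
  qed
  have "(LINT v|lborel. chain_integrand s a z (Suc m) q (x(m := x m - v, Suc m := v)))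
      = (if \<forall>k\<in>{1..<m}. 0 < x k then c * lfrac (a m) (z m) (x m) else 0) *
        (LINT v:{0<..<x m}|lborel. of_real (x m - v) powr (s m - 1) * q v)"
    unfolding eq set_lebesgue_integral_def by (rule integral_mult_right_zero)
  also have "\<dots> = chain_integrand s a z m (chain_step (s m) (a m) (z m) q) x"
  proof (cases "x m > 0")
    case True
    have "{1..m} = insert m {1..<m}" using m by auto
    then have "(\<forall>k\<in>{1..m}. 0 < x k) \<longleftrightarrow> (\<forall>k\<in>{1..<m}. 0 < x k)" using True by auto
    then show ?thesis unfolding chain_integrand_def chain_step_def c_def by simp
  next
    case False
    then have "\<not> (\<forall>k\<in>{1..m}. 0 < x k)" using m by auto
    then have "chain_integrand s a z m (chain_step (s m) (a m) (z m) q) x = 0"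
      unfolding chain_integrand_def by (rule if_not_P)
    moreover have "{0<..<x m} = {}" using False by auto
    ultimately show ?thesis by (simp add: set_lebesgue_integral_def)
  qed
  finally show ?thesis .
qed

lemma chain_integral_Suc:
  assumes m: "m \<ge> 1" and i: "integrable (PiL {1..Suc m}) (chain_integrand s a z (Suc m) q)"
  shows "integrable (PiL {1..m}) (chain_integrand s a z m (chain_step (s m) (a m) (z m) q))"
    and "integral\<^sup>L (PiL {1..Suc m}) (chain_integrand s a z (Suc m) q) =
         integral\<^sup>L (PiL {1..m}) (chain_integrand s a z m (chain_step (s m) (a m) (z m) q))"
proof -
  have eqs: "{1..Suc m} = insert (Suc m) (insert m {1..<m})" "{1..m} = insert m {1..<m}" using m by auto
  note sh = integral_shear[of "{1..<m}" m "Suc m" "chain_integrand s a z (Suc m) q", folded eqs, OF _ _ _ _ i]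
  show "integrable (PiL {1..m}) (chain_integrand s a z m (chain_step (s m) (a m) (z m) q))"
    using sh(1) unfolding chain_integrand_Suc[OF m] by simp
  show "integral\<^sup>L (PiL {1..Suc m}) (chain_integrand s a z (Suc m) q) =
         integral\<^sup>L (PiL {1..m}) (chain_integrand s a z m (chain_step (s m) (a m) (z m) q))"
    using sh(2) unfolding chain_integrand_Suc[OF m] by simp
qed

text \<open>The index counts the variables already integrated, beginning with the last;
  \<open>chain_fun r s a z k\<close> is a function of the tail u_(r-k) + ... + u_r.\<close>

primrec chain_fun :: "nat \<Rightarrow> (nat \<Rightarrow> complex) \<Rightarrow> (nat \<Rightarrow> complex) \<Rightarrow> (nat \<Rightarrow> complex) \<Rightarrow> nat \<Rightarrow> real \<Rightarrow> complex" where
  "chain_fun r s a z 0 = (\<lambda>U. lfrac (a r) (z r) U * of_real U powr (s r - 1))"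
| "chain_fun r s a z (Suc k) = chain_step (s (r - Suc k)) (a (r - Suc k)) (z (r - Suc k))
  (chain_fun r s a z k)"

lemma chain_integral:
  assumes i: "integrable (PiL {1..r}) (chain_integrand s a z r (chain_fun r s a z 0))" and k: "k < r"
  shows "integrable (PiL {1..r - k}) (chain_integrand s a z (r - k) (chain_fun r s a z k)) \<and>
     integral\<^sup>L (PiL {1..r}) (chain_integrand s a z r (chain_fun r s a z 0)) =
     integral\<^sup>L (PiL {1..r - k}) (chain_integrand s a z (r - k) (chain_fun r s a z k))"
  using k
proof (induction k)
  case (Suc k)
  then have e: "r - k = Suc (r - Suc k)" by simp
  have m: "1 \<le> r - Suc k" using Suc.prems by simp
  have IH: "integrable (PiL {1..Suc (r - Suc k)})
    (chain_integrand s a z (Suc (r - Suc k)) (chain_fun r s a z k))"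
    "integral\<^sup>L (PiL {1..r}) (chain_integrand s a z r (chain_fun r s a z 0)) =
     integral\<^sup>L (PiL {1..Suc (r - Suc k)}) (chain_integrand s a z (Suc (r - Suc k)) (chain_fun r s a z k))"
    using Suc.IH Suc.prems unfolding e by auto
  show ?case using chain_integral_Suc[OF m IH(1)] IH(2) by simp
qed (use i in simp)

lemma chain_integral_1:
  "integral\<^sup>L (PiL {1..1}) (chain_integrand s a z 1 q) = (LINT U:{0<..}|lborel. q U)"
  if i: "integrable (PiL {1..1}) (chain_integrand s a z 1 q)"
proof -
  have c: "chain_integrand s a z 1 q x = indicator {0<..} (x 1) *\<^sub>R q (x 1)" for x
    by (simp add: chain_integrand_def)
  have e: "{1..1} = {1::nat}" by simp
  have "(\<lambda>y. (\<lambda>_\<in>{1::nat}. y)) \<in> measurable lborel (PiL {1})"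
    by (rule measurable_restrict) simp
  moreover have "chain_integrand s a z 1 q \<in> borel_measurable (PiL {1})" using i unfolding e by auto
  ultimately have "(\<lambda>y. chain_integrand s a z 1 q (\<lambda>_\<in>{1::nat}. y)) \<in> borel_measurable lborel"
    by (rule measurable_compose)
  then have "(\<lambda>y. indicator {0<..} y *\<^sub>R q y) \<in> borel_measurable lborel" unfolding c by simp
  from lborel_prod.product_integral_singleton[OF this, of 1] show ?thesis
    unfolding c e set_lebesgue_integral_def .
qed

text \<open>The subtracted integer counts the kernels j, ..., r: each contributes one power of
  \<open>1 / U\<close> when \<open>lfrac\<close> is written as \<open>lker\<close> divided by
  \<open>U\<close>.\<close>

definition sig :: "nat \<Rightarrow> (nat \<Rightarrow> complex) \<Rightarrow> nat \<Rightarrow> complex" where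
  "sig r s j = (\<Sum>k=j..r. s k) - of_nat (r + 1 - j)"

text \<open>Built from the inside, so that step \<open>k\<close> is a function of the tail beginning
  at index \<open>r - k\<close>. The exponents \<sigma> and s are separate arguments, not tied by
  \<open>sig\<close>, because the remainder estimate varies them independently.\<close>

primrec nest :: "nat \<Rightarrow> nat \<Rightarrow> (nat \<Rightarrow> complex) \<Rightarrow> (nat \<Rightarrow> complex) \<Rightarrow> (nat \<Rightarrow> complex) \<Rightarrow> (nat \<Rightarrow> complex) \<Rightarrow> nat \<Rightarrow>
  complex \<Rightarrow> complex" where
  "nest N r a z \<sigma> s 0 = lker (a r) (z r)"
| "nest N r a z \<sigma> s (Suc k) =
     (\<lambda>U. lker (a (r - Suc k)) (z (r - Suc k)) U * ek N (nest N r a z \<sigma> s k) (\<sigma> (r - k)) (s (r - Suc k)) U)"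

lemma lfrac_lker: "U > 0 \<Longrightarrow> lfrac a z U = lker a z (of_real U) / of_real U"
  by (simp add: lfrac_def lker_def)

lemma sig_last: "r \<ge> 1 \<Longrightarrow> sig r s r = s r - 1"
  by (simp add: sig_def)

lemma sig_rec: "1 \<le> j \<Longrightarrow> j < r \<Longrightarrow> sig r s j = sig r s (Suc j) + s j - 1"
proof -
  assume j: "1 \<le> j" "j < r"
  then have "{j..r} = insert j {Suc j..r}" by auto
  moreover have "r + 1 - j = Suc (r + 1 - Suc j)" using j by simp
  ultimately show ?thesis by (simp add: sig_def)
qed

text \<open>The substitution \<open>v = U * t\<close> turns the convolution into an average and
  frees the power \<open>\<sigma> + s - 1\<close> of \<open>U\<close>; the \<open>1 / U\<close> in
  \<open>lfrac\<close> lowers it once more.\<close>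

lemma chain_step_scaling:
  assumes U: "U > 0" and q: "\<And>v. v > 0 \<Longrightarrow> c * q v = of_real v powr (\<sigma> - 1) * \<phi> (of_real v)"
  shows "rGamma \<sigma> * rGamma s * (c * chain_step s a z q U) =
     of_real U powr (\<sigma> + s - 1 - 1) * (lker a z (of_real U) * ek 0 \<phi> \<sigma> s (of_real U))"
proof -
  have "c * (LINT v:{0<..<U}|lborel. of_real (U - v) powr (s - 1) * q v)
      = (LINT v:{0<..<U}|lborel. of_real (U - v) powr (s - 1) * (c * q v))"
    by (simp add: mult_ac flip: set_integral_mult_right)
  also have "\<dots> = (LINT v:{0<..<U}|lborel. of_real (U - v) powr (s - 1)
    * (of_real v powr (\<sigma> - 1) * \<phi> (of_real v)))"
    by (rule set_lebesgue_integral_cong) (auto simp: q)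
  also have "\<dots> = \<bar>U\<bar> *\<^sub>R (LINT t|lborel. indicator {0<..<U} (0 + U * t) *\<^sub>R
       (of_real (U - (0 + U * t)) powr (s - 1) *
         (of_real (0 + U * t) powr (\<sigma> - 1) * \<phi> (of_real (0 + U * t)))))"
    unfolding set_lebesgue_integral_def by (rule lborel_integral_real_affine) (use U in simp)
  also have "\<dots> = of_real U * (LINT t:{0<..<1}|lborel. of_real U powr (\<sigma> - 1) * of_real U powr (s - 1)
    * (\<phi> (of_real t * of_real U) * beta_ker \<sigma> s t))"
  proof -
    have "indicator {0<..<U} (0 + U * t) *\<^sub>R
       (of_real (U - (0 + U * t)) powr (s - 1) * (of_real (0 + U * t) powr (\<sigma> - 1) * \<phi> (of_real (0 + U * t))))
      = indicator {0<..<1} t *\<^sub>R (of_real U powr (\<sigma> - 1) * of_real U powr (s - 1) *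
        (\<phi> (of_real t * of_real U) * beta_ker \<sigma> s t))" for t
    proof (cases "t \<in> {0<..<1}")
      case True
      then have "U * t \<in> {0<..<U}" using U by auto
      moreover have "complex_of_real (U * t) powr (\<sigma> - 1) = of_real U powr (\<sigma> - 1) * of_real t powr (\<sigma> - 1)"
        using U True unfolding of_real_mult by (intro powr_times_real) auto
      moreover have "complex_of_real (U - U * t) powr (s - 1) = of_real U powr (s - 1)
        * of_real (1 - t) powr (s - 1)"
      proof -
        have "U - U * t = U * (1 - t)" by (simp add: algebra_simps)
        then show ?thesis using U True by (simp only: of_real_mult) (intro powr_times_real; simp)
      qed
      ultimately show ?thesis using True by (simp add: beta_ker_def mult_ac del: of_real_diff)
    next
      case False
      then have "U * t \<notin> {0<..<U}" using U by (auto simp: zero_less_mult_iff)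
      then show ?thesis using False by simp
    qed
    then show ?thesis unfolding set_lebesgue_integral_def
      by (simp only: abs_of_pos[OF U]) (simp only: scaleR_conv_of_real)
  qed
  also have "\<dots> = of_real U * (of_real U powr (\<sigma> - 1) * of_real U powr (s - 1))
    * (LINT t:{0<..<1}|lborel. \<phi> (of_real t * of_real U) * beta_ker \<sigma> s t)"
    by simp
  also have "of_real U * (of_real U powr (\<sigma> - 1) * of_real U powr (s - 1))
    = of_real U * of_real U powr (\<sigma> + s - 1 - 1)"
    by (simp add: powr_add[symmetric] algebra_simps)
  finally have *: "c * (LINT v:{0<..<U}|lborel. of_real (U - v) powr (s - 1) * q v)
     = of_real U * of_real U powr (\<sigma> + s - 1 - 1) * (LINT t:{0<..<1}|lborel. \<phi> (of_real t * of_real U) *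
       beta_ker \<sigma> s t)" .
  have "rGamma \<sigma> * rGamma s * (c * chain_step s a z q U) =
     rGamma \<sigma> * rGamma s * lfrac a z U * (c * (LINT v:{0<..<U}|lborel. of_real (U - v) powr (s - 1) * q v))"
    by (simp add: chain_step_def)
  also have "\<dots> = of_real U powr (\<sigma> + s - 1 - 1) * (lker a z (of_real U) * ek 0 \<phi> \<sigma> s (of_real U))"
    unfolding * lfrac_lker[OF U] using U by (simp add: field_simps)
  finally show ?thesis .
qed

lemma chain_fun_nest:
  assumes r: "r \<ge> 1" and k: "k < r" and U: "U > 0"
  shows "(\<Prod>j\<in>{r-k..<r}. rGamma (sig r s (Suc j)) * rGamma (s j)) * chain_fun r s a z k U =
         of_real U powr (sig r s (r - k) - 1) * nest 0 r a z (sig r s) s k (of_real U)"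
  using k U
proof (induction k arbitrary: U)
  case 0
  then show ?case using r by (simp add: lfrac_lker sig_last powr_diff power2_eq_square mult_ac)
next
  case (Suc k)
  define m where "m = r - Suc k"
  have m: "r - k = Suc m" "1 \<le> m" "m < r" using Suc.prems by (auto simp: m_def)
  define c where "c = (\<Prod>j\<in>{Suc m..<r}. rGamma (sig r s (Suc j)) * rGamma (s j))"
  have q: "c * chain_fun r s a z k v = of_real v powr (sig r s (Suc m) - 1) * nest 0 r a z (sig r s) s k
    (of_real v)" if "v > 0" for v
    using Suc.IH[OF _ that] Suc.prems unfolding c_def m(1) by simp
  have "{m..<r} = insert m {Suc m..<r}" using m by auto
  then have "(\<Prod>j\<in>{m..<r}. rGamma (sig r s (Suc j)) * rGamma (s j)) * chain_fun r s a z (Suc k) U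
     = rGamma (sig r s (Suc m)) * rGamma (s m) * (c * chain_step (s m) (a m) (z m) (chain_fun r s a z k) U)"
    by (simp add: c_def m_def)
  also have "\<dots> = of_real U powr (sig r s (Suc m) + s m - 1 - 1) * (lker (a m) (z m) (of_real U) *
       ek 0 (nest 0 r a z (sig r s) s k) (sig r s (Suc m)) (s m) (of_real U))"
    by (rule chain_step_scaling[OF Suc.prems(2) q])
  also have "\<dots> = of_real U powr (sig r s m - 1) * nest 0 r a z (sig r s) s (Suc k) (of_real U)"
    using m by (simp add: sig_rec m_def del: ek.simps)
  finally show ?case by (simp add: m_def)
qed

section \<open>Absolute convergence and the Mellin form of the integral\<close>

lemma lfrac_bound:
  assumes h: "exp_bounded (- Re a) \<rho> (lker a z)" "0 < \<rho>" and d: "0 < d"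
  shows "\<exists>B\<ge>0. \<forall>U>0. norm (lfrac a z U) \<le> B * exp ((d - Re a) * U) / U"
proof -
  obtain e B where eB: "e > 0" "B \<ge> 0"
    "\<forall>x\<in>(UNIV::complex set) \<inter> ball 0 e. \<forall>u\<in>strip (\<rho>/2). norm (lker a z u) \<le> B * exp ((d - Re a) * Re u)"
    using hol_familyD(4)[OF h(1) UNIV_I, of "d - Re a" "\<rho>/2" 0] h d by auto
  have "norm (lfrac a z U) \<le> B * exp ((d - Re a) * U) / U" if "U > 0" for U
  proof -
    have "norm (lker a z (of_real U)) \<le> B * exp ((d - Re a) * Re (of_real U))"
      by (rule eB(3)[rule_format, of 0]) (use eB(1) that h in auto)
    then show ?thesis using that by (simp add: lfrac_lker norm_divide divide_right_mono)
  qed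
  with eB(2) show ?thesis by blast
qed

text \<open>Regrouping by single variables makes partial sums of the coefficients appear; here the
  hypothesis on the partial sums of the \<open>a j\<close> enters the convergence.\<close>

lemma sum_swap_tails:
  fixes u b :: "nat \<Rightarrow> real"
  shows "(\<Sum>j=1..r. b j * (\<Sum>k=j..r. u k)) = (\<Sum>k=1..r. (\<Sum>j=1..k. b j) * u k)"
proof -
  have "(\<Sum>j=1..r. b j * (\<Sum>k=j..r. u k)) = (\<Sum>j=1..r. \<Sum>k\<in>{1..r}. if j \<le> k then b j * u k else 0)"
    unfolding sum_distrib_left by (intro sum.cong refl sum.mono_neutral_cong_left) auto
  also have "\<dots> = (\<Sum>k=1..r. \<Sum>j\<in>{1..r}. if j \<le> k then b j * u k else 0)" by (rule sum.swap)
  also have "\<dots> = (\<Sum>k=1..r. (\<Sum>j=1..k. b j) * u k)"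
    unfolding sum_distrib_right by (intro sum.cong refl sum.mono_neutral_cong_right) auto
  finally show ?thesis .
qed

lemma chain_integrand_alt:
  assumes r: "r \<ge> 1"
  shows "chain_integrand s a z r (chain_fun r s a z 0) x = (if \<forall>k\<in>{1..r}. 0 < x k then
     (\<Prod>j=1..r. lfrac (a j) (z j) (\<Sum>k=j..r. x k) * of_real (x j) powr (s j - 1)) else 0)"
proof -
  have "{1..r} = insert r {1..<r}" using r by auto
  then show ?thesis unfolding chain_integrand_def by simp
qed

text \<open>After regrouping, the exponentials decay in each variable separately, and a tail sum is
  at least its first term, so its reciprocal is bounded by that of a single variable. The majorant
  is a product of Gamma integrands, integrable at 0 because \<open>Re (s j) > 1\<close>.\<close>

lemma integrable_chain_integrand:
  assumes r: "r \<ge> 1" and s: "\<And>j. j \<in> {1..r} \<Longrightarrow> Re (s j) > 1"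
    and a: "\<And>j. j \<in> {1..r} \<Longrightarrow> Re (\<Sum>k=1..j. a k) > 0"
    and h: "\<And>j. j \<in> {1..r} \<Longrightarrow> exp_bounded (- Re (a j)) \<rho> (lker (a j) (z j))" and \<rho>: "0 < \<rho>"
  shows "integrable (PiL {1..r}) (chain_integrand s a z r (chain_fun r s a z 0))"
proof -
  define A where "A k = Re (\<Sum>j=1..k. a j)" for k
  define c where "c = Min (A ` {1..r}) / 2"
  have fin: "finite (A ` {1..r})" "A ` {1..r} \<noteq> {}" using r by auto
  have c: "c > 0" using a fin by (simp add: c_def A_def)
  have Ac: "A k \<ge> 2 * c" if "k \<in> {1..r}" for k using fin that by (simp add: c_def)
  \<comment> \<open>The loss \<open>d\<close> of each kernel, summed over at most \<open>r\<close>
    kernels, is at most \<open>c\<close>, while the partial sums are at least \<open>2 * c\<close>;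
    a decay of rate \<open>c\<close> remains.\<close>
  define d where "d = c / of_nat r"
  have d: "d > 0" using c r by (simp add: d_def)
  have "\<forall>j\<in>{1..r}. \<exists>B\<ge>0. \<forall>U>0. norm (lfrac (a j) (z j) U) \<le> B * exp ((d - Re (a j)) * U) / U"
    using lfrac_bound[OF h \<rho> d] by blast
  then obtain B where B: "\<And>j. j \<in> {1..r} \<Longrightarrow> B j \<ge> 0"
    "\<And>j U. j \<in> {1..r} \<Longrightarrow> U > 0 \<Longrightarrow> norm (lfrac (a j) (z j) U) \<le> B j * exp ((d - Re (a j)) * U) / U"
    by metis
  \<comment> \<open>The exponent is \<open>Re (s k) - 1\<close> minus one: the second decrement is
    the reciprocal taken over from the tail sum.\<close>
  define g where "g k u = B k * (indicator {0<..} u *\<^sub>R (u powr ((Re (s k) - 1) - 1) * exp (- c * u)))" for k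
    and u :: real
  have gi: "integrable lborel (g k)" if "k \<in> {1..r}" for k
    unfolding g_def using set_integrable_powr_exp[of "Re (s k) - 1" c] s[OF that] c
    by (intro integrable_mult_right) (simp add: set_integrable_def)
  have int: "integrable (PiL {1..r}) (\<lambda>x. \<Prod>k\<in>{1..r}. g k (x k))"
    by (rule lborel_prod.product_integrable_prod) (use gi in auto)
  have bnd: "norm (chain_integrand s a z r (chain_fun r s a z 0) x) \<le> (\<Prod>k\<in>{1..r}. g k (x k))" for x
  proof (cases "\<forall>k\<in>{1..r}. 0 < x k")
    case True
    have U: "(\<Sum>k=j..r. x k) \<ge> x j" "(\<Sum>k=j..r. x k) > 0" if "j \<in> {1..r}" for j
    proof -
      show "(\<Sum>k=j..r. x k) \<ge> x j"
        by (rule member_le_sum) (use that True in \<open>auto simp: less_imp_le\<close>)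
      with True that show "(\<Sum>k=j..r. x k) > 0" by force
    qed
    have "norm (chain_integrand s a z r (chain_fun r s a z 0) x)
       = (\<Prod>j=1..r. norm (lfrac (a j) (z j) (\<Sum>k=j..r. x k)) * x j powr (Re (s j) - 1))"
      unfolding chain_integrand_alt[OF r] if_P[OF True] prod_norm[symmetric]
      using True by (intro prod.cong) (auto simp: norm_mult norm_powr_of_real)
    also have "\<dots> \<le> (\<Prod>j=1..r. B j * exp ((d - Re (a j)) * (\<Sum>k=j..r. x k)) * x j powr (Re (s j) - 1 - 1))"
    proof (rule prod_mono, intro conjI)
      fix j assume j: "j \<in> {1..r}"
      have xj: "x j > 0" using True j by auto
      have "norm (lfrac (a j) (z j) (\<Sum>k=j..r. x k)) \<le> B j * exp ((d - Re (a j)) * (\<Sum>k=j..r. x k))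
        / (\<Sum>k=j..r. x k)"
        by (rule B(2)[OF j U(2)[OF j]])
      also have "\<dots> \<le> B j * exp ((d - Re (a j)) * (\<Sum>k=j..r. x k)) / x j"
        using U[OF j] B(1)[OF j] xj by (intro divide_left_mono mult_pos_pos) auto
      finally have "norm (lfrac (a j) (z j) (\<Sum>k=j..r. x k)) * x j powr (Re (s j) - 1) \<le>
          B j * exp ((d - Re (a j)) * (\<Sum>k=j..r. x k)) / x j * x j powr (Re (s j) - 1)"
        by (intro mult_right_mono) auto
      also have "\<dots> = B j * exp ((d - Re (a j)) * (\<Sum>k=j..r. x k)) * x j powr (Re (s j) - 1 - 1)"
        using xj by (simp add: powr_diff power2_eq_square)
      finally show "norm (lfrac (a j) (z j) (\<Sum>k=j..r. x k)) * x j powr (Re (s j) - 1) \<le>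
          B j * exp ((d - Re (a j)) * (\<Sum>k=j..r. x k)) * x j powr (Re (s j) - 1 - 1)" .
    qed simp
    also have "\<dots> = (\<Prod>j=1..r. B j * x j powr (Re (s j) - 1 - 1))
      * exp (\<Sum>j=1..r. (d - Re (a j)) * (\<Sum>k=j..r. x k))"
      by (simp add: exp_sum prod.distrib mult_ac)
    also have "(\<Sum>j=1..r. (d - Re (a j)) * (\<Sum>k=j..r. x k)) = (\<Sum>k=1..r. (\<Sum>j=1..k. d - Re (a j)) * x k)"
      by (rule sum_swap_tails)
    also have "(\<Prod>j=1..r. B j * x j powr (Re (s j) - 1 - 1)) * exp (\<Sum>k=1..r. (\<Sum>j=1..k. d - Re (a j)) * x k)
       \<le> (\<Prod>j=1..r. B j * x j powr (Re (s j) - 1 - 1)) * exp (\<Sum>k=1..r. - c * x k)"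
    proof (intro mult_left_mono prod_nonneg)
      have "(\<Sum>j=1..k. d - Re (a j)) * x k \<le> - c * x k" if k: "k \<in> {1..r}" for k
      proof (rule mult_right_mono)
        have "(\<Sum>j=1..k. d - Re (a j)) = real k * d - A k" by (simp add: sum_subtractf A_def Re_sum)
        also have "real k * d \<le> real r * d" using k d by (intro mult_right_mono) auto
        also have "real r * d = c" using r by (simp add: d_def)
        finally show "(\<Sum>j=1..k. d - Re (a j)) \<le> - c" using Ac[OF k] by linarith
        show "0 \<le> x k" using True k by (auto simp: less_imp_le)
      qed
      then show "exp (\<Sum>k=1..r. (\<Sum>j=1..k. d - Re (a j)) * x k) \<le> exp (\<Sum>k=1..r. - c * x k)"
        by (simp only: exp_le_cancel_iff) (rule sum_mono)
    qed (use B(1) in auto)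
    also have "\<dots> = (\<Prod>k\<in>{1..r}. g k (x k))"
    proof -
      have "(\<Prod>k\<in>{1..r}. g k (x k)) = (\<Prod>k\<in>{1..r}. B k * x k powr (Re (s k) - 1 - 1) * exp (- c * x k))"
        using True by (intro prod.cong) (auto simp: g_def)
      then show ?thesis by (simp add: exp_sum prod.distrib)
    qed
    finally show ?thesis .
  next
    case False
    have "0 \<le> (\<Prod>k\<in>{1..r}. g k (x k))" using B(1) by (intro prod_nonneg) (auto simp: g_def)
    then show ?thesis unfolding chain_integrand_alt[OF r] if_not_P[OF False] by simp
  qed
  have comp: "(\<lambda>x. x k) \<in> borel_measurable (PiL {1..r})" if "k \<in> {1..r}" for k
    using measurable_component_singleton[OF that, of "\<lambda>_. lborel"] by simp
  have "(\<lambda>x. if \<forall>k\<in>{1..r}. 0 < x k then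
     (\<Prod>j=1..r. lfrac (a j) (z j) (\<Sum>k=j..r. x k) * exp ((s j - 1) * of_real (ln (x j)))) else 0) \<in>
       borel_measurable (PiL {1..r})"
  proof (rule measurable_If)
    show "(\<lambda>x. \<Prod>j=1..r. lfrac (a j) (z j) (\<Sum>k=j..r. x k) * exp ((s j - 1) * of_real (ln (x j))))
      \<in> borel_measurable (PiL {1..r})"
    proof (rule borel_measurable_prod)
      fix j assume j: "j \<in> {1..r}"
      have [measurable]: "(\<lambda>x. \<Sum>k=j..r. x k) \<in> borel_measurable (PiL {1..r})"
        using j by (intro borel_measurable_sum comp) auto
      have [measurable]: "(\<lambda>x. x j) \<in> borel_measurable (PiL {1..r})" by (rule comp[OF j])
      show "(\<lambda>x. lfrac (a j) (z j) (\<Sum>k=j..r. x k) * exp ((s j - 1) * of_real (ln (x j))))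
        \<in> borel_measurable (PiL {1..r})"
        unfolding lfrac_def by measurable
    qed
    show "{x \<in> space (PiL {1..r}). \<forall>k\<in>{1..r}. 0 < x k} \<in> sets (PiL {1..r})"
    proof (rule sets.sets_Collect_finite_All')
      fix k assume k: "k \<in> {1..r}"
      show "{x \<in> space (PiL {1..r}). 0 < x k} \<in> sets (PiL {1..r})"
        using comp[OF k] by (intro borel_measurable_less) auto
    qed (use r in auto)
  qed simp
  moreover have "chain_integrand s a z r (chain_fun r s a z 0) = (\<lambda>x. if \<forall>k\<in>{1..r}. 0 < x k then
     (\<Prod>j=1..r. lfrac (a j) (z j) (\<Sum>k=j..r. x k) * exp ((s j - 1) * of_real (ln (x j)))) else 0)"
    unfolding chain_integrand_alt[OF r, abs_def] by (auto simp: fun_eq_iff powr_of_real_pos intro!: prod.cong)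
  ultimately have "chain_integrand s a z r (chain_fun r s a z 0) \<in> borel_measurable (PiL {1..r})" by simp
  then show ?thesis
    by (rule Bochner_Integration.integrable_bound[OF int])
       (use bnd in \<open>auto intro!: AE_I2 intro: order_trans[OF _ abs_ge_self]\<close>)
qed

lemma hl_integral_chain:
  assumes r: "r \<ge> 1"
  shows "hl_integral r s a z = integral\<^sup>L (PiL {1..r}) (chain_integrand s a z r (chain_fun r s a z 0))
    * (\<Prod>j=1..r. rGamma (s j))"
proof -
  have "(LINT u : ({1..r} \<rightarrow>\<^sub>E {0<..}) | PiL {1..r}.
        (\<Prod>j=1..r. exp (- a j * of_real (\<Sum>k=j..r. u k)) /
                    (1 - z j * exp (- of_real (\<Sum>k=j..r. u k))) *
                    of_real (u j) powr (s j - 1))) = integral\<^sup>L (PiL {1..r})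
                      (chain_integrand s a z r (chain_fun r s a z 0))"
    unfolding set_lebesgue_integral_def
  proof (rule Bochner_Integration.integral_cong[OF refl])
    fix u assume "u \<in> space (PiL {1..r})"
    then have "u \<in> ({1..r} \<rightarrow>\<^sub>E {0<..}) \<longleftrightarrow> (\<forall>k\<in>{1..r}. 0 < u k)" by (auto simp: space_PiM PiE_iff)
    then show "indicator ({1..r} \<rightarrow>\<^sub>E {0<..}) u *\<^sub>R
        (\<Prod>j=1..r. exp (- a j * of_real (\<Sum>k=j..r. u k)) /
                    (1 - z j * exp (- of_real (\<Sum>k=j..r. u k))) *
                    of_real (u j) powr (s j - 1)) = chain_integrand s a z r (chain_fun r s a z 0) u"
      unfolding chain_integrand_alt[OF r] lfrac_def by (simp add: indicator_def)
  qed
  then show ?thesis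
    unfolding hl_integral_def
      by (simp add: rGamma_inverse_Gamma prod_inversef[symmetric] divide_inverse o_def)
qed

text \<open>The averages consume \<Gamma>(\<sigma>_(j+1)) and \<Gamma>(s_j) for j < r, the Mellin
  transform \<Gamma>(\<sigma>_1). Of the Gamma factors in \<open>hl_integral\<close> only the one
  for \<open>s r\<close> is left over, whence the factor on the right.\<close>

lemma hl_integral_eq_mellin:
  assumes r: "r \<ge> 1" and s: "\<And>j. j \<in> {1..r} \<Longrightarrow> Re (s j) > 1"
    and a: "\<And>j. j \<in> {1..r} \<Longrightarrow> Re (\<Sum>k=1..j. a k) > 0"
    and h: "\<And>j. j \<in> {1..r} \<Longrightarrow> exp_bounded (- Re (a j)) \<rho> (lker (a j) (z j))" and \<rho>: "0 < \<rho>"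
  shows "(\<Prod>j=1..r. rGamma (sig r s j)) * hl_integral r s a z
       = rGamma (s r) * mellin 0 (nest 0 r a z (sig r s) s (r - 1)) (sig r s 1)"
proof -
  have k: "r - 1 < r" "r - (r - 1) = 1" using r by auto
  have "integrable (PiL {1..r}) (chain_integrand s a z r (chain_fun r s a z 0))"
    by (rule integrable_chain_integrand[where \<rho>=\<rho>]) fact+
  note ci = chain_integral[OF this k(1)]
  have I1: "integrable (PiL {1..1}) (chain_integrand s a z 1 (chain_fun r s a z (r - 1)))"
    using ci k by simp
  have I: "integral\<^sup>L (PiL {1..r}) (chain_integrand s a z r (chain_fun r s a z 0))
    = (LINT U:{0<..}|lborel. chain_fun r s a z (r - 1) U)"
    using ci chain_integral_1[OF I1] k(2) by simp
  define c where "c = (\<Prod>j\<in>{1..<r}. rGamma (sig r s (Suc j)) * rGamma (s j))"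
  have "c * (LINT U:{0<..}|lborel. chain_fun r s a z (r - 1) U)
    = (LINT U:{0<..}|lborel. c * chain_fun r s a z (r - 1) U)"
    by simp
  also have "\<dots> = (LINT U:{0<..}|lborel. nest 0 r a z (sig r s) s (r - 1) (of_real U)
    * of_real U powr (sig r s 1 - 1))"
    by (rule set_lebesgue_integral_cong) (use chain_fun_nest[OF r k(1)] k(2) in \<open>auto simp: c_def mult_ac\<close>)
  finally have *: "rGamma (sig r s 1) * (c * (LINT U:{0<..}|lborel. chain_fun r s a z (r - 1) U))
    = mellin 0 (nest 0 r a z (sig r s) s (r - 1)) (sig r s 1)"
    by simp
  have p1: "(\<Prod>j=1..r. rGamma (sig r s j)) = rGamma (sig r s 1) * (\<Prod>j\<in>{1..<r}. rGamma (sig r s (Suc j)))"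
  proof -
    have "(\<Prod>j\<in>{1..<r}. rGamma (sig r s (Suc j))) = (\<Prod>j\<in>{Suc 1..r}. rGamma (sig r s j))"
      using r by (subst prod.atLeast_Suc_lessThan_Suc_shift[symmetric, unfolded o_def])
        (simp add: atLeastLessThanSuc_atLeastAtMost)
    moreover have "{1..r} = insert 1 {Suc 1..r}" using r by auto
    ultimately show ?thesis by simp
  qed
  have p2: "(\<Prod>j=1..r. rGamma (s j)) = rGamma (s r) * (\<Prod>j\<in>{1..<r}. rGamma (s j))"
  proof -
    have "{1..r} = insert r {1..<r}" using r by auto
    then show ?thesis by simp
  qed
  show ?thesis
    unfolding hl_integral_chain[OF r] I p1 p2 *[symmetric] by (simp add: c_def prod.distrib mult_ac)
qed

section \<open>Uniqueness of meromorphic continuation\<close>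

lemma mv_holomorphic_nonzero_open:
  assumes "mv_holomorphic_on I g U"
  shows "openin (cspace I) {y \<in> U. g y \<noteq> 0}"
proof -
  have U: "openin (cspace I) U" and c: "continuous_map (subtopology (cspace I) U) euclidean g"
    using assms by (auto simp: mv_holomorphic_on_def)
  have "openin (subtopology (cspace I) U) {y \<in> topspace (subtopology (cspace I) U). g y \<in> - {0}}"
    by (rule openin_continuous_map_preimage[OF c]) auto
  moreover have "{y \<in> topspace (subtopology (cspace I) U). g y \<in> - {0}} = {y \<in> U. g y \<noteq> 0}"
    using openin_subset[OF U] by auto
  ultimately show ?thesis using openin_open_subtopology[OF U] by metis
qed

lemma openin_cspace_PiE:
  assumes "finite I" "\<And>i. i \<in> I \<Longrightarrow> open (B i)"
  shows "openin (cspace I) (PiE I B)"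
  using assms by (simp add: openin_PiE_gen)

lemma cspace_box_basis:
  assumes "openin (cspace I) U" "y \<in> U"
  obtains e where "\<And>i. i \<in> I \<Longrightarrow> e i > 0" "y \<in> PiE I (\<lambda>i. ball (y i) (e i))" "PiE I (\<lambda>i. ball (y i) (e i)) \<subseteq> U"
proof -
  obtain V where V: "\<And>i. i \<in> I \<Longrightarrow> open (V i)" "y \<in> PiE I V" "PiE I V \<subseteq> U"
    using assms unfolding openin_product_topology_alt by (metis open_openin)
  have "\<forall>i\<in>I. \<exists>e>0. ball (y i) e \<subseteq> V i"
    using V(1,2) open_contains_ball by (metis PiE_mem)
  then obtain e where e: "\<And>i. i \<in> I \<Longrightarrow> e i > 0 \<and> ball (y i) (e i) \<subseteq> V i" by metis
  show ?thesis
  proof (rule that[of e])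
    have "PiE I (\<lambda>i. ball (y i) (e i)) \<subseteq> PiE I V" using e by (intro PiE_mono) auto
    then show "PiE I (\<lambda>i. ball (y i) (e i)) \<subseteq> U" using V by blast
    show "y \<in> PiE I (\<lambda>i. ball (y i) (e i))" using e V(2) by (auto simp: PiE_iff)
  qed (use e in auto)
qed

text \<open>Pointwise equality is too much to ask, since values of a meromorphic function are
  unconstrained where the local denominators vanish. Equality near the points of a dense set is the
  notion that propagates.\<close>

definition agree_densely :: "'i set \<Rightarrow> (('i \<Rightarrow> complex) \<Rightarrow> complex) \<Rightarrow> (('i \<Rightarrow> complex) \<Rightarrow> complex) \<Rightarrow> ('i \<Rightarrow> complex)
  set \<Rightarrow> bool" where
  "agree_densely I F1 F2 V \<longleftrightarrow> (\<forall>V'. openin (cspace I) V' \<and> V' \<subseteq> V \<and> V' \<noteq> {} \<longrightarrow>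
     (\<exists>V''. openin (cspace I) V'' \<and> V'' \<subseteq> V' \<and> V'' \<noteq> {} \<and> (\<forall>y\<in>V''. F1 y = F2 y)))"

text \<open>On a small box both functions are quotients. If they agree on an open part, the
  holomorphic function \<open>f1 * g2 - f2 * g1\<close> vanishes there, hence on the whole box, and
  the quotients agree wherever neither denominator vanishes.\<close>

lemma meromorphic_agree_densely_local:
  assumes I: "finite I" and F: "mv_meromorphic_on I F1 D" "mv_meromorphic_on I F2 D" and y: "y \<in> D"
  shows "\<exists>V. openin (cspace I) V \<and> y \<in> V \<and> V \<subseteq> D \<and>
     (\<forall>V0. openin (cspace I) V0 \<and> V0 \<subseteq> V \<and> V0 \<noteq> {} \<and> (\<forall>y\<in>V0. F1 y = F2 y) \<longrightarrow> agree_densely I F1 F2 V)"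
proof -
  obtain U1 f1 g1 where 1: "y \<in> U1" "U1 \<subseteq> D" "mv_holomorphic_on I f1 U1" "mv_holomorphic_on I g1 U1"
    "\<And>V. openin (cspace I) V \<and> V \<subseteq> U1 \<and> V \<noteq> {} \<Longrightarrow> \<exists>y\<in>V. g1 y \<noteq> 0" "\<And>y. y \<in> U1 \<Longrightarrow> g1 y \<noteq> 0 \<Longrightarrow> F1 y = f1 y / g1 y"
    using F(1) y unfolding mv_meromorphic_on_def by metis
  obtain U2 f2 g2 where 2: "y \<in> U2" "U2 \<subseteq> D" "mv_holomorphic_on I f2 U2" "mv_holomorphic_on I g2 U2"
    "\<And>V. openin (cspace I) V \<and> V \<subseteq> U2 \<and> V \<noteq> {} \<Longrightarrow> \<exists>y\<in>V. g2 y \<noteq> 0" "\<And>y. y \<in> U2 \<Longrightarrow> g2 y \<noteq> 0 \<Longrightarrow> F2 y = f2 y / g2 y"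
    using F(2) y unfolding mv_meromorphic_on_def by metis
  have "openin (cspace I) (U1 \<inter> U2)" using 1(3) 2(3) by (auto simp: mv_holomorphic_on_def)
  then obtain e where e: "\<And>i. i \<in> I \<Longrightarrow> e i > 0" "y \<in> PiE I (\<lambda>i. ball (y i) (e i))"
      "PiE I (\<lambda>i. ball (y i) (e i)) \<subseteq> U1 \<inter> U2"
    using cspace_box_basis[of I "U1 \<inter> U2" y] 1(1) 2(1) by blast
  define V where "V = PiE I (\<lambda>i. ball (y i) (e i))"
  have V: "openin (cspace I) V" "V \<subseteq> U1" "V \<subseteq> U2"
    using e(3) openin_cspace_PiE[OF I, of "\<lambda>i. ball (y i) (e i)"] by (auto simp: V_def)
  note sub1 = mv_holomorphic_on_subset[OF _ V(1,2)]
  note sub2 = mv_holomorphic_on_subset[OF _ V(1,3)]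
  have nz: "openin (cspace I) {x \<in> V'. g1 x \<noteq> 0 \<and> g2 x \<noteq> 0} \<and> {x \<in> V'. g1 x \<noteq> 0 \<and> g2 x \<noteq> 0} \<noteq> {}"
    if V': "openin (cspace I) V'" "V' \<subseteq> V" "V' \<noteq> {}" for V'
  proof -
    have o1: "openin (cspace I) {x \<in> V'. g1 x \<noteq> 0}"
      using mv_holomorphic_nonzero_open[OF mv_holomorphic_on_subset[OF 1(4) V'(1)]] V' V by auto
    moreover have "{x \<in> V'. g1 x \<noteq> 0} \<noteq> {}" using 1(5)[of V'] V' V by auto
    ultimately have ne: "{x \<in> {x \<in> V'. g1 x \<noteq> 0}. g2 x \<noteq> 0} \<noteq> {}" using 2(5)[of "{x \<in> V'. g1 x \<noteq> 0}"] V' V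
      by blast
    have o2: "openin (cspace I) {x \<in> V'. g2 x \<noteq> 0}"
      using mv_holomorphic_nonzero_open[OF mv_holomorphic_on_subset[OF 2(4) V'(1)]] V' V by auto
    have "{x \<in> V'. g1 x \<noteq> 0 \<and> g2 x \<noteq> 0} = {x \<in> V'. g1 x \<noteq> 0} \<inter> {x \<in> V'. g2 x \<noteq> 0}" by auto
    then show ?thesis using o1 o2 ne by auto
  qed
  have h: "mv_holomorphic_on I (\<lambda>x. f1 x * g2 x - f2 x * g1 x) V"
    by (intro mv_holomorphic_on_diff mv_holomorphic_on_mult sub1 sub2 1 2)
  have "agree_densely I F1 F2 V"
    if V0: "openin (cspace I) V0" "V0 \<subseteq> V" "V0 \<noteq> {}" "\<forall>y\<in>V0. F1 y = F2 y" for V0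
  proof -
    have zero: "f1 x * g2 x - f2 x * g1 x = 0" if x: "x \<in> V" for x
    proof (rule box_identity[OF I _ _ h[unfolded V_def]])
      show "openin (cspace I) {x \<in> V0. g1 x \<noteq> 0 \<and> g2 x \<noteq> 0}" "{x \<in> V0. g1 x \<noteq> 0 \<and> g2 x \<noteq> 0} \<noteq> {}"
        using nz[OF V0(1,2,3)] by auto
      show "f1 w * g2 w - f2 w * g1 w = 0" if "w \<in> {x \<in> V0. g1 x \<noteq> 0 \<and> g2 x \<noteq> 0}" for w
      proof -
        have w: "w \<in> V0" "w \<in> U1" "w \<in> U2" "g1 w \<noteq> 0" "g2 w \<noteq> 0" using V0(2) V that by auto
        have "f1 w / g1 w = f2 w / g2 w"
          using V0(4)[rule_format, OF w(1)] 1(6)[OF w(2,4)] 2(6)[OF w(3,5)] by simp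
        then show ?thesis using that by (simp add: field_simps)
      qed
      show "{x \<in> V0. g1 x \<noteq> 0 \<and> g2 x \<noteq> 0} \<subseteq> (\<Pi>\<^sub>E i\<in>I. ball (y i) (e i))" using V0(2) by (auto simp: V_def)
      show "x \<in> (\<Pi>\<^sub>E i\<in>I. ball (y i) (e i))" using x by (simp add: V_def)
    qed auto
    show ?thesis unfolding agree_densely_def
    proof (intro allI impI, elim conjE)
      fix V' assume V': "openin (cspace I) V'" "V' \<subseteq> V" "V' \<noteq> {}"
      have "F1 w = F2 w" if w: "w \<in> {x \<in> V'. g1 x \<noteq> 0 \<and> g2 x \<noteq> 0}" for w
      proof -
        have "F1 w = f1 w / g1 w" "F2 w = f2 w / g2 w" using 1(6)[of w] 2(6)[of w] V V' w by auto
        moreover have "f1 w * g2 w = f2 w * g1 w" using zero[of w] V' w by auto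
        ultimately show ?thesis using w by (simp add: frac_eq_eq)
      qed
      then show "\<exists>V''. openin (cspace I) V'' \<and> V'' \<subseteq> V' \<and> V'' \<noteq> {} \<and> (\<forall>y\<in>V''. F1 y = F2 y)"
        using nz[OF V'] by (intro exI[of _ "{x \<in> V'. g1 x \<noteq> 0 \<and> g2 x \<noteq> 0}"]) auto
    qed
  qed
  then show ?thesis using V 1(2) e(2) by (intro exI[of _ V]) (auto simp: V_def)
qed

text \<open>The local dichotomy, dense agreement or agreement on no nonempty open set, splits the
  connected domain into two disjoint open pieces, and \<open>W\<close> lies in the first.\<close>

lemma meromorphic_unique:
  assumes I: "finite I" and F: "mv_meromorphic_on I F1 D" "mv_meromorphic_on I F2 D"
    and D: "connectedin (cspace I) D"
    and W: "openin (cspace I) W" "W \<subseteq> D" "W \<noteq> {}" "\<And>y. y \<in> W \<Longrightarrow> F1 y = F2 y"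
    and x: "x \<in> D" "x \<in> U1" "x \<in> U2" "mv_holomorphic_on I F1 U1" "mv_holomorphic_on I F2 U2"
  shows "F1 x = F2 x"
proof -
  define A1 where "A1 = \<Union>{V. openin (cspace I) V \<and> V \<subseteq> D \<and> agree_densely I F1 F2 V}"
  define A2 where "A2 = \<Union>{V. openin (cspace I) V \<and> V \<subseteq> D \<and>
     \<not> (\<exists>V0. openin (cspace I) V0 \<and> V0 \<subseteq> V \<and> V0 \<noteq> {} \<and> (\<forall>y\<in>V0. F1 y = F2 y))}"
  have o: "openin (cspace I) A1" "openin (cspace I) A2"
    unfolding A1_def A2_def by (rule openin_Union; blast)+
  have cov: "D \<subseteq> A1 \<union> A2"
  proof
    fix y assume "y \<in> D"
    from meromorphic_agree_densely_local[OF I F this] obtain V where V: "openin (cspace I) V" "y \<in> V" "V \<subseteq> D"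
     "\<forall>V0. openin (cspace I) V0 \<and> V0 \<subseteq> V \<and> V0 \<noteq> {} \<and> (\<forall>y\<in>V0. F1 y = F2 y) \<longrightarrow> agree_densely I F1 F2 V"
      by (elim exE conjE)
    show "y \<in> A1 \<union> A2"
    proof (cases "\<exists>V0. openin (cspace I) V0 \<and> V0 \<subseteq> V \<and> V0 \<noteq> {} \<and> (\<forall>y\<in>V0. F1 y = F2 y)")
      case True
      then have "agree_densely I F1 F2 V" using V(4) by blast
      then show ?thesis using V unfolding A1_def by blast
    next
      case False
      then show ?thesis using V unfolding A2_def by blast
    qed
  qed
  have disj: "A1 \<inter> A2 = {}"
  proof (rule ccontr)
    assume "A1 \<inter> A2 \<noteq> {}"
    then obtain y V V2 where V: "y \<in> V" "openin (cspace I) V" "agree_densely I F1 F2 V"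
      and V2: "y \<in> V2" "openin (cspace I) V2" "\<not> (\<exists>V0. openin (cspace I) V0 \<and> V0 \<subseteq> V2 \<and> V0 \<noteq> {} \<and>
        (\<forall>y\<in>V0. F1 y = F2 y))"
      unfolding A1_def A2_def by blast
    have "openin (cspace I) (V \<inter> V2)" "V \<inter> V2 \<noteq> {}" using V V2 by auto
    then obtain V'' where "openin (cspace I) V''" "V'' \<subseteq> V \<inter> V2" "V'' \<noteq> {}" "\<forall>y\<in>V''. F1 y = F2 y"
      using V(3) unfolding agree_densely_def by (metis inf_le1)
    then show False using V2(3) by blast
  qed
  have "W \<subseteq> A1"
  proof -
    have "agree_densely I F1 F2 W" unfolding agree_densely_def using W(4) by blast
    then show ?thesis using W unfolding A1_def by blast
  qed
  then have "A1 \<inter> D \<noteq> {}" using W by blast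
  then have "A2 \<inter> D = {}" using D o cov disj unfolding connectedin by blast
  then have "x \<in> A1" using cov x by blast
  then obtain V where V: "x \<in> V" "openin (cspace I) V" "agree_densely I F1 F2 V" unfolding A1_def by blast
  show ?thesis
  \<comment> \<open>Both functions are continuous near \<open>x\<close>, so different values at
    \<open>x\<close> would differ on an open set, against dense agreement.\<close>
  proof (rule ccontr)
    assume ne: "F1 x \<noteq> F2 x"
    have oo: "openin (cspace I) (U1 \<inter> U2 \<inter> V)" using x V by (auto simp: mv_holomorphic_on_def)
    have "mv_holomorphic_on I (\<lambda>y. F1 y - F2 y) (U1 \<inter> U2 \<inter> V)"
      by (intro mv_holomorphic_on_diff mv_holomorphic_on_subset[OF x(4) oo]
        mv_holomorphic_on_subset[OF x(5) oo]) auto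
    from mv_holomorphic_nonzero_open[OF this] have "openin (cspace I) {y \<in> U1 \<inter> U2 \<inter> V. F1 y - F2 y \<noteq> 0}" .
    moreover have "{y \<in> U1 \<inter> U2 \<inter> V. F1 y - F2 y \<noteq> 0} \<subseteq> V" "{y \<in> U1 \<inter> U2 \<inter> V. F1 y - F2 y \<noteq> 0} \<noteq> {}"
      using x V ne by auto
    ultimately obtain V'' where "V'' \<subseteq> {y \<in> U1 \<inter> U2 \<inter> V. F1 y - F2 y \<noteq> 0}" "V'' \<noteq> {}" "\<forall>y\<in>V''. F1 y = F2 y"
      using V(3) unfolding agree_densely_def by meson
    then show False by auto
  qed
qed

primrec nest_exponent :: "nat \<Rightarrow> (nat \<Rightarrow> complex) \<Rightarrow> nat \<Rightarrow> real" where
  "nest_exponent r a 0 = - Re (a r)"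
| "nest_exponent r a (Suc k) = - Re (a (r - Suc k)) + max (nest_exponent r a k) 0"

text \<open>If the real part of a_1 + ... + a_(m+1) exceeds both the previous exponent and 0,
  subtracting Re a_(m+1) leaves the next partial sum as a bound. For \<open>k = r - 1\<close> that
  sum is empty and the exponent is negative, as the Mellin transform requires.\<close>

lemma nest_exponent_less:
  assumes "\<And>j. j \<in> {1..r} \<Longrightarrow> Re (\<Sum>k=1..j. a k) > 0" "k < r"
  shows "nest_exponent r a k < Re (\<Sum>j=1..r - Suc k. a j)"
  using assms(2)
proof (induction k)
  case 0
  then obtain m where "r = Suc m" by (cases r) auto
  then show ?case using assms(1)[of r] by simp
next
  case (Suc k)
  define m where "m = r - Suc (Suc k)"
  have m: "r - Suc k = Suc m" using Suc.prems by (simp add: m_def)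
  have "nest_exponent r a k < Re (\<Sum>j=1..Suc m. a j)" using Suc by (simp add: m)
  moreover have "Re (\<Sum>j=1..Suc m. a j) > 0" using assms(1)[of "Suc m"] m Suc.prems by simp
  moreover have "Re (\<Sum>j=1..Suc m. a j) = Re (\<Sum>j=1..m. a j) + Re (a (Suc m))" by simp
  ultimately show ?case unfolding m_def[symmetric] nest_exponent.simps m by linarith
qed

lemma nest_family:
  assumes contC: "\<And>c. c \<in> C \<Longrightarrow> continuous_on UNIV c"
    and h: "\<And>j. j \<in> {1..r} \<Longrightarrow> hol_family X C (- Re (a j)) \<rho> (\<lambda>x. lker (a j) (z x j))"
    and \<sigma>: "\<And>j. j \<in> {1..r} \<Longrightarrow> param_hol X C (\<lambda>x. \<sigma> x j)" "\<And>j x. j \<in> {1..r} \<Longrightarrow> x \<in> X \<Longrightarrow> Re (\<sigma> x j) > - real N"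
    and s: "\<And>j. j \<in> {1..<r} \<Longrightarrow> param_hol X C (\<lambda>x. s x j)" "\<And>j x. j \<in> {1..<r} \<Longrightarrow> x \<in> X \<Longrightarrow> Re (s x j) > - real N"
    and k: "k < r"
  shows "hol_family X C (nest_exponent r a k) \<rho> (\<lambda>x. nest N r a (z x) (\<sigma> x) (s x) k)"
  using k
proof (induction k)
  case 0
  then show ?case using h[of r] by simp
next
  case (Suc k)
  have j: "r - k \<in> {1..r}" "r - Suc k \<in> {1..<r}" "r - Suc k \<in> {1..r}" using Suc.prems by auto
  have "hol_family X C (max (nest_exponent r a k) 0) \<rho>
      (\<lambda>x. ek N (nest N r a (z x) (\<sigma> x) (s x) k) (\<sigma> x (r - k)) (s x (r - Suc k)))"
    using Suc j by (intro hol_family_ek[OF contC] \<sigma> s) auto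
  from hol_family_mult[OF h[OF j(3)] this] show ?case by simp
qed

text \<open>Where all averages converge, the integrations by parts change nothing; this ties the
  continued expression to the original integral.\<close>

lemma nest_eq_nest_0:
  assumes h: "\<And>j. j \<in> {1..r} \<Longrightarrow> exp_bounded (- Re (a j)) \<rho> (lker (a j) (z j))"
    and \<sigma>: "\<And>j. j \<in> {1..r} \<Longrightarrow> Re (\<sigma> j) > 0" and s: "\<And>j. j \<in> {1..<r} \<Longrightarrow> Re (s j) > 0"
    and k: "k < r" and U: "U \<in> strip \<rho>"
  shows "nest N r a z \<sigma> s k U = nest 0 r a z \<sigma> s k U"
  using k U
proof (induction k arbitrary: U)
  case (Suc k)
  have j: "r - k \<in> {1..r}" "r - Suc k \<in> {1..<r}" using Suc.prems by auto
  have "exp_bounded (nest_exponent r a k) \<rho> (nest N r a z \<sigma> s k)"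
  proof (rule nest_family[where z="\<lambda>_. z" and \<sigma>="\<lambda>_. \<sigma>" and s="\<lambda>_. s"])
    show "- real N < Re (\<sigma> j)" if "j \<in> {1..r}" for j
      by (rule order.strict_trans1[OF _ \<sigma>[OF that]]) simp
    show "- real N < Re (s j)" if "j \<in> {1..<r}" for j
      by (rule order.strict_trans1[OF _ s[OF that]]) simp
  qed (use h Suc.prems in \<open>auto intro!: param_hol_const\<close>)
  then have hol: "nest N r a z \<sigma> s k holomorphic_on strip \<rho>" by (rule exp_boundedD)
  have "ek N (nest N r a z \<sigma> s k) (\<sigma> (r - k)) (s (r - Suc k)) U
    = ek 0 (nest N r a z \<sigma> s k) (\<sigma> (r - k)) (s (r - Suc k)) U"
    by (rule ek_eq_ek_0[OF hol Suc.prems(2)]) (use \<sigma> s j in auto)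
  also have "\<dots> = ek 0 (nest 0 r a z \<sigma> s k) (\<sigma> (r - k)) (s (r - Suc k)) U"
  proof -
    have "nest N r a z \<sigma> s k (of_real t * U) = nest 0 r a z \<sigma> s k (of_real t * U)" if "t \<in> {0<..<1}" for t
      using Suc scale_in_strip[OF Suc.prems(2), of t] that by auto
    then have "(LINT t:{0<..<1}|lborel. nest N r a z \<sigma> s k (of_real t * U)
      * beta_ker (\<sigma> (r - k)) (s (r - Suc k)) t)
      = (LINT t:{0<..<1}|lborel. nest 0 r a z \<sigma> s k (of_real t * U) * beta_ker (\<sigma> (r - k)) (s (r - Suc k)) t)"
      by (intro set_lebesgue_integral_cong) auto
    then show ?thesis by simp
  qed
  finally show ?case by (simp del: ek.simps)
qed simp

section \<open>The value of the zeta function\<close>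

lemma slit_eq: "complex_of_real ` {1..} = {z. Im z = 0 \<and> Re z \<ge> 1}"
  by (auto simp: complex_eq_iff intro!: image_eqI[where x="Re _"])

lemma open_slit_complement: "open (- (complex_of_real ` {1..}))"
proof -
  have "closed {z. Im z = 0 \<and> Re z \<ge> 1}"
    by (intro closed_Collect_conj closed_Collect_eq closed_Collect_le continuous_intros)
  then show ?thesis unfolding slit_eq by (simp add: open_Compl)
qed

lemma connected_slit_complement: "connected (- (complex_of_real ` {1..}))"
proof -
  have "starlike (- (complex_of_real ` {1..}))"
    unfolding starlike_def
  proof (rule bexI[of _ 0], intro ballI subsetI)
    fix x y assume x: "x \<in> - (complex_of_real ` {1..})" and y: "y \<in> closed_segment 0 x"
    then obtain t where t: "0 \<le> t" "t \<le> 1" "y = of_real t * x"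
      by (auto simp: closed_segment_def scaleR_conv_of_real)
    have "\<not> (Im y = 0 \<and> 1 \<le> Re y)"
    proof
      assume h: "Im y = 0 \<and> 1 \<le> Re y"
      then have t0: "t \<noteq> 0" using t by auto
      have "Im x = 0" using h t t0 by simp
      moreover have "1 \<le> Re x"
      proof (rule ccontr)
        assume "\<not> 1 \<le> Re x"
        then have "t * Re x < t * 1" using t t0 by (intro mult_strict_left_mono) auto
        then show False using h t by simp
      qed
      ultimately show False using x unfolding slit_eq by auto
    qed
    then show "y \<in> - (complex_of_real ` {1..})" unfolding slit_eq by auto
  qed auto
  then show ?thesis by (rule starlike_imp_connected)
qed

lemma param_hol_proj: "param_hol X (coord_curves Y) (\<lambda>x. x i)"
  unfolding param_hol_def curve_hol_def coord_curves_def
proof (intro conjI ballI allI impI)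
  show "continuous_on X (\<lambda>x. x i)" by (rule continuous_on_product_then_coordinatewise[OF continuous_on_id])
  fix c W assume "c \<in> {\<lambda>w. x(i := w) |x i. x \<in> Y}"
  then obtain x k where c: "c = (\<lambda>w. x(k := w))" by auto
  show "(\<lambda>w. c w i) holomorphic_on W" unfolding c by (cases "i = k") (auto intro!: holomorphic_intros)
qed

lemma param_hol_sum:
  assumes "\<And>j. j \<in> A \<Longrightarrow> param_hol X C (f j)"
  shows "param_hol X C (\<lambda>x. \<Sum>j\<in>A. f j x)"
  using assms by (induction A rule: infinite_finite_induct) (auto intro: param_hol_comb)

lemma param_hol_prod:
  assumes "\<And>j. j \<in> A \<Longrightarrow> param_hol X C (f j)"
  shows "param_hol X C (\<lambda>x. \<Prod>j\<in>A. f j x)"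
  using assms by (induction A rule: infinite_finite_induct) (auto intro: param_hol_comb)

lemma param_hol_divide:
  assumes "param_hol X C f" "param_hol X C g" "\<And>x. x \<in> X \<Longrightarrow> g x \<noteq> 0"
  shows "param_hol X C (\<lambda>x. f x / g x)"
  using assms unfolding param_hol_def curve_hol_def
  by (auto intro!: continuous_intros holomorphic_intros simp: image_subset_iff)

lemma param_hol_subset: "param_hol X C f \<Longrightarrow> X' \<subseteq> X \<Longrightarrow> C' \<subseteq> C \<Longrightarrow> param_hol X' C' f"
  unfolding param_hol_def curve_hol_def by (meson continuous_on_subset subset_eq subset_trans)

lemma coord_curves_mono: "X \<subseteq> Y \<Longrightarrow> coord_curves X \<subseteq> coord_curves Y"
  unfolding coord_curves_def by blast

section \<open>Numerator and denominator of the continuation\<close>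

definition zval :: "nat set \<Rightarrow> (nat + nat \<Rightarrow> complex) \<Rightarrow> nat \<Rightarrow> complex" where
  "zval P x = (\<lambda>j. if j \<in> P then x (Inr j) else 1)"

definition sval :: "(nat + nat \<Rightarrow> complex) \<Rightarrow> nat \<Rightarrow> complex" where
  "sval x = (\<lambda>j. x (Inl j))"

definition hl_num :: "nat \<Rightarrow> nat \<Rightarrow> (nat \<Rightarrow> complex) \<Rightarrow> nat set \<Rightarrow> (nat + nat \<Rightarrow> complex) \<Rightarrow> complex" where
  "hl_num N r a P x = rGamma (sval x r) *
     mellin N (nest N r a (zval P x) (sig r (sval x)) (sval x) (r - 1)) (sig r (sval x) 1)"

definition hl_den :: "nat \<Rightarrow> (nat + nat \<Rightarrow> complex) \<Rightarrow> complex" where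
  "hl_den r x = (\<Prod>j=1..r. rGamma (sig r (sval x) j))"

text \<open>
  Enough integrations by parts for all exponents \<open>s\<^sub>j\<close>, \<open>\<sigma>\<^sub>j\<close> when \<open>Re s\<^sub>j > - n\<close>.
\<close>

definition hl_order :: "nat \<Rightarrow> nat \<Rightarrow> nat" where
  "hl_order r n = r * n + r + 1"

text \<open>All factors are connected and each half-plane reaches into \<open>Re s > 1\<close>, so
  the identity theorem on such a box starts from the region where the integral formula
  holds.\<close>

definition hl_box :: "nat \<Rightarrow> nat set \<Rightarrow> nat \<Rightarrow> (nat + nat \<Rightarrow> complex) \<Rightarrow> (nat \<Rightarrow> real) \<Rightarrow> (nat + nat \<Rightarrow> complex) set"
  where
  "hl_box r P n x0 \<eta> = PiE (hl_index r P)
    (case_sum (\<lambda>_. {s. Re s > - real n}) (\<lambda>p. thick (x0 (Inr p)) (\<eta> p)))"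

lemma param_hol_sig: "param_hol X (coord_curves Y) (\<lambda>x. sig r (sval x) j)"
  unfolding sig_def sval_def by (intro param_hol_comb param_hol_sum param_hol_proj)

lemma param_hol_hl_den: "param_hol X (coord_curves Y) (hl_den r)"
  unfolding hl_den_def by (intro param_hol_prod param_hol_comb param_hol_sig)

lemma Re_sig_lower:
  assumes "j \<in> {1..r}" "\<And>k. k \<in> {1..r} \<Longrightarrow> Re (s k) > - real n"
  shows "Re (sig r s j) > - real (hl_order r n)"
proof -
  have "(\<Sum>k=j..r. - real n) \<le> (\<Sum>k=j..r. Re (s k))"
    using assms by (intro sum_mono) (auto intro: less_imp_le)
  then have "- (real (r + 1 - j) * real n) \<le> Re (\<Sum>k=j..r. s k)" by (simp add: Re_sum)
  moreover have "real (r + 1 - j) * real n \<le> real r * real n" using assms(1) by (intro mult_right_mono) auto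
  moreover have "real (r + 1 - j) \<le> real r" using assms(1) by auto
  moreover have "Re (sig r s j) = Re (\<Sum>k=j..r. s k) - real (r + 1 - j)"
    unfolding sig_def minus_complex.sel complex_Re_of_nat ..
  moreover have "real (hl_order r n) = real r * real n + real r + 1" by (simp add: hl_order_def)
  ultimately show ?thesis by linarith
qed

lemma Re_sig_pos:
  assumes "j \<in> {1..r}" "\<And>k. k \<in> {1..r} \<Longrightarrow> Re (s k) > 1"
  shows "Re (sig r s j) > 0"
proof -
  have "(\<Sum>k=j..r. (1::real)) < (\<Sum>k=j..r. Re (s k))"
    using assms by (intro sum_strict_mono) auto
  then have "real (r + 1 - j) < Re (\<Sum>k=j..r. s k)" by (simp add: Re_sum)
  moreover have "Re (sig r s j) = Re (\<Sum>k=j..r. s k) - real (r + 1 - j)"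
    unfolding sig_def minus_complex.sel complex_Re_of_nat ..
  ultimately show ?thesis by linarith
qed

lemma hl_den_nonzero:
  assumes "\<And>k. k \<in> {1..r} \<Longrightarrow> Re (sval x k) > 1"
  shows "hl_den r x \<noteq> 0"
proof -
  have "rGamma (sig r (sval x) j) \<noteq> 0" if j: "j \<in> {1..r}" for j
  proof -
    have "Re (sig r (sval x) j) > 0" by (rule Re_sig_pos[OF j assms])
    then have "sig r (sval x) j \<notin> \<int>\<^sub>\<le>\<^sub>0" by (auto elim!: nonpos_Ints_cases)
    then show ?thesis by (simp add: rGamma_eq_zero_iff)
  qed
  then show ?thesis by (simp add: hl_den_def)
qed

lemma hl_domainD: "x \<in> hl_domain r P \<Longrightarrow> p \<in> P \<Longrightarrow> x (Inr p) \<notin> complex_of_real ` {1..}"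
  unfolding hl_domain_def using PiE_mem[of x "hl_index r P" _ "Inr p"] InrI[of p P "{1..r}"] by fastforce

lemma hl_boxD:
  assumes "x \<in> hl_box r P n x0 \<eta>"
  shows "j \<in> {1..r} \<Longrightarrow> Re (sval x j) > - real n" "p \<in> P \<Longrightarrow> x (Inr p) \<in> thick (x0 (Inr p)) (\<eta> p)"
  using PiE_mem[OF assms[unfolded hl_box_def], of "Inl j"] PiE_mem[OF assms[unfolded hl_box_def], of "Inr p"]
    InlI[of j "{1..r}" P] InrI[of p P "{1..r}"] by (auto simp: sval_def)

text \<open>Gives all kernels a common strip, whether their \<open>z\<close> varies near a point off
  the slit or is fixed at 1.\<close>

lemma kernel_families:
  assumes P: "finite P" and z0: "\<And>p. p \<in> P \<Longrightarrow> z0 p \<notin> complex_of_real ` {1..}"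
  obtains \<eta> \<rho> where "0 < \<rho>" "\<And>p. p \<in> P \<Longrightarrow> 0 < \<eta> p"
    "\<And>p. p \<in> P \<Longrightarrow> thick (z0 p) (\<eta> p) \<subseteq> - (complex_of_real ` {1..})"
    "\<And>(X :: 'p::metric_space set) C z a j. (\<And>c. c \<in> C \<Longrightarrow> continuous_on UNIV c) \<Longrightarrow>
      (j \<in> P \<Longrightarrow> param_hol X C z \<and> (\<forall>x\<in>X. z x \<in> thick (z0 j) (\<eta> j))) \<Longrightarrow>
      (j \<notin> P \<Longrightarrow> z = (\<lambda>x. 1)) \<Longrightarrow> hol_family X C (- Re a) \<rho> (\<lambda>x. lker a (z x))"
proof -
  have "\<forall>p\<in>P. \<exists>d \<rho> \<eta>. 0 < d \<and> 0 < \<rho> \<and> 0 < \<eta> \<and> (\<forall>w\<in>thick (z0 p) \<eta>. \<forall>U\<in>strip \<rho>. d \<le> norm (1 - w * exp (- U)))"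
    using lker_denominator_bound[OF z0] by metis
  then obtain d \<rho> \<eta> where "\<forall>p\<in>P. 0 < d p \<and> 0 < \<rho> p \<and> 0 < \<eta> p \<and>
      (\<forall>w\<in>thick (z0 p) (\<eta> p). \<forall>U\<in>strip (\<rho> p). d p \<le> norm (1 - w * exp (- U)))"
    by (auto simp only: bchoice_iff)
  then have b: "\<And>p. p \<in> P \<Longrightarrow> 0 < d p" "\<And>p. p \<in> P \<Longrightarrow> 0 < \<rho> p" "\<And>p. p \<in> P \<Longrightarrow> 0 < \<eta> p"
    "\<And>p w U. p \<in> P \<Longrightarrow> w \<in> thick (z0 p) (\<eta> p) \<Longrightarrow> U \<in> strip (\<rho> p) \<Longrightarrow> d p \<le> norm (1 - w * exp (- U))"
    by auto
  \<comment> \<open>The entry 1 is the width on which the kernel at \<open>z = 1\<close> is known to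
    be holomorphic, and it keeps the minimum defined when \<open>P\<close> is empty.\<close>
  define \<rho>0 where "\<rho>0 = Min (insert 1 (\<rho> ` P))"
  have \<rho>0: "0 < \<rho>0" "\<rho>0 \<le> 1" "\<And>p. p \<in> P \<Longrightarrow> \<rho>0 \<le> \<rho> p"
    using P b(2) by (auto simp: \<rho>0_def)
  show ?thesis
  proof (rule that[of \<rho>0 \<eta>])
    show "thick (z0 p) (\<eta> p) \<subseteq> - (complex_of_real ` {1..})" if "p \<in> P" for p
      by (rule thick_avoids[OF b(4)[OF that] b(1)[OF that] b(2)[OF that]])
    fix X :: "'p set" and C z a j
    assume h: "\<And>c. c \<in> C \<Longrightarrow> continuous_on UNIV c"
      "j \<in> P \<Longrightarrow> param_hol X C z \<and> (\<forall>x\<in>X. z x \<in> thick (z0 j) (\<eta> j))"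
      "j \<notin> P \<Longrightarrow> z = (\<lambda>x. 1)"
    show "hol_family X C (- Re a) \<rho>0 (\<lambda>x. lker a (z x))"
    proof (cases "j \<in> P")
      case True
      have "hol_family X C (- Re a) (\<rho> j) (\<lambda>x. lker a (z x))"
        by (rule hol_family_lker_param[OF h(1) b(4)[OF True] b(1)[OF True] b(2)[OF True]])
          (use h(2)[OF True] in auto)
      then show ?thesis by (rule hol_family_mono) (use \<rho>0(3)[OF True] in auto)
    next
      case False
      have "hol_family X C (- Re a) 1 (\<lambda>x. lker a 1)" by (rule hol_family_lker_1)
      then show ?thesis unfolding h(3)[OF False] by (rule hol_family_mono) (use \<rho>0(2) in auto)
    qed
  qed (use \<rho>0 b in auto)
qed

text \<open>The radii depend only on the \<open>z\<close> coordinates of \<open>x0\<close> and serve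
  every order \<open>n\<close> at once; this is what allows numerators of different orders to be
  compared on one box.\<close>

lemma hl_local:
  assumes r: "r \<ge> 1" and a: "\<And>j. j \<in> {1..r} \<Longrightarrow> Re (\<Sum>k=1..j. a k) > 0"
    and P: "P \<subseteq> {1..r}" and x0: "x0 \<in> hl_domain r P"
  obtains \<eta> where "\<And>p. p \<in> P \<Longrightarrow> 0 < \<eta> p"
    "\<And>p. p \<in> P \<Longrightarrow> thick (x0 (Inr p)) (\<eta> p) \<subseteq> - (complex_of_real ` {1..})"
    "\<And>n. param_hol (hl_box r P n x0 \<eta>) (coord_curves (hl_box r P n x0 \<eta>)) (hl_num (hl_order r n) r a P)"
    "\<And>n x. x \<in> hl_box r P n x0 \<eta> \<Longrightarrow> (\<And>j. j \<in> {1..r} \<Longrightarrow> Re (sval x j) > 1) \<Longrightarrow>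
       hl_num (hl_order r n) r a P x = hl_den r x * hl_integral r (sval x) a (zval P x)"
proof -
  have P': "finite P" using P finite_subset by blast
  have z0: "x0 (Inr p) \<notin> complex_of_real ` {1..}" if "p \<in> P" for p
    by (rule hl_domainD[OF x0 that])
  obtain \<eta> \<rho> where b: "0 < \<rho>" "\<And>p. p \<in> P \<Longrightarrow> 0 < \<eta> p"
    "\<And>p. p \<in> P \<Longrightarrow> thick (x0 (Inr p)) (\<eta> p) \<subseteq> - (complex_of_real ` {1..})"
    "\<And>(X :: (nat + nat \<Rightarrow> complex) set) C z a j. (\<And>c. c \<in> C \<Longrightarrow> continuous_on UNIV c) \<Longrightarrow>
      (j \<in> P \<Longrightarrow> param_hol X C z \<and> (\<forall>x\<in>X. z x \<in> thick (x0 (Inr j)) (\<eta> j))) \<Longrightarrow>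
      (j \<notin> P \<Longrightarrow> z = (\<lambda>x. 1)) \<Longrightarrow> hol_family X C (- Re a) \<rho> (\<lambda>x. lker a (z x))"
  proof (rule kernel_families[of P "\<lambda>p. x0 (Inr p)", OF P' z0])
    fix \<eta> \<rho>
    assume as: "0 < \<rho>" "\<And>p. p \<in> P \<Longrightarrow> 0 < \<eta> p"
      "\<And>p. p \<in> P \<Longrightarrow> thick (x0 (Inr p)) (\<eta> p) \<subseteq> - (complex_of_real ` {1..})"
      "\<And>(X :: (nat + nat \<Rightarrow> complex) set) C z a j. (\<And>c. c \<in> C \<Longrightarrow> continuous_on UNIV c) \<Longrightarrow>
        (j \<in> P \<Longrightarrow> param_hol X C z \<and> (\<forall>x\<in>X. z x \<in> thick (x0 (Inr j)) (\<eta> j))) \<Longrightarrow>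
        (j \<notin> P \<Longrightarrow> z = (\<lambda>x. 1)) \<Longrightarrow> hol_family X C (- Re a) \<rho> (\<lambda>x. lker a (z x))"
    show thesis by (rule that; fact as)
  qed
  define X where "X n = hl_box r P n x0 \<eta>" for n
  define C where "C n = coord_curves (X n)" for n
  define N where "N n = hl_order r n" for n
  have contC: "continuous_on UNIV c" if "c \<in> C n" for c n
    using that unfolding C_def by (rule continuous_coord_curves)
  have lk: "hol_family (X n) (C n) (- Re (a j)) \<rho> (\<lambda>x. lker (a j) (zval P x j))" for j n
  proof (rule b(4)[where j=j])
    show "continuous_on UNIV c" if "c \<in> C n" for c by (rule contC[OF that])
    assume j: "j \<in> P"
    then have e: "(\<lambda>x. zval P x j) = (\<lambda>x. x (Inr j))" by (simp add: zval_def)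
    show "param_hol (X n) (C n) (\<lambda>x. zval P x j) \<and> (\<forall>x\<in>X n. zval P x j \<in> thick (x0 (Inr j)) (\<eta> j))"
      unfolding e C_def using j by (auto intro!: param_hol_proj hl_boxD(2) simp: X_def zval_def)
  qed (simp add: zval_def)
  have sX: "Re (sval x j) > - real n" if "x \<in> X n" "j \<in> {1..r}" for x j n
    using that unfolding X_def by (intro hl_boxD(1))
  have sgX: "Re (sig r (sval x) j) > - real (N n)" if "x \<in> X n" "j \<in> {1..r}" for x j n
    unfolding N_def by (rule Re_sig_lower[OF that(2) sX[OF that(1)]])
  have sX': "Re (sval x j) > - real (N n)" if "x \<in> X n" "j \<in> {1..r}" for x j n
  proof -
    have "1 * n \<le> r * n" using r by (rule mult_right_mono) simp
    then have "n \<le> N n" unfolding N_def hl_order_def by linarith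
    then show ?thesis using sX[OF that] by (smt (verit) of_nat_mono)
  qed
  have nf: "hol_family (X n) (C n) (nest_exponent r a (r - 1)) \<rho>
      (\<lambda>x. nest (N n) r a (zval P x) (sig r (sval x)) (sval x) (r - 1))" for n
    using r by (intro nest_family[OF contC] lk sgX sX')
      (auto simp: C_def sval_def intro!: param_hol_sig[unfolded sval_def] param_hol_proj)
  have neg: "nest_exponent r a (r - 1) < 0" using nest_exponent_less[OF a, of r "r - 1"] r by simp
  show ?thesis
  proof (rule that[of \<eta>])
    show "param_hol (hl_box r P n x0 \<eta>) (coord_curves (hl_box r P n x0 \<eta>)) (hl_num (hl_order r n) r a P)"
      for n
    proof -
      have "param_hol (X n) (C n)
        (\<lambda>x. mellin (N n) (nest (N n) r a (zval P x) (sig r (sval x)) (sval x) (r - 1)) (sig r (sval x) 1))"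
        by (rule param_hol_mellin[OF contC nf _ neg b(1)])
          (use r sgX in \<open>auto simp: C_def intro: param_hol_sig\<close>)
      moreover have "param_hol (X n) (C n) (\<lambda>x. rGamma (sval x r))"
        unfolding C_def sval_def by (intro param_hol_comb param_hol_proj)
      ultimately have "param_hol (X n) (C n) (hl_num (N n) r a P)"
        unfolding hl_num_def[abs_def] by (rule param_hol_binary(3)[rotated])
      then show ?thesis by (simp add: X_def C_def N_def)
    qed
    fix n x assume x: "x \<in> hl_box r P n x0 \<eta>" and s: "\<And>j. j \<in> {1..r} \<Longrightarrow> Re (sval x j) > 1"
    then have xX: "x \<in> X n" by (simp add: X_def)
    have sp: "Re (sig r (sval x) j) > 0" if "j \<in> {1..r}" for j by (rule Re_sig_pos[OF that s])
    have ker: "exp_bounded (- Re (a j)) \<rho> (lker (a j) (zval P x j))" for j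
      by (rule hol_family_slice[OF lk xX])
    let ?n = "\<lambda>N. nest N r a (zval P x) (sig r (sval x)) (sval x) (r - 1)"
    have "mellin (N n) (?n (N n)) (sig r (sval x) 1) = mellin 0 (?n (N n)) (sig r (sval x) 1)"
      by (rule mellin_eq_le[OF hol_family_slice[OF nf xX] neg b(1)]) (use sp[of 1] r in auto)
    also have "\<dots> = mellin 0 (?n 0) (sig r (sval x) 1)"
    proof -
      have "?n (N n) (of_real u) = ?n 0 (of_real u)" if "u \<in> {0<..}" for u
        by (rule nest_eq_nest_0[where \<rho>=\<rho>]) (use ker sp s r b(1) that in \<open>force+\<close>)
      then have "(LINT u:{0<..}|lborel. ?n (N n) (of_real u) * of_real u powr (sig r (sval x) 1 - 1))
          = (LINT u:{0<..}|lborel. ?n 0 (of_real u) * of_real u powr (sig r (sval x) 1 - 1))"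
        by (intro set_lebesgue_integral_cong) auto
      then show ?thesis by simp
    qed
    finally have m: "mellin (N n) (?n (N n)) (sig r (sval x) 1) = mellin 0 (?n 0) (sig r (sval x) 1)" .
    have "hl_den r x * hl_integral r (sval x) a (zval P x)
      = rGamma (sval x r) * mellin 0 (?n 0) (sig r (sval x) 1)"
      unfolding hl_den_def by (rule hl_integral_eq_mellin[where \<rho>=\<rho>]) (rule r b(1) ker | erule s | erule a)+
    then show "hl_num (hl_order r n) r a P x = hl_den r x * hl_integral r (sval x) a (zval P x)"
      using m by (simp only: hl_num_def N_def)
  qed (use b in auto)
qed

lemma finite_hl_index: "P \<subseteq> {1..r} \<Longrightarrow> finite (hl_index r P)"
  by (auto intro: finite_subset)

lemma hl_box_props:
  assumes P: "P \<subseteq> {1..r}" and x0: "x0 \<in> hl_domain r P" and n: "\<And>j. j \<in> {1..r} \<Longrightarrow> Re (sval x0 j) > - real n"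
    and \<eta>: "\<And>p. p \<in> P \<Longrightarrow> 0 < \<eta> p" "\<And>p. p \<in> P \<Longrightarrow> thick (x0 (Inr p)) (\<eta> p) \<subseteq> - (complex_of_real ` {1..})"
  shows "x0 \<in> hl_box r P n x0 \<eta>" "hl_box r P n x0 \<eta> \<subseteq> hl_domain r P"
    "openin (cspace (hl_index r P)) (hl_box r P n x0 \<eta>)"
proof -
  show "x0 \<in> hl_box r P n x0 \<eta>"
    using x0 n \<eta>(1) unfolding hl_box_def hl_domain_def sval_def
      by (auto simp: PiE_iff thick_mem split: sum.splits)
  show "hl_box r P n x0 \<eta> \<subseteq> hl_domain r P"
    unfolding hl_box_def hl_domain_def
  proof (rule PiE_mono)
    fix i assume "i \<in> hl_index r P"
    then show "case_sum (\<lambda>_. {s. Re s > - real n}) (\<lambda>p. thick (x0 (Inr p)) (\<eta> p)) i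
        \<subseteq> case_sum (\<lambda>_. UNIV) (\<lambda>_. - (complex_of_real ` {1..})) i"
      by (cases i) (use \<eta>(2) in auto)
  qed
  show "openin (cspace (hl_index r P)) (hl_box r P n x0 \<eta>)"
    unfolding hl_box_def
    by (rule openin_cspace_PiE[OF finite_hl_index[OF P]])
       (auto simp: open_thick open_halfspace_Re_gt)
qed

lemma hl_box_mono: "n \<le> m \<Longrightarrow> hl_box r P n x0 \<eta> \<subseteq> hl_box r P m x0 \<eta>"
  unfolding hl_box_def by (intro PiE_mono) (auto split: sum.splits)

text \<open>On the smaller of the two boxes both numerators are holomorphic, and where all
  \<open>Re s > 1\<close> both equal denominator times integral. The identity theorem on the box
  does the rest.\<close>

lemma hl_num_cong_order:
  assumes r: "r \<ge> 1" and a: "\<And>j. j \<in> {1..r} \<Longrightarrow> Re (\<Sum>k=1..j. a k) > 0"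
    and P: "P \<subseteq> {1..r}" and x0: "x0 \<in> hl_domain r P"
    and n: "\<And>j. j \<in> {1..r} \<Longrightarrow> Re (sval x0 j) > - real n" and m: "\<And>j. j \<in> {1..r} \<Longrightarrow> Re (sval x0 j) > - real m"
  shows "hl_num (hl_order r n) r a P x0 = hl_num (hl_order r m) r a P x0"
proof -
  have "hl_num (hl_order r n) r a P x0 = hl_num (hl_order r m) r a P x0"
    if nm: "n \<le> m" and n: "\<And>j. j \<in> {1..r} \<Longrightarrow> Re (sval x0 j) > - real n" for n m
  proof -
    obtain \<eta> where \<eta>: "\<And>p. p \<in> P \<Longrightarrow> 0 < \<eta> p"
      "\<And>p. p \<in> P \<Longrightarrow> thick (x0 (Inr p)) (\<eta> p) \<subseteq> - (complex_of_real ` {1..})"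
      "\<And>n. param_hol (hl_box r P n x0 \<eta>) (coord_curves (hl_box r P n x0 \<eta>)) (hl_num (hl_order r n) r a P)"
      "\<And>n x. x \<in> hl_box r P n x0 \<eta> \<Longrightarrow> (\<And>j. j \<in> {1..r} \<Longrightarrow> Re (sval x j) > 1) \<Longrightarrow>
       hl_num (hl_order r n) r a P x = hl_den r x * hl_integral r (sval x) a (zval P x)"
      using hl_local[OF r a P x0] by blast
    have bp: "x0 \<in> hl_box r P n x0 \<eta>" "hl_box r P n x0 \<eta> \<subseteq> hl_domain r P"
      "openin (cspace (hl_index r P)) (hl_box r P n x0 \<eta>)"
    by (rule hl_box_props[OF P x0]; fact)+
    let ?X = "hl_box r P n x0 \<eta>"
    let ?V = "PiE (hl_index r P) (case_sum (\<lambda>_. {s. Re s > 1}) (\<lambda>p. thick (x0 (Inr p)) (\<eta> p)))"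
    have sub: "?X \<subseteq> hl_box r P m x0 \<eta>" by (rule hl_box_mono[OF nm])
    have "param_hol ?X (coord_curves ?X) (\<lambda>x. hl_num (hl_order r n) r a P x - hl_num (hl_order r m) r a P x)"
      by (intro param_hol_comb \<eta>(3) param_hol_subset[OF \<eta>(3)[of m] sub coord_curves_mono[OF sub]])
    then have h: "mv_holomorphic_on (hl_index r P) (\<lambda>x. hl_num (hl_order r n) r a P x - hl_num (hl_order r m)
      r a P x) ?X"
      by (rule param_hol_imp_mv_holomorphic_on[OF bp(3)])
    have VX: "?V \<subseteq> ?X" unfolding hl_box_def by (intro PiE_mono) (auto split: sum.splits)
    have "hl_num (hl_order r n) r a P x0 - hl_num (hl_order r m) r a P x0 = 0"
    proof (rule box_identity[OF finite_hl_index[OF P] _ _ h[unfolded hl_box_def] _ _ _ _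
      bp(1)[unfolded hl_box_def]])
      show "openin (cspace (hl_index r P)) ?V"
        by (rule openin_cspace_PiE[OF finite_hl_index[OF P]]) (auto simp: open_thick open_halfspace_Re_gt)
      show "?V \<subseteq> PiE (hl_index r P) (case_sum (\<lambda>_. {s. Re s > - real n}) (\<lambda>p. thick (x0 (Inr p)) (\<eta> p)))"
        using VX by (simp add: hl_box_def)
      \<comment> \<open>All exponents equal to 2, with the \<open>z\<close> coordinates of
        \<open>x0\<close>, give a point in the region of convergence.\<close>
      have "restrict (case_sum (\<lambda>_. 2) (\<lambda>p. x0 (Inr p))) (hl_index r P) \<in> ?V"
        using \<eta>(1) by (auto simp: PiE_iff thick_mem)
      then show "?V \<noteq> {}" by blast
      fix x assume x: "x \<in> ?V"
      then have "x \<in> ?X" "x \<in> hl_box r P m x0 \<eta>" using VX sub by auto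
      moreover have "Re (sval x j) > 1" if "j \<in> {1..r}" for j
        using PiE_mem[OF x, of "Inl j"] InlI[OF that, of P] by (simp add: sval_def)
      ultimately show "hl_num (hl_order r n) r a P x - hl_num (hl_order r m) r a P x = 0" using \<eta>(4) by auto
    qed (auto simp: open_thick open_halfspace_Re_gt convex_thick convex_halfspace_Re_gt
      intro!: convex_connected)
    then show ?thesis by simp
  qed
  from this[of n m] this[of m n] n m show ?thesis by (metis nat_le_linear)
qed

lemma exists_order: "\<exists>n. \<forall>j\<in>{1..r}. Re (sval x j) > - real n"
proof -
  have "\<forall>j\<in>{1..r}. \<exists>n::nat. - Re (sval x j) < real n" using reals_Archimedean2 by blast
  then obtain f where f: "\<And>j. j \<in> {1..r} \<Longrightarrow> - Re (sval x j) < real (f j)" by metis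
  have "Re (sval x j) > - real (\<Sum>j=1..r. f j)" if "j \<in> {1..r}" for j
  proof -
    have "f j \<le> (\<Sum>j=1..r. f j)" by (rule member_le_sum) (use that in auto)
    then show ?thesis using f[OF that] by (smt (verit) of_nat_mono)
  qed
  then show ?thesis by blast
qed

definition some_order :: "nat \<Rightarrow> (nat + nat \<Rightarrow> complex) \<Rightarrow> nat" where
  "some_order r x = (SOME n. \<forall>j\<in>{1..r}. Re (sval x j) > - real n)"

lemma some_order: "j \<in> {1..r} \<Longrightarrow> Re (sval x j) > - real (some_order r x)"
  using someI_ex[OF exists_order[of r x]] unfolding some_order_def by blast

text \<open>No fixed order covers all exponents, so the order is chosen pointwise; as any admissible
  order gives the same value, this is locally a quotient with one fixed order.\<close>

definition hl_cont :: "nat \<Rightarrow> (nat \<Rightarrow> complex) \<Rightarrow> nat set \<Rightarrow> (nat + nat \<Rightarrow> complex) \<Rightarrow> complex" where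
  "hl_cont r a P x = hl_num (hl_order r (some_order r x)) r a P x / hl_den r x"

context
  fixes r :: nat and a :: "nat \<Rightarrow> complex" and P :: "nat set"
  assumes r: "r \<ge> 1" and a: "\<And>j. j \<in> {1..r} \<Longrightarrow> Re (\<Sum>k=1..j. a k) > 0" and P: "P \<subseteq> {1..r}"
begin

lemma hl_cont_eq:
  assumes "x \<in> hl_domain r P" "\<And>j. j \<in> {1..r} \<Longrightarrow> Re (sval x j) > - real n"
  shows "hl_cont r a P x = hl_num (hl_order r n) r a P x / hl_den r x"
  unfolding hl_cont_def using hl_num_cong_order[OF r a P assms(1) some_order assms(2)] by simp

lemma openin_hl_domain: "openin (cspace (hl_index r P)) (hl_domain r P)"
  unfolding hl_domain_def
  by (rule openin_cspace_PiE[OF finite_hl_index[OF P]]) (auto simp: open_slit_complement)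

lemma connectedin_hl_domain: "connectedin (cspace (hl_index r P)) (hl_domain r P)"
  unfolding hl_domain_def connectedin_PiE using connected_slit_complement by auto

text \<open>The domain is itself a box with connected factors, so a denominator that vanished on an
  open set would vanish where all exponents equal 2.\<close>

lemma hl_den_not_identically_zero:
  assumes V: "openin (cspace (hl_index r P)) V" "V \<subseteq> hl_domain r P" "V \<noteq> {}"
  shows "\<exists>y\<in>V. hl_den r y \<noteq> 0"
proof (rule ccontr)
  assume n: "\<not> (\<exists>y\<in>V. hl_den r y \<noteq> 0)"
  let ?x = "restrict (case_sum (\<lambda>_. 2) (\<lambda>_. 0)) (hl_index r P)"
  have h: "mv_holomorphic_on (hl_index r P) (hl_den r) (hl_domain r P)"
    by (rule param_hol_imp_mv_holomorphic_on[OF openin_hl_domain param_hol_hl_den])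
  have x: "?x \<in> hl_domain r P" unfolding hl_domain_def by (auto simp: PiE_iff)
  have "hl_den r ?x = 0"
    by (rule box_identity[OF finite_hl_index[OF P] _ _ h[unfolded hl_domain_def] V(1)
      V(2)[unfolded hl_domain_def] V(3) _ x[unfolded hl_domain_def]])
       (use n in \<open>auto simp: open_slit_complement connected_slit_complement\<close>)
  moreover have "hl_den r ?x \<noteq> 0" by (rule hl_den_nonzero) (auto simp: sval_def)
  ultimately show False by simp
qed

lemma hl_cont_local:
  assumes x0: "x0 \<in> hl_domain r P" and n: "\<And>j. j \<in> {1..r} \<Longrightarrow> Re (sval x0 j) > - real n"
  obtains U where "x0 \<in> U" "U \<subseteq> hl_domain r P" "openin (cspace (hl_index r P)) U"
    "param_hol U (coord_curves U) (hl_num (hl_order r n) r a P)"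
    "\<And>y. y \<in> U \<Longrightarrow> hl_cont r a P y = hl_num (hl_order r n) r a P y / hl_den r y"
proof -
  obtain \<eta> where \<eta>: "\<And>p. p \<in> P \<Longrightarrow> 0 < \<eta> p"
      "\<And>p. p \<in> P \<Longrightarrow> thick (x0 (Inr p)) (\<eta> p) \<subseteq> - (complex_of_real ` {1..})"
      "\<And>n. param_hol (hl_box r P n x0 \<eta>) (coord_curves (hl_box r P n x0 \<eta>)) (hl_num (hl_order r n) r a P)"
      using hl_local[OF r a P x0] by metis
  have bp: "x0 \<in> hl_box r P n x0 \<eta>" "hl_box r P n x0 \<eta> \<subseteq> hl_domain r P"
      "openin (cspace (hl_index r P)) (hl_box r P n x0 \<eta>)"
    by (rule hl_box_props[OF P x0]; fact)+
  show ?thesis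
  proof (rule that[OF bp \<eta>(3)])
    fix y assume y: "y \<in> hl_box r P n x0 \<eta>"
    then have "Re (sval y j) > - real n" if "j \<in> {1..r}" for j
      using that by (rule hl_boxD(1))
    then show "hl_cont r a P y = hl_num (hl_order r n) r a P y / hl_den r y"
      by (intro hl_cont_eq) (use y bp in auto)
  qed
qed

lemma hl_continuation_hl_cont: "hl_continuation r a P (hl_cont r a P)"
  unfolding hl_continuation_def mv_meromorphic_on_def
proof (intro conjI ballI impI openin_hl_domain)
  fix x assume x: "x \<in> hl_domain r P"
  obtain U where U: "x \<in> U" "U \<subseteq> hl_domain r P" "openin (cspace (hl_index r P)) U"
    "param_hol U (coord_curves U) (hl_num (hl_order r (some_order r x)) r a P)"
    "\<And>y. y \<in> U \<Longrightarrow> hl_cont r a P y = hl_num (hl_order r (some_order r x)) r a P y / hl_den r y"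
    using hl_cont_local[OF x some_order] by blast
  show "\<exists>U f g. x \<in> U \<and> U \<subseteq> hl_domain r P \<and> mv_holomorphic_on (hl_index r P) f U \<and>
      mv_holomorphic_on (hl_index r P) g U \<and>
      (\<forall>V. openin (cspace (hl_index r P)) V \<and> V \<subseteq> U \<and> V \<noteq> {} \<longrightarrow> (\<exists>y\<in>V. g y \<noteq> 0)) \<and>
      (\<forall>y\<in>U. g y \<noteq> 0 \<longrightarrow> hl_cont r a P y = f y / g y)"
  proof (rule exI[of _ U], rule exI[of _ "hl_num (hl_order r (some_order r x)) r a P"], rule exI[of _
    "hl_den r"], intro conjI)
    show "mv_holomorphic_on (hl_index r P) (hl_num (hl_order r (some_order r x)) r a P) U"
      by (rule param_hol_imp_mv_holomorphic_on[OF U(3,4)])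
    show "mv_holomorphic_on (hl_index r P) (hl_den r) U"
      by (rule param_hol_imp_mv_holomorphic_on[OF U(3) param_hol_hl_den])
    show "\<forall>V. openin (cspace (hl_index r P)) V \<and> V \<subseteq> U \<and> V \<noteq> {} \<longrightarrow> (\<exists>y\<in>V. hl_den r y \<noteq> 0)"
      using hl_den_not_identically_zero U(2) by blast
  qed (use U in auto)
next
  fix x assume x: "x \<in> hl_domain r P" and s: "\<forall>j\<in>{1..r}. 1 < Re (x (Inl j))"
  then have s': "\<And>j. j \<in> {1..r} \<Longrightarrow> Re (sval x j) > 1" by (auto simp: sval_def)
  obtain \<eta> where \<eta>: "\<And>p. p \<in> P \<Longrightarrow> 0 < \<eta> p"
      "\<And>p. p \<in> P \<Longrightarrow> thick (x (Inr p)) (\<eta> p) \<subseteq> - (complex_of_real ` {1..})"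
      "\<And>n y. y \<in> hl_box r P n x \<eta> \<Longrightarrow> (\<And>j. j \<in> {1..r} \<Longrightarrow> Re (sval y j) > 1) \<Longrightarrow>
       hl_num (hl_order r n) r a P y = hl_den r y * hl_integral r (sval y) a (zval P y)"
      using hl_local[OF r a P x] by metis
  have "hl_num (hl_order r (some_order r x)) r a P x = hl_den r x * hl_integral r (sval x) a (zval P x)"
    by (rule \<eta>(3)[OF hl_box_props(1)[OF P x some_order \<eta>(1,2)] s'])
  then show "hl_cont r a P x = hl_integral r (\<lambda>j. x (Inl j)) a (\<lambda>j. if j \<in> P then x (Inr j) else 1)"
    using hl_den_nonzero[OF s'] by (simp add: hl_cont_def sval_def zval_def)
qed

end

text \<open>Off the zeros of the denominator \<open>hl_cont\<close> is holomorphic and witnesses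
  existence; every competitor agrees with it for \<open>Re s > 1\<close>, hence at \<open>x\<close>
  by uniqueness of the continuation.\<close>

lemma hl_zeta_eq:
  assumes r: "r \<ge> 1" and a: "\<And>j. j \<in> {1..r} \<Longrightarrow> Re (\<Sum>k=1..j. a k) > 0"
    and z: "\<And>j. j \<in> {1..r} \<Longrightarrow> z j \<notin> complex_of_real ` {1<..}"
    and P: "P = {p \<in> {1..r}. z p \<noteq> 1}" and x: "x = restrict (case_sum s z) (hl_index r P)"
    and n: "\<And>j. j \<in> {1..r} \<Longrightarrow> Re (s j) > - real n" and d: "hl_den r x \<noteq> 0"
  shows "hl_zeta r s a z = hl_num (hl_order r n) r a P x / hl_den r x"
proof -
  have P': "P \<subseteq> {1..r}" using P by auto
  have xD: "x \<in> hl_domain r P"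
  proof -
    have "z p \<notin> complex_of_real ` {1..}" if "p \<in> P" for p
    proof
      assume "z p \<in> complex_of_real ` {1..}"
      then obtain t where t: "z p = of_real t" "t \<ge> 1" by auto
      have "t \<noteq> 1" using t that P by auto
      then show False using t z[of p] that P by auto
    qed
    then show ?thesis unfolding x hl_domain_def by (auto simp: PiE_iff)
  qed
  have sx: "sval x j = s j" if "j \<in> {1..r}" for j using that by (auto simp: x sval_def InlI)
  have n': "\<And>j. j \<in> {1..r} \<Longrightarrow> Re (sval x j) > - real n" using n sx by simp
  note cont = hl_continuation_hl_cont[OF r a P']
  obtain U where U: "x \<in> U" "U \<subseteq> hl_domain r P" "openin (cspace (hl_index r P)) U"
    "param_hol U (coord_curves U) (hl_num (hl_order r n) r a P)"
    "\<And>y. y \<in> U \<Longrightarrow> hl_cont r a P y = hl_num (hl_order r n) r a P y / hl_den r y"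
    using hl_cont_local[OF r a P' xD n'] by metis
  \<comment> \<open>The description behind \<open>hl_zeta\<close> demands holomorphy on a
    neighbourhood of \<open>x\<close>; this one stays away from the poles.\<close>
  define U' where "U' = {y \<in> U. hl_den r y \<noteq> 0}"
  have oU': "openin (cspace (hl_index r P)) U'"
    unfolding U'_def by (rule mv_holomorphic_nonzero_open[OF param_hol_imp_mv_holomorphic_on[OF U(3)
      param_hol_hl_den]])
  have sub: "U' \<subseteq> U" by (auto simp: U'_def)
  have "param_hol U' (coord_curves U') (\<lambda>y. hl_num (hl_order r n) r a P y / hl_den r y)"
    by (rule param_hol_divide[OF param_hol_subset[OF U(4) sub coord_curves_mono[OF sub]] param_hol_hl_den])
      (simp add: U'_def)
  then have "mv_holomorphic_on (hl_index r P) (\<lambda>y. hl_num (hl_order r n) r a P y / hl_den r y) U'"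
    by (rule param_hol_imp_mv_holomorphic_on[OF oU'])
  then have hol: "mv_holomorphic_on (hl_index r P) (hl_cont r a P) U'"
    by (rule mv_holomorphic_on_cong) (use U(5) sub in auto)
  have xU': "x \<in> U'" using U(1) d by (simp add: U'_def)
  have val: "hl_cont r a P x = hl_num (hl_order r n) r a P x / hl_den r x" using U by simp
  let ?W = "PiE (hl_index r P) (case_sum (\<lambda>_. {s. Re s > 1}) (\<lambda>_. - (complex_of_real ` {1..})))"
  have W: "openin (cspace (hl_index r P)) ?W"
    by (rule openin_cspace_PiE[OF finite_hl_index[OF P']])
      (auto simp: open_slit_complement open_halfspace_Re_gt)
  have "restrict (case_sum (\<lambda>_. 2) (\<lambda>_. 0)) (hl_index r P) \<in> ?W" by (auto simp: PiE_iff)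
  then have Wne: "?W \<noteq> {}" by blast
  have WD: "?W \<subseteq> hl_domain r P" unfolding hl_domain_def by (intro PiE_mono) (auto split: sum.splits)
  have "(THE w. \<exists>F U. hl_continuation r a P F \<and> x \<in> U \<and> mv_holomorphic_on (hl_index r P) F U \<and> F x = w)
      = hl_num (hl_order r n) r a P x / hl_den r x"
  proof (rule the_equality)
    show "\<exists>F U. hl_continuation r a P F \<and> x \<in> U \<and> mv_holomorphic_on (hl_index r P) F U \<and>
      F x = hl_num (hl_order r n) r a P x / hl_den r x"
      using cont xU' hol val by blast
    fix w assume "\<exists>F U. hl_continuation r a P F \<and> x \<in> U \<and> mv_holomorphic_on (hl_index r P) F U \<and> F x = w"
    then obtain F V where F: "hl_continuation r a P F" "x \<in> V" "mv_holomorphic_on (hl_index r P) F V"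
      "F x = w" by blast
    have "F x = hl_cont r a P x"
    proof (rule meromorphic_unique[OF finite_hl_index[OF P'] _ _ connectedin_hl_domain[OF r a P'] W WD Wne _
      xD F(2) xU' F(3) hol])
      fix y assume y: "y \<in> ?W"
      have "Re (y (Inl j)) > 1" if "j \<in> {1..r}" for j
        using PiE_mem[OF y, of "Inl j"] InlI[OF that, of P] by simp
      then have "\<forall>j\<in>{1..r}. Re (y (Inl j)) > 1" by blast
      then show "F y = hl_cont r a P y"
        using F(1)[unfolded hl_continuation_def, THEN conjunct2, rule_format, of y]
          cont[unfolded hl_continuation_def, THEN conjunct2, rule_format, of y] subsetD[OF WD y] by auto
    qed (use F(1) cont in \<open>auto simp: hl_continuation_def\<close>)
    then show "w = hl_num (hl_order r n) r a P x / hl_den r x" using val F(4) by simp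
  qed
  then show ?thesis unfolding hl_zeta_def Let_def P[symmetric] x[symmetric] .
qed

section \<open>Asymptotics at nonpositive integers\<close>

text \<open>The cofactor of the simple zero of 1/\<Gamma> at \<open>- m\<close>. Its nonzero value
  at 0 carries the factorials and signs of the final formula.\<close>

definition rGamma_rest :: "nat \<Rightarrow> complex \<Rightarrow> complex" where
  "rGamma_rest m \<eta> = (\<Prod>i=1..m. \<eta> - of_nat i) * rGamma (1 + \<eta>)"

lemma rGamma_near_neg_nat: "rGamma (- of_nat m + \<eta>) = \<eta> * rGamma_rest m \<eta>"
proof (induction m)
  case 0
  then show ?case using rGamma_plus1[of \<eta>] by (simp add: rGamma_rest_def add.commute)
next
  case (Suc m)
  have "rGamma (- of_nat (Suc m) + \<eta>) = (- of_nat (Suc m) + \<eta>) * rGamma (- of_nat m + \<eta>)"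
    using rGamma_plus1[of "- of_nat (Suc m) + \<eta>"] by (simp add: algebra_simps)
  then show ?case unfolding Suc.IH by (simp add: rGamma_rest_def algebra_simps)
qed

lemma rGamma_rest_0: "rGamma_rest m 0 = (-1) ^ m * fact m"
  by (simp add: rGamma_rest_def fact_prod prod_uminus)

lemma rGamma_rest_0_nonzero: "rGamma_rest m 0 \<noteq> 0"
  by (simp add: rGamma_rest_0)

lemma rGamma_rest_field_differentiable: "rGamma_rest m field_differentiable at 0"
proof -
  have "rGamma_rest m holomorphic_on UNIV"
    unfolding rGamma_rest_def[abs_def] by (intro holomorphic_intros)
  then show ?thesis by (auto intro: holomorphic_on_imp_differentiable_at)
qed

lemma field_differentiable_Lipschitz_0:
  assumes "f field_differentiable at (0::complex)"
  shows "\<exists>\<delta>>0. \<exists>C\<ge>0. \<forall>\<eta>. norm \<eta> < \<delta> \<longrightarrow> norm (f \<eta> - f 0 :: complex) \<le> C * norm \<eta>"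
proof -
  obtain D where "(f has_field_derivative D) (at 0)" using assms by (auto simp: field_differentiable_def)
  then have "((\<lambda>\<eta>. (f \<eta> - f 0) / \<eta>) \<longlongrightarrow> D) (at 0)" by (simp add: has_field_derivative_iff)
  then obtain \<delta> where \<delta>: "\<delta> > 0" "\<And>\<eta>. \<eta> \<noteq> 0 \<Longrightarrow> norm \<eta> < \<delta> \<Longrightarrow> norm ((f \<eta> - f 0) / \<eta> - D) < 1"
    unfolding LIM_eq by (metis diff_zero zero_less_one)
  have "norm (f \<eta> - f 0) \<le> (norm D + 1) * norm \<eta>" if "norm \<eta> < \<delta>" for \<eta>
  proof (cases "\<eta> = 0")
    case False
    then have "norm ((f \<eta> - f 0) / \<eta>) \<le> norm D + 1"
      using \<delta>(2)[OF False that] norm_triangle_ineq2[of "(f \<eta> - f 0) / \<eta>" D] by linarith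
    then show ?thesis using False by (simp add: norm_divide divide_le_eq)
  qed auto
  then show ?thesis using \<delta>(1) by (intro exI[of _ \<delta>] conjI exI[of _ "norm D + 1"]) auto
qed

section \<open>Estimates uniform over the admissible region of \<epsilon>\<close>

definition tail_sum :: "nat \<Rightarrow> (nat \<Rightarrow> complex) \<Rightarrow> nat \<Rightarrow> complex" where
  "tail_sum r \<epsilon> j = (\<Sum>i=j..r. \<epsilon> i)"

definition eps_region :: "nat \<Rightarrow> real \<Rightarrow> real \<Rightarrow> (nat \<Rightarrow> complex) set" where
  "eps_region r M \<delta> = {\<epsilon>. (\<forall>j\<in>{1..r}. norm (\<epsilon> j) < \<delta> \<and> \<epsilon> j \<noteq> 0 \<and> tail_sum r \<epsilon> j \<noteq> 0) \<and>
     (\<forall>j\<in>{1..r}. \<forall>k\<in>{j..r}. norm (\<epsilon> k) \<le> M * norm (tail_sum r \<epsilon> j))}"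

definition eps_size :: "nat \<Rightarrow> (nat \<Rightarrow> complex) \<Rightarrow> real" where
  "eps_size r \<epsilon> = (\<Sum>j=1..r. norm (\<epsilon> j))"

text \<open>
  The comparison function \<open>g\<close> is not a constant, since \<open>\<epsilon>(j+1,r)/\<epsilon>(j,r)\<close> has no limit; its boundedness is what makes
  the relation compatible with products.
\<close>

definition approx :: "nat \<Rightarrow> real \<Rightarrow> ((nat \<Rightarrow> complex) \<Rightarrow> complex) \<Rightarrow> ((nat \<Rightarrow> complex) \<Rightarrow> complex) \<Rightarrow> bool" where
  "approx r M f g \<longleftrightarrow> (\<exists>\<delta>>0. \<exists>C\<ge>0. \<forall>\<epsilon>\<in>eps_region r M \<delta>.
     norm (f \<epsilon> - g \<epsilon>) \<le> C * eps_size r \<epsilon> \<and> norm (g \<epsilon>) \<le> C)"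

lemma approxI:
  assumes "\<delta> > 0" "C \<ge> 0"
    and "\<And>\<epsilon>. \<epsilon> \<in> eps_region r M \<delta> \<Longrightarrow> norm (f \<epsilon> - g \<epsilon>) \<le> C * eps_size r \<epsilon> \<and> norm (g \<epsilon>) \<le> C"
  shows "approx r M f g"
  using assms unfolding approx_def by blast

lemma eps_size_nonneg: "eps_size r \<epsilon> \<ge> 0"
  by (simp add: eps_size_def sum_nonneg)

lemma eps_region_mono: "\<delta> \<le> \<delta>' \<Longrightarrow> eps_region r M \<delta> \<subseteq> eps_region r M \<delta>'"
  by (force simp: eps_region_def)

lemma norm_tail_sum_le: "j \<in> {1..r} \<Longrightarrow> norm (tail_sum r \<epsilon> j) \<le> eps_size r \<epsilon>"
  unfolding tail_sum_def eps_size_def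
  by (rule order_trans[OF norm_sum]) (auto intro!: sum_mono2)

lemma eps_size_less:
  assumes "\<epsilon> \<in> eps_region r M \<delta>" "r \<ge> 1"
  shows "eps_size r \<epsilon> < r * \<delta>"
proof -
  have "(\<Sum>j=1..r. norm (\<epsilon> j)) < (\<Sum>j=1..r. \<delta>)"
    using assms by (intro sum_strict_mono) (auto simp: eps_region_def)
  then show ?thesis by (simp add: eps_size_def)
qed

lemma tail_sum_ratio:
  assumes \<epsilon>: "\<epsilon> \<in> eps_region r M \<delta>" and j: "1 \<le> j" "j < r" and M: "M > 0"
  shows "norm (tail_sum r \<epsilon> (Suc j)) \<le> real r * M * norm (tail_sum r \<epsilon> j)"
proof -
  have "norm (tail_sum r \<epsilon> (Suc j)) \<le> (\<Sum>i=Suc j..r. norm (\<epsilon> i))" unfolding tail_sum_def by (rule norm_sum)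
  also have "\<dots> \<le> (\<Sum>i=Suc j..r. M * norm (tail_sum r \<epsilon> j))"
    using \<epsilon> j by (intro sum_mono) (auto simp: eps_region_def)
  also have "\<dots> = real (r - j) * (M * norm (tail_sum r \<epsilon> j))" by simp
  also have "\<dots> \<le> real r * (M * norm (tail_sum r \<epsilon> j))" using M by (intro mult_right_mono) auto
  finally show ?thesis by (simp add: mult_ac)
qed

lemma approx_cong:
  assumes "approx r M f g" "\<delta> > 0" "\<And>\<epsilon>. \<epsilon> \<in> eps_region r M \<delta> \<Longrightarrow> f' \<epsilon> = f \<epsilon>" "\<And>\<epsilon>. \<epsilon> \<in> eps_region r M \<delta> \<Longrightarrow>
    g' \<epsilon> = g \<epsilon>"
  shows "approx r M f' g'"
proof -
  obtain \<delta>1 C where 1: "\<delta>1 > 0" "C \<ge> 0" "\<And>\<epsilon>. \<epsilon> \<in> eps_region r M \<delta>1 \<Longrightarrow> norm (f \<epsilon> - g \<epsilon>) \<le> C * eps_size r \<epsilon> \<and>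
    norm (g \<epsilon>) \<le> C"
    using assms(1) unfolding approx_def by blast
  have "norm (f' \<epsilon> - g' \<epsilon>) \<le> C * eps_size r \<epsilon> \<and> norm (g' \<epsilon>) \<le> C" if "\<epsilon> \<in> eps_region r M (min \<delta> \<delta>1)" for \<epsilon>
  proof -
    have "\<epsilon> \<in> eps_region r M \<delta>" "\<epsilon> \<in> eps_region r M \<delta>1"
      using that eps_region_mono[of "min \<delta> \<delta>1" \<delta> r M] eps_region_mono[of "min \<delta> \<delta>1" \<delta>1 r M] by auto
    then show ?thesis using assms(3,4) 1(3) by metis
  qed
  then show ?thesis using 1 assms(2) by (intro approxI[of "min \<delta> \<delta>1" C]) auto
qed

lemma approx_const: "approx r M (\<lambda>_. c) (\<lambda>_. c)"
  unfolding approx_def by (rule exI[of _ 1], rule conjI, simp, rule exI[of _ "norm c"])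
    (auto simp: eps_size_nonneg)

lemma approx_add:
  assumes "approx r M f g" "approx r M f' g'"
  shows "approx r M (\<lambda>\<epsilon>. f \<epsilon> + f' \<epsilon>) (\<lambda>\<epsilon>. g \<epsilon> + g' \<epsilon>)"
proof -
  obtain \<delta>1 C1 where 1: "\<delta>1 > 0" "C1 \<ge> 0" "\<And>\<epsilon>. \<epsilon> \<in> eps_region r M \<delta>1 \<Longrightarrow> norm (f \<epsilon> - g \<epsilon>) \<le> C1 * eps_size r \<epsilon> \<and>
    norm (g \<epsilon>) \<le> C1"
    using assms(1) unfolding approx_def by blast
  obtain \<delta>2 C2 where 2: "\<delta>2 > 0" "C2 \<ge> 0" "\<And>\<epsilon>. \<epsilon> \<in> eps_region r M \<delta>2 \<Longrightarrow> norm (f' \<epsilon> - g' \<epsilon>)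
    \<le> C2 * eps_size r \<epsilon> \<and> norm (g' \<epsilon>) \<le> C2"
    using assms(2) unfolding approx_def by blast
  have "norm (f \<epsilon> + f' \<epsilon> - (g \<epsilon> + g' \<epsilon>)) \<le> (C1 + C2) * eps_size r \<epsilon> \<and> norm (g \<epsilon> + g' \<epsilon>) \<le> C1 + C2"
    if \<epsilon>: "\<epsilon> \<in> eps_region r M (min \<delta>1 \<delta>2)" for \<epsilon>
  proof -
    have "\<epsilon> \<in> eps_region r M \<delta>1" "\<epsilon> \<in> eps_region r M \<delta>2"
      using \<epsilon> eps_region_mono[of "min \<delta>1 \<delta>2" \<delta>1 r M] eps_region_mono[of "min \<delta>1 \<delta>2" \<delta>2 r M] by auto
    with 1(3) 2(3) have b: "norm (f \<epsilon> - g \<epsilon>) \<le> C1 * eps_size r \<epsilon>" "norm (g \<epsilon>) \<le> C1"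
      "norm (f' \<epsilon> - g' \<epsilon>) \<le> C2 * eps_size r \<epsilon>" "norm (g' \<epsilon>) \<le> C2" by blast+
    have e: "f \<epsilon> + f' \<epsilon> - (g \<epsilon> + g' \<epsilon>) = (f \<epsilon> - g \<epsilon>) + (f' \<epsilon> - g' \<epsilon>)" by simp
    have "norm (f \<epsilon> + f' \<epsilon> - (g \<epsilon> + g' \<epsilon>)) \<le> C1 * eps_size r \<epsilon> + C2 * eps_size r \<epsilon>"
      unfolding e using b norm_triangle_ineq[of "f \<epsilon> - g \<epsilon>" "f' \<epsilon> - g' \<epsilon>"] by linarith
    moreover have "norm (g \<epsilon> + g' \<epsilon>) \<le> C1 + C2" using b norm_triangle_ineq[of "g \<epsilon>" "g' \<epsilon>"] by linarith
    ultimately show ?thesis by (simp add: distrib_right)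
  qed
  then show ?thesis using 1 2 by (intro approxI[of "min \<delta>1 \<delta>2" "C1 + C2"]) auto
qed

lemma approx_mult:
  assumes r: "r \<ge> 1" and fg: "approx r M f g" "approx r M f' g'"
  shows "approx r M (\<lambda>\<epsilon>. f \<epsilon> * f' \<epsilon>) (\<lambda>\<epsilon>. g \<epsilon> * g' \<epsilon>)"
proof -
  obtain \<delta>1 C1 where 1: "\<delta>1 > 0" "C1 \<ge> 0" "\<And>\<epsilon>. \<epsilon> \<in> eps_region r M \<delta>1 \<Longrightarrow> norm (f \<epsilon> - g \<epsilon>) \<le> C1 * eps_size r \<epsilon> \<and>
    norm (g \<epsilon>) \<le> C1"
    using fg(1) unfolding approx_def by blast
  obtain \<delta>2 C2 where 2: "\<delta>2 > 0" "C2 \<ge> 0" "\<And>\<epsilon>. \<epsilon> \<in> eps_region r M \<delta>2 \<Longrightarrow> norm (f' \<epsilon> - g' \<epsilon>)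
    \<le> C2 * eps_size r \<epsilon> \<and> norm (g' \<epsilon>) \<le> C2"
    using fg(2) unfolding approx_def by blast
  \<comment> \<open>Below \<open>1 / r\<close> the size of \<epsilon> is at most 1, so the product
    of the two errors is again of first order.\<close>
  define \<delta> where "\<delta> = min (min \<delta>1 \<delta>2) (1 / real r)"
  have "\<delta> \<le> 1 / real r" by (simp add: \<delta>_def)
  then have "real r * \<delta> \<le> 1" using r by (simp add: field_simps)
  then have \<delta>: "\<delta> > 0" "\<delta> \<le> \<delta>1" "\<delta> \<le> \<delta>2" "real r * \<delta> \<le> 1" using 1 2 r by (auto simp: \<delta>_def)
  have "norm (f \<epsilon> * f' \<epsilon> - g \<epsilon> * g' \<epsilon>) \<le> (3 * C1 * C2) * eps_size r \<epsilon> \<and> norm (g \<epsilon> * g' \<epsilon>) \<le> 3 * C1 * C2"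
    if \<epsilon>: "\<epsilon> \<in> eps_region r M \<delta>" for \<epsilon>
  proof -
    have "\<epsilon> \<in> eps_region r M \<delta>1" "\<epsilon> \<in> eps_region r M \<delta>2"
      using \<epsilon> eps_region_mono[OF \<delta>(2), of r M] eps_region_mono[OF \<delta>(3), of r M] by auto
    with 1(3) 2(3) have b: "norm (f \<epsilon> - g \<epsilon>) \<le> C1 * eps_size r \<epsilon>" "norm (g \<epsilon>) \<le> C1"
      "norm (f' \<epsilon> - g' \<epsilon>) \<le> C2 * eps_size r \<epsilon>" "norm (g' \<epsilon>) \<le> C2" by blast+
    have s: "0 \<le> eps_size r \<epsilon>" "eps_size r \<epsilon> \<le> 1"
      using eps_size_nonneg eps_size_less[OF \<epsilon> r] \<delta>(4) by (auto simp: less_imp_le)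
    have e: "f \<epsilon> * f' \<epsilon> - g \<epsilon> * g' \<epsilon> = (f \<epsilon> - g \<epsilon>) * (f' \<epsilon> - g' \<epsilon>)
      + ((f \<epsilon> - g \<epsilon>) * g' \<epsilon> + g \<epsilon> * (f' \<epsilon> - g' \<epsilon>))"
      by (simp add: algebra_simps)
    have "norm (f \<epsilon> * f' \<epsilon> - g \<epsilon> * g' \<epsilon>) \<le> norm ((f \<epsilon> - g \<epsilon>) * (f' \<epsilon> - g' \<epsilon>))
      + (norm ((f \<epsilon> - g \<epsilon>) * g' \<epsilon>) + norm (g \<epsilon> * (f' \<epsilon> - g' \<epsilon>)))"
      unfolding e by (rule order_trans[OF norm_triangle_ineq add_left_mono[OF norm_triangle_ineq]])
    also have "\<dots> \<le> (C1 * eps_size r \<epsilon>) * (C2 * 1) + ((C1 * eps_size r \<epsilon>) * C2 + C1 * (C2 * eps_size r \<epsilon>))"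
    proof (intro add_mono)
      have "norm (f' \<epsilon> - g' \<epsilon>) \<le> C2 * 1" using b(3) s(2) 2(2) by (meson mult_left_mono order_trans)
      then show "norm ((f \<epsilon> - g \<epsilon>) * (f' \<epsilon> - g' \<epsilon>)) \<le> (C1 * eps_size r \<epsilon>) * (C2 * 1)"
        unfolding norm_mult using b 1 s by (intro mult_mono) auto
      show "norm ((f \<epsilon> - g \<epsilon>) * g' \<epsilon>) \<le> (C1 * eps_size r \<epsilon>) * C2"
        unfolding norm_mult using b 1 s by (intro mult_mono) auto
      show "norm (g \<epsilon> * (f' \<epsilon> - g' \<epsilon>)) \<le> C1 * (C2 * eps_size r \<epsilon>)"
        unfolding norm_mult using b 1 s by (intro mult_mono) auto
    qed
    also have "\<dots> = (3 * C1 * C2) * eps_size r \<epsilon>" by (simp add: algebra_simps)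
    finally have A: "norm (f \<epsilon> * f' \<epsilon> - g \<epsilon> * g' \<epsilon>) \<le> (3 * C1 * C2) * eps_size r \<epsilon>" .
    have "norm (g \<epsilon> * g' \<epsilon>) \<le> C1 * C2" unfolding norm_mult using b 1 by (intro mult_mono) auto
    also have "\<dots> \<le> 3 * C1 * C2" using 1 2 by simp
    finally show ?thesis using A by simp
  qed
  then show ?thesis using \<delta>(1) 1 2 by (intro approxI[of \<delta> "3 * C1 * C2"]) auto
qed

lemma approx_sum:
  assumes "\<And>i. i \<in> A \<Longrightarrow> approx r M (f i) (g i)"
  shows "approx r M (\<lambda>\<epsilon>. \<Sum>i\<in>A. f i \<epsilon>) (\<lambda>\<epsilon>. \<Sum>i\<in>A. g i \<epsilon>)"
  using assms by (induction A rule: infinite_finite_induct) (auto intro: approx_const approx_add)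

lemma approx_prod:
  assumes "r \<ge> 1" "\<And>i. i \<in> A \<Longrightarrow> approx r M (f i) (g i)"
  shows "approx r M (\<lambda>\<epsilon>. \<Prod>i\<in>A. f i \<epsilon>) (\<lambda>\<epsilon>. \<Prod>i\<in>A. g i \<epsilon>)"
  using assms(2) by (induction A rule: infinite_finite_induct) (auto intro: approx_const approx_mult assms(1))

lemma approx_tail_sum_fun:
  assumes f: "f field_differentiable at 0" and j: "j \<in> {1..r}"
  shows "approx r M (\<lambda>\<epsilon>. f (tail_sum r \<epsilon> j)) (\<lambda>_. f 0)"
proof -
  obtain \<delta> C where d: "\<delta> > 0" "C \<ge> 0" "\<And>\<eta>. norm \<eta> < \<delta> \<Longrightarrow> norm (f \<eta> - f 0) \<le> C * norm \<eta>"
    using field_differentiable_Lipschitz_0[OF f] by blast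
  have r: "r \<ge> 1" using j by auto
  have "norm (f (tail_sum r \<epsilon> j) - f 0) \<le> max C (norm (f 0)) * eps_size r \<epsilon>"
    if \<epsilon>: "\<epsilon> \<in> eps_region r M (\<delta> / real r)" for \<epsilon>
  proof -
    have "norm (tail_sum r \<epsilon> j) < \<delta>"
      using norm_tail_sum_le[OF j, of \<epsilon>] eps_size_less[OF \<epsilon> r] r by simp
    then have "norm (f (tail_sum r \<epsilon> j) - f 0) \<le> C * norm (tail_sum r \<epsilon> j)" by (rule d(3))
    also have "\<dots> \<le> max C (norm (f 0)) * eps_size r \<epsilon>"
      using norm_tail_sum_le[OF j, of \<epsilon>] d(2) by (intro mult_mono) auto
    finally show ?thesis .
  qed
  then show ?thesis using d r by (intro approxI[of "\<delta> / real r" "max C (norm (f 0))"]) auto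
qed

text \<open>The ratio is compared with itself; the content is its boundedness, which comes from the
  hypothesis relating single \<epsilon> to tail sums.\<close>

lemma approx_ratio:
  assumes j: "1 \<le> j" "j < r" and M: "M > 0"
  shows "approx r M (\<lambda>\<epsilon>. tail_sum r \<epsilon> (Suc j) / tail_sum r \<epsilon> j) (\<lambda>\<epsilon>. tail_sum r \<epsilon> (Suc j) / tail_sum r \<epsilon> j)"
  unfolding approx_def
proof (rule exI[of _ 1], rule conjI, simp, rule exI[of _ "real r * M"], intro conjI ballI)
  fix \<epsilon> assume \<epsilon>: "\<epsilon> \<in> eps_region r M 1"
  have "tail_sum r \<epsilon> j \<noteq> 0" using \<epsilon> j by (auto simp: eps_region_def)
  then show "norm (tail_sum r \<epsilon> (Suc j) / tail_sum r \<epsilon> j) \<le> real r * M"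
    using tail_sum_ratio[OF \<epsilon> j M] by (simp add: norm_divide divide_le_eq)
qed (use M eps_size_nonneg in auto)

section \<open>Limits of the Gamma quotients\<close>

lemma rGamma_shift_field_differentiable: "(\<lambda>\<eta>. rGamma (c + \<eta>)) field_differentiable at (0::complex)"
proof -
  have "(\<lambda>\<eta>::complex. rGamma (c + \<eta>)) holomorphic_on UNIV" by (intro holomorphic_intros)
  then show ?thesis by (auto intro: holomorphic_on_imp_differentiable_at)
qed

lemma rGamma_of_nat_pos: "u > 0 \<Longrightarrow> rGamma (of_nat u :: complex) = 1 / fact (u - 1)"
  using Gamma_fact[of "u - 1", where 'a=complex]
    by (cases u) (auto simp: rGamma_inverse_Gamma divide_inverse add_ac)

lemma field_differentiable_inverse_0:
  "f field_differentiable at (0::complex) \<Longrightarrow> f 0 \<noteq> 0 \<Longrightarrow> (\<lambda>\<eta>. 1 / f \<eta>) field_differentiable at 0"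
  by (intro field_differentiable_divide field_differentiable_const)

text \<open>The Taylor multiplier of degree \<open>q\<close> of the \<open>j\<close>-th average,
  divided by \<open>rGamma\<close> of \<sigma>_(j+1) and multiplied by a ratio of tail sums. Over
  all \<open>j\<close> these ratios telescope to \<epsilon>(r,r)/\<epsilon>(1,r), the simple zeros
  of 1/\<Gamma>(s_r) over 1/\<Gamma>(\<sigma>_1).\<close>

definition Gamma_quot :: "nat \<Rightarrow> (nat \<Rightarrow> nat) \<Rightarrow> nat \<Rightarrow> nat \<Rightarrow> (nat \<Rightarrow> complex) \<Rightarrow> complex" where
  "Gamma_quot r l j q \<epsilon> = tail_sum r \<epsilon> (Suc j) / tail_sum r \<epsilon> j *
     (rGamma (of_nat q - of_nat ((\<Sum>k=j..r. l k) + (r - j)) + tail_sum r \<epsilon> j) /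
      rGamma (of_nat q - of_nat ((\<Sum>k=Suc j..r. l k) + (r - j)) + tail_sum r \<epsilon> (Suc j)))"

text \<open>The first two cases are the factors \<open>h_factor\<close> for \<open>d = 0\<close> and
  \<open>d = 1\<close>; the value 0 covers the degrees that belong to neither index set.\<close>

definition Gamma_quot_limit :: "nat \<Rightarrow> (nat \<Rightarrow> nat) \<Rightarrow> nat \<Rightarrow> nat \<Rightarrow> (nat \<Rightarrow> complex) \<Rightarrow> complex" where
  "Gamma_quot_limit r l j q \<epsilon> =
     (if q \<le> (\<Sum>k=Suc j..r. l k) + (r - j) then
        (-1) ^ l j * fact ((\<Sum>k=j..r. l k) + (r - j) - q) / fact ((\<Sum>k=Suc j..r. l k) + (r - j) - q)
      else if (\<Sum>k=j..r. l k) + (r - j) < q then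
        tail_sum r \<epsilon> (Suc j) / tail_sum r \<epsilon> j *
          (fact (q - (\<Sum>k=Suc j..r. l k) - (r - j) - 1) / fact (q - (\<Sum>k=j..r. l k) - (r - j) - 1))
      else 0)"

text \<open>For small \<open>q\<close> both reciprocal Gamma values have simple zeros, and these
  cancel the ratio of tail sums. For large \<open>q\<close> neither vanishes and the ratio survives.
  In between only the numerator vanishes; its zero cancels \<epsilon>(j,r), and the remaining factor
  \<epsilon>(j+1,r) is an error term.\<close>

lemma approx_Gamma_quot:
  assumes j: "1 \<le> j" "j < r" and M: "M > 0"
  shows "approx r M (Gamma_quot r l j q) (Gamma_quot_limit r l j q)"
proof -
  define t where "t = (\<Sum>k=Suc j..r. l k) + (r - j)"
  have t: "(\<Sum>k=j..r. l k) + (r - j) = t + l j"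
  proof -
    have "{j..r} = insert j {Suc j..r}" using j by auto
    then show ?thesis by (simp add: t_def)
  qed
  have jj: "j \<in> {1..r}" "Suc j \<in> {1..r}" "r \<ge> 1" using j by auto
  let ?e = "\<lambda>\<epsilon>. tail_sum r \<epsilon> j" and ?e' = "\<lambda>\<epsilon>. tail_sum r \<epsilon> (Suc j)"
  have nz: "?e \<epsilon> \<noteq> 0" "?e' \<epsilon> \<noteq> 0" if "\<epsilon> \<in> eps_region r M 1" for \<epsilon>
    using that jj by (auto simp: eps_region_def)
  have Q: "Gamma_quot r l j q \<epsilon>
    = ?e' \<epsilon> / ?e \<epsilon> * (rGamma (of_nat q - of_nat (t + l j) + ?e \<epsilon>) / rGamma (of_nat q - of_nat t + ?e' \<epsilon>))"
    for \<epsilon>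
    unfolding Gamma_quot_def t t_def[symmetric] ..
  consider "q \<le> t" | "t + l j < q" | "t < q" "q \<le> t + l j" by linarith
  then show ?thesis
  proof cases
    case 1
    define u where "u = t - q"
    have u: "of_nat q - of_nat t = - (of_nat u :: complex)" "of_nat q - of_nat (t + l j)
      = - (of_nat (u + l j) :: complex)"
      using 1 by (auto simp: u_def of_nat_diff)
    have "approx r M (\<lambda>\<epsilon>. rGamma_rest (u + l j) (?e \<epsilon>) * (1 / rGamma_rest u (?e' \<epsilon>)))
       (\<lambda>\<epsilon>. rGamma_rest (u + l j) 0 * (1 / rGamma_rest u 0))"
      by (intro approx_mult jj approx_tail_sum_fun rGamma_rest_field_differentiable
          approx_tail_sum_fun[where f="\<lambda>\<eta>. 1 / rGamma_rest u \<eta>"]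
            field_differentiable_inverse_0 rGamma_rest_0_nonzero)
    then show ?thesis
    proof (rule approx_cong[of _ _ _ _ 1])
      fix \<epsilon> assume \<epsilon>: "\<epsilon> \<in> eps_region r M 1"
      show "Gamma_quot r l j q \<epsilon> = rGamma_rest (u + l j) (?e \<epsilon>) * (1 / rGamma_rest u (?e' \<epsilon>))"
        unfolding Q u rGamma_near_neg_nat using nz[OF \<epsilon>] by simp
      have "t + l j - q = u + l j" using 1 by (simp add: u_def)
      then show "Gamma_quot_limit r l j q \<epsilon> = rGamma_rest (u + l j) 0 * (1 / rGamma_rest u 0)"
        unfolding Gamma_quot_limit_def t t_def[symmetric] using 1
        by (simp add: rGamma_rest_0 u_def[symmetric] power_add)
    qed simp
  next
    case 2
    define u where "u = q - t - l j"
    have u: "of_nat q - of_nat t = (of_nat (u + l j) :: complex)" "of_nat q - of_nat (t + l j)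
      = (of_nat u :: complex)" "u > 0"
      using 2 by (auto simp: u_def of_nat_diff)
    have n0: "rGamma (of_nat (u + l j) + 0 :: complex) \<noteq> 0"
      using rGamma_of_nat_pos[of "u + l j"] u(3) by (simp add: add_ac)
    have "approx r M (\<lambda>\<epsilon>. ?e' \<epsilon> / ?e \<epsilon> * (rGamma (of_nat u + ?e \<epsilon>) * (1 / rGamma (of_nat (u + l j) + ?e' \<epsilon>))))
       (\<lambda>\<epsilon>. ?e' \<epsilon> / ?e \<epsilon> * (rGamma (of_nat u + 0) * (1 / rGamma (of_nat (u + l j) + 0))))"
      by (intro approx_mult jj approx_ratio j M approx_tail_sum_fun[where f="\<lambda>\<eta>. rGamma (of_nat u + \<eta>)"]
        rGamma_shift_field_differentiable
          approx_tail_sum_fun[where f="\<lambda>\<eta>. 1 / rGamma (of_nat (u + l j) + \<eta>)"]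
            field_differentiable_inverse_0 n0)
    then show ?thesis
    proof (rule approx_cong[of _ _ _ _ 1])
      fix \<epsilon> assume \<epsilon>: "\<epsilon> \<in> eps_region r M 1"
      show "Gamma_quot r l j q \<epsilon>
        = ?e' \<epsilon> / ?e \<epsilon> * (rGamma (of_nat u + ?e \<epsilon>) * (1 / rGamma (of_nat (u + l j) + ?e' \<epsilon>)))"
        unfolding Q u(1,2) by simp
      have e: "q - (\<Sum>k=Suc j..r. l k) - (r - j) - 1 = u + l j - 1" "q - (\<Sum>k=j..r. l k) - (r - j) - 1 = u - 1"
        using 2 t unfolding u_def t_def by linarith+
      show "Gamma_quot_limit r l j q \<epsilon>
        = ?e' \<epsilon> / ?e \<epsilon> * (rGamma (of_nat u + 0) * (1 / rGamma (of_nat (u + l j) + 0)))"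
        unfolding Gamma_quot_limit_def t t_def[symmetric] e using 2 u(3)
        by (simp only: add_0_right rGamma_of_nat_pos[OF u(3)] rGamma_of_nat_pos[OF trans_less_add1[OF u(3)]])
          simp
    qed simp
  next
    case 3
    define u where "u = t + l j - q"
    define w where "w = q - t"
    have u: "of_nat q - of_nat t = (of_nat w :: complex)" "of_nat q - of_nat (t + l j)
      = - (of_nat u :: complex)" "w > 0"
      using 3 by (auto simp: u_def w_def of_nat_diff)
    have n0: "rGamma (of_nat w + 0 :: complex) \<noteq> 0" using rGamma_of_nat_pos[OF u(3)] by simp
    have "approx r M (\<lambda>\<epsilon>. ?e' \<epsilon> * (rGamma_rest u (?e \<epsilon>) * (1 / rGamma (of_nat w + ?e' \<epsilon>))))
       (\<lambda>\<epsilon>. 0 * (rGamma_rest u 0 * (1 / rGamma (of_nat w + 0))))"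
      by (intro approx_mult jj approx_tail_sum_fun[where f="\<lambda>\<eta>. \<eta>"]
        approx_tail_sum_fun[where f="rGamma_rest u"] rGamma_rest_field_differentiable
          approx_tail_sum_fun[where f="\<lambda>\<eta>. 1 / rGamma (of_nat w + \<eta>)"] field_differentiable_inverse_0
          rGamma_shift_field_differentiable n0 field_differentiable_ident)
    then show ?thesis
    proof (rule approx_cong[of _ _ _ _ 1])
      fix \<epsilon> assume \<epsilon>: "\<epsilon> \<in> eps_region r M 1"
      show "Gamma_quot r l j q \<epsilon> = ?e' \<epsilon> * (rGamma_rest u (?e \<epsilon>) * (1 / rGamma (of_nat w + ?e' \<epsilon>)))"
        unfolding Q u(1,2) rGamma_near_neg_nat using nz[OF \<epsilon>] by simp
      show "Gamma_quot_limit r l j q \<epsilon> = 0 * (rGamma_rest u 0 * (1 / rGamma (of_nat w + 0)))"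
        unfolding Gamma_quot_limit_def t t_def[symmetric] using 3 by simp
    qed simp
  qed
qed

section \<open>Taylor coefficients and the remainder\<close>

definition compositions :: "nat \<Rightarrow> nat \<Rightarrow> nat \<Rightarrow> (nat \<Rightarrow> nat) set" where
  "compositions m r q = {n \<in> {m..r} \<rightarrow>\<^sub>E UNIV. (\<Sum>k=m..r. n k) = q}"

lemma finite_compositions: "finite (compositions m r q)"
proof (rule finite_subset)
  show "compositions m r q \<subseteq> {m..r} \<rightarrow>\<^sub>E {..q}"
  proof
    fix n assume n: "n \<in> compositions m r q"
    have "n k \<le> q" if "k \<in> {m..r}" for k
    proof -
      have "n k \<le> (\<Sum>k=m..r. n k)" by (rule member_le_sum) (use that in auto)
      then show ?thesis using n by (simp add: compositions_def)
    qed
    then show "n \<in> {m..r} \<rightarrow>\<^sub>E {..q}" using n by (auto simp: compositions_def PiE_iff)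
  qed
qed (auto intro: finite_PiE)

lemma compositions_single: "compositions r r q = {\<lambda>k\<in>{r}. q}"
  by (auto simp: compositions_def PiE_iff extensional_def fun_eq_iff restrict_def)

text \<open>The combinatorial side of a Cauchy product: the first part \<open>n m\<close> is split
  off as the degree of one factor, and \<open>g\<close> ignores it.\<close>

lemma sum_compositions_rec:
  fixes f :: "nat \<Rightarrow> nat \<Rightarrow> complex"
  assumes m: "m < r" and g: "\<And>n i. g (n(m := i)) = g n"
  shows "(\<Sum>i=0..q. f i (q - i) * (\<Sum>n\<in>compositions (Suc m) r (q - i). g n))
       = (\<Sum>n\<in>compositions m r q. f (n m) (\<Sum>k=Suc m..r. n k) * g n)"
proof -
  have e: "{m..r} = insert m {Suc m..r}" using m by auto
  have "(\<Sum>i=0..q. f i (q - i) * (\<Sum>n\<in>compositions (Suc m) r (q - i). g n))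
      = (\<Sum>(i, n)\<in>(SIGMA i:{0..q}. compositions (Suc m) r (q - i)). f i (q - i) * g n)"
    unfolding sum_distrib_left by (rule sum.Sigma) (auto intro: finite_compositions)
  also have "\<dots> = (\<Sum>n\<in>compositions m r q. f (n m) (\<Sum>k=Suc m..r. n k) * g n)"
  proof (rule sum.reindex_bij_witness[where i="\<lambda>n. (n m, restrict n {Suc m..r})" and j="\<lambda>(i, n). n(m := i)"])
    fix p assume p: "p \<in> (SIGMA i:{0..q}. compositions (Suc m) r (q - i))"
    obtain i n where pe: "p = (i, n)" "i \<le> q" "n \<in> compositions (Suc m) r (q - i)" using p by auto
    have ext: "n \<in> extensional {Suc m..r}" and sm: "(\<Sum>k=Suc m..r. n k) = q - i"
      using pe(3) by (auto simp: compositions_def PiE_iff)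
    have r1: "restrict (n(m := i)) {Suc m..r} = n"
      using ext by (auto simp: fun_eq_iff extensional_def restrict_def)
    have s1: "(\<Sum>k=Suc m..r. (n(m := i)) k) = q - i"
      unfolding sm[symmetric] by (rule sum.cong) auto
    show "(\<lambda>n. (n m, restrict n {Suc m..r})) (case p of (i, n) \<Rightarrow> n(m := i)) = p"
      using r1 pe by simp
    show "(case p of (i, n) \<Rightarrow> n(m := i)) \<in> compositions m r q"
      using pe ext s1 unfolding compositions_def e by (auto simp: PiE_iff extensional_def)
    show "f ((case p of (i, n) \<Rightarrow> n(m := i)) m) (\<Sum>k=Suc m..r. (case p of (i, n) \<Rightarrow> n(m := i)) k)
      * g (case p of (i, n) \<Rightarrow> n(m := i))
        = (case p of (i, n) \<Rightarrow> f i (q - i) * g n)"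
      using s1 pe g by simp
  next
    fix n assume n: "n \<in> compositions m r q"
    then have ext: "n \<in> extensional {m..r}" and sm: "n m + (\<Sum>k=Suc m..r. n k) = q"
      unfolding compositions_def e by (auto simp: PiE_iff)
    show "(case (n m, restrict n {Suc m..r}) of (i, n) \<Rightarrow> n(m := i)) = n"
      using ext by (auto simp: fun_eq_iff extensional_def restrict_def)
    show "(n m, restrict n {Suc m..r}) \<in> (SIGMA i:{0..q}. compositions (Suc m) r (q - i))"
      using sm by (auto simp: compositions_def)
  qed
  finally show ?thesis .
qed

definition ek_coeff :: "complex \<Rightarrow> complex \<Rightarrow> nat \<Rightarrow> complex" where
  "ek_coeff \<sigma> s q = pochhammer \<sigma> q * rGamma (\<sigma> + s + of_nat q)"

text \<open>Each level multiplies by a kernel, which is a Leibniz sum, and applies an average, which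
  is diagonal on Taylor coefficients. The \<open>j\<close>-th average acts in the degree already
  used by the inner kernels, namely the sum of the parts after \<open>j\<close>.\<close>

lemma nest_higher_deriv_0:
  assumes h: "\<And>j. j \<in> {1..r} \<Longrightarrow> exp_bounded (- Re (a j)) \<rho> (lker (a j) (z j))" and \<rho>: "0 < \<rho>"
    and \<sigma>: "\<And>j. j \<in> {1..r} \<Longrightarrow> Re (\<sigma> j) > - real N" and s: "\<And>j. j \<in> {1..<r} \<Longrightarrow> Re (s j) > - real N"
    and k: "k < r"
  shows "(deriv ^^ q) (nest N r a z \<sigma> s k) 0 / fact q =
    (\<Sum>n\<in>compositions (r - k) r q.
       (\<Prod>j=r-k..r. (-1) ^ n j * (apostol_bernoulli (n j) (a j) (z j) / fact (n j))) *
       (\<Prod>j\<in>{r-k..<r}. ek_coeff (\<sigma> (Suc j)) (s j) (\<Sum>i=Suc j..r. n i)))"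
  using k
proof (induction k arbitrary: q)
  case 0
  have "(deriv ^^ q) (lker (a r) (z r)) 0 / fact q = (-1) ^ q * (apostol_bernoulli q (a r) (z r) / fact q)"
    by (rule lker_higher_deriv_0[OF exp_boundedD[OF h] \<rho>]) (use 0 in auto)
  then show ?case by (simp add: compositions_single)
next
  case (Suc k)
  define m where "m = r - Suc k"
  have m: "r - k = Suc m" "1 \<le> m" "m < r" using Suc.prems by (auto simp: m_def)
  have mr: "m \<in> {1..r}" "Suc m \<in> {1..r}" "m \<in> {1..<r}" using m by auto
  define G where "G = lker (a m) (z m)"
  define \<phi> where "\<phi> = nest N r a z \<sigma> s k"
  define H where "H = ek N \<phi> (\<sigma> (Suc m)) (s m)"
  have eb: "exp_bounded (nest_exponent r a k) \<rho> \<phi>"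
    unfolding \<phi>_def
    by (rule nest_family[where z="\<lambda>_. z" and \<sigma>="\<lambda>_. \<sigma>" and s="\<lambda>_. s"])
       (use h \<sigma> s Suc.prems in \<open>auto intro: param_hol_const\<close>)
  have hG: "G holomorphic_on strip \<rho>" unfolding G_def by (rule exp_boundedD[OF h[OF mr(1)]])
  have hH: "H holomorphic_on strip \<rho>" unfolding H_def
    by (rule exp_boundedD[OF exp_bounded_ek[OF eb \<sigma>[OF mr(2)] s[OF mr(3)]]])
  have dG: "(deriv ^^ i) G 0 / fact i = (-1) ^ i * (apostol_bernoulli i (a m) (z m) / fact i)" for i
    unfolding G_def by (rule lker_higher_deriv_0[OF hG[unfolded G_def] \<rho>])
  define X where "X n = (\<Prod>j=Suc m..r. (-1) ^ n j * (apostol_bernoulli (n j) (a j) (z j) / fact (n j))) *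
       (\<Prod>j\<in>{Suc m..<r}. ek_coeff (\<sigma> (Suc j)) (s j) (\<Sum>i=Suc j..r. n i))" for n :: "nat \<Rightarrow> nat"
  have dH: "(deriv ^^ i) H 0 / fact i = ek_coeff (\<sigma> (Suc m)) (s m) i * (\<Sum>n\<in>compositions (Suc m) r i. X n)"
    for i
  proof -
    have "(deriv ^^ i) H 0 / fact i = ek_coeff (\<sigma> (Suc m)) (s m) i * ((deriv ^^ i) \<phi> 0 / fact i)"
      unfolding H_def ek_coeff_def by (subst ek_higher_deriv_0[OF eb \<rho> \<sigma>[OF mr(2)] s[OF mr(3)]]) simp
    then show ?thesis using Suc.IH[of i] Suc.prems unfolding \<phi>_def m(1) X_def by simp
  qed
  have "(deriv ^^ q) (nest N r a z \<sigma> s (Suc k)) 0 / fact q = (deriv ^^ q) (\<lambda>U. G U * H U) 0 / fact q"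
    unfolding G_def H_def \<phi>_def nest.simps(2) m_def[symmetric] m(1) ..
  also have "\<dots> = (\<Sum>i=0..q. of_nat (q choose i) * (deriv ^^ i) G 0 * (deriv ^^ (q - i)) H 0) / fact q"
    by (subst higher_deriv_mult[OF hG hH open_strip]) (use \<rho> in auto)
  also have "\<dots> = (\<Sum>i=0..q. ((deriv ^^ i) G 0 / fact i) * ((deriv ^^ (q - i)) H 0 / fact (q - i)))"
    unfolding sum_divide_distrib
  proof (rule sum.cong[OF refl])
    fix i assume "i \<in> {0..q}"
    then have "of_nat (q choose i) = (fact q / (fact i * fact (q - i)) :: complex)"
      by (intro binomial_fact) auto
    then show "of_nat (q choose i) * (deriv ^^ i) G 0 * (deriv ^^ (q - i)) H 0 / fact q =
       ((deriv ^^ i) G 0 / fact i) * ((deriv ^^ (q - i)) H 0 / fact (q - i))" by simp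
  qed
  also have "\<dots> = (\<Sum>i=0..q. ((-1) ^ i * (apostol_bernoulli i (a m) (z m) / fact i) * ek_coeff (\<sigma> (Suc m)) (s m)
    (q - i))
       * (\<Sum>n\<in>compositions (Suc m) r (q - i). X n))"
    unfolding dG dH by (simp add: mult_ac)
  also have "\<dots> = (\<Sum>n\<in>compositions m r q. ((-1) ^ n m * (apostol_bernoulli (n m) (a m) (z m) / fact (n m)) *
        ek_coeff (\<sigma> (Suc m)) (s m) (\<Sum>k=Suc m..r. n k)) * X n)"
  proof (rule sum_compositions_rec[OF m(3), where f="\<lambda>i q. (-1) ^ i
    * (apostol_bernoulli i (a m) (z m) / fact i) * ek_coeff (\<sigma> (Suc m)) (s m) q"])
    fix n :: "nat \<Rightarrow> nat" and i :: nat
    have "(\<Sum>i'=Suc j..r. (n(m := i)) i') = (\<Sum>i=Suc j..r. n i)" if "j \<ge> m" for j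
      using that by (intro sum.cong) auto
    then show "X (n(m := i)) = X n" unfolding X_def by (intro arg_cong2[where f="(*)"] prod.cong) auto
  qed
  also have "\<dots> = (\<Sum>n\<in>compositions m r q.
       (\<Prod>j=m..r. (-1) ^ n j * (apostol_bernoulli (n j) (a j) (z j) / fact (n j))) *
       (\<Prod>j\<in>{m..<r}. ek_coeff (\<sigma> (Suc j)) (s j) (\<Sum>i=Suc j..r. n i)))"
  proof -
    have "{m..r} = insert m {Suc m..r}" "{m..<r} = insert m {Suc m..<r}" using m by auto
    then show ?thesis unfolding X_def by (simp add: mult_ac)
  qed
  finally show ?case unfolding m_def .
qed

section \<open>The remainder of the Mellin transform\<close>

lemma nest_cong:
  assumes "k < r" "\<And>j. j \<in> {1..r} \<Longrightarrow> z j = z' j" "\<And>j. j \<in> {1..r} \<Longrightarrow> \<sigma> j = \<sigma>' j"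
    "\<And>j. j \<in> {1..<r} \<Longrightarrow> s j = s' j"
  shows "nest N r a z \<sigma> s k = nest N r a z' \<sigma>' s' k"
  using assms(1)
proof (induction k)
  case 0
  then show ?case using assms(2) by simp
next
  case (Suc k)
  have "nest N r a z \<sigma> s k = nest N r a z' \<sigma>' s' k" using Suc by simp
  moreover have "z (r - Suc k) = z' (r - Suc k)" "\<sigma> (r - k) = \<sigma>' (r - k)" "s (r - Suc k) = s' (r - Suc k)"
    using Suc.prems by (auto intro!: assms)
  ultimately show ?case by (simp only: nest.simps)
qed

lemma ek_zero:
  assumes "\<And>u. u \<in> strip \<rho> \<Longrightarrow> \<phi> u = 0" "U \<in> strip \<rho>"
  shows "ek N \<phi> \<sigma> s U = 0"
  using assms(1)
proof (induction N arbitrary: \<phi> \<sigma> s)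
  case 0
  have "(LINT t:{0<..<1}|lborel. \<phi> (of_real t * U) * beta_ker \<sigma> s t)
    = (LINT t:{0<..<(1::real)}|lborel. (0::complex))"
    using 0 scale_in_strip[OF assms(2)] by (intro set_lebesgue_integral_cong) auto
  then show ?case by simp
next
  case (Suc N)
  have d: "deriv \<phi> u = 0" if u: "u \<in> strip \<rho>" for u
  proof -
    have "eventually (\<lambda>w. w \<in> strip \<rho>) (nhds u)" using u by (intro eventually_nhds_in_open) auto
    then have "eventually (\<lambda>w. \<phi> w = (\<lambda>_. 0) w) (nhds u)" by (rule eventually_mono) (use Suc.prems in auto)
    then have "deriv \<phi> u = deriv (\<lambda>_. 0) u" by (rule deriv_cong_ev) simp
    then show ?thesis by simp
  qed
  have e: "u * deriv \<phi> u = 0" if "u \<in> strip \<rho>" for u using d[OF that] by simp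
  have "ek N \<phi> \<sigma>' s' U = 0" "ek N (deriv \<phi>) \<sigma>' s' U = 0" "ek N (\<lambda>u. u * deriv \<phi> u) \<sigma>' s' U = 0" for \<sigma>' s'
    using Suc.IH[of \<phi> \<sigma>' s'] Suc.IH[of "deriv \<phi>" \<sigma>' s'] Suc.IH[of "\<lambda>u. u * deriv \<phi> u" \<sigma>' s'] Suc.prems d e
      by blast+
  then show ?case unfolding ek.simps(2) by simp
qed

lemma higher_deriv_zero_strip:
  assumes "\<And>u. u \<in> strip \<rho> \<Longrightarrow> \<phi> u = 0" "U \<in> strip \<rho>"
  shows "(deriv ^^ K) \<phi> U = 0"
proof -
  have "eventually (\<lambda>w. w \<in> strip \<rho>) (nhds U)" using assms by (intro eventually_nhds_in_open) auto
  then have "eventually (\<lambda>w. \<phi> w = (\<lambda>_. 0) w) (nhds U)" by (rule eventually_mono) (use assms in auto)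
  then have "(deriv ^^ K) \<phi> U = (deriv ^^ K) (\<lambda>_. 0) U" by (rule higher_deriv_cong_ev) simp
  then show ?thesis by simp
qed

lemma mellin_zero:
  assumes "\<And>u. u \<in> strip \<rho> \<Longrightarrow> \<phi> u = 0" "0 < \<rho>"
  shows "mellin N \<phi> \<sigma> = 0"
  using assms(1)
proof (induction N arbitrary: \<phi> \<sigma>)
  case 0
  have "(LINT u:{0<..}|lborel. \<phi> (of_real u) * of_real u powr (\<sigma> - 1))
    = (LINT u:{0::real<..}|lborel. (0::complex))"
    using 0 assms(2) by (intro set_lebesgue_integral_cong) auto
  then show ?case by simp
next
  case (Suc N)
  have "deriv \<phi> u = 0" if u: "u \<in> strip \<rho>" for u
    using higher_deriv_zero_strip[OF Suc.prems u, where K=1] by simp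
  from Suc.IH[OF this] show ?case by simp
qed

text \<open>Once one average vanishes identically on the strip, every outer level is built from the
  zero function.\<close>

lemma nest_zero:
  assumes eb: "exp_bounded (nest_exponent r a k) \<rho> (nest N r a z \<sigma> s k)"
    and v: "\<sigma> (r - k) = - of_nat m" "s (r - Suc k) = - of_nat m'" "m < N" "m' < N"
    and k': "k < k'" and U: "U \<in> strip \<rho>"
  shows "nest N r a z \<sigma> s k' U = 0"
  using k' U
proof (induction k' arbitrary: U)
  case (Suc k')
  show ?case
  proof (cases "k' = k")
    case True
    then show ?thesis using ek_vanishes[OF eb Suc.prems(2) v(3,4)] v(1,2) by simp
  next
    case False
    then have "nest N r a z \<sigma> s k' u = 0" if "u \<in> strip \<rho>" for u using Suc that by auto
    from ek_zero[OF this Suc.prems(2)] show ?thesis by simp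
  qed
qed simp

text \<open>Arbitrary directions are needed because one polydisc variable will move \<sigma>_j and
  s_(j-1) together.\<close>

definition affine_curves :: "(complex \<Rightarrow> 'i \<Rightarrow> complex) set" where
  "affine_curves = {\<lambda>w i. p i + w * q i | p q. True}"

lemma continuous_affine_curves: "c \<in> affine_curves \<Longrightarrow> continuous_on UNIV c"
  unfolding affine_curves_def
  by (auto intro!: continuous_on_coordinatewise_then_product continuous_intros)

lemma param_hol_affine_proj: "param_hol X affine_curves (\<lambda>x. x i)"
  unfolding param_hol_def curve_hol_def
proof (intro conjI ballI allI impI)
  show "continuous_on X (\<lambda>x. x i)" by (rule continuous_on_product_then_coordinatewise[OF continuous_on_id])
  fix c :: "complex \<Rightarrow> 'a \<Rightarrow> complex" and W assume "c \<in> affine_curves"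
  then obtain p q where c: "c = (\<lambda>w i. p i + w * q i)" unfolding affine_curves_def by auto
  show "(\<lambda>w. c w i) holomorphic_on W" unfolding c by (intro holomorphic_intros)
qed

text \<open>Tychonoff's theorem, also for infinitely many coordinates; it bounds the remainder near
  the base point without any explicit estimate.\<close>

lemma compact_polydisc: "compact {x :: 'i \<Rightarrow> complex. \<forall>i. norm (x i - c i) \<le> 1}"
proof -
  have "{x. \<forall>i. norm (x i - c i) \<le> 1} = PiE UNIV (\<lambda>i. cball (c i) 1)"
    by (auto simp: PiE_iff dist_norm norm_minus_commute)
  moreover have "compactin (product_topology (\<lambda>i. euclidean) UNIV) (PiE UNIV (\<lambda>i. cball (c i) 1))"
    by (simp add: compactin_PiE)
  ultimately show ?thesis by (simp add: euclidean_product_topology)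
qed

text \<open>Where \<eta>_j and \<xi>_(j-1) vanish together the zero set has codimension two, out of
  reach of a one-variable Schwarz lemma. Fixing the direction of the pair (\<eta>_j, \<xi>_(j-1))
  and moving only its size, the variable \<open>v j\<close>, turns this into vanishing at
  \<open>v j = 0\<close>.\<close>

lemma remainder_bound:
  fixes l :: "nat \<Rightarrow> nat"
  assumes r: "r \<ge> 1" and a: "\<And>j. j \<in> {1..r} \<Longrightarrow> Re (\<Sum>k=1..j. a k) > 0"
    and h: "\<And>(X :: (nat + nat \<Rightarrow> complex) set) j. j \<in> {1..r} \<Longrightarrow>
      hol_family X affine_curves (- Re (a j)) \<rho> (\<lambda>x. lker (a j) (z j))"
    and \<rho>: "0 < \<rho>"
    and N: "\<And>j. j \<in> {1..r} \<Longrightarrow> m j + 1 < N" "\<And>j. j \<in> {1..<r} \<Longrightarrow> l j + 1 < N"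
  shows "\<exists>B\<ge>0. \<forall>\<eta> \<xi>. (\<forall>j\<in>{1..r}. norm (\<eta> j) + norm (\<xi> (j - 1)) < 1) \<longrightarrow> (\<forall>j\<in>{1..r}. \<eta> j \<noteq> 0) \<longrightarrow>
    (let \<phi> = nest N r a z (\<lambda>j. - of_nat (m j) + \<eta> j) (\<lambda>j. - of_nat (l j) + \<xi> j) (r - 1) in
     norm (mellin N \<phi> (- of_nat (m 1) + \<eta> 1) - (-1) ^ m 1 * (deriv ^^ m 1) \<phi> 0)
       \<le> B * (norm (\<eta> 1) * (\<Prod>j=2..r. norm (\<eta> j) + norm (\<xi> (j - 1)))))"
proof -
  define base where "base = case_sum (\<lambda>j. - of_nat (m j) :: complex) (\<lambda>j. - of_nat (l j))"
  define X where "X = {x :: nat + nat \<Rightarrow> complex. \<forall>i. norm (x i - base i) \<le> 1}"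
  define F where "F x = nest N r a z (\<lambda>j. x (Inl j)) (\<lambda>j. x (Inr j)) (r - 1)" for x :: "nat + nat \<Rightarrow> complex"
  define \<Phi> where "\<Phi> x = mellin N (F x) (x (Inl 1)) - (-1) ^ m 1 * (deriv ^^ m 1) (F x) 0" for x
  have XRe: "Re (x (Inl j)) > - real N" if "x \<in> X" "j \<in> {1..r}" for x j
  proof -
    have "norm (x (Inl j) - base (Inl j)) \<le> 1" using that(1) by (auto simp: X_def)
    then have "\<bar>Re (x (Inl j)) + real (m j)\<bar> \<le> 1" using abs_Re_le_cmod[of "x (Inl j) - base (Inl j)"]
      by (simp add: base_def)
    moreover have "real (m j) + 1 < real N" using N(1)[OF that(2)] by linarith
    ultimately show ?thesis by linarith
  qed
  have XRe': "Re (x (Inr j)) > - real N" if "x \<in> X" "j \<in> {1..<r}" for x j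
  proof -
    have "norm (x (Inr j) - base (Inr j)) \<le> 1" using that(1) by (auto simp: X_def)
    then have "\<bar>Re (x (Inr j)) + real (l j)\<bar> \<le> 1" using abs_Re_le_cmod[of "x (Inr j) - base (Inr j)"]
      by (simp add: base_def)
    moreover have "real (l j) + 1 < real N" using N(2)[OF that(2)] by linarith
    ultimately show ?thesis by linarith
  qed
  have nf: "hol_family X affine_curves (nest_exponent r a k) \<rho>
    (\<lambda>x. nest N r a z (\<lambda>j. x (Inl j)) (\<lambda>j. x (Inr j)) k)" if "k < r" for k
    using that by (intro nest_family[where z="\<lambda>_. z"] continuous_affine_curves h param_hol_affine_proj XRe
      XRe')
  have F: "hol_family X affine_curves (nest_exponent r a (r - 1)) \<rho> F"
    unfolding F_def[abs_def] using r by (intro nf) auto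
  have neg: "nest_exponent r a (r - 1) < 0" using nest_exponent_less[OF a, of r "r - 1"] r by simp
  have dF: "hol_family X affine_curves (nest_exponent r a (r - 1)) \<rho> (\<lambda>x. (deriv ^^ k) (F x))" for k
    by (induction k) (use F in \<open>auto intro: hol_family_deriv continuous_affine_curves\<close>)
  have ph: "param_hol X affine_curves \<Phi>"
    unfolding \<Phi>_def[abs_def] using \<rho> r
    by (intro param_hol_binary(2) param_hol_binary(3) param_hol_const hol_family_param[OF dF]
          param_hol_mellin[OF continuous_affine_curves F param_hol_affine_proj neg \<rho>] XRe) auto
  have "compact (\<Phi> ` X)"
    using ph compact_polydisc[of base] unfolding param_hol_def X_def by (intro compact_continuous_image) auto
  then obtain B0 where "\<forall>w\<in>\<Phi> ` X. norm w \<le> B0" using compact_imp_bounded bounded_iff by blast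
  then have B0: "norm (\<Phi> x) \<le> max B0 0" if "x \<in> X" for x using that by (simp add: le_max_iff_disj)
  \<comment> \<open>At a nonpositive integer the Mellin transform is exactly the derivative that is
    subtracted.\<close>
  have van1: "\<Phi> x = 0" if x: "x \<in> X" "x (Inl 1) = - of_nat (m 1)" for x
  proof -
    note eb = hol_family_slice[OF F x(1)]
    have m1: "m 1 + 1 < N" using N(1)[of 1] r by simp
    have "mellin N (F x) (- of_nat (m 1)) = mellin (Suc (m 1)) (F x) (- of_nat (m 1))"
      by (rule mellin_eq_le[OF eb neg \<rho>]) (use m1 in auto)
    also have "\<dots> = (-1) ^ m 1 * (deriv ^^ m 1) (F x) 0" by (rule mellin_at_neg_nat[OF eb neg \<rho>])
    finally show ?thesis unfolding \<Phi>_def x(2) by simp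
  qed
  \<comment> \<open>Both exponents of one average are nonpositive integers, so the nested function,
    and with it both terms of \<open>\<Phi>\<close>, is zero.\<close>
  have van2: "\<Phi> x = 0" if x: "x \<in> X" "x (Inl j) = - of_nat (m j)" "x (Inr (j - 1)) = - of_nat (l (j - 1))"
    and j: "j \<in> {2..r}" for x j
  proof -
    have rk: "r - (r - j) = j" "r - Suc (r - j) = j - 1" "r - j < r - 1" using j by auto
    have "F x U = 0" if U: "U \<in> strip \<rho>" for U
      unfolding F_def
    proof (rule nest_zero[where k="r - j" and m="m j" and m'="l (j - 1)"])
      show "exp_bounded (nest_exponent r a (r - j)) \<rho> (nest N r a z (\<lambda>j. x (Inl j)) (\<lambda>j. x (Inr j)) (r - j))"
        by (rule hol_family_slice[OF nf x(1)]) (use j in auto)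
      have "m j + 1 < N" using N(1)[of j] j by auto
      then show "m j < N" by simp
      have "j - 1 \<in> {1..<r}" using j by auto
      then have "l (j - 1) + 1 < N" by (rule N(2))
      then show "l (j - 1) < N" by simp
    qed (use x rk U in auto)
    then show ?thesis
      unfolding \<Phi>_def using mellin_zero[of \<rho> "F x"] higher_deriv_zero_strip[of \<rho> "F x" 0] \<rho> by simp
  qed
  show ?thesis
  proof (intro exI[of _ "max B0 0"] conjI allI impI)
    fix \<eta> \<xi> :: "nat \<Rightarrow> complex"
    assume small: "\<forall>j\<in>{1..r}. norm (\<eta> j) + norm (\<xi> (j - 1)) < 1" and nz: "\<forall>j\<in>{1..r}. \<eta> j \<noteq> 0"
    \<comment> \<open>The size of the \<open>j\<close>-th pair; for \<open>j = 1\<close> there is no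
      average outside, and \<eta>_1 stands alone. Positivity uses that no \<eta>_j vanishes.\<close>
    define t where "t j = (if j = 1 then norm (\<eta> 1) else norm (\<eta> j) + norm (\<xi> (j - 1)))" for j :: nat
    have t: "t j > 0" "t j < 1" "norm (\<eta> j) \<le> t j" if "j \<in> {1..r}" for j
      using small[rule_format, OF that] nz[rule_format, OF that] norm_ge_zero[of "\<xi> (j - 1)"]
      by (auto simp: t_def add_pos_nonneg simp del: norm_ge_zero)
    have t': "norm (\<xi> j) \<le> t (Suc j)" if "j \<in> {1..<r}" for j using that by (auto simp: t_def)
    \<comment> \<open>The normalized direction of the \<open>j\<close>-th pair, with entries of
      modulus at most 1, so that the open polydisc is mapped into \<open>X\<close>.\<close>
    define q where "q j = case_sum (\<lambda>i. if i = j \<and> i \<in> {1..r} then \<eta> i / of_real (t i) else 0)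
       (\<lambda>i. if Suc i = j \<and> i \<in> {1..<r} then \<xi> i / of_real (t (Suc i)) else 0)" for j :: nat
    define x where "x v = case_sum
      (\<lambda>i. - of_nat (m i) + (if i \<in> {1..r} then v i * (\<eta> i / of_real (t i)) else 0))
       (\<lambda>i. - of_nat (l i) + (if i \<in> {1..<r} then v (Suc i) * (\<xi> i / of_real (t (Suc i))) else 0))" for v ::
         "nat \<Rightarrow> complex"
    have xX: "x v \<in> X" if v: "\<And>i. norm (v i) < 1" for v
    proof -
      have "norm (x v i - base i) \<le> 1" for i
      proof (cases i)
        case (Inl j)
        have "norm (v j * (\<eta> j / of_real (t j))) \<le> 1 * 1" if "j \<in> {1..r}"
          unfolding norm_mult using v[of j] t[OF that] by (intro mult_mono) (auto simp: norm_divide)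
        then show ?thesis using Inl by (auto simp: x_def base_def)
      next
        case (Inr j)
        have "norm (v (Suc j) * (\<xi> j / of_real (t (Suc j)))) \<le> 1 * 1" if "j \<in> {1..<r}"
          unfolding norm_mult using v[of "Suc j"] t[of "Suc j"] t'[OF that] that
            by (intro mult_mono) (auto simp: norm_divide)
        then show ?thesis using Inr by (auto simp: x_def base_def)
      qed
      then show ?thesis by (simp add: X_def)
    qed
    have curve: "x (v(j := w)) = (\<lambda>i. x (v(j := 0)) i + w * q j i)" for v j w
      by (rule ext) (auto simp: x_def q_def split: sum.splits)
    \<comment> \<open>The sizes themselves are the point of the polydisc that \<open>x\<close> sends
      to the given exponents.\<close>
    define v0 where "v0 j = (if j \<in> {1..r} then complex_of_real (t j) else 0)" for j
    have v0: "norm (v0 i) < 1" for i using t[of i] by (auto simp: v0_def)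
    have "norm (\<Phi> (x v0)) \<le> max B0 0 * (\<Prod>j\<in>{1..r}. norm (v0 j))"
    proof (rule Schwarz_polydisc[where h="\<lambda>v. \<Phi> (x v)"])
      fix v :: "nat \<Rightarrow> complex" and j assume v: "\<And>i. norm (v i) < 1" and j: "j \<in> {1..r}"
      have "(\<lambda>w. x (v(j := w))) = (\<lambda>w i. x (v(j := 0)) i + w * q j i)" by (rule ext, rule curve)
      then have "(\<lambda>w. x (v(j := w))) \<in> affine_curves" unfolding affine_curves_def by blast
      moreover have "(\<lambda>w. x (v(j := w))) ` ball 0 1 \<subseteq> X" using v by (auto intro!: xX)
      ultimately show "(\<lambda>w. \<Phi> (x (v(j := w)))) holomorphic_on ball 0 1"
        using ph open_ball unfolding param_hol_def curve_hol_def by blast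
      assume vj: "v j = 0"
      show "\<Phi> (x v) = 0"
      proof (cases "j = 1")
        case True
        then show ?thesis using vj by (intro van1 xX v) (simp add: x_def)
      next
        case False
        then show ?thesis using vj j by (intro van2[of _ j] xX v) (auto simp: x_def)
      qed
    qed (use B0 xX v0 in auto)
    also have "(\<Prod>j\<in>{1..r}. norm (v0 j)) = norm (\<eta> 1) * (\<Prod>j=2..r. norm (\<eta> j) + norm (\<xi> (j - 1)))"
    proof -
      have e: "{1..r} = insert 1 {2..r}" using r by auto
      have "(\<Prod>j\<in>{1..r}. norm (v0 j)) = (\<Prod>j\<in>{1..r}. t j)" using t(1)
        by (intro prod.cong) (auto simp: v0_def less_imp_le)
      also have "\<dots> = t 1 * (\<Prod>j=2..r. t j)" unfolding e by simp
      also have "(\<Prod>j=2..r. t j) = (\<Prod>j=2..r. norm (\<eta> j) + norm (\<xi> (j - 1)))"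
        by (intro prod.cong) (auto simp: t_def)
      finally show ?thesis by (simp add: t_def)
    qed
    finally have fin: "norm (\<Phi> (x v0)) \<le> max B0 0 * (norm (\<eta> 1) * (\<Prod>j=2..r. norm (\<eta> j) + norm (\<xi> (j - 1))))" .
    have xl: "x v0 (Inl j) = - of_nat (m j) + \<eta> j" if "j \<in> {1..r}" for j
      using t[OF that] that by (simp add: x_def v0_def)
    have xr: "x v0 (Inr j) = - of_nat (l j) + \<xi> j" if "j \<in> {1..<r}" for j
      using t[of "Suc j"] that by (simp add: x_def v0_def)
    have "nest N r a z (\<lambda>j. x v0 (Inl j)) (\<lambda>j. x v0 (Inr j)) k
      = nest N r a z (\<lambda>j. - of_nat (m j) + \<eta> j) (\<lambda>j. - of_nat (l j) + \<xi> j) k" if "k < r" for k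
      using that by (intro nest_cong xl xr) auto
    then show "let \<phi> = nest N r a z (\<lambda>j. - of_nat (m j) + \<eta> j) (\<lambda>j. - of_nat (l j) + \<xi> j) (r - 1) in
       norm (mellin N \<phi> (- of_nat (m 1) + \<eta> 1) - (-1) ^ m 1 * (deriv ^^ m 1) \<phi> 0)
       \<le> max B0 0 * (norm (\<eta> 1) * (\<Prod>j=2..r. norm (\<eta> j) + norm (\<xi> (j - 1))))"
      using fin r xl[of 1] unfolding \<Phi>_def F_def Let_def by simp
  qed simp
qed

section \<open>The asymptotic formula\<close>

text \<open>The zeros are integers, and a nonzero \<eta> of modulus below 1 is not one.\<close>

lemma rGamma_near_neg_nat_nonzero:
  assumes "\<eta> \<noteq> 0" "norm \<eta> < 1"
  shows "rGamma (- of_nat m + \<eta> :: complex) \<noteq> 0"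
proof
  assume "rGamma (- of_nat m + \<eta>) = 0"
  then have "- of_nat m + \<eta> \<in> \<int>\<^sub>\<le>\<^sub>0" by (simp add: rGamma_eq_zero_iff)
  then obtain k where "- of_nat m + \<eta> = of_int k" by (auto elim: nonpos_Ints_cases)
  then have e: "\<eta> = of_int (k + int m)" by (simp add: algebra_simps)
  then have "\<bar>k + int m\<bar> < 1" using assms(2) by (simp only: norm_of_int)
  then show False using assms(1) e by simp
qed

lemma sig_near:
  "sig r (\<lambda>k. - of_nat (l k) + \<epsilon> k) j = - of_nat ((\<Sum>k=j..r. l k) + (r + 1 - j)) + tail_sum r \<epsilon> j"
  unfolding sig_def tail_sum_def by (simp add: sum.distrib sum_negf sum_subtractf)

lemma sig_cong: "1 \<le> j \<Longrightarrow> (\<And>k. k \<in> {1..r} \<Longrightarrow> s k = s' k) \<Longrightarrow> sig r s j = sig r s' j"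
  unfolding sig_def by (intro arg_cong2[where f="(-)"] sum.cong) auto

lemma hl_zeta_eq_nest:
  assumes r: "r \<ge> 1" and a: "\<And>j. j \<in> {1..r} \<Longrightarrow> Re (\<Sum>k=1..j. a k) > 0"
    and z: "\<And>j. j \<in> {1..r} \<Longrightarrow> z j \<notin> complex_of_real ` {1<..}"
    and n: "\<And>j. j \<in> {1..r} \<Longrightarrow> Re (s j) > - real n"
    and d: "\<And>j. j \<in> {1..r} \<Longrightarrow> rGamma (sig r s j) \<noteq> 0" and N: "N = hl_order r n"
  shows "hl_zeta r s a z = rGamma (s r) * mellin N (nest N r a z (sig r s) s (r - 1)) (sig r s 1)
    / (\<Prod>j=1..r. rGamma (sig r s j))"
proof -
  define P where "P = {p \<in> {1..r}. z p \<noteq> 1}"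
  define x where "x = restrict (case_sum s z) (hl_index r P)"
  have sx: "sval x j = s j" if "j \<in> {1..r}" for j using that by (auto simp: x_def sval_def InlI)
  have sgx: "sig r (sval x) j = sig r s j" if "j \<in> {1..r}" for j by (rule sig_cong) (use that sx in auto)
  have zx: "zval P x j = z j" if "j \<in> {1..r}" for j using that by (auto simp: x_def zval_def P_def InrI)
  have den: "hl_den r x = (\<Prod>j=1..r. rGamma (sig r s j))" unfolding hl_den_def using sgx
    by (intro prod.cong) auto
  have "nest N r a (zval P x) (sig r (sval x)) (sval x) (r - 1) = nest N r a z (sig r s) s (r - 1)"
    using r by (intro nest_cong zx sgx sx) auto
  then have num: "hl_num N r a P x = rGamma (s r) * mellin N (nest N r a z (sig r s) s (r - 1)) (sig r s 1)"
    unfolding hl_num_def using sx[of r] sgx[of 1] r by simp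
  have nz: "hl_den r x \<noteq> 0" unfolding den using d by simp
  show ?thesis
    using hl_zeta_eq[OF r a z P_def x_def n nz] unfolding N[symmetric] num den by simp
qed

lemma prod_ratio_telescope:
  fixes f :: "nat \<Rightarrow> complex"
  assumes "1 \<le> r" "\<And>j. j \<in> {1..r} \<Longrightarrow> f j \<noteq> 0"
  shows "(\<Prod>j\<in>{1..<r}. f j / f (Suc j)) = f 1 / f r"
  using assms
proof (induction r rule: nat_induct_at_least)
  case (Suc r)
  have "{1..<Suc r} = insert r {1..<r}" using Suc.hyps by auto
  then show ?case using Suc by simp
qed simp

lemma prod_split_first:
  fixes f :: "nat \<Rightarrow> 'a::comm_monoid_mult"
  assumes "1 \<le> r"
  shows "(\<Prod>j=1..r. f j) = f 1 * (\<Prod>j\<in>{1..<r}. f (Suc j))"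
proof -
  have "(\<Prod>j=1..r. f j) = f 1 * prod f {Suc 1..r}" by (rule prod.atLeast_Suc_atMost[OF assms])
  also have "{Suc 1..r} = {Suc 1..<Suc r}" by auto
  also have "prod f \<dots> = (\<Prod>j\<in>{1..<r}. f (Suc j))" unfolding prod.atLeast_Suc_lessThan_Suc_shift by simp
  finally show ?thesis .
qed

text \<open>The Pochhammer factor is a quotient of two values of \<open>rGamma\<close>; the one at
  \<open>sig r s (Suc j)\<close> is pulled out in order to cancel against the denominator of
  zeta.\<close>

lemma ek_coeff_eq_Gamma_quot:
  fixes \<epsilon> :: "nat \<Rightarrow> complex" and l :: "nat \<Rightarrow> nat"
  defines "s \<equiv> \<lambda>k. - of_nat (l k) + \<epsilon> k"
  assumes j: "1 \<le> j" "j < r" and nz: "rGamma (sig r s (Suc j)) \<noteq> 0"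
    and t: "tail_sum r \<epsilon> j \<noteq> 0" "tail_sum r \<epsilon> (Suc j) \<noteq> 0"
  shows "ek_coeff (sig r s (Suc j)) (s j) q = rGamma (sig r s (Suc j))
    * (Gamma_quot r l j q \<epsilon> * (tail_sum r \<epsilon> j / tail_sum r \<epsilon> (Suc j)))"
proof -
  let ?\<sigma> = "sig r s (Suc j)"
  have p: "rGamma ?\<sigma> = pochhammer ?\<sigma> q * rGamma (?\<sigma> + of_nat q)" by (rule pochhammer_rGamma)
  have e1: "?\<sigma> + of_nat q = of_nat q - of_nat ((\<Sum>k=Suc j..r. l k) + (r - j)) + tail_sum r \<epsilon> (Suc j)"
    unfolding s_def sig_near by simp
  have e2: "?\<sigma> + s j + of_nat q = of_nat q - of_nat ((\<Sum>k=j..r. l k) + (r - j)) + tail_sum r \<epsilon> j"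
  proof -
    have "?\<sigma> + s j = sig r s j + 1" using sig_rec[OF j, of s] by (simp add: algebra_simps)
    moreover have "of_nat (r + 1 - j) = (of_nat (r - j) + 1 :: complex)" using j by (simp add: Suc_diff_le)
    ultimately show ?thesis unfolding s_def sig_near of_nat_add by (simp add: algebra_simps)
  qed
  have g: "Gamma_quot r l j q \<epsilon> * (tail_sum r \<epsilon> j / tail_sum r \<epsilon> (Suc j)) = rGamma (?\<sigma> + s j + of_nat q)
    / rGamma (?\<sigma> + of_nat q)"
    unfolding Gamma_quot_def e1[symmetric] e2[symmetric] using t by simp
  have "rGamma (?\<sigma> + of_nat q) \<noteq> 0" using nz p by auto
  then show ?thesis unfolding g ek_coeff_def by (subst p) simp
qed

text \<open>All zeros cancel: the inner Gamma factors against those of the denominator, and the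
  telescoped ratio of tail sums against the zeros of \<open>rGamma (s r)\<close> and
  \<open>rGamma (sig r s 1)\<close>. Only regular cofactors and the Gamma quotients remain.\<close>

lemma ek_coeff_product:
  fixes \<epsilon> :: "nat \<Rightarrow> complex" and l :: "nat \<Rightarrow> nat"
  defines "s \<equiv> \<lambda>k. - of_nat (l k) + \<epsilon> k"
  assumes r: "1 \<le> r" and nz: "\<And>j. j \<in> {1..r} \<Longrightarrow> rGamma (sig r s j) \<noteq> 0"
    and t: "\<And>j. j \<in> {1..r} \<Longrightarrow> tail_sum r \<epsilon> j \<noteq> 0"
  shows "rGamma (s r) * (\<Prod>j\<in>{1..<r}. ek_coeff (sig r s (Suc j)) (s j) (q j)) / (\<Prod>j=1..r. rGamma (sig r s j))
    = rGamma_rest (l r) (tail_sum r \<epsilon> r) * (1 / rGamma_rest ((\<Sum>k=1..r. l k) + r) (tail_sum r \<epsilon> 1)) *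
      (\<Prod>j\<in>{1..<r}. Gamma_quot r l j (q j) \<epsilon>)"
proof -
  have T: "(\<Prod>j\<in>{1..<r}. tail_sum r \<epsilon> j / tail_sum r \<epsilon> (Suc j)) = tail_sum r \<epsilon> 1 / tail_sum r \<epsilon> r"
    by (rule prod_ratio_telescope[OF r t])
  have "(\<Prod>j\<in>{1..<r}. ek_coeff (sig r s (Suc j)) (s j) (q j))
     = (\<Prod>j\<in>{1..<r}. rGamma (sig r s (Suc j)) *
       (Gamma_quot r l j (q j) \<epsilon> * (tail_sum r \<epsilon> j / tail_sum r \<epsilon> (Suc j))))"
    unfolding s_def by (intro prod.cong ek_coeff_eq_Gamma_quot refl nz[unfolded s_def] t) auto
  also have "\<dots> = (\<Prod>j\<in>{1..<r}. rGamma (sig r s (Suc j)))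
    * ((\<Prod>j\<in>{1..<r}. Gamma_quot r l j (q j) \<epsilon>) * (tail_sum r \<epsilon> 1 / tail_sum r \<epsilon> r))"
    by (simp only: prod.distrib T)
  finally have A: "(\<Prod>j\<in>{1..<r}. ek_coeff (sig r s (Suc j)) (s j) (q j)) = \<dots>" .
  have B: "(\<Prod>j=1..r. rGamma (sig r s j)) = rGamma (sig r s 1) * (\<Prod>j\<in>{1..<r}. rGamma (sig r s (Suc j)))"
    by (rule prod_split_first[OF r])
  have "(\<Prod>j\<in>{1..<r}. rGamma (sig r s (Suc j))) \<noteq> 0" using nz by simp
  moreover have "rGamma (s r) = tail_sum r \<epsilon> r * rGamma_rest (l r) (tail_sum r \<epsilon> r)"
    unfolding s_def by (simp add: tail_sum_def flip: rGamma_near_neg_nat)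
  moreover have s1: "rGamma (sig r s 1) = tail_sum r \<epsilon> 1 * rGamma_rest ((\<Sum>k=1..r. l k) + r) (tail_sum r \<epsilon> 1)"
    unfolding s_def sig_near by (simp flip: rGamma_near_neg_nat)
  moreover have "rGamma_rest ((\<Sum>k=1..r. l k) + r) (tail_sum r \<epsilon> 1) \<noteq> 0" using nz[of 1] r s1 by auto
  ultimately show ?thesis unfolding A B using t[of 1] t[of r] r by (simp add: field_simps)
qed

text \<open>The index sets for \<open>d = 0\<close> and \<open>d = 1\<close> are disjoint and leave
  a gap, so at most one summand is present, and in the gap both sides are 0.\<close>

lemma Gamma_quot_limit_eq_h_factor:
  assumes n: "n \<in> compositions 1 r ((\<Sum>k=1..r. l k) + r)" and j: "j \<in> {1..<r}"
  shows "Gamma_quot_limit r l j (\<Sum>k=Suc j..r. n k) \<epsilon>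
    = (\<Sum>d\<in>{0,1}. if n \<in> S_set r l j d then h_factor r l \<epsilon> j d n else 0)"
proof -
  have "{j..r} = insert j {Suc j..r}" using j by auto
  then have le: "(\<Sum>k=Suc j..r. l k) \<le> (\<Sum>k=j..r. l k)" by simp
  have S0: "n \<in> S_set r l j 0 \<longleftrightarrow> (\<Sum>k=Suc j..r. n k) \<le> (\<Sum>k=Suc j..r. l k) + (r - j)"
    and S1: "n \<in> S_set r l j 1 \<longleftrightarrow> (\<Sum>k=j..r. l k) + (r - j) < (\<Sum>k=Suc j..r. n k)"
    using n unfolding S_set_def compositions_def by auto
  have "(\<Sum>d\<in>{0,1}. if n \<in> S_set r l j d then h_factor r l \<epsilon> j d n else 0)
     = (if n \<in> S_set r l j 0 then h_factor r l \<epsilon> j 0 n else 0) +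
       (if n \<in> S_set r l j 1 then h_factor r l \<epsilon> j 1 n else 0)"
    by simp
  then show ?thesis
    unfolding S0 S1 Gamma_quot_limit_def h_factor_def tail_sum_def using le by auto
qed

text \<open>Extended by zero, the inner sums all run over the same compositions. The sum over
  \<open>d\<close> of a product over \<open>j\<close> is then the product over \<open>j\<close> of
  two-term sums, each of which is a limiting Gamma quotient.\<close>

lemma main_term_eq:
  assumes r: "r \<ge> 2"
  shows "main_term r l \<epsilon> a z = (\<Sum>n\<in>compositions 1 r ((\<Sum>k=1..r. l k) + r).
     (-1) ^ ((\<Sum>k=1..r. l k) + r) * (\<Prod>j=1..r. apostol_bernoulli (n j) (a j) (z j) / fact (n j)) *
       ((-1) ^ l r * fact (l r))
       * (\<Prod>j\<in>{1..<r}. Gamma_quot_limit r l j (\<Sum>k=Suc j..r. n k) \<epsilon>))"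
proof -
  define K where "K = (\<Sum>k=1..r. l k) + r"
  define D where "D = {1..<r} \<rightarrow>\<^sub>E {0, 1::nat}"
  define b where "b n = (\<Prod>j=1..r. apostol_bernoulli (n j) (a j) (z j) / fact (n j))" for n
  define g where "g n j d = (if n \<in> S_set r l j d then h_factor r l \<epsilon> j d n else 0)" for n j d
  have e: "{1..r-1} = {1..<r}" using r by auto
  have sub: "(\<Inter>j\<in>{1..<r}. S_set r l j (d j)) \<subseteq> compositions 1 r K" for d
  proof
    fix n assume "n \<in> (\<Inter>j\<in>{1..<r}. S_set r l j (d j))"
    \<comment> \<open>Here \<open>r \<ge> 2\<close> matters: an intersection over no index would be
      everything.\<close>
    then have "n \<in> S_set r l 1 (d 1)" using r by auto
    then show "n \<in> compositions 1 r K" unfolding S_set_def compositions_def K_def by auto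
  qed
  have prod_g: "(\<Prod>j\<in>{1..<r}. g n j (d j))
    = (if n \<in> (\<Inter>j\<in>{1..<r}. S_set r l j (d j)) then \<Prod>j\<in>{1..<r}. h_factor r l \<epsilon> j (d j) n else 0)" for n d
    by (auto simp: g_def)
  have "(\<Sum>d\<in>D. \<Sum>n \<in> (\<Inter>j\<in>{1..<r}. S_set r l j (d j)). b n * h_coeff r l \<epsilon> d n)
     = (\<Sum>d\<in>D. \<Sum>n\<in>compositions 1 r K. b n * ((-1) ^ l r * fact (l r)) * (\<Prod>j\<in>{1..<r}. g n j (d j)))"
  proof (rule sum.cong[OF refl], rule sum.mono_neutral_cong_left[OF finite_compositions sub])
    fix d
    show "\<forall>n\<in>compositions 1 r K - (\<Inter>j\<in>{1..<r}. S_set r l j (d j)).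
        b n * ((-1) ^ l r * fact (l r)) * (\<Prod>j\<in>{1..<r}. g n j (d j)) = 0"
    proof
      fix n assume "n \<in> compositions 1 r K - (\<Inter>j\<in>{1..<r}. S_set r l j (d j))"
      then have "n \<notin> (\<Inter>j\<in>{1..<r}. S_set r l j (d j))" using DiffE by metis
      then show "b n * ((-1) ^ l r * fact (l r)) * (\<Prod>j\<in>{1..<r}. g n j (d j)) = 0"
        by (simp only: prod_g if_False mult_zero_right)
    qed
    fix n assume "n \<in> (\<Inter>j\<in>{1..<r}. S_set r l j (d j))"
    then show "b n * h_coeff r l \<epsilon> d n = b n * ((-1) ^ l r * fact (l r)) * (\<Prod>j\<in>{1..<r}. g n j (d j))"
      unfolding prod_g h_coeff_def e by simp
  qed
  also have "\<dots> = (\<Sum>n\<in>compositions 1 r K. \<Sum>d\<in>D. b n * ((-1) ^ l r * fact (l r)) * (\<Prod>j\<in>{1..<r}. g n j (d j)))"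
    by (rule sum.swap)
  also have "\<dots> = (\<Sum>n\<in>compositions 1 r K. b n * ((-1) ^ l r * fact (l r)) * (\<Prod>j\<in>{1..<r}. \<Sum>d\<in>{0,1}. g n j d))"
    unfolding D_def sum_distrib_left[symmetric] by (subst prod_sum_PiE) auto
  also have "\<dots> = (\<Sum>n\<in>compositions 1 r K. b n * ((-1) ^ l r * fact (l r)) *
      (\<Prod>j\<in>{1..<r}. Gamma_quot_limit r l j (\<Sum>k=Suc j..r. n k) \<epsilon>))"
    unfolding g_def K_def
    by (intro sum.cong arg_cong2[where f="(*)"] prod.cong refl Gamma_quot_limit_eq_h_factor[symmetric])
  finally show ?thesis
    unfolding main_term_def e D_def[symmetric] b_def[symmetric] K_def[symmetric]
      by (simp only: sum_distrib_left mult.assoc)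
qed

lemma lker_families:
  fixes z :: "nat \<Rightarrow> complex"
  assumes z: "\<And>j. j \<in> {1..r} \<Longrightarrow> z j \<notin> complex_of_real ` {1<..}"
  obtains \<rho> where "0 < \<rho>"
    "\<And>(X :: (nat + nat \<Rightarrow> complex) set) j. j \<in> {1..r} \<Longrightarrow>
      hol_family X affine_curves (- Re (a j)) \<rho> (\<lambda>x. lker (a j) (z j))"
proof -
  define P where "P = {p \<in> {1..r}. z p \<noteq> 1}"
  have P: "finite P" by (simp add: P_def)
  have z0: "z p \<notin> complex_of_real ` {1..}" if "p \<in> P" for p
  proof
    assume "z p \<in> complex_of_real ` {1..}"
    then obtain t where t: "z p = of_real t" "t \<ge> 1" by auto
    have "t \<noteq> 1" using t that by (auto simp: P_def)
    then show False using t z[of p] that by (auto simp: P_def)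
  qed
  show thesis
  proof (rule kernel_families[of P z, OF P z0])
    fix \<eta> \<rho>
    assume as: "0 < \<rho>" "\<And>p. p \<in> P \<Longrightarrow> 0 < \<eta> p"
      "\<And>(X :: (nat + nat \<Rightarrow> complex) set) C z' a j. (\<And>c. c \<in> C \<Longrightarrow> continuous_on UNIV c) \<Longrightarrow>
        (j \<in> P \<Longrightarrow> param_hol X C z' \<and> (\<forall>x\<in>X. z' x \<in> thick (z j) (\<eta> j))) \<Longrightarrow>
        (j \<notin> P \<Longrightarrow> z' = (\<lambda>x. 1)) \<Longrightarrow> hol_family X C (- Re a) \<rho> (\<lambda>x. lker a (z' x))"
    show thesis
    proof (rule that[OF as(1)])
      fix X :: "(nat + nat \<Rightarrow> complex) set" and j assume j: "j \<in> {1..r}"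
      show "hol_family X affine_curves (- Re (a j)) \<rho> (\<lambda>x. lker (a j) (z j))"
      proof (rule as(3)[where j=j and z'="\<lambda>_. z j"])
        show "continuous_on UNIV c" if "c \<in> affine_curves" for c :: "complex \<Rightarrow> nat + nat \<Rightarrow> complex"
          by (rule continuous_affine_curves[OF that])
        show "param_hol X affine_curves (\<lambda>_. z j) \<and> (\<forall>x\<in>X. z j \<in> thick (z j) (\<eta> j))" if "j \<in> P"
          using thick_mem(1)[OF as(2)[OF that], of "z j"] by (simp add: param_hol_const)
        show "(\<lambda>_. z j) = (\<lambda>x. 1)" if "j \<notin> P" using that j by (simp add: P_def)
      qed
    qed
  qed
qed

lemma approx_bounded:
  assumes "approx r M f g" "r \<ge> 1"
  obtains \<delta> C where "\<delta> > 0" "C \<ge> 0" "\<And>\<epsilon>. \<epsilon> \<in> eps_region r M \<delta> \<Longrightarrow> norm (f \<epsilon>) \<le> C"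
proof -
  obtain \<delta> C where 1: "\<delta> > 0" "C \<ge> 0" "\<And>\<epsilon>. \<epsilon> \<in> eps_region r M \<delta> \<Longrightarrow> norm (f \<epsilon> - g \<epsilon>) \<le> C * eps_size r \<epsilon> \<and>
    norm (g \<epsilon>) \<le> C"
    using assms(1) unfolding approx_def by blast
  show ?thesis
  proof (rule that[of \<delta> "C * (r * \<delta>) + C"])
    fix \<epsilon> assume \<epsilon>: "\<epsilon> \<in> eps_region r M \<delta>"
    have "norm (f \<epsilon> - g \<epsilon>) \<le> C * eps_size r \<epsilon>" "norm (g \<epsilon>) \<le> C" using 1(3)[OF \<epsilon>] by auto
    moreover have "C * eps_size r \<epsilon> \<le> C * (r * \<delta>)"
      using eps_size_less[OF \<epsilon> assms(2)] 1(2) by (intro mult_left_mono) auto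
    ultimately show "norm (f \<epsilon>) \<le> C * (r * \<delta>) + C" using norm_triangle_ineq2[of "f \<epsilon>" "g \<epsilon>"] by linarith
  qed (use 1 in auto)
qed

lemma approx_remainder:
  assumes r: "r \<ge> 1" and M: "M > 0" and B: "B \<ge> 0" and \<delta>0: "\<delta>0 > 0"
    and R: "\<And>\<epsilon>. \<epsilon> \<in> eps_region r M \<delta>0 \<Longrightarrow> norm (R \<epsilon>) \<le>
      B * (norm (tail_sum r \<epsilon> 1) * (\<Prod>j\<in>{1..<r}. norm (tail_sum r \<epsilon> (Suc j)) + norm (\<epsilon> j)))"
  shows "approx r M (\<lambda>\<epsilon>. rGamma (- of_nat (l r) + \<epsilon> r) * R \<epsilon>
    / (\<Prod>j=1..r. rGamma (sig r (\<lambda>k. - of_nat (l k) + \<epsilon> k) j))) (\<lambda>_. 0)"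
proof -
  define m where "m j = (\<Sum>k=j..r. l k) + (r + 1 - j)" for j
  define E where "E \<epsilon> = rGamma_rest (l r) (tail_sum r \<epsilon> r)
    * (\<Prod>j\<in>{1..r}. 1 / rGamma_rest (m j) (tail_sum r \<epsilon> j))" for \<epsilon>
  have "approx r M E (\<lambda>_. rGamma_rest (l r) 0 * (\<Prod>j\<in>{1..r}. 1 / rGamma_rest (m j) 0))"
    unfolding E_def[abs_def] using r
    by (intro approx_mult approx_prod approx_tail_sum_fun rGamma_rest_field_differentiable
        approx_tail_sum_fun[where f="\<lambda>\<eta>. 1 / rGamma_rest _ \<eta>"]
          field_differentiable_inverse_0 rGamma_rest_0_nonzero) auto
  then obtain \<delta>1 C where E: "\<delta>1 > 0" "C \<ge> 0" "\<And>\<epsilon>. \<epsilon> \<in> eps_region r M \<delta>1 \<Longrightarrow> norm (E \<epsilon>) \<le> C"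
    using approx_bounded r by blast
  \<comment> \<open>The first term bounds the ratio of consecutive tail sums, the second that of
    \<epsilon>_j to \<epsilon>(j,r).\<close>
  define Q where "Q = real r * M + M"
  have Q: "Q > 0" using M by (simp add: Q_def add_nonneg_pos)
  have "norm (rGamma (- of_nat (l r) + \<epsilon> r) * R \<epsilon> / (\<Prod>j=1..r. rGamma (sig r (\<lambda>k. - of_nat (l k) + \<epsilon> k) j)))
    \<le> C * B * Q ^ (r - 1) * eps_size r \<epsilon>"
    if \<epsilon>: "\<epsilon> \<in> eps_region r M (min \<delta>0 \<delta>1)" for \<epsilon>
  proof -
    have \<epsilon>0: "\<epsilon> \<in> eps_region r M \<delta>0" and \<epsilon>1: "\<epsilon> \<in> eps_region r M \<delta>1"
      using \<epsilon> eps_region_mono[of "min \<delta>0 \<delta>1" \<delta>0 r M] eps_region_mono[of "min \<delta>0 \<delta>1" \<delta>1 r M] by auto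
    let ?t = "tail_sum r \<epsilon>"
    have tn: "?t j \<noteq> 0" if "j \<in> {1..r}" for j using \<epsilon> that by (auto simp: eps_region_def)
    have e: "{1..r} = insert r {1..<r}" using r by auto
    have tr: "?t r = \<epsilon> r" by (simp add: tail_sum_def)
    have p: "(\<Prod>j=1..r. ?t j) = ?t r * (\<Prod>j\<in>{1..<r}. ?t j)" unfolding e by simp
    have "(\<Prod>j=1..r. rGamma (sig r (\<lambda>k. - of_nat (l k) + \<epsilon> k) j)) = (\<Prod>j=1..r. ?t j * rGamma_rest (m j) (?t j))"
      unfolding sig_near m_def rGamma_near_neg_nat ..
    also have "\<dots> = ?t r * (\<Prod>j\<in>{1..<r}. ?t j) * (\<Prod>j=1..r. rGamma_rest (m j) (?t j))"
      unfolding prod.distrib p ..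
    finally have "rGamma (- of_nat (l r) + \<epsilon> r) * R \<epsilon> / (\<Prod>j=1..r. rGamma (sig r (\<lambda>k. - of_nat (l k) + \<epsilon> k) j))
        = E \<epsilon> * (R \<epsilon> / (\<Prod>j\<in>{1..<r}. ?t j))"
      unfolding E_def rGamma_near_neg_nat tr prod_dividef using tn[of r] tr r by simp
    also have "norm \<dots> \<le> C * (B * (eps_size r \<epsilon> * Q ^ (r - 1)))"
      unfolding norm_mult
    proof (rule mult_mono[OF E(3)[OF \<epsilon>1]])
      have "norm (R \<epsilon> / (\<Prod>j\<in>{1..<r}. ?t j)) \<le> B * (norm (?t 1) * (\<Prod>j\<in>{1..<r}. norm (?t (Suc j)) + norm (\<epsilon> j)))
        / norm (\<Prod>j\<in>{1..<r}. ?t j)"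
        unfolding norm_divide by (rule divide_right_mono[OF R[OF \<epsilon>0]]) simp
      also have "\<dots> = B * (norm (?t 1) * (\<Prod>j\<in>{1..<r}. (norm (?t (Suc j)) + norm (\<epsilon> j)) / norm (?t j)))"
        by (simp add: prod_dividef prod_norm)
      also have "\<dots> \<le> B * (eps_size r \<epsilon> * Q ^ (r - 1))"
      proof (intro mult_left_mono B mult_mono norm_tail_sum_le)
        have "(\<Prod>j\<in>{1..<r}. (norm (?t (Suc j)) + norm (\<epsilon> j)) / norm (?t j)) \<le> (\<Prod>j\<in>{1..<r}. Q)"
        proof (intro prod_mono conjI)
          fix j assume j: "j \<in> {1..<r}"
          have "norm (?t (Suc j)) \<le> real r * M * norm (?t j)"
            by (rule tail_sum_ratio[OF \<epsilon> _ _ M]) (use j in auto)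
          moreover have "norm (\<epsilon> j) \<le> M * norm (?t j)" using \<epsilon> j by (auto simp: eps_region_def)
          ultimately have "norm (?t (Suc j)) + norm (\<epsilon> j) \<le> Q * norm (?t j)"
            by (simp add: Q_def distrib_right)
          moreover have "norm (?t j) > 0" using tn[of j] j by simp
          ultimately show "(norm (?t (Suc j)) + norm (\<epsilon> j)) / norm (?t j) \<le> Q"
            by (simp only: pos_divide_le_eq)
        qed simp
        then show "(\<Prod>j\<in>{1..<r}. (norm (?t (Suc j)) + norm (\<epsilon> j)) / norm (?t j)) \<le> Q ^ (r - 1)" by simp
      qed (use r eps_size_nonneg in \<open>auto intro!: prod_nonneg\<close>)
      finally show "norm (R \<epsilon> / (\<Prod>j\<in>{1..<r}. ?t j)) \<le> B * (eps_size r \<epsilon> * Q ^ (r - 1))" .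
    qed (use E in auto)
    finally show ?thesis by (simp add: mult_ac)
  qed
  then show ?thesis
    using \<delta>0 E B Q by (intro approxI[of "min \<delta>0 \<delta>1" "C * B * Q ^ (r - 1)"]) auto
qed

lemma approx_main:
  assumes r: "r \<ge> 2" and M: "M > 0"
  shows "approx r M (\<lambda>\<epsilon>. \<Sum>n\<in>compositions 1 r ((\<Sum>k=1..r. l k) + r).
       fact ((\<Sum>k=1..r. l k) + r) * (\<Prod>j=1..r. apostol_bernoulli (n j) (a j) (z j) / fact (n j)) *
       (rGamma_rest (l r) (tail_sum r \<epsilon> r) * (1 / rGamma_rest ((\<Sum>k=1..r. l k) + r) (tail_sum r \<epsilon> 1)) *
        (\<Prod>j\<in>{1..<r}. Gamma_quot r l j (\<Sum>k=Suc j..r. n k) \<epsilon>)))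
     (\<lambda>\<epsilon>. main_term r l \<epsilon> a z)"
proof -
  define K where "K = (\<Sum>k=1..r. l k) + r"
  have "approx r M (\<lambda>\<epsilon>. \<Sum>n\<in>compositions 1 r K.
       fact K * (\<Prod>j=1..r. apostol_bernoulli (n j) (a j) (z j) / fact (n j)) *
       (rGamma_rest (l r) (tail_sum r \<epsilon> r) * (1 / rGamma_rest K (tail_sum r \<epsilon> 1)) *
        (\<Prod>j\<in>{1..<r}. Gamma_quot r l j (\<Sum>k=Suc j..r. n k) \<epsilon>)))
     (\<lambda>\<epsilon>. \<Sum>n\<in>compositions 1 r K.
       fact K * (\<Prod>j=1..r. apostol_bernoulli (n j) (a j) (z j) / fact (n j)) *
       (rGamma_rest (l r) 0 * (1 / rGamma_rest K 0) *
        (\<Prod>j\<in>{1..<r}. Gamma_quot_limit r l j (\<Sum>k=Suc j..r. n k) \<epsilon>)))"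
    using r
    by (intro approx_sum approx_mult approx_const approx_prod approx_Gamma_quot
      approx_tail_sum_fun[where f="rGamma_rest (l r)"]
        rGamma_rest_field_differentiable approx_tail_sum_fun[where f="\<lambda>\<eta>. 1 / rGamma_rest K \<eta>"]
        field_differentiable_inverse_0 rGamma_rest_0_nonzero M) auto
  then show ?thesis
  proof (rule approx_cong[of _ _ _ _ 1])
    fix \<epsilon>
    \<comment> \<open>The global sign of the main term is the sign of the residue of \<Gamma> at
      \<open>- K\<close>; the factorial is cancelled by that of the \<open>K\<close>-th
      derivative.\<close>
    have "(1 / rGamma_rest K 0) * fact K = (-1) ^ K"
      by (simp add: rGamma_rest_0 divide_simps flip: power_mult_distrib)
    moreover have "fact K * b * (rGamma_rest (l r) 0 * c * g) = (c * fact K) * b * ((-1) ^ l r * fact (l r))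
      * g" for b c g
      by (simp add: rGamma_rest_0 mult_ac)
    ultimately have k: "fact K * b * (rGamma_rest (l r) 0 * (1 / rGamma_rest K 0) * g)
      = (-1) ^ K * b * ((-1) ^ l r * fact (l r)) * g" for b g
      by (simp only:)
    show "main_term r l \<epsilon> a z = (\<Sum>n\<in>compositions 1 r K.
       fact K * (\<Prod>j=1..r. apostol_bernoulli (n j) (a j) (z j) / fact (n j)) *
       (rGamma_rest (l r) 0 * (1 / rGamma_rest K 0) *
        (\<Prod>j\<in>{1..<r}. Gamma_quot_limit r l j (\<Sum>k=Suc j..r. n k) \<epsilon>)))"
      unfolding main_term_eq[OF r] K_def[symmetric] k ..
  qed (simp_all add: K_def)
qed

theorem theorem1p1:
  fixes r :: nat and a z :: "nat \<Rightarrow> complex" and l :: "nat \<Rightarrow> nat" and M :: real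
  assumes "r \<ge> 2"
    and "\<forall>j\<in>{1..r}. Re (\<Sum>k=1..j. a k) > 0"
    and "\<forall>j\<in>{1..r}. z j \<notin> complex_of_real ` {1<..}"
    and "M > 0"
  shows "\<exists>\<delta>>0. \<exists>C>0. \<forall>\<epsilon> :: nat \<Rightarrow> complex.
           (\<forall>j\<in>{1..r}. norm (\<epsilon> j) < \<delta> \<and> \<epsilon> j \<noteq> 0 \<and> (\<Sum>i=j..r. \<epsilon> i) \<noteq> 0) \<longrightarrow>
           (\<forall>j\<in>{1..r}. \<forall>k\<in>{j..r}. norm (\<epsilon> k) \<le> M * norm (\<Sum>i=j..r. \<epsilon> i)) \<longrightarrow>
           norm (hl_zeta r (\<lambda>j. - of_nat (l j) + \<epsilon> j) a z - main_term r l \<epsilon> a z)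
             \<le> C * (\<Sum>j=1..r. norm (\<epsilon> j))"
proof -
  note r2 = assms(1) and M = assms(4)
  have r: "r \<ge> 1" using r2 by simp
  have a: "\<And>j. j \<in> {1..r} \<Longrightarrow> Re (\<Sum>k=1..j. a k) > 0" using assms(2) by blast
  have z: "\<And>j. j \<in> {1..r} \<Longrightarrow> z j \<notin> complex_of_real ` {1<..}" using assms(3) by blast
  \<comment> \<open>Exceeds every \<open>l j\<close> by at least one, so that
    \<open>Re (s \<epsilon> j) > - n\<close> as soon as the modulus of \<epsilon>_j is below
    1.\<close>
  define n where "n = (\<Sum>k=1..r. l k) + 1"
  define N where "N = hl_order r n"
  define K where "K = (\<Sum>k=1..r. l k) + r"
  \<comment> \<open>The exponent \<sigma>_j equals \<open>- m j\<close> plus the tail sum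
    \<epsilon>(j,r); for \<open>j = 1\<close> this fixes the order \<open>K\<close> of the
    derivative.\<close>
  define m where "m j = (\<Sum>k=j..r. l k) + (r + 1 - j)" for j
  have m1: "m 1 = K" by (simp add: m_def K_def)
  have "1 * n \<le> r * n" using r by (intro mult_right_mono) auto
  then have nN: "n + r + 1 \<le> N" unfolding N_def hl_order_def by linarith
  have ln: "l j + 1 \<le> n" if "j \<in> {1..r}" for j
    unfolding n_def using member_le_sum[of j "{1..r}" l] that by auto
  have mN: "m j + 1 < N" if "j \<in> {1..r}" for j
  proof -
    have "(\<Sum>k=j..r. l k) \<le> (\<Sum>k=1..r. l k)" using that by (intro sum_mono2) auto
    then show ?thesis using nN that unfolding m_def n_def by auto
  qed
  have lN: "l j + 1 < N" if "j \<in> {1..<r}" for j using ln[of j] that nN r by auto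
  obtain \<rho> where \<rho>: "0 < \<rho>" and h:
    "\<And>(X :: (nat + nat \<Rightarrow> complex) set) j. j \<in> {1..r} \<Longrightarrow>
      hol_family X affine_curves (- Re (a j)) \<rho> (\<lambda>x. lker (a j) (z j))"
  proof (rule lker_families[OF z])
    fix \<rho>
    assume as: "0 < \<rho>" "\<And>(X :: (nat + nat \<Rightarrow> complex) set) j. j \<in> {1..r} \<Longrightarrow>
      hol_family X affine_curves (- Re (a j)) \<rho> (\<lambda>x. lker (a j) (z j))"
    show thesis by (rule that; fact as)
  qed
  have "\<exists>B\<ge>0. \<forall>\<eta> \<xi>. (\<forall>j\<in>{1..r}. norm (\<eta> j) + norm (\<xi> (j - 1)) < 1) \<longrightarrow> (\<forall>j\<in>{1..r}. \<eta> j \<noteq> 0) \<longrightarrow>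
    (let \<phi> = nest N r a z (\<lambda>j. - of_nat (m j) + \<eta> j) (\<lambda>j. - of_nat (l j) + \<xi> j) (r - 1) in
     norm (mellin N \<phi> (- of_nat (m 1) + \<eta> 1) - (-1) ^ m 1 * (deriv ^^ m 1) \<phi> 0)
       \<le> B * (norm (\<eta> 1) * (\<Prod>j=2..r. norm (\<eta> j) + norm (\<xi> (j - 1)))))"
    by (rule remainder_bound[where l=l and m=m and \<rho>=\<rho>]; fact)
  then obtain B where B: "B \<ge> 0"
    and rb: "\<And>\<eta> \<xi>. (\<forall>j\<in>{1..r}. norm (\<eta> j) + norm (\<xi> (j - 1)) < 1) \<Longrightarrow> (\<forall>j\<in>{1..r}. \<eta> j \<noteq> 0) \<Longrightarrow>
    (let \<phi> = nest N r a z (\<lambda>j. - of_nat (m j) + \<eta> j) (\<lambda>j. - of_nat (l j) + \<xi> j) (r - 1) in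
     norm (mellin N \<phi> (- of_nat (m 1) + \<eta> 1) - (-1) ^ m 1 * (deriv ^^ m 1) \<phi> 0)
       \<le> B * (norm (\<eta> 1) * (\<Prod>j=2..r. norm (\<eta> j) + norm (\<xi> (j - 1)))))"
    by blast
  define s where "s \<epsilon> = (\<lambda>k. - of_nat (l k) + \<epsilon> k)" for \<epsilon> :: "nat \<Rightarrow> complex"
  define \<phi> where "\<phi> \<epsilon> = nest N r a z (sig r (s \<epsilon>)) (s \<epsilon>) (r - 1)" for \<epsilon>
  define R where "R \<epsilon> = mellin N (\<phi> \<epsilon>) (sig r (s \<epsilon>) 1) - (-1) ^ K * (deriv ^^ K) (\<phi> \<epsilon>) 0" for \<epsilon>
  \<comment> \<open>Makes the total size of \<epsilon> less than 1/2, so that a tail sum and a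
    single entry together stay below 1.\<close>
  define \<delta>0 where "\<delta>0 = 1 / (2 * real r)"
  have \<delta>0: "\<delta>0 > 0" using r by (simp add: \<delta>0_def)
  have sg: "sig r (s \<epsilon>) j = - of_nat (m j) + tail_sum r \<epsilon> j" for \<epsilon> j unfolding s_def sig_near m_def ..
  have half: "norm (tail_sum r \<epsilon> j) < 1/2" "norm (\<epsilon> j) < 1/2" "tail_sum r \<epsilon> j \<noteq> 0"
    if \<epsilon>: "\<epsilon> \<in> eps_region r M \<delta>0" and j: "j \<in> {1..r}" for \<epsilon> j
  proof -
    have e: "eps_size r \<epsilon> < 1/2" using eps_size_less[OF \<epsilon> r] r by (simp add: \<delta>0_def)
    then show "norm (tail_sum r \<epsilon> j) < 1/2" using norm_tail_sum_le[OF j, of \<epsilon>] by linarith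
    have "norm (\<epsilon> j) \<le> eps_size r \<epsilon>" unfolding eps_size_def by (rule member_le_sum[OF j]) auto
    then show "norm (\<epsilon> j) < 1/2" using e by linarith
    show "tail_sum r \<epsilon> j \<noteq> 0" using \<epsilon> j by (auto simp: eps_region_def)
  qed
  have Rb: "norm (R \<epsilon>) \<le> B * (norm (tail_sum r \<epsilon> 1) * (\<Prod>j\<in>{1..<r}. norm (tail_sum r \<epsilon> (Suc j)) + norm (\<epsilon> j)))"
    if \<epsilon>: "\<epsilon> \<in> eps_region r M \<delta>0" for \<epsilon>
  proof -
    \<comment> \<open>The entry at 0 occurs only in the smallness condition for
      \<open>j = 1\<close>, while \<epsilon> is unrestricted there; so it is set to 0.\<close>
    define \<xi> where "\<xi> j = (if j = 0 then 0 else \<epsilon> j)" for j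
    have "norm (tail_sum r \<epsilon> j) + norm (\<xi> (j - 1)) < 1" if "j \<in> {1..r}" for j
    proof -
      have "j - 1 = 0 \<or> j - 1 \<in> {1..r}" using that by auto
      then have "norm (\<xi> (j - 1)) < 1/2" using half(2)[OF \<epsilon>, of "j - 1"] by (auto simp: \<xi>_def)
      then show ?thesis using half(1)[OF \<epsilon> that] by linarith
    qed
    moreover have "nest N r a z (\<lambda>j. - of_nat (m j) + tail_sum r \<epsilon> j) (\<lambda>j. - of_nat (l j) + \<xi> j) (r - 1)
      = \<phi> \<epsilon>"
      unfolding \<phi>_def
    proof (rule nest_cong)
      show "- of_nat (l j) + \<xi> j = s \<epsilon> j" if "j \<in> {1..<r}" for j using that by (simp add: s_def \<xi>_def)
      show "- of_nat (m j) + tail_sum r \<epsilon> j = sig r (s \<epsilon>) j" for j by (rule sg[symmetric])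
    qed (use r in auto)
    moreover have "(\<Prod>j=2..r. norm (tail_sum r \<epsilon> j) + norm (\<xi> (j - 1)))
      = (\<Prod>j\<in>{1..<r}. norm (tail_sum r \<epsilon> (Suc j)) + norm (\<epsilon> j))"
    proof -
      have e: "{2..r} = {Suc 1..<Suc r}" by auto
      show ?thesis unfolding e prod.atLeast_Suc_lessThan_Suc_shift by (intro prod.cong) (auto simp: \<xi>_def)
    qed
    ultimately show ?thesis using rb[of "tail_sum r \<epsilon>" \<xi>] half(3)[OF \<epsilon>] unfolding R_def sg m1 Let_def by simp
  qed
  note AR = approx_remainder[where l=l, OF r M B \<delta>0 Rb]
  note A = approx_add[OF AR approx_main[OF r2 M, where l=l and a=a and z=z]]
  have "approx r M (\<lambda>\<epsilon>. hl_zeta r (s \<epsilon>) a z) (\<lambda>\<epsilon>. 0 + main_term r l \<epsilon> a z)"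
  proof (rule approx_cong[OF A \<delta>0])
    fix \<epsilon> assume \<epsilon>: "\<epsilon> \<in> eps_region r M \<delta>0"
    define D where "D = (\<Prod>j=1..r. rGamma (sig r (s \<epsilon>) j))"
    \<comment> \<open>The nonvanishing tail sums keep the point off the polar hyperplanes, so it is
      a regular point of the continuation.\<close>
    have gnz: "rGamma (sig r (s \<epsilon>) j) \<noteq> 0" if "j \<in> {1..r}" for j
      unfolding sg using half[OF \<epsilon> that] by (intro rGamma_near_neg_nat_nonzero) auto
    have sn: "Re (s \<epsilon> j) > - real n" if "j \<in> {1..r}" for j
    proof -
      have "\<bar>Re (\<epsilon> j)\<bar> < 1" using half(2)[OF \<epsilon> that] abs_Re_le_cmod[of "\<epsilon> j"] by linarith
      moreover have "real (l j) + 1 \<le> real n" using ln[OF that] by linarith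
      ultimately show ?thesis by (simp add: s_def)
    qed
    have sgN: "Re (sig r (s \<epsilon>) j) > - real N" if "j \<in> {1..r}" for j
      unfolding N_def by (rule Re_sig_lower[OF that sn])
    have sN: "Re (s \<epsilon> j) > - real N" if "j \<in> {1..<r}" for j
    proof -
      have "real n \<le> real N" using nN by linarith
      then show ?thesis using sn[of j] that by auto
    qed
    have hk: "exp_bounded (- Re (a j)) \<rho> (lker (a j) (z j))" if "j \<in> {1..r}" for j
      by (rule hol_family_slice[OF h[OF that, of UNIV]]) simp
    have "(deriv ^^ K) (\<phi> \<epsilon>) 0 / fact K =
      (\<Sum>n\<in>compositions (r - (r - 1)) r K.
         (\<Prod>j=r-(r-1)..r. (-1) ^ n j * (apostol_bernoulli (n j) (a j) (z j) / fact (n j))) *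
         (\<Prod>j\<in>{r-(r-1)..<r}. ek_coeff (sig r (s \<epsilon>) (Suc j)) (s \<epsilon> j) (\<Sum>i=Suc j..r. n i)))"
      unfolding \<phi>_def by (rule nest_higher_deriv_0[OF hk \<rho> sgN sN]) (use r in auto)
    moreover have "r - (r - 1) = 1" using r by simp
    ultimately have "(deriv ^^ K) (\<phi> \<epsilon>) 0 = fact K * (\<Sum>n\<in>compositions 1 r K.
         (\<Prod>j=1..r. (-1) ^ n j * (apostol_bernoulli (n j) (a j) (z j) / fact (n j))) *
         (\<Prod>j\<in>{1..<r}. ek_coeff (sig r (s \<epsilon>) (Suc j)) (s \<epsilon> j) (\<Sum>i=Suc j..r. n i)))"
      by (simp add: field_simps)
    also have "\<dots> = fact K * (\<Sum>n\<in>compositions 1 r K.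
         (-1) ^ K * (\<Prod>j=1..r. apostol_bernoulli (n j) (a j) (z j) / fact (n j)) *
         (\<Prod>j\<in>{1..<r}. ek_coeff (sig r (s \<epsilon>) (Suc j)) (s \<epsilon> j) (\<Sum>i=Suc j..r. n i)))"
    proof (intro arg_cong2[where f="(*)"] sum.cong refl)
      fix n assume "n \<in> compositions 1 r K"
      then have "(\<Prod>j=1..r. (-1) ^ n j) = ((-1) ^ K :: complex)"
        by (simp add: compositions_def flip: power_sum)
      then show "(\<Prod>j=1..r. (-1) ^ n j * (apostol_bernoulli (n j) (a j) (z j) / fact (n j)))
         = (-1) ^ K * (\<Prod>j=1..r. apostol_bernoulli (n j) (a j) (z j) / fact (n j))"
        by (simp only: prod.distrib)
    qed
    finally have d: "(deriv ^^ K) (\<phi> \<epsilon>) 0 = \<dots>" .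
    \<comment> \<open>One sign comes from the Mellin transform at \<open>- K\<close>, the other from
      expanding the kernels in \<open>- U\<close>; they cancel.\<close>
    have sq: "(-1) ^ K * ((-1) ^ K * x) = (x :: complex)" for x
      by (simp flip: mult.assoc power_mult_distrib)
    have "rGamma (s \<epsilon> r) * ((-1) ^ K * (deriv ^^ K) (\<phi> \<epsilon>) 0) / D = (\<Sum>n\<in>compositions 1 r K.
         fact K * (\<Prod>j=1..r. apostol_bernoulli (n j) (a j) (z j) / fact (n j)) *
         (rGamma (s \<epsilon> r) * (\<Prod>j\<in>{1..<r}. ek_coeff (sig r (s \<epsilon>) (Suc j)) (s \<epsilon> j) (\<Sum>i=Suc j..r. n i)) / D))"
      unfolding d sum_distrib_left sum_divide_distrib
    proof (rule sum.cong[OF refl])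
      fix n
      show "rGamma (s \<epsilon> r) * ((-1) ^ K * (fact K * ((-1) ^ K * b * c))) / D
        = fact K * b * (rGamma (s \<epsilon> r) * c / D)" for b c
        using sq[of "fact K * b * c"] by (simp add: mult_ac)
    qed
    also have "\<dots> = (\<Sum>n\<in>compositions 1 r K.
       fact K * (\<Prod>j=1..r. apostol_bernoulli (n j) (a j) (z j) / fact (n j)) *
       (rGamma_rest (l r) (tail_sum r \<epsilon> r) * (1 / rGamma_rest K (tail_sum r \<epsilon> 1)) *
        (\<Prod>j\<in>{1..<r}. Gamma_quot r l j (\<Sum>k=Suc j..r. n k) \<epsilon>)))"
      unfolding D_def s_def K_def
      by (intro sum.cong refl arg_cong2[where f="(*)"] ek_coeff_product r gnz[unfolded s_def] half(3)[OF \<epsilon>])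
    finally have main: "rGamma (s \<epsilon> r) * ((-1) ^ K * (deriv ^^ K) (\<phi> \<epsilon>) 0) / D = \<dots>" .
    have "hl_zeta r (s \<epsilon>) a z = rGamma (s \<epsilon> r) * mellin N (\<phi> \<epsilon>) (sig r (s \<epsilon>) 1) / D"
      unfolding D_def \<phi>_def by (rule hl_zeta_eq_nest[OF r a z sn gnz N_def])
    \<comment> \<open>The derivative yields the sum estimated by \<open>approx_main\<close>, and
      \<open>R\<close> falls under \<open>approx_remainder\<close>.\<close>
    also have "mellin N (\<phi> \<epsilon>) (sig r (s \<epsilon>) 1) = R \<epsilon> + (-1) ^ K * (deriv ^^ K) (\<phi> \<epsilon>) 0" by (simp add: R_def)
    finally have "hl_zeta r (s \<epsilon>) a z = rGamma (s \<epsilon> r) * R \<epsilon> / D + rGamma (s \<epsilon> r)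
      * ((-1) ^ K * (deriv ^^ K) (\<phi> \<epsilon>) 0) / D"
      by (simp only: distrib_left add_divide_distrib)
    then show "hl_zeta r (s \<epsilon>) a z = rGamma (- of_nat (l r) + \<epsilon> r) * R \<epsilon>
      / (\<Prod>j=1..r. rGamma (sig r (\<lambda>k. - of_nat (l k) + \<epsilon> k) j)) +
       (\<Sum>n\<in>compositions 1 r ((\<Sum>k=1..r. l k) + r).
       fact ((\<Sum>k=1..r. l k) + r) * (\<Prod>j=1..r. apostol_bernoulli (n j) (a j) (z j) / fact (n j)) *
       (rGamma_rest (l r) (tail_sum r \<epsilon> r) * (1 / rGamma_rest ((\<Sum>k=1..r. l k) + r) (tail_sum r \<epsilon> 1)) *
        (\<Prod>j\<in>{1..<r}. Gamma_quot r l j (\<Sum>k=Suc j..r. n k) \<epsilon>)))"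
      unfolding main unfolding D_def s_def K_def .
  qed (assumption, rule refl)
  then obtain \<delta> C where \<delta>: "\<delta> > 0" "C \<ge> 0"
    "\<And>\<epsilon>. \<epsilon> \<in> eps_region r M \<delta> \<Longrightarrow> norm (hl_zeta r (s \<epsilon>) a z - main_term r l \<epsilon> a z) \<le> C * eps_size r \<epsilon>"
    unfolding approx_def by auto
  \<comment> \<open>\<open>C\<close> may be 0 whereas a positive constant is claimed, hence
    \<open>C + 1\<close>.\<close>
  show ?thesis
  proof (rule exI[of _ \<delta>], rule conjI[OF \<delta>(1)], rule exI[of _ "C + 1"], rule conjI, use \<delta>(2) in simp,
    intro allI impI)
    fix \<epsilon> :: "nat \<Rightarrow> complex"
    assume "\<forall>j\<in>{1..r}. norm (\<epsilon> j) < \<delta> \<and> \<epsilon> j \<noteq> 0 \<and> (\<Sum>i=j..r. \<epsilon> i) \<noteq> 0"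
      "\<forall>j\<in>{1..r}. \<forall>k\<in>{j..r}. norm (\<epsilon> k) \<le> M * norm (\<Sum>i=j..r. \<epsilon> i)"
    then have "\<epsilon> \<in> eps_region r M \<delta>" unfolding eps_region_def tail_sum_def by blast
    then have "norm (hl_zeta r (s \<epsilon>) a z - main_term r l \<epsilon> a z) \<le> C * eps_size r \<epsilon>" by (rule \<delta>(3))
    also have "\<dots> \<le> (C + 1) * eps_size r \<epsilon>" using eps_size_nonneg by (intro mult_right_mono) auto
    finally show "norm (hl_zeta r (\<lambda>j. - of_nat (l j) + \<epsilon> j) a z - main_term r l \<epsilon> a z)
      \<le> (C + 1) * (\<Sum>j=1..r. norm (\<epsilon> j))"
      unfolding s_def eps_size_def .
  qed
qed

end
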